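(* Let $\Gamma$ be a row-finite digraph and $\mathbb F$ a field. Let $\mathfrak M_{\mathbb F\Gamma}$ and $\mathfrak M_{L(\Gamma)}$ be the categories of unital right modules over the path algebra $\mathbb F\Gamma$ and the Leavitt path algebra $L(\Gamma)$ respectively. The full subcategory $\widehat{\mathfrak M}_\Gamma$ of $\mathfrak M_{\mathbb F\Gamma}$ whose objects are the modules $M$ with $M=\widehat M$ is a Serre subcategory, and the quotient category $\mathfrak M_{\mathbb F\Gamma}/\widehat{\mathfrak M}_\Gamma$ is equivalent to $\mathfrak M_{L(\Gamma)}$.
   Context: A digraph $\Gamma=(V,E,s,t)$ has vertex set $V$, arrow set $E$ (possibly infinite) and source and target maps $s,t$; it is row-finite if $s^{-1}(v)$ is finite for all $v\in V$. A sink is a vertex $v$ with $s^{-1}(v)=\emptyset$. The path algebra $\mathbb F\Gamma$ has the paths of $\Gamma$ (including vertices, as paths of length $0$) as basis with concatenation product ($0$ if not composable). $L(\Gamma)$ is the (not necessarily unital) $\mathbb F$-algebra generated by $V\sqcup E\sqcup E^*$, $E^*=\{e^*:e\in E\}$, $s(e^* )=t(e)$, $t(e^* )=s(e)$, subject to $vw=\delta_{v,w}v$ ($v,w\in V$); $s(e)e=e=e\,t(e)$ ($e\in E\sqcup E^*$); $e^*f=\delta_{e,f}\,t(e)$ ($e,f\in E$); $v=\sum_{s(e)=v}ee^*$ for every non-sink $v$. A right module $M$ over an algebra $A$ is unital if $MA=M$. For $n\in\mathbb N$ let $E_n$ be the set of paths $p$ of $\Gamma$ of length $n$, or of length less than $n$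 and ending at a sink. For an $\mathbb F\Gamma$-module $M$, $\widehat M=\{m\in M:\exists n\in\mathbb N\ \forall p\in E_n\ mp=0\}$, which is a submodule of $M$. A Serre subcategory is a full subcategory closed under subobjects, quotients and extensions; the quotient category is the usual (Serre/Gabriel) quotient of abelian categories. *)

theory Defs
  imports
    "HOL-Algebra.Algebraic_Closure_Type"
    "HOL-Library.Poly_Mapping"
    "HOL-Library.Equipollence"
    "Graph_Theory.Arc_Walk"
begin

section \<open>Categories\<close>

record ('o, 'a) cat =
  Obj :: "'o set"
  Arr :: "'a set"
  Dom :: "'a \<Rightarrow> 'o"
  Cod :: "'a \<Rightarrow> 'o"
  Ident :: "'o \<Rightarrow> 'a"
  Comp :: "'a \<Rightarrow> 'a \<Rightarrow> 'a"  (infixl \<open>\<cdot>\<index>\<close> 70)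

text \<open>Composition is in applicative order: \<open>g \<cdot> f\<close> is meaningful when \<open>Cod f = Dom g\<close>.\<close>

definition hom_set :: "('o, 'a) cat \<Rightarrow> 'o \<Rightarrow> 'o \<Rightarrow> 'a set" where
  "hom_set C a b = {f \<in> Arr C. Dom C f = a \<and> Cod C f = b}"

locale category =
  fixes C :: "('o, 'a) cat" (structure)
  assumes Dom_Obj: "f \<in> Arr C \<Longrightarrow> Dom C f \<in> Obj C"
    and Cod_Obj: "f \<in> Arr C \<Longrightarrow> Cod C f \<in> Obj C"
    and Ident_hom: "a \<in> Obj C \<Longrightarrow> Ident C a \<in> hom_set C a a"
    and Comp_hom: "\<lbrakk>f \<in> hom_set C a b; g \<in> hom_set C b c\<rbrakk> \<Longrightarrow> g \<cdot> f \<in> hom_set C a c"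
    and Comp_Ident_left: "f \<in> hom_set C a b \<Longrightarrow> Ident C b \<cdot> f = f"
    and Comp_Ident_right: "f \<in> hom_set C a b \<Longrightarrow> f \<cdot> Ident C a = f"
    and Comp_assoc: "\<lbrakk>f \<in> hom_set C a b; g \<in> hom_set C b c; h \<in> hom_set C c d\<rbrakk>
      \<Longrightarrow> h \<cdot> (g \<cdot> f) = (h \<cdot> g) \<cdot> f"

locale covariant_functor = C: category C + D: category D
  for C :: "('o, 'a) cat" and D :: "('p, 'b) cat" +
  fixes Fo :: "'o \<Rightarrow> 'p" and Fa :: "'a \<Rightarrow> 'b"
  assumes Fo_Obj: "a \<in> Obj C \<Longrightarrow> Fo a \<in> Obj D"
    and Fa_hom: "f \<in> hom_set C a b \<Longrightarrow> Fa f \<in> hom_set D (Fo a) (Fo b)"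
    and Fa_Ident: "a \<in> Obj C \<Longrightarrow> Fa (Ident C a) = Ident D (Fo a)"
    and Fa_Comp: "\<lbrakk>f \<in> hom_set C a b; g \<in> hom_set C b c\<rbrakk>
      \<Longrightarrow> Fa (g \<cdot>\<^bsub>C\<^esub> f) = Fa g \<cdot>\<^bsub>D\<^esub> Fa f"

definition iso_arrow :: "('o, 'a) cat \<Rightarrow> 'a \<Rightarrow> bool" where
  "iso_arrow C f \<longleftrightarrow> f \<in> Arr C \<and>
     (\<exists>g \<in> hom_set C (Cod C f) (Dom C f).
        g \<cdot>\<^bsub>C\<^esub> f = Ident C (Dom C f) \<and> f \<cdot>\<^bsub>C\<^esub> g = Ident C (Cod C f))"

definition natural_isomorphism ::
  "('o, 'a) cat \<Rightarrow> ('p, 'b) cat \<Rightarrow> ('o \<Rightarrow> 'p) \<Rightarrow> ('a \<Rightarrow> 'b) \<Rightarrow> ('o \<Rightarrow> 'p) \<Rightarrow> ('a \<Rightarrow> 'b) \<Rightarrow> ('o \<Rightarrow> 'b) \<Rightarrow> bool"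
where
  "natural_isomorphism C D Fo Fa Go Ga \<eta> \<longleftrightarrow>
     (\<forall>a \<in> Obj C. \<eta> a \<in> hom_set D (Fo a) (Go a) \<and> iso_arrow D (\<eta> a)) \<and>
     (\<forall>f \<in> Arr C. \<eta> (Cod C f) \<cdot>\<^bsub>D\<^esub> Fa f = Ga f \<cdot>\<^bsub>D\<^esub> \<eta> (Dom C f))"

definition equivalent_categories :: "('o, 'a) cat \<Rightarrow> ('p, 'b) cat \<Rightarrow> bool" where
  "equivalent_categories C D \<longleftrightarrow>
     (\<exists>Fo Fa Go Ga \<eta> \<epsilon>.
        covariant_functor C D Fo Fa \<and> covariant_functor D C Go Ga \<and>
        natural_isomorphism C C (\<lambda>a. a) (\<lambda>f. f) (Go \<circ> Fo) (Ga \<circ> Fa) \<eta> \<and>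
        natural_isomorphism D D (Fo \<circ> Go) (Fa \<circ> Ga) (\<lambda>a. a) (\<lambda>f. f) \<epsilon>)"

definition mono_arrow :: "('o, 'a) cat \<Rightarrow> 'a \<Rightarrow> bool" where
  "mono_arrow C f \<longleftrightarrow> f \<in> Arr C \<and>
     (\<forall>x. \<forall>g \<in> hom_set C x (Dom C f). \<forall>h \<in> hom_set C x (Dom C f).
        f \<cdot>\<^bsub>C\<^esub> g = f \<cdot>\<^bsub>C\<^esub> h \<longrightarrow> g = h)"

definition epi_arrow :: "('o, 'a) cat \<Rightarrow> 'a \<Rightarrow> bool" where
  "epi_arrow C f \<longleftrightarrow> f \<in> Arr C \<and>
     (\<forall>x. \<forall>g \<in> hom_set C (Cod C f) x. \<forall>h \<in> hom_set C (Cod C f) x.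
        g \<cdot>\<^bsub>C\<^esub> f = h \<cdot>\<^bsub>C\<^esub> f \<longrightarrow> g = h)"

definition zero_object :: "('o, 'a) cat \<Rightarrow> 'o \<Rightarrow> bool" where
  "zero_object C z \<longleftrightarrow> z \<in> Obj C \<and>
     (\<forall>a \<in> Obj C. (\<exists>!f. f \<in> hom_set C a z) \<and> (\<exists>!f. f \<in> hom_set C z a))"

definition zero_arrow :: "('o, 'a) cat \<Rightarrow> 'a \<Rightarrow> bool" where
  "zero_arrow C f \<longleftrightarrow> f \<in> Arr C \<and>
     (\<exists>z. zero_object C z \<and>
        (\<exists>g \<in> hom_set C (Dom C f) z. \<exists>h \<in> hom_set C z (Cod C f). f = h \<cdot>\<^bsub>C\<^esub> g))"

definition is_kernel :: "('o, 'a) cat \<Rightarrow> 'a \<Rightarrow> 'a \<Rightarrow> bool" where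
  "is_kernel C f k \<longleftrightarrow> f \<in> Arr C \<and> k \<in> Arr C \<and> Cod C k = Dom C f \<and> zero_arrow C (f \<cdot>\<^bsub>C\<^esub> k) \<and>
     (\<forall>h \<in> Arr C. Cod C h = Dom C f \<and> zero_arrow C (f \<cdot>\<^bsub>C\<^esub> h) \<longrightarrow>
        (\<exists>!u. u \<in> hom_set C (Dom C h) (Dom C k) \<and> k \<cdot>\<^bsub>C\<^esub> u = h))"

definition is_cokernel :: "('o, 'a) cat \<Rightarrow> 'a \<Rightarrow> 'a \<Rightarrow> bool" where
  "is_cokernel C f c \<longleftrightarrow> f \<in> Arr C \<and> c \<in> Arr C \<and> Dom C c = Cod C f \<and> zero_arrow C (c \<cdot>\<^bsub>C\<^esub> f) \<and>
     (\<forall>h \<in> Arr C. Dom C h = Cod C f \<and> zero_arrow C (h \<cdot>\<^bsub>C\<^esub> f) \<longrightarrow>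
        (\<exists>!u. u \<in> hom_set C (Cod C c) (Cod C h) \<and> u \<cdot>\<^bsub>C\<^esub> c = h))"

definition short_exact :: "('o, 'a) cat \<Rightarrow> 'a \<Rightarrow> 'a \<Rightarrow> bool" where
  "short_exact C f g \<longleftrightarrow> is_kernel C g f \<and> is_cokernel C f g"


section \<open>Serre subcategories and Gabriel's quotient category\<close>

text \<open>A full subcategory is given by its set of objects \<open>S\<close>.\<close>

definition serre_subcategory :: "('o, 'a) cat \<Rightarrow> 'o set \<Rightarrow> bool" where
  "serre_subcategory C S \<longleftrightarrow> category C \<and> S \<subseteq> Obj C \<and> S \<noteq> {} \<and>
     (\<forall>f. mono_arrow C f \<and> Cod C f \<in> S \<longrightarrow> Dom C f \<in> S) \<and>
     (\<forall>f. epi_arrow C f \<and> Dom C f \<in> S \<longrightarrow> Cod C f \<in> S) \<and>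
     (\<forall>f g. short_exact C f g \<and> Dom C f \<in> S \<and> Cod C g \<in> S \<longrightarrow> Cod C f \<in> S)"

text \<open>
  Gabriel's quotient has the objects of \<open>C\<close>, and its morphisms from \<open>a\<close> to \<open>b\<close> are the direct limit
  of \<open>Hom(a', b/b')\<close> over the subobjects \<open>a'\<close> of \<open>a\<close> and \<open>b'\<close> of \<open>b\<close> such that \<open>a/a'\<close> and \<open>b'\<close>
  are in \<open>S\<close>.  An element of one of these sets is a triple \<open>(i, f, q)\<close> with \<open>i : a' \<rightarrow> a\<close> a
  monomorphism, \<open>q : b \<rightarrow> b/b'\<close> an epimorphism and \<open>f : a' \<rightarrow> b/b'\<close>.
\<close>

definition cosmall_mono :: "('o, 'a) cat \<Rightarrow> 'o set \<Rightarrow> 'a \<Rightarrow> bool" where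
  "cosmall_mono C S i \<longleftrightarrow> mono_arrow C i \<and> (\<exists>c. is_cokernel C i c \<and> Cod C c \<in> S)"

definition small_epi :: "('o, 'a) cat \<Rightarrow> 'o set \<Rightarrow> 'a \<Rightarrow> bool" where
  "small_epi C S q \<longleftrightarrow> epi_arrow C q \<and> (\<exists>k. is_kernel C q k \<and> Dom C k \<in> S)"

definition partial_maps :: "('o, 'a) cat \<Rightarrow> 'o set \<Rightarrow> 'o \<Rightarrow> 'o \<Rightarrow> ('a \<times> 'a \<times> 'a) set" where
  "partial_maps C S a b =
     {(i, f, q). cosmall_mono C S i \<and> Cod C i = a \<and> small_epi C S q \<and> Dom C q = b \<and>
                 f \<in> hom_set C (Dom C i) (Cod C q)}"

text \<open>Two triples are identified in the direct limit iff they agree at some later stage, that is,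
  on a smaller subobject of \<open>a\<close> and in a smaller quotient of \<open>b\<close>.\<close>

definition limit_rel ::
  "('o, 'a) cat \<Rightarrow> 'o set \<Rightarrow> 'o \<Rightarrow> 'o \<Rightarrow> (('a \<times> 'a \<times> 'a) \<times> ('a \<times> 'a \<times> 'a)) set"
where
  "limit_rel C S a b =
     {((i, f, q), (i', f', q')).
        (i, f, q) \<in> partial_maps C S a b \<and> (i', f', q') \<in> partial_maps C S a b \<and>
        (\<exists>x y. \<exists>u \<in> hom_set C x (Dom C i). \<exists>u' \<in> hom_set C x (Dom C i').
               \<exists>w \<in> hom_set C (Cod C q) y. \<exists>w' \<in> hom_set C (Cod C q') y.
           i \<cdot>\<^bsub>C\<^esub> u = i' \<cdot>\<^bsub>C\<^esub> u' \<and> cosmall_mono C S (i \<cdot>\<^bsub>C\<^esub> u) \<and>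
           w \<cdot>\<^bsub>C\<^esub> q = w' \<cdot>\<^bsub>C\<^esub> q' \<and> small_epi C S (w \<cdot>\<^bsub>C\<^esub> q) \<and>
           w \<cdot>\<^bsub>C\<^esub> f \<cdot>\<^bsub>C\<^esub> u = w' \<cdot>\<^bsub>C\<^esub> f' \<cdot>\<^bsub>C\<^esub> u')}"

text \<open>
  Composition of \<open>f : a' \<rightarrow> b/b'\<close> with \<open>g : b'' \<rightarrow> c/c'\<close>.  Let \<open>m \<circ> e\<close> be the epi-mono factorization
  of \<open>b'' \<rightarrow> b \<rightarrow> b/b'\<close>, with image \<open>z = (b'' + b')/b' = b''/(b'' \<inter> b')\<close>.  After restricting \<open>f\<close> along
  \<open>u\<close> (for instance to \<open>f\<^sup>-\<^sup>1(z)\<close>) it factors through \<open>m\<close> as \<open>f1\<close>; after extending \<open>g\<close> along \<open>w\<close> (for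
  instance dividing by \<open>g(b'' \<inter> b')\<close>) it factors through \<open>e\<close> as \<open>g1\<close>.  The composite is \<open>g1 \<circ> f1\<close>.
\<close>

definition composite_rel ::
  "('o, 'a) cat \<Rightarrow> 'o set \<Rightarrow> 'a \<times> 'a \<times> 'a \<Rightarrow> 'a \<times> 'a \<times> 'a \<Rightarrow> 'a \<times> 'a \<times> 'a \<Rightarrow> bool"
where
  "composite_rel C S = (\<lambda>(j, g, r) (i, f, q) (k, h, t).
     \<exists>x y z. \<exists>u \<in> hom_set C x (Dom C i). \<exists>w \<in> hom_set C (Cod C r) y.
       \<exists>e \<in> hom_set C (Dom C j) z. \<exists>m \<in> hom_set C z (Cod C q).
       \<exists>f1 \<in> hom_set C x z. \<exists>g1 \<in> hom_set C z y.
         k = i \<cdot>\<^bsub>C\<^esub> u \<and> cosmall_mono C S k \<and>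
         t = w \<cdot>\<^bsub>C\<^esub> r \<and> small_epi C S t \<and>
         epi_arrow C e \<and> mono_arrow C m \<and> q \<cdot>\<^bsub>C\<^esub> j = m \<cdot>\<^bsub>C\<^esub> e \<and>
         f \<cdot>\<^bsub>C\<^esub> u = m \<cdot>\<^bsub>C\<^esub> f1 \<and> w \<cdot>\<^bsub>C\<^esub> g = g1 \<cdot>\<^bsub>C\<^esub> e \<and>
         h = g1 \<cdot>\<^bsub>C\<^esub> f1)"

text \<open>An arrow is an equivalence class of triples, tagged with its domain and codomain.\<close>

definition serre_quotient ::
  "('o, 'a) cat \<Rightarrow> 'o set \<Rightarrow> ('o, 'o \<times> ('a \<times> 'a \<times> 'a) set \<times> 'o) cat"
where
  "serre_quotient C S = \<lparr>
     Obj = Obj C,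
     Arr = {(a, U, b). a \<in> Obj C \<and> b \<in> Obj C \<and> U \<in> partial_maps C S a b // limit_rel C S a b},
     Dom = (\<lambda>(a, U, b). a),
     Cod = (\<lambda>(a, U, b). b),
     Ident = (\<lambda>a. (a, limit_rel C S a a `` {(Ident C a, Ident C a, Ident C a)}, a)),
     Comp = (\<lambda>(b', W, c) (a, U, b).
       (a, \<Union>{limit_rel C S a c `` {\<tau>} |\<tau>. \<exists>\<sigma> \<in> W. \<exists>\<rho> \<in> U. composite_rel C S \<sigma> \<rho> \<tau>}, c)) \<rparr>"


section \<open>Algebras over a field and their right modules\<close>

text \<open>
  A not necessarily unital algebra over the field \<open>'k\<close> is represented by the record type
  \<open>('k, 'a) module\<close> of HOL-Algebra; its field \<open>one\<close> is not used.
\<close>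

text \<open>The algebra with basis \<open>B\<close> in which the product of two basis elements is given by \<open>cat\<close>,
  with \<open>None\<close> standing for \<open>0\<close>.\<close>

definition basis_algebra :: "'b set \<Rightarrow> ('b \<Rightarrow> 'b \<Rightarrow> 'b option) \<Rightarrow> ('k::field, 'b \<Rightarrow>\<^sub>0 'k) module" where
  "basis_algebra B cat = \<lparr>
     carrier = {x. Poly_Mapping.keys x \<subseteq> B},
     monoid.mult = (\<lambda>x y. \<Sum>p \<in> Poly_Mapping.keys x. \<Sum>q \<in> Poly_Mapping.keys y.
        (case cat p q of
           None \<Rightarrow> 0
         | Some r \<Rightarrow> Poly_Mapping.single r (Poly_Mapping.lookup x p * Poly_Mapping.lookup y q))),
     one = undefined,
     ring.zero = 0,
     add = (+),
     module.smult = (\<lambda>c. Poly_Mapping.map ((*) c)) \<rparr>"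

text \<open>The free non-unital algebra: the basis consists of the nonempty words.\<close>

definition free_algebra :: "'g set \<Rightarrow> ('k::field, 'g list \<Rightarrow>\<^sub>0 'k) module" where
  "free_algebra U = basis_algebra (lists U - {[]}) (\<lambda>p q. Some (p @ q))"

inductive_set generated_ideal :: "('k, 'a) module \<Rightarrow> 'a set \<Rightarrow> 'a set"
  for A :: "('k, 'a) module" and R :: "'a set" where
  zero: "\<zero>\<^bsub>A\<^esub> \<in> generated_ideal A R"
| incl: "r \<in> R \<Longrightarrow> r \<in> generated_ideal A R"
| add: "\<lbrakk>x \<in> generated_ideal A R; y \<in> generated_ideal A R\<rbrakk> \<Longrightarrow> x \<oplus>\<^bsub>A\<^esub> y \<in> generated_ideal A R"
| smult: "x \<in> generated_ideal A R \<Longrightarrow> c \<odot>\<^bsub>A\<^esub> x \<in> generated_ideal A R"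
| mult_left: "\<lbrakk>a \<in> carrier A; x \<in> generated_ideal A R\<rbrakk> \<Longrightarrow> a \<otimes>\<^bsub>A\<^esub> x \<in> generated_ideal A R"
| mult_right: "\<lbrakk>a \<in> carrier A; x \<in> generated_ideal A R\<rbrakk> \<Longrightarrow> x \<otimes>\<^bsub>A\<^esub> a \<in> generated_ideal A R"

definition quotient_algebra :: "('k, 'a) module \<Rightarrow> 'a set \<Rightarrow> ('k, 'a set) module" where
  "quotient_algebra A I = \<lparr>
     carrier = a_rcosets\<^bsub>A\<^esub> I,
     monoid.mult = rcoset_mult A I,
     one = undefined,
     ring.zero = I,
     add = set_add A,
     module.smult = (\<lambda>c U. \<Union>x \<in> U. I +>\<^bsub>A\<^esub> (c \<odot>\<^bsub>A\<^esub> x)) \<rparr>"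

text \<open>For a right module too, the fields \<open>mult\<close> and \<open>one\<close> of the underlying record are not used.\<close>

record ('k, 'a, 'm) rmodule = "('k, 'm) module" +
  act :: "'m \<Rightarrow> 'a \<Rightarrow> 'm"

locale right_module = module "ring_of_type_algebra :: 'k::field ring" M
  for A :: "('k::field, 'a) module" and M :: "('k::field, 'a, 'm) rmodule" +
  assumes act_closed: "\<lbrakk>m \<in> carrier M; a \<in> carrier A\<rbrakk> \<Longrightarrow> act M m a \<in> carrier M"
    and act_add_left: "\<lbrakk>m \<in> carrier M; n \<in> carrier M; a \<in> carrier A\<rbrakk>
      \<Longrightarrow> act M (m \<oplus>\<^bsub>M\<^esub> n) a = act M m a \<oplus>\<^bsub>M\<^esub> act M n a"
    and act_add_right: "\<lbrakk>m \<in> carrier M; a \<in> carrier A; b \<in> carrier A\<rbrakk>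
      \<Longrightarrow> act M m (a \<oplus>\<^bsub>A\<^esub> b) = act M m a \<oplus>\<^bsub>M\<^esub> act M m b"
    and act_smult_left: "\<lbrakk>m \<in> carrier M; a \<in> carrier A\<rbrakk>
      \<Longrightarrow> act M (c \<odot>\<^bsub>M\<^esub> m) a = c \<odot>\<^bsub>M\<^esub> act M m a"
    and act_smult_right: "\<lbrakk>m \<in> carrier M; a \<in> carrier A\<rbrakk>
      \<Longrightarrow> act M m (c \<odot>\<^bsub>A\<^esub> a) = c \<odot>\<^bsub>M\<^esub> act M m a"
    and act_mult: "\<lbrakk>m \<in> carrier M; a \<in> carrier A; b \<in> carrier A\<rbrakk>
      \<Longrightarrow> act M m (a \<otimes>\<^bsub>A\<^esub> b) = act M (act M m a) b"

text \<open>\<open>MA\<close> is the additive subgroup generated by the products \<open>ma\<close>.\<close>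

locale unital_right_module = right_module +
  assumes unital: "generate (add_monoid M) {act M m a |m a. m \<in> carrier M \<and> a \<in> carrier A} = carrier M"

definition module_homs ::
  "('k, 'a) module \<Rightarrow> ('k, 'a, 'm) rmodule \<Rightarrow> ('k, 'a, 'm) rmodule \<Rightarrow> ('m \<Rightarrow> 'm) set"
where
  "module_homs A M N =
     {f \<in> carrier M \<rightarrow>\<^sub>E carrier N.
        (\<forall>x \<in> carrier M. \<forall>y \<in> carrier M. f (x \<oplus>\<^bsub>M\<^esub> y) = f x \<oplus>\<^bsub>N\<^esub> f y) \<and>
        (\<forall>c. \<forall>x \<in> carrier M. f (c \<odot>\<^bsub>M\<^esub> x) = c \<odot>\<^bsub>N\<^esub> f x) \<and>
        (\<forall>x \<in> carrier M. \<forall>a \<in> carrier A. f (act M x a) = act N (f x) a)}"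

text \<open>The category of the unital right \<open>A\<close>-modules whose carrier is a subset of the type \<open>'m\<close>:
  the type \<open>'m\<close> plays the role of the universe, and it has to be large enough for a given
  construction (such as tensoring with a given algebra) not to lead out of it.\<close>

definition module_category ::
  "('k::field, 'a) module \<Rightarrow>
   (('k, 'a, 'm) rmodule, ('k, 'a, 'm) rmodule \<times> ('m \<Rightarrow> 'm) \<times> ('k, 'a, 'm) rmodule) cat"
where
  "module_category A = \<lparr>
     Obj = {M. unital_right_module A M},
     Arr = {(M, f, N). unital_right_module A M \<and> unital_right_module A N \<and> f \<in> module_homs A M N},
     Dom = (\<lambda>(M, f, N). M),
     Cod = (\<lambda>(M, f, N). N),
     Ident = (\<lambda>M. (M, (\<lambda>x \<in> carrier M. x), M)),
     Comp = (\<lambda>(N', g, P) (M, f, N). (M, compose (carrier M) g f, P)) \<rparr>"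


section \<open>Path algebras and Leavitt path algebras\<close>

text \<open>The source and target maps of a digraph are \<open>tail\<close> and \<open>head\<close>.\<close>

definition row_finite :: "('v, 'e) pre_digraph \<Rightarrow> bool" where
  "row_finite G \<longleftrightarrow> (\<forall>v \<in> verts G. finite (out_arcs G v))"

definition is_sink :: "('v, 'e) pre_digraph \<Rightarrow> 'v \<Rightarrow> bool" where
  "is_sink G v \<longleftrightarrow> v \<in> verts G \<and> out_arcs G v = {}"

text \<open>A path is given by its initial vertex and its list of arcs.\<close>

definition paths :: "('v, 'e) pre_digraph \<Rightarrow> ('v \<times> 'e list) set" where
  "paths G = {(u, p). \<exists>v. pre_digraph.awalk G u p v}"

definition path_end :: "('v, 'e) pre_digraph \<Rightarrow> 'v \<times> 'e list \<Rightarrow> 'v" where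
  "path_end G = (\<lambda>(u, p). pre_digraph.awlast G u p)"

definition path_concat :: "('v, 'e) pre_digraph \<Rightarrow> 'v \<times> 'e list \<Rightarrow> 'v \<times> 'e list \<Rightarrow> ('v \<times> 'e list) option"
where
  "path_concat G p q = (if path_end G p = fst q then Some (fst p, snd p @ snd q) else None)"

type_synonym ('v, 'e, 'k) path_algebra_elem = "('v \<times> 'e list) \<Rightarrow>\<^sub>0 'k"

definition path_algebra :: "('v, 'e) pre_digraph \<Rightarrow> ('k::field, ('v, 'e, 'k) path_algebra_elem) module" where
  "path_algebra G = basis_algebra (paths G) (path_concat G)"

datatype ('v, 'e) gen = Vertex 'v | Arrow 'e | Ghost 'e

fun gen_source :: "('v, 'e) pre_digraph \<Rightarrow> ('v, 'e) gen \<Rightarrow> 'v" where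
  "gen_source G (Vertex v) = v"
| "gen_source G (Arrow e) = tail G e"
| "gen_source G (Ghost e) = head G e"

fun gen_target :: "('v, 'e) pre_digraph \<Rightarrow> ('v, 'e) gen \<Rightarrow> 'v" where
  "gen_target G (Vertex v) = v"
| "gen_target G (Arrow e) = head G e"
| "gen_target G (Ghost e) = tail G e"

definition gens :: "('v, 'e) pre_digraph \<Rightarrow> ('v, 'e) gen set" where
  "gens G = Vertex ` verts G \<union> Arrow ` arcs G \<union> Ghost ` arcs G"

abbreviation basis_elem :: "'b \<Rightarrow> ('b \<Rightarrow>\<^sub>0 'k::field)" where
  "basis_elem p \<equiv> Poly_Mapping.single p 1"

definition leavitt_relations :: "('v, 'e) pre_digraph \<Rightarrow> (('v, 'e) gen list \<Rightarrow>\<^sub>0 'k::field) set" where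
  "leavitt_relations G =
     {basis_elem [Vertex v, Vertex w] - (if v = w then basis_elem [Vertex v] else 0) |v w.
        v \<in> verts G \<and> w \<in> verts G} \<union>
     {basis_elem [Vertex (gen_source G x), x] - basis_elem [x] |x.
        x \<in> Arrow ` arcs G \<union> Ghost ` arcs G} \<union>
     {basis_elem [x, Vertex (gen_target G x)] - basis_elem [x] |x.
        x \<in> Arrow ` arcs G \<union> Ghost ` arcs G} \<union>
     {basis_elem [Ghost e, Arrow f] - (if e = f then basis_elem [Vertex (head G e)] else 0) |e f.
        e \<in> arcs G \<and> f \<in> arcs G} \<union>
     {basis_elem [Vertex v] - (\<Sum>e \<in> out_arcs G v. basis_elem [Arrow e, Ghost e]) |v.
        v \<in> verts G \<and> \<not> is_sink G v}"

type_synonym ('v, 'e, 'k) leavitt_elem = "(('v, 'e) gen list \<Rightarrow>\<^sub>0 'k) set"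

definition leavitt_path_algebra ::
  "('v, 'e) pre_digraph \<Rightarrow> ('k::field, ('v, 'e, 'k) leavitt_elem) module"
where
  "leavitt_path_algebra G =
     quotient_algebra (free_algebra (gens G))
       (generated_ideal (free_algebra (gens G)) (leavitt_relations G))"


section \<open>The subcategory of the path algebra modules with \<open>M\<close> equal to its hat\<close>

definition level_paths :: "('v, 'e) pre_digraph \<Rightarrow> nat \<Rightarrow> ('v \<times> 'e list) set" where
  "level_paths G n =
     {p \<in> paths G. length (snd p) = n \<or> length (snd p) < n \<and> is_sink G (path_end G p)}"

definition hat ::
  "('v, 'e) pre_digraph \<Rightarrow> ('k::field, ('v, 'e, 'k) path_algebra_elem, 'm) rmodule \<Rightarrow> 'm set"
where
  "hat G M = {m \<in> carrier M. \<exists>n. \<forall>p \<in> level_paths G n. act M m (basis_elem p) = \<zero>\<^bsub>M\<^esub>}"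

definition hat_modules ::
  "('v, 'e) pre_digraph \<Rightarrow> ('k::field, ('v, 'e, 'k) path_algebra_elem, 'm) rmodule set"
where
  "hat_modules G = {M. unital_right_module (path_algebra G) M \<and> hat G M = carrier M}"

end

theory Submission
  imports Defs
begin

text \<open>Call a homomorphism \<open>\<alpha>\<close> from a module \<open>M\<close> over the path algebra to a module \<open>N\<close> over the Leavitt
  path algebra a localization if its kernel is the hat of \<open>M\<close> and every \<open>y \<in> N\<close> satisfies
  \<open>y p \<in> \<alpha>(M)\<close> for all \<open>p \<in> E\<^sub>n\<close>, for some \<open>n\<close>. Since \<open>y\<close> is the sum of the elements \<open>(y p) p\<^sup>*\<close>, \<open>p \<in> E\<^sub>n\<close>,
  homomorphisms from \<open>M\<close> to a module over the Leavitt path algebra extend uniquely to \<open>N\<close>. Localizations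
  exist: an element of \<open>N\<close> is recorded by its products with the paths in \<open>E\<^sub>n\<close> for large \<open>n\<close>, so \<open>N\<close> can
  be built from coherent families of elements of \<open>M\<close> indexed by the long paths. A morphism of the
  quotient category extends to the localizations, and a homomorphism \<open>g\<close> of localizations comes from
  its restriction to the elements of \<open>M\<close> that \<open>g\<close> sends into the image of the target module.\<close>

section \<open>Right modules over an algebra\<close>

text \<open>All modules are carried by subsets of one type \<open>'m\<close>, while a tensor product
  with the Leavitt path algebra is carried by another type. So every construction must return to
  \<open>'m\<close>: quotients live on chosen coset representatives, and the localization is coded
  into \<open>'m\<close>. The size conditions on \<open>'m\<close> come from there: up to its values
  on short paths, a germ is given by a level n and finitely many nonzero values (by unitality and
  row-finiteness), indexed by lists of arcs. Sums over \<open>E_n\<close> are avoided by two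
  devices. The hat is generalized to the saturation \<open>sat M B\<close> of a submodule B, whose
  idempotence gives closure under extensions. The expansion of y is used through sets closed under
  linear operations and ghosts (\<open>ghost_closed_mem\<close>), such as equalizers or {0}. In this
  way a homomorphism is extended to N as a relation, which is single-valued because modules over the
  Leavitt path algebra have zero hat. The calculus of triples in the quotient category is bypassed:
  a bijection from its arrows to homomorphisms of localizations transports the category
  axioms.\<close>

lemma right_moduleI:
  fixes M :: "('k::field, 'a, 'm) rmodule" (structure)
  assumes "\<zero> \<in> carrier M"
    and "\<And>x y. \<lbrakk>x \<in> carrier M; y \<in> carrier M\<rbrakk> \<Longrightarrow> x \<oplus> y \<in> carrier M"
    and "\<And>x y z. \<lbrakk>x \<in> carrier M; y \<in> carrier M; z \<in> carrier M\<rbrakk> \<Longrightarrow> (x \<oplus> y) \<oplus> z = x \<oplus> (y \<oplus> z)"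
    and "\<And>x y. \<lbrakk>x \<in> carrier M; y \<in> carrier M\<rbrakk> \<Longrightarrow> x \<oplus> y = y \<oplus> x"
    and "\<And>x. x \<in> carrier M \<Longrightarrow> \<zero> \<oplus> x = x"
    and "\<And>c x. x \<in> carrier M \<Longrightarrow> c \<odot> x \<in> carrier M"
    and "\<And>c d x. x \<in> carrier M \<Longrightarrow> (c + d) \<odot> x = c \<odot> x \<oplus> d \<odot> x"
    and "\<And>c x y. \<lbrakk>x \<in> carrier M; y \<in> carrier M\<rbrakk> \<Longrightarrow> c \<odot> (x \<oplus> y) = c \<odot> x \<oplus> c \<odot> y"
    and "\<And>c d x. x \<in> carrier M \<Longrightarrow> (c * d) \<odot> x = c \<odot> (d \<odot> x)"
    and "\<And>x. x \<in> carrier M \<Longrightarrow> 1 \<odot> x = x"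
    and "\<And>x. x \<in> carrier M \<Longrightarrow> 0 \<odot> x = \<zero>"
    and "\<And>m a. \<lbrakk>m \<in> carrier M; a \<in> carrier A\<rbrakk> \<Longrightarrow> act M m a \<in> carrier M"
    and "\<And>m n a. \<lbrakk>m \<in> carrier M; n \<in> carrier M; a \<in> carrier A\<rbrakk>
      \<Longrightarrow> act M (m \<oplus> n) a = act M m a \<oplus> act M n a"
    and "\<And>m a b. \<lbrakk>m \<in> carrier M; a \<in> carrier A; b \<in> carrier A\<rbrakk>
      \<Longrightarrow> act M m (a \<oplus>\<^bsub>A\<^esub> b) = act M m a \<oplus> act M m b"
    and "\<And>c m a. \<lbrakk>m \<in> carrier M; a \<in> carrier A\<rbrakk> \<Longrightarrow> act M (c \<odot> m) a = c \<odot> act M m a"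
    and "\<And>c m a. \<lbrakk>m \<in> carrier M; a \<in> carrier A\<rbrakk> \<Longrightarrow> act M m (c \<odot>\<^bsub>A\<^esub> a) = c \<odot> act M m a"
    and "\<And>m a b. \<lbrakk>m \<in> carrier M; a \<in> carrier A; b \<in> carrier A\<rbrakk>
      \<Longrightarrow> act M m (a \<otimes>\<^bsub>A\<^esub> b) = act M (act M m a) b"
  shows "right_module A M"
proof -
  \<comment> \<open>Negatives are produced by the scalar -1, from (-1) x + x = 0 x.\<close>
  have neg: "\<exists>y\<in>carrier M. y \<oplus> x = \<zero>" if "x \<in> carrier M" for x
  proof
    show "(-1) \<odot> x \<oplus> x = \<zero>"
      using assms(7)[OF that, of "-1" 1] assms(10,11)[OF that] by simp
    show "(-1) \<odot> x \<in> carrier M" using assms(6) that by simp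
  qed
  have "abelian_group M"
    by (rule abelian_groupI) (use assms neg in auto)
  then show ?thesis
    unfolding right_module_def right_module_axioms_def
    by (intro conjI moduleI cring_from_type_algebra)
      (insert assms, simp_all only: ring_of_type_algebra_def ring.simps monoid.simps partial_object.simps, simp_all)
qed

context right_module
begin

lemma sm_closed [simp, intro]: "x \<in> carrier M \<Longrightarrow> c \<odot>\<^bsub>M\<^esub> x \<in> carrier M"
  and sm_add_left: "x \<in> carrier M \<Longrightarrow> (c + d) \<odot>\<^bsub>M\<^esub> x = c \<odot>\<^bsub>M\<^esub> x \<oplus>\<^bsub>M\<^esub> d \<odot>\<^bsub>M\<^esub> x"
  and sm_add_right: "\<lbrakk>x \<in> carrier M; y \<in> carrier M\<rbrakk> \<Longrightarrow> c \<odot>\<^bsub>M\<^esub> (x \<oplus>\<^bsub>M\<^esub> y) = c \<odot>\<^bsub>M\<^esub> x \<oplus>\<^bsub>M\<^esub> c \<odot>\<^bsub>M\<^esub> y"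
  and sm_mult: "x \<in> carrier M \<Longrightarrow> (c * d) \<odot>\<^bsub>M\<^esub> x = c \<odot>\<^bsub>M\<^esub> (d \<odot>\<^bsub>M\<^esub> x)"
  and sm_one [simp]: "x \<in> carrier M \<Longrightarrow> 1 \<odot>\<^bsub>M\<^esub> x = x"
  and sm_zero_left [simp]: "x \<in> carrier M \<Longrightarrow> 0 \<odot>\<^bsub>M\<^esub> x = \<zero>\<^bsub>M\<^esub>"
  and sm_zero_right [simp]: "c \<odot>\<^bsub>M\<^esub> \<zero>\<^bsub>M\<^esub> = \<zero>\<^bsub>M\<^esub>"
  using smult_closed smult_l_distr smult_r_distr smult_assoc1 smult_one smult_l_null smult_r_null
  by (auto simp: ring_of_type_algebra_def)

lemma sm_minus_one: "x \<in> carrier M \<Longrightarrow> (-1) \<odot>\<^bsub>M\<^esub> x = \<ominus>\<^bsub>M\<^esub> x"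
  using sm_add_left[of x "-1" 1] by (simp add: M.minus_equality)

lemma act_zero [simp]: "a \<in> carrier A \<Longrightarrow> act M \<zero>\<^bsub>M\<^esub> a = \<zero>\<^bsub>M\<^esub>"
  using act_smult_left[of "\<zero>\<^bsub>M\<^esub>" a 0] by (simp add: act_closed)

lemma minus_zero_iff: "\<lbrakk>x \<in> carrier M; y \<in> carrier M\<rbrakk> \<Longrightarrow> x \<ominus>\<^bsub>M\<^esub> y = \<zero>\<^bsub>M\<^esub> \<longleftrightarrow> x = y"
  by (metis M.a_inv_closed M.minus_equality M.minus_minus M.r_neg a_minus_def)

end

text \<open>In contrast to \<open>module_homs\<close>, the two carriers may lie in different types,
  and maps are not forced to be \<open>undefined\<close> off the carrier, so that inclusions and
  composites are plain lambda terms.\<close>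

definition rhom ::
  "('k, 'a) module \<Rightarrow> ('k, 'a, 'm) rmodule \<Rightarrow> ('k, 'a, 'n) rmodule \<Rightarrow> ('m \<Rightarrow> 'n) \<Rightarrow> bool"
where
  "rhom A M N f \<longleftrightarrow> f \<in> carrier M \<rightarrow> carrier N \<and>
     (\<forall>x \<in> carrier M. \<forall>y \<in> carrier M. f (x \<oplus>\<^bsub>M\<^esub> y) = f x \<oplus>\<^bsub>N\<^esub> f y) \<and>
     (\<forall>c. \<forall>x \<in> carrier M. f (c \<odot>\<^bsub>M\<^esub> x) = c \<odot>\<^bsub>N\<^esub> f x) \<and>
     (\<forall>x \<in> carrier M. \<forall>a \<in> carrier A. f (act M x a) = act N (f x) a)"

lemma module_homs_iff:
  "f \<in> module_homs A M N \<longleftrightarrow> f \<in> extensional (carrier M) \<and> rhom A M N f"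
  by (auto simp: module_homs_def rhom_def PiE_def)

lemma rhomI:
  assumes "\<And>x. x \<in> carrier M \<Longrightarrow> f x \<in> carrier N"
    and "\<And>x y. \<lbrakk>x \<in> carrier M; y \<in> carrier M\<rbrakk> \<Longrightarrow> f (x \<oplus>\<^bsub>M\<^esub> y) = f x \<oplus>\<^bsub>N\<^esub> f y"
    and "\<And>c x. x \<in> carrier M \<Longrightarrow> f (c \<odot>\<^bsub>M\<^esub> x) = c \<odot>\<^bsub>N\<^esub> f x"
    and "\<And>x a. \<lbrakk>x \<in> carrier M; a \<in> carrier A\<rbrakk> \<Longrightarrow> f (act M x a) = act N (f x) a"
  shows "rhom A M N f"
  using assms by (auto simp: rhom_def)

lemma rhomD:
  assumes "rhom A M N f"
  shows rhom_closed: "x \<in> carrier M \<Longrightarrow> f x \<in> carrier N"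
    and rhom_add: "\<lbrakk>x \<in> carrier M; y \<in> carrier M\<rbrakk> \<Longrightarrow> f (x \<oplus>\<^bsub>M\<^esub> y) = f x \<oplus>\<^bsub>N\<^esub> f y"
    and rhom_smult: "x \<in> carrier M \<Longrightarrow> f (c \<odot>\<^bsub>M\<^esub> x) = c \<odot>\<^bsub>N\<^esub> f x"
    and rhom_act: "\<lbrakk>x \<in> carrier M; a \<in> carrier A\<rbrakk> \<Longrightarrow> f (act M x a) = act N (f x) a"
  using assms by (auto simp: rhom_def)

lemma rhom_comp: "rhom A M N f \<Longrightarrow> rhom A N P g \<Longrightarrow> rhom A M P (\<lambda>x. g (f x))"
  by (auto simp: rhom_def Pi_iff)

lemma rhom_cong: "rhom A M N f \<Longrightarrow> right_module A M \<Longrightarrow> (\<And>x. x \<in> carrier M \<Longrightarrow> g x = f x) \<Longrightarrow> rhom A M N g"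
proof -
  assume "right_module A M"
  then interpret M: right_module A M .
  show "rhom A M N f \<Longrightarrow> (\<And>x. x \<in> carrier M \<Longrightarrow> g x = f x) \<Longrightarrow> rhom A M N g"
    by (intro rhomI) (auto simp: rhomD M.act_closed)
qed

lemma rhom_restrict: "rhom A M N f \<Longrightarrow> right_module A M \<Longrightarrow> rhom A M N (restrict f (carrier M))"
  by (erule rhom_cong) auto

context
  fixes A :: "('k::field, 'a) module" and M :: "('k, 'a, 'm) rmodule" and N :: "('k, 'a, 'n) rmodule" and f
  assumes M: "right_module A M" and N: "right_module A N" and f: "rhom A M N f"
begin

interpretation M: right_module A M by (fact M)
interpretation N: right_module A N by (fact N)

lemma rhom_zero: "f \<zero>\<^bsub>M\<^esub> = \<zero>\<^bsub>N\<^esub>"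
  by (metis M.sm_zero_right N.sm_zero_left f rhom_closed rhom_smult M.M.zero_closed)

lemma rhom_uminus: "x \<in> carrier M \<Longrightarrow> f (\<ominus>\<^bsub>M\<^esub> x) = \<ominus>\<^bsub>N\<^esub> f x"
  using rhom_smult[OF f, of x "-1"] by (simp add: M.sm_minus_one N.sm_minus_one rhom_closed[OF f])

lemma rhom_minus: "\<lbrakk>x \<in> carrier M; y \<in> carrier M\<rbrakk> \<Longrightarrow> f (x \<ominus>\<^bsub>M\<^esub> y) = f x \<ominus>\<^bsub>N\<^esub> f y"
  by (simp add: a_minus_def rhom_add[OF f] rhom_uminus)

lemma rhom_eq_iff: "\<lbrakk>x \<in> carrier M; y \<in> carrier M\<rbrakk> \<Longrightarrow> f x = f y \<longleftrightarrow> f (x \<ominus>\<^bsub>M\<^esub> y) = \<zero>\<^bsub>N\<^esub>"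
  by (simp add: rhom_minus N.minus_zero_iff rhom_closed[OF f])

lemma rhom_inj_on: "inj_on f (carrier M) \<longleftrightarrow> (\<forall>x \<in> carrier M. f x = \<zero>\<^bsub>N\<^esub> \<longrightarrow> x = \<zero>\<^bsub>M\<^esub>)"
proof
  assume "inj_on f (carrier M)"
  then show "\<forall>x \<in> carrier M. f x = \<zero>\<^bsub>N\<^esub> \<longrightarrow> x = \<zero>\<^bsub>M\<^esub>"
    using rhom_zero by (metis M.M.zero_closed inj_onD)
next
  assume "\<forall>x \<in> carrier M. f x = \<zero>\<^bsub>N\<^esub> \<longrightarrow> x = \<zero>\<^bsub>M\<^esub>"
  then show "inj_on f (carrier M)"
    by (intro inj_onI) (metis M.M.minus_closed M.minus_zero_iff rhom_eq_iff)
qed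

end

section \<open>Submodules, their images and preimages\<close>

definition submod :: "('k, 'a) module \<Rightarrow> ('k, 'a, 'm) rmodule \<Rightarrow> 'm set \<Rightarrow> bool" where
  "submod A M B \<longleftrightarrow> B \<subseteq> carrier M \<and> \<zero>\<^bsub>M\<^esub> \<in> B \<and> (\<forall>x \<in> B. \<forall>y \<in> B. x \<oplus>\<^bsub>M\<^esub> y \<in> B) \<and>
     (\<forall>c. \<forall>x \<in> B. c \<odot>\<^bsub>M\<^esub> x \<in> B) \<and> (\<forall>x \<in> B. \<forall>a \<in> carrier A. act M x a \<in> B)"

lemma submodI:
  assumes "B \<subseteq> carrier M" "\<zero>\<^bsub>M\<^esub> \<in> B" "\<And>x y. \<lbrakk>x \<in> B; y \<in> B\<rbrakk> \<Longrightarrow> x \<oplus>\<^bsub>M\<^esub> y \<in> B"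
    "\<And>c x. x \<in> B \<Longrightarrow> c \<odot>\<^bsub>M\<^esub> x \<in> B" "\<And>x a. \<lbrakk>x \<in> B; a \<in> carrier A\<rbrakk> \<Longrightarrow> act M x a \<in> B"
  shows "submod A M B"
  using assms by (auto simp: submod_def)

lemma submodD:
  assumes "submod A M B"
  shows submod_sub: "B \<subseteq> carrier M" and submod_zero: "\<zero>\<^bsub>M\<^esub> \<in> B"
    and submod_add: "\<lbrakk>x \<in> B; y \<in> B\<rbrakk> \<Longrightarrow> x \<oplus>\<^bsub>M\<^esub> y \<in> B"
    and submod_smult: "x \<in> B \<Longrightarrow> c \<odot>\<^bsub>M\<^esub> x \<in> B"
    and submod_act: "\<lbrakk>x \<in> B; a \<in> carrier A\<rbrakk> \<Longrightarrow> act M x a \<in> B"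
  using assms by (auto simp: submod_def)

lemma submod_mem: "submod A M B \<Longrightarrow> x \<in> B \<Longrightarrow> x \<in> carrier M"
  by (auto simp: submod_def)

lemma submod_minus:
  assumes "right_module A M" "submod A M B" "x \<in> B" "y \<in> B"
  shows "x \<ominus>\<^bsub>M\<^esub> y \<in> B"
proof -
  interpret right_module A M by fact
  have "x \<ominus>\<^bsub>M\<^esub> y = x \<oplus>\<^bsub>M\<^esub> (-1) \<odot>\<^bsub>M\<^esub> y"
    using assms by (simp add: sm_minus_one a_minus_def submod_mem)
  then show ?thesis using assms by (simp add: submodD)
qed

lemma submod_Int: "submod A M B \<Longrightarrow> submod A M C \<Longrightarrow> submod A M (B \<inter> C)"
  by (auto simp: submod_def)

lemma submod_carrier:
  assumes "right_module A M"
  shows "submod A M (carrier M)"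
proof -
  interpret M: right_module A M by fact
  show ?thesis by (auto simp: submod_def M.act_closed)
qed

lemma submod_vimage:
  assumes "right_module A M" "right_module A N" "rhom A M N f" "submod A N C"
  shows "submod A M {x \<in> carrier M. f x \<in> C}"
proof -
  interpret M: right_module A M by fact
  show ?thesis using assms
    by (intro submodI) (auto simp: rhom_zero submodD rhomD M.act_closed)
qed

lemma submod_singleton_zero: "right_module A M \<Longrightarrow> submod A M {\<zero>\<^bsub>M\<^esub>}"
proof -
  assume "right_module A M"
  then interpret M: right_module A M .
  show ?thesis by (intro submodI) auto
qed

lemma submod_kernel:
  assumes "right_module A M" "right_module A N" "rhom A M N f"
  shows "submod A M {x \<in> carrier M. f x = \<zero>\<^bsub>N\<^esub>}"
  using submod_vimage[OF assms submod_singleton_zero[OF assms(2)]] by simp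

lemma submod_image:
  assumes "right_module A M" "right_module A N" "rhom A M N f" "submod A M B"
  shows "submod A N (f ` B)"
proof -
  interpret M: right_module A M by fact
  interpret N: right_module A N by fact
  note B = submodD[OF assms(4)]
  show ?thesis
  proof (rule submodI)
    show "f ` B \<subseteq> carrier N" using assms B(1) by (auto simp: rhomD)
    show "\<zero>\<^bsub>N\<^esub> \<in> f ` B" using rhom_zero[OF assms(1-3)] B(2) by (metis imageI)
    show "x \<oplus>\<^bsub>N\<^esub> y \<in> f ` B" if "x \<in> f ` B" "y \<in> f ` B" for x y
    proof -
      from that obtain u v where uv: "u \<in> B" "v \<in> B" "x = f u" "y = f v" by auto
      then have "f u \<oplus>\<^bsub>N\<^esub> f v = f (u \<oplus>\<^bsub>M\<^esub> v)"
        using rhom_add[OF assms(3), of u v, symmetric] subsetD[OF B(1)] by blast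
      with uv B(3) show ?thesis by simp
    qed
    show "c \<odot>\<^bsub>N\<^esub> x \<in> f ` B" if "x \<in> f ` B" for x c
      using that B(1,4) by (auto simp flip: rhom_smult[OF assms(3)])
    show "act N x a \<in> f ` B" if "x \<in> f ` B" "a \<in> carrier A" for x a
      using that B(1,5) by (auto simp: subset_eq simp flip: rhom_act[OF assms(3)])
  qed
qed

lemma submod_right_module:
  assumes "right_module A M" "submod A M B"
  shows "right_module A (M\<lparr>carrier := B\<rparr>)"
proof -
  interpret right_module A M by fact
  note B = submodD[OF assms(2)] submod_mem[OF assms(2)]
  show ?thesis
    by (rule right_moduleI)
      (use B in \<open>auto simp: M.a_ac sm_add_left sm_add_right sm_mult
        act_add_left act_add_right act_smult_left act_smult_right act_mult\<close>)
qed

lemma rhom_incl: "submod A M B \<Longrightarrow> rhom A (M\<lparr>carrier := B\<rparr>) M (\<lambda>x. x)"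
  by (intro rhomI) (auto simp: submod_mem)

lemma rhom_corestrict:
  "rhom A M N f \<Longrightarrow> (\<And>x. x \<in> carrier M \<Longrightarrow> f x \<in> C) \<Longrightarrow> rhom A M (N\<lparr>carrier := C\<rparr>) f"
  by (auto simp: rhom_def)

lemma rhom_subdomain: "rhom A M N f \<Longrightarrow> B \<subseteq> carrier M \<Longrightarrow> rhom A (M\<lparr>carrier := B\<rparr>) N f"
  by (auto simp: rhom_def subset_eq)

text \<open>\<open>right_module\<close> says nothing about closure of A itself. Closure is what
  permits the homomorphism law at a + b, a b and c a when the module axioms are moved along a
  map.\<close>

definition closed_algebra :: "('k, 'a) module \<Rightarrow> bool" where
  "closed_algebra A \<longleftrightarrow> (\<forall>a \<in> carrier A. \<forall>b \<in> carrier A. a \<oplus>\<^bsub>A\<^esub> b \<in> carrier A \<and> a \<otimes>\<^bsub>A\<^esub> b \<in> carrier A) \<and>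
     (\<forall>c. \<forall>a \<in> carrier A. c \<odot>\<^bsub>A\<^esub> a \<in> carrier A)"

text \<open>Every axiom of N is the image under f of the same axiom of M. The zero is treated by its
  own assumption because N is not yet known to be a group.\<close>

lemma right_module_image:
  assumes A: "closed_algebra A" and "right_module A M" "carrier N = f ` carrier M" "rhom A M N f" "f \<zero>\<^bsub>M\<^esub> = \<zero>\<^bsub>N\<^esub>"
  shows "right_module A N"
proof -
  interpret right_module A M by fact
  note h = rhomD(2-)[OF assms(4), symmetric] A[unfolded closed_algebra_def]
  show ?thesis
    apply (rule right_moduleI)
    unfolding assms(3) assms(5)[symmetric]
    by (auto simp: h act_closed sm_add_left[symmetric] sm_mult[symmetric] sm_add_right[symmetric]
        act_add_left[symmetric] act_add_right[symmetric] act_smult_left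
        act_smult_right act_mult[symmetric] M.a_ac)
qed

text \<open>The image of a module under a map \<open>\<pi>\<close> whose fibres are the cosets of a submodule: the quotient,
  realized in the type of the values of \<open>\<pi>\<close>.\<close>

definition image_module :: "('k, 'a, 'n) rmodule \<Rightarrow> ('n \<Rightarrow> 'm) \<Rightarrow> ('k, 'a, 'm) rmodule" where
  "image_module M \<pi> = (let s = inv_into (carrier M) \<pi> in \<lparr>
     carrier = \<pi> ` carrier M, monoid.mult = undefined, one = undefined,
     ring.zero = \<pi> \<zero>\<^bsub>M\<^esub>, add = (\<lambda>x y. \<pi> (s x \<oplus>\<^bsub>M\<^esub> s y)),
     module.smult = (\<lambda>c x. \<pi> (c \<odot>\<^bsub>M\<^esub> s x)), act = (\<lambda>x a. \<pi> (act M (s x) a)) \<rparr>)"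

text \<open>The operations are computed on chosen preimages \<open>s\<close>. Another preimage
  differs by an element of B, and B is stable under all operations, so the results have the same
  value under \<pi>.\<close>

lemma
  assumes A: "closed_algebra A" and M: "right_module A M" and B: "submod A M B"
    and fib: "\<And>x y. \<lbrakk>x \<in> carrier M; y \<in> carrier M\<rbrakk> \<Longrightarrow> \<pi> x = \<pi> y \<longleftrightarrow> x \<ominus>\<^bsub>M\<^esub> y \<in> B"
  shows image_module_rhom: "rhom A M (image_module M \<pi>) \<pi>"
    and image_module_right_module: "right_module A (image_module M \<pi>)"
    and image_module_carrier: "carrier (image_module M \<pi>) = \<pi> ` carrier M"
    and image_module_zero_iff: "x \<in> carrier M \<Longrightarrow> \<pi> x = \<zero>\<^bsub>image_module M \<pi>\<^esub> \<longleftrightarrow> x \<in> B"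
proof -
  interpret right_module A M by fact
  define s where "s = inv_into (carrier M) \<pi>"
  have s: "s (\<pi> x) \<in> carrier M" "\<pi> (s (\<pi> x)) = \<pi> x" if "x \<in> carrier M" for x
    using that by (auto simp: s_def inv_into_into f_inv_into_f)
  have sB: "s (\<pi> x) \<ominus>\<^bsub>M\<^esub> x \<in> B" if "x \<in> carrier M" for x
    using that s fib by blast
  note defs = image_module_def Let_def s_def[symmetric]
  note BD = submodD[OF B] submod_mem[OF B]
  show c: "carrier (image_module M \<pi>) = \<pi> ` carrier M" by (simp add: defs)
  show hom: "rhom A M (image_module M \<pi>) \<pi>"
  proof (rule rhomI)
    fix x y assume xy: "x \<in> carrier M" "y \<in> carrier M"
    have "x \<oplus>\<^bsub>M\<^esub> y \<ominus>\<^bsub>M\<^esub> (s (\<pi> x) \<oplus>\<^bsub>M\<^esub> s (\<pi> y)) = \<ominus>\<^bsub>M\<^esub> (s (\<pi> x) \<ominus>\<^bsub>M\<^esub> x) \<ominus>\<^bsub>M\<^esub> (s (\<pi> y) \<ominus>\<^bsub>M\<^esub> y)"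
      using xy s by (simp add: a_minus_def M.minus_add M.a_ac)
    also have "\<dots> = (-1) \<odot>\<^bsub>M\<^esub> (s (\<pi> x) \<ominus>\<^bsub>M\<^esub> x) \<ominus>\<^bsub>M\<^esub> (s (\<pi> y) \<ominus>\<^bsub>M\<^esub> y)"
      using xy s by (simp add: sm_minus_one)
    also have "\<dots> \<in> B" by (intro submod_minus[OF M B] BD sB xy)
    finally show "\<pi> (x \<oplus>\<^bsub>M\<^esub> y) = \<pi> x \<oplus>\<^bsub>image_module M \<pi>\<^esub> \<pi> y"
      using xy s fib by (simp add: defs)
  next
    fix c x assume x: "x \<in> carrier M"
    have "c \<odot>\<^bsub>M\<^esub> x \<ominus>\<^bsub>M\<^esub> c \<odot>\<^bsub>M\<^esub> s (\<pi> x) = (-c) \<odot>\<^bsub>M\<^esub> (s (\<pi> x) \<ominus>\<^bsub>M\<^esub> x)"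
    proof -
      have "(-c) \<odot>\<^bsub>M\<^esub> (s (\<pi> x) \<ominus>\<^bsub>M\<^esub> x) = (-c) \<odot>\<^bsub>M\<^esub> s (\<pi> x) \<oplus>\<^bsub>M\<^esub> (-c) \<odot>\<^bsub>M\<^esub> ((-1) \<odot>\<^bsub>M\<^esub> x)"
        using x s by (simp add: a_minus_def sm_add_right sm_minus_one)
      also have "(-c) \<odot>\<^bsub>M\<^esub> ((-1) \<odot>\<^bsub>M\<^esub> x) = c \<odot>\<^bsub>M\<^esub> x"
        using x by (simp flip: sm_mult)
      also have "(-c) \<odot>\<^bsub>M\<^esub> s (\<pi> x) = \<ominus>\<^bsub>M\<^esub> (c \<odot>\<^bsub>M\<^esub> s (\<pi> x))"
        using x s sm_mult[of "s (\<pi> x)" "-1" c] by (simp add: sm_minus_one)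
      finally show ?thesis using x s by (simp add: a_minus_def M.a_comm)
    qed
    also have "\<dots> \<in> B" by (intro BD sB x)
    finally show "\<pi> (c \<odot>\<^bsub>M\<^esub> x) = c \<odot>\<^bsub>image_module M \<pi>\<^esub> \<pi> x"
      using x s fib by (simp add: defs)
  next
    fix x a assume x: "x \<in> carrier M" and a: "a \<in> carrier A"
    have "act M (s (\<pi> x)) a \<ominus>\<^bsub>M\<^esub> act M x a = act M (s (\<pi> x) \<ominus>\<^bsub>M\<^esub> x) a"
      using x a s by (simp add: a_minus_def act_add_left act_smult_left act_closed flip: sm_minus_one)
    also have "\<dots> \<in> B" by (intro BD sB x a)
    finally show "\<pi> (act M x a) = act (image_module M \<pi>) (\<pi> x) a"
      using x a s fib act_closed by (simp add: defs) metis
  qed (simp add: c)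
  show "right_module A (image_module M \<pi>)"
    by (rule right_module_image[OF A M c hom]) (simp add: defs)
  show "\<pi> x = \<zero>\<^bsub>image_module M \<pi>\<^esub> \<longleftrightarrow> x \<in> B" if "x \<in> carrier M"
    using fib[OF that M.zero_closed] that M.minus_equality[of "\<zero>\<^bsub>M\<^esub>" "\<zero>\<^bsub>M\<^esub>"] by (simp add: defs a_minus_def)
qed

text \<open>Cosets are represented by elements, not by sets, so that a quotient of a module on
  \<open>'m\<close> is again carried by \<open>'m\<close>. For a submodule B, the choice predicate
  depends on x only through its coset.\<close>

definition coset_rep :: "('k, 'a, 'm) rmodule \<Rightarrow> 'm set \<Rightarrow> 'm \<Rightarrow> 'm" where
  "coset_rep M B x = (SOME y. y \<in> carrier M \<and> y \<ominus>\<^bsub>M\<^esub> x \<in> B)"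

lemma (in abelian_group) minus_minus_cancel:
  assumes "x \<in> carrier G" "y \<in> carrier G" "z \<in> carrier G"
  shows "(z \<ominus> y) \<ominus> (z \<ominus> x) = x \<ominus> y" "(z \<ominus> x) \<oplus> (x \<ominus> y) = z \<ominus> y"
proof -
  have "(z \<ominus> y) \<ominus> (z \<ominus> x) = (x \<ominus> y) \<oplus> (z \<ominus> z)"
    using assms by (simp add: a_minus_def minus_add a_ac)
  then show "(z \<ominus> y) \<ominus> (z \<ominus> x) = x \<ominus> y" using assms by (simp add: a_minus_def r_neg)
  have "(z \<ominus> x) \<oplus> (x \<ominus> y) = (z \<ominus> y) \<oplus> (x \<ominus> x)"
    using assms by (simp add: a_minus_def a_ac)
  then show "(z \<ominus> x) \<oplus> (x \<ominus> y) = z \<ominus> y" using assms by (simp add: a_minus_def r_neg)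
qed

lemma coset_rep_eq_iff:
  assumes M: "right_module A M" and B: "submod A M B" and x: "x \<in> carrier M" and y: "y \<in> carrier M"
  shows "coset_rep M B x = coset_rep M B y \<longleftrightarrow> x \<ominus>\<^bsub>M\<^esub> y \<in> B"
proof -
  interpret right_module A M by fact
  note BD = submodD[OF B] submod_mem[OF B]
  have ex: "\<exists>u. u \<in> carrier M \<and> u \<ominus>\<^bsub>M\<^esub> z \<in> B" if "z \<in> carrier M" for z
    using that BD(2) minus_zero_iff[of z z] by auto
  have r: "coset_rep M B z \<in> carrier M \<and> coset_rep M B z \<ominus>\<^bsub>M\<^esub> z \<in> B" if "z \<in> carrier M" for z
    unfolding coset_rep_def by (rule someI_ex[OF ex[OF that]])
  show ?thesis
  proof
    assume e: "coset_rep M B x = coset_rep M B y"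
    let ?r = "coset_rep M B x"
    have "(?r \<ominus>\<^bsub>M\<^esub> y) \<ominus>\<^bsub>M\<^esub> (?r \<ominus>\<^bsub>M\<^esub> x) \<in> B"
      by (rule submod_minus[OF M B]) (use r[OF x] r[OF y] e in auto)
    then show "x \<ominus>\<^bsub>M\<^esub> y \<in> B" using M.minus_minus_cancel(1)[OF x y] r[OF x] by simp
  next
    assume xy: "x \<ominus>\<^bsub>M\<^esub> y \<in> B"
    \<comment> \<open>The two choice predicates agree on the carrier, so \<open>SOME\<close> returns
      the same element.\<close>
    have "z \<ominus>\<^bsub>M\<^esub> x \<in> B \<longleftrightarrow> z \<ominus>\<^bsub>M\<^esub> y \<in> B" if z: "z \<in> carrier M" for z
    proof
      assume "z \<ominus>\<^bsub>M\<^esub> x \<in> B"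
      then show "z \<ominus>\<^bsub>M\<^esub> y \<in> B" using BD(3)[OF _ xy] M.minus_minus_cancel(2)[OF x y z] by force
    next
      assume "z \<ominus>\<^bsub>M\<^esub> y \<in> B"
      moreover have "y \<ominus>\<^bsub>M\<^esub> x = (x \<ominus>\<^bsub>M\<^esub> x) \<ominus>\<^bsub>M\<^esub> (x \<ominus>\<^bsub>M\<^esub> y)"
        using M.minus_minus_cancel(1)[OF y x x] by simp
      then have "y \<ominus>\<^bsub>M\<^esub> x \<in> B"
        using submod_minus[OF M B BD(2) xy] x minus_zero_iff[of x x] by simp
      ultimately show "z \<ominus>\<^bsub>M\<^esub> x \<in> B" using BD(3) M.minus_minus_cancel(2)[OF y x z] by force
    qed
    then show "coset_rep M B x = coset_rep M B y"
      unfolding coset_rep_def by (metis (no_types, lifting))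
  qed
qed

section \<open>The category of unital modules over an algebra with local units\<close>

text \<open>Arbitrary preimages under c can be used: two of them differ by an element of the kernel
  of c, on which h vanishes.\<close>

lemma rhom_factor_surj:
  assumes M: "right_module A M" and Q: "right_module A Q" and P: "right_module A P"
    and c: "rhom A M Q c" and surj: "c ` carrier M = carrier Q" and h: "rhom A M P h"
    and ker: "\<And>x. x \<in> carrier M \<Longrightarrow> c x = \<zero>\<^bsub>Q\<^esub> \<Longrightarrow> h x = \<zero>\<^bsub>P\<^esub>"
  obtains u where "rhom A Q P u" "\<And>x. x \<in> carrier M \<Longrightarrow> u (c x) = h x"
proof
  interpret M: right_module A M by fact
  let ?u = "\<lambda>y. h (inv_into (carrier M) c y)"
  show u: "?u (c x) = h x" if x: "x \<in> carrier M" for x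
  proof -
    let ?x = "inv_into (carrier M) c (c x)"
    have x': "?x \<in> carrier M" "c ?x = c x" using x by (auto intro: inv_into_into f_inv_into_f)
    then have "h (?x \<ominus>\<^bsub>M\<^esub> x) = \<zero>\<^bsub>P\<^esub>"
      using x rhom_eq_iff[OF M Q c x'(1) x] by (intro ker) blast+
    then show ?thesis using rhom_eq_iff[OF M P h x'(1) x] by blast
  qed
  show "rhom A Q P ?u"
  proof (rule rhomI)
    fix y assume "y \<in> carrier Q"
    then obtain x where "x \<in> carrier M" "y = c x" using surj by blast
    then show "?u y \<in> carrier P" using u rhom_closed[OF h] by simp
  next
    fix y y' assume "y \<in> carrier Q" "y' \<in> carrier Q"
    then obtain x x' where "x \<in> carrier M" "x' \<in> carrier M" "y = c x" "y' = c x'"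
      using surj by blast
    then show "?u (y \<oplus>\<^bsub>Q\<^esub> y') = ?u y \<oplus>\<^bsub>P\<^esub> ?u y'"
      using u[of "x \<oplus>\<^bsub>M\<^esub> x'"] u rhom_add[OF c] rhom_add[OF h] by simp
  next
    fix k y assume "y \<in> carrier Q"
    then obtain x where "x \<in> carrier M" "y = c x" using surj by blast
    then show "?u (k \<odot>\<^bsub>Q\<^esub> y) = k \<odot>\<^bsub>P\<^esub> ?u y"
      using u[of "k \<odot>\<^bsub>M\<^esub> x"] u rhom_smult[OF c] rhom_smult[OF h] by simp
  next
    fix y a assume "y \<in> carrier Q" and a: "a \<in> carrier A"
    then obtain x where "x \<in> carrier M" "y = c x" using surj by blast
    then show "?u (act Q y a) = act P (?u y) a"
      using u[of "act M x a"] u rhom_act[OF c] rhom_act[OF h] a M.act_closed by simp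
  qed
qed

text \<open>Since k is injective, each homomorphism law for u can be checked after applying k, where
  it becomes a law for h.\<close>

lemma rhom_lift_inj:
  assumes K: "right_module A K" and W: "right_module A W"
    and k: "rhom A K M k" and inj: "inj_on k (carrier K)" and h: "rhom A W M h"
    and sub: "h ` carrier W \<subseteq> k ` carrier K"
  obtains u where "rhom A W K u" "\<And>x. x \<in> carrier W \<Longrightarrow> k (u x) = h x"
proof
  interpret K: right_module A K by fact
  interpret W: right_module A W by fact
  let ?u = "\<lambda>x. inv_into (carrier K) k (h x)"
  have uc: "?u x \<in> carrier K" if "x \<in> carrier W" for x
    using that sub by (meson image_subset_iff inv_into_into)
  show ku: "k (?u x) = h x" if "x \<in> carrier W" for x
    using that sub by (meson image_subset_iff f_inv_into_f)
  have uniq: "?u x = y" if "x \<in> carrier W" "y \<in> carrier K" "k y = h x" for x y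
    using inv_into_f_f[OF inj that(2)] that(3) by simp
  show "rhom A W K ?u"
  proof (rule rhomI)
    show "?u x \<in> carrier K" if "x \<in> carrier W" for x by (rule uc[OF that])
    show "?u (x \<oplus>\<^bsub>W\<^esub> y) = ?u x \<oplus>\<^bsub>K\<^esub> ?u y" if "x \<in> carrier W" "y \<in> carrier W" for x y
      using that by (intro uniq) (simp_all add: uc ku rhom_add[OF k] rhom_add[OF h])
    show "?u (c \<odot>\<^bsub>W\<^esub> x) = c \<odot>\<^bsub>K\<^esub> ?u x" if "x \<in> carrier W" for x c
      using that by (intro uniq) (simp_all add: uc ku rhom_smult[OF k] rhom_smult[OF h])
    show "?u (act W x a) = act K (?u x) a" if "x \<in> carrier W" "a \<in> carrier A" for x a
      using that by (intro uniq) (simp_all add: uc ku rhom_act[OF k] rhom_act[OF h] K.act_closed W.act_closed)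
  qed
qed

text \<open>Common setting for the path algebra and the Leavitt path algebra, where finite sums of
  vertices replace the unit that is missing when there are infinitely many vertices.\<close>

locale local_unit_algebra =
  fixes A :: "('k::field, 'a) module"
  assumes closed: "closed_algebra A"
    and nonempty: "carrier A \<noteq> {}"
    and local_unit: "\<lbrakk>a \<in> carrier A; b \<in> carrier A\<rbrakk> \<Longrightarrow> \<exists>e \<in> carrier A. a \<otimes>\<^bsub>A\<^esub> e = a \<and> b \<otimes>\<^bsub>A\<^esub> e = b"
begin

abbreviation UM :: "('k, 'a, 'm) rmodule \<Rightarrow> bool" where
  "UM M \<equiv> unital_right_module A M"

abbreviation ModC :: "(('k, 'a, 'm) rmodule, ('k, 'a, 'm) rmodule \<times> ('m \<Rightarrow> 'm) \<times> ('k, 'a, 'm) rmodule) cat"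
  where "ModC \<equiv> module_category A"

lemma UM_right_module: "UM M \<Longrightarrow> right_module A M"
  by (simp add: unital_right_module_def)

text \<open>The elements fixed by some member of A form a subgroup: if a and b fix two elements, a
  common right unit e of a and b fixes both of them, hence their sum. Unitality thus becomes a
  condition on single elements.\<close>

lemma UM_iff: "UM M \<longleftrightarrow> right_module A M \<and> (\<forall>m \<in> carrier M. \<exists>a \<in> carrier A. act M m a = m)"
proof (cases "right_module A M")
  case True
  then interpret right_module A M .
  let ?G = "{act M m a |m a. m \<in> carrier M \<and> a \<in> carrier A}"
  interpret AG: group "add_monoid M" by (rule M.a_group)
  have fixed: "m \<in> carrier M \<and> (\<exists>a \<in> carrier A. act M m a = m)"
    if "m \<in> generate (add_monoid M) ?G" for m
    using that
  proof (induction rule: generate.induct)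
    case one
    then show ?case using nonempty by auto
  next
    case (incl h)
    then obtain m a where m: "m \<in> carrier M" "a \<in> carrier A" "h = act M m a" by auto
    with local_unit[of a a] obtain e where "e \<in> carrier A" "a \<otimes>\<^bsub>A\<^esub> e = a" by auto
    with m show ?case using act_mult[of m a e] act_closed by force
  next
    case (inv h)
    then obtain m a where m: "m \<in> carrier M" "a \<in> carrier A" "h = act M m a" by auto
    with local_unit[of a a] obtain e where e: "e \<in> carrier A" "a \<otimes>\<^bsub>A\<^esub> e = a" by auto
    have h: "h \<in> carrier M" "act M h e = h" using m e act_mult[of m a e] act_closed by auto
    have "act M (\<ominus>\<^bsub>M\<^esub> h) e = \<ominus>\<^bsub>M\<^esub> h"
      using act_smult_left[of h e "-1"] h e by (simp add: sm_minus_one)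
    with e h show ?case unfolding a_inv_def[symmetric] by blast
  next
    case (eng h1 h2)
    then obtain a b where "a \<in> carrier A" "b \<in> carrier A" "act M h1 a = h1" "act M h2 b = h2" by auto
    moreover from this obtain e where "e \<in> carrier A" "a \<otimes>\<^bsub>A\<^esub> e = a" "b \<otimes>\<^bsub>A\<^esub> e = b"
      using local_unit by blast
    ultimately have "act M h1 e = h1" "act M h2 e = h2"
      using eng.IH act_mult[of h1 a e] act_mult[of h2 b e] by auto
    with \<open>e \<in> carrier A\<close> eng.IH show ?case
      using act_add_left[of h1 h2 e] by auto
  qed
  show ?thesis
  proof
    assume "UM M"
    then have "generate (add_monoid M) ?G = carrier M"
      by (simp add: unital_right_module_def unital_right_module_axioms_def)
    with fixed True show "right_module A M \<and> (\<forall>m \<in> carrier M. \<exists>a \<in> carrier A. act M m a = m)" by blast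
  next
    assume *: "right_module A M \<and> (\<forall>m \<in> carrier M. \<exists>a \<in> carrier A. act M m a = m)"
    have "carrier M \<subseteq> generate (add_monoid M) ?G"
    proof
      fix m assume m: "m \<in> carrier M"
      with * obtain a where "a \<in> carrier A" "act M m a = m" by blast
      with m have "m \<in> ?G" by (metis (mono_tags, lifting) mem_Collect_eq)
      then show "m \<in> generate (add_monoid M) ?G" by (rule generate.incl)
    qed
    with fixed True show "UM M"
      by (auto simp: unital_right_module_def unital_right_module_axioms_def)
  qed
qed (simp add: unital_right_module_def)

lemma UM_image_of:
  assumes "UM M" "right_module A N" "carrier N = f ` carrier M" "rhom A M N f"
  shows "UM N"
proof -
  have "\<exists>a \<in> carrier A. act N y a = y" if "y \<in> carrier N" for y
  proof -
    from that assms(3) obtain m where m: "m \<in> carrier M" "y = f m" by auto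
    with assms(1) obtain a where "a \<in> carrier A" "act M m a = m" by (auto simp: UM_iff)
    with m show ?thesis using rhom_act[OF assms(4), of m a] by metis
  qed
  with assms(2) show ?thesis by (simp add: UM_iff)
qed

lemma UM_submod: "UM M \<Longrightarrow> submod A M B \<Longrightarrow> UM (M\<lparr>carrier := B\<rparr>)"
  by (simp add: UM_iff submod_right_module) (metis submod_mem)

abbreviation quot :: "('k, 'a, 'm) rmodule \<Rightarrow> 'm set \<Rightarrow> ('k, 'a, 'm) rmodule" where
  "quot M B \<equiv> image_module M (coset_rep M B)"

lemma
  assumes M: "UM M" and B: "submod A M B"
  shows UM_quot: "UM (quot M B)"
    and rhom_quot: "rhom A M (quot M B) (coset_rep M B)"
    and surj_quot: "coset_rep M B ` carrier M = carrier (quot M B)"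
    and quot_zero_iff: "x \<in> carrier M \<Longrightarrow> coset_rep M B x = \<zero>\<^bsub>quot M B\<^esub> \<longleftrightarrow> x \<in> B"
proof -
  have rm: "right_module A M" by (rule UM_right_module[OF M])
  note ax = closed rm B coset_rep_eq_iff[OF rm B]
  show h: "rhom A M (quot M B) (coset_rep M B)"
    and "x \<in> carrier M \<Longrightarrow> coset_rep M B x = \<zero>\<^bsub>quot M B\<^esub> \<longleftrightarrow> x \<in> B"
    and c: "coset_rep M B ` carrier M = carrier (quot M B)"
    by (rule image_module_rhom[OF ax] image_module_zero_iff[OF ax] image_module_carrier[OF ax, symmetric]; assumption)+
  show "UM (quot M B)"
    by (rule UM_image_of[OF M image_module_right_module[OF ax] c[symmetric] h])
qed

lemma
  shows Mod_Obj [simp]: "M \<in> Obj ModC \<longleftrightarrow> UM M"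
    and Mod_Arr [simp]: "(M, f, N) \<in> Arr ModC \<longleftrightarrow> UM M \<and> UM N \<and> f \<in> module_homs A M N"
    and Mod_Dom [simp]: "Dom ModC (M, f, N) = M"
    and Mod_Cod [simp]: "Cod ModC (M, f, N) = N"
    and Mod_Ident [simp]: "Ident ModC M = (M, \<lambda>x \<in> carrier M. x, M)"
    and Mod_Comp [simp]: "(N', g, P) \<cdot>\<^bsub>ModC\<^esub> (M, f, N) = (M, compose (carrier M) g f, P)"
  by (auto simp: module_category_def)

lemma Mod_hom_iff:
  "\<phi> \<in> hom_set ModC M N \<longleftrightarrow> (\<exists>f. \<phi> = (M, f, N) \<and> UM M \<and> UM N \<and> f \<in> module_homs A M N)"
  by (cases \<phi>) (auto simp: hom_set_def)

lemma Mod_hom_Pair [simp]: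
  "(M', f, N') \<in> hom_set ModC M N \<longleftrightarrow> M' = M \<and> N' = N \<and> UM M \<and> UM N \<and> f \<in> module_homs A M N"
  by (auto simp: Mod_hom_iff)

lemma module_homs_rhom: "f \<in> module_homs A M N \<Longrightarrow> rhom A M N f"
  by (simp add: module_homs_iff)

lemma restrict_module_homs: "UM M \<Longrightarrow> rhom A M N f \<Longrightarrow> restrict f (carrier M) \<in> module_homs A M N"
  by (simp add: module_homs_iff rhom_restrict UM_right_module)

lemma module_homs_eqI:
  "\<lbrakk>f \<in> module_homs A M N; g \<in> module_homs A M N; \<And>x. x \<in> carrier M \<Longrightarrow> f x = g x\<rbrakk> \<Longrightarrow> f = g"
  by (auto simp: module_homs_iff intro: extensionalityI)

lemma compose_module_homs:
  "\<lbrakk>UM M; f \<in> module_homs A M N; g \<in> module_homs A N P\<rbrakk> \<Longrightarrow> compose (carrier M) g f \<in> module_homs A M P"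
  unfolding compose_def by (rule restrict_module_homs) (auto simp: module_homs_iff intro: rhom_comp)

lemma id_module_homs: "UM M \<Longrightarrow> (\<lambda>x \<in> carrier M. x) \<in> module_homs A M M"
  by (rule restrict_module_homs) (auto simp: rhom_def)

lemma compose_eqI:
  assumes "UM M" "f \<in> module_homs A M N" "g \<in> module_homs A N P" "h \<in> module_homs A M P"
    "\<And>x. x \<in> carrier M \<Longrightarrow> g (f x) = h x"
  shows "compose (carrier M) g f = h"
  using assms by (intro module_homs_eqI[OF compose_module_homs]) (auto simp: compose_def)

lemma compose_eqD: "compose S g f = compose S g' f' \<Longrightarrow> x \<in> S \<Longrightarrow> g (f x) = g' (f' x)"
  by (metis compose_eq)

lemma category_Mod: "category ModC"
proof
  fix f g h :: "('k, 'a, 'm) rmodule \<times> ('m \<Rightarrow> 'm) \<times> ('k, 'a, 'm) rmodule"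
    and a b c d :: "('k, 'a, 'm) rmodule"
  show "f \<in> Arr ModC \<Longrightarrow> Dom ModC f \<in> Obj ModC" "f \<in> Arr ModC \<Longrightarrow> Cod ModC f \<in> Obj ModC" by (cases f; simp)+
  show "a \<in> Obj ModC \<Longrightarrow> Ident ModC a \<in> hom_set ModC a a"
    by (simp add: id_module_homs)
  show "f \<in> hom_set ModC a b \<Longrightarrow> g \<in> hom_set ModC b c \<Longrightarrow> g \<cdot>\<^bsub>ModC\<^esub> f \<in> hom_set ModC a c"
    by (auto simp: Mod_hom_iff compose_module_homs)
  show "f \<in> hom_set ModC a b \<Longrightarrow> Ident ModC b \<cdot>\<^bsub>ModC\<^esub> f = f"
    by (auto simp: Mod_hom_iff intro!: compose_eqI id_module_homs simp: rhom_closed[OF module_homs_rhom])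
  show "f \<in> hom_set ModC a b \<Longrightarrow> f \<cdot>\<^bsub>ModC\<^esub> Ident ModC a = f"
    by (auto simp: Mod_hom_iff intro!: compose_eqI id_module_homs)
  show "\<lbrakk>f \<in> hom_set ModC a b; g \<in> hom_set ModC b c; h \<in> hom_set ModC c d\<rbrakk>
    \<Longrightarrow> h \<cdot>\<^bsub>ModC\<^esub> (g \<cdot>\<^bsub>ModC\<^esub> f) = (h \<cdot>\<^bsub>ModC\<^esub> g) \<cdot>\<^bsub>ModC\<^esub> f"
    by (auto simp: Mod_hom_iff compose_def rhom_closed[OF module_homs_rhom] intro!: restrict_ext)
qed

section \<open>Zero objects and zero arrows\<close>

lemma zero_map_homs: "UM M \<Longrightarrow> UM N \<Longrightarrow> (\<lambda>x \<in> carrier M. \<zero>\<^bsub>N\<^esub>) \<in> module_homs A M N"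
proof -
  assume "UM M" "UM N"
  then interpret N: right_module A N by (simp add: UM_right_module)
  show ?thesis
    by (rule restrict_module_homs[OF \<open>UM M\<close>]) (auto simp: rhom_def)
qed

lemma zero_objectI:
  assumes z: "UM z" and "carrier z = {\<zero>\<^bsub>z\<^esub>}"
  shows "zero_object ModC z"
proof -
  have 1: "f = (\<lambda>x \<in> carrier M. \<zero>\<^bsub>z\<^esub>)" if "f \<in> module_homs A M z" "UM M" for f M
    by (rule module_homs_eqI[OF that(1) zero_map_homs[OF that(2) z]])
      (use rhom_closed[OF module_homs_rhom[OF that(1)]] assms in auto)
  have 2: "f = (\<lambda>x \<in> carrier z. \<zero>\<^bsub>M\<^esub>)" if "f \<in> module_homs A z M" "UM M" for f M
    by (rule module_homs_eqI[OF that(1) zero_map_homs[OF z that(2)]])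
      (use rhom_zero[OF _ _ module_homs_rhom[OF that(1)]] assms UM_right_module that in auto)
  have "(\<exists>!f. f \<in> hom_set ModC M z) \<and> (\<exists>!f. f \<in> hom_set ModC z M)" if "UM M" for M
  proof
    show "\<exists>!f. f \<in> hom_set ModC M z"
      by (rule ex1I[of _ "(M, \<lambda>x \<in> carrier M. \<zero>\<^bsub>z\<^esub>, z)"])
        (use that z zero_map_homs[OF that z] in \<open>auto simp: Mod_hom_iff dest: 1\<close>)
    show "\<exists>!f. f \<in> hom_set ModC z M"
      by (rule ex1I[of _ "(z, \<lambda>x \<in> carrier z. \<zero>\<^bsub>M\<^esub>, M)"])
        (use that z zero_map_homs[OF z that] in \<open>auto simp: Mod_hom_iff dest: 2\<close>)
  qed
  with z show ?thesis by (simp add: zero_object_def)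
qed

lemma zero_objectD:
  assumes "zero_object ModC z" shows "UM z" "carrier z = {\<zero>\<^bsub>z\<^esub>}"
proof -
  show z: "UM z" using assms by (simp add: zero_object_def)
  interpret right_module A z using z by (rule UM_right_module)
  have "\<exists>!f. f \<in> hom_set ModC z z" using assms z by (simp add: zero_object_def)
  then obtain f where u: "\<And>g. g \<in> hom_set ModC z z \<Longrightarrow> g = f" by (elim ex1E) blast
  \<comment> \<open>The identity and the zero map are both endomorphisms of z, so they
    coincide.\<close>
  have "(z, \<lambda>x \<in> carrier z. x, z) = f" by (rule u) (simp add: id_module_homs z)
  moreover have "(z, \<lambda>x \<in> carrier z. \<zero>\<^bsub>z\<^esub>, z) = f" by (rule u) (simp add: zero_map_homs z)
  ultimately have "(\<lambda>x \<in> carrier z. x) = (\<lambda>x \<in> carrier z. \<zero>\<^bsub>z\<^esub>)" by (metis prod.inject)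
  then show "carrier z = {\<zero>\<^bsub>z\<^esub>}" using M.zero_closed by (auto simp: fun_eq_iff restrict_def split: if_splits)
qed

lemma zero_object_exists:
  assumes "UM M" shows "zero_object ModC (M\<lparr>carrier := {\<zero>\<^bsub>M\<^esub>}\<rparr>)"
  by (rule zero_objectI) (simp_all add: UM_submod submod_singleton_zero UM_right_module assms)

lemma zero_arrow_iff:
  "zero_arrow ModC (M, f, N) \<longleftrightarrow>
     UM M \<and> UM N \<and> f \<in> module_homs A M N \<and> (\<forall>x \<in> carrier M. f x = \<zero>\<^bsub>N\<^esub>)"
proof
  assume "zero_arrow ModC (M, f, N)"
  then obtain z g h where z: "zero_object ModC z" and *: "UM M" "UM N" "f \<in> module_homs A M N"
    "g \<in> module_homs A M z" "h \<in> module_homs A z N" "f = compose (carrier M) h g"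
    by (auto simp: zero_arrow_def Mod_hom_iff)
  have "f x = \<zero>\<^bsub>N\<^esub>" if "x \<in> carrier M" for x
  proof -
    have "g x = \<zero>\<^bsub>z\<^esub>" using rhom_closed[OF module_homs_rhom[OF *(4)] that] zero_objectD[OF z] by auto
    then show ?thesis
      using that * rhom_zero[OF _ _ module_homs_rhom[OF *(5)]] zero_objectD[OF z]
      by (simp add: compose_def UM_right_module)
  qed
  with * show "UM M \<and> UM N \<and> f \<in> module_homs A M N \<and> (\<forall>x \<in> carrier M. f x = \<zero>\<^bsub>N\<^esub>)" by blast
next
  assume *: "UM M \<and> UM N \<and> f \<in> module_homs A M N \<and> (\<forall>x \<in> carrier M. f x = \<zero>\<^bsub>N\<^esub>)"
  \<comment> \<open>The zero submodule of M serves as the zero object through which f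
    factors.\<close>
  let ?z = "M\<lparr>carrier := {\<zero>\<^bsub>M\<^esub>}\<rparr>"
  have z: "zero_object ModC ?z" using * zero_object_exists by blast
  have "f = compose (carrier M) (\<lambda>x \<in> carrier ?z. \<zero>\<^bsub>N\<^esub>) (\<lambda>x \<in> carrier M. \<zero>\<^bsub>?z\<^esub>)"
    by (rule compose_eqI[symmetric, where N = ?z])
      (use * zero_map_homs[of M ?z] zero_map_homs[of ?z N] zero_objectD[OF z] in auto)
  then show "zero_arrow ModC (M, f, N)"
    using * z zero_map_homs[of M ?z] zero_map_homs[of ?z N] zero_objectD(1)[OF z]
    unfolding zero_arrow_def Mod_Dom Mod_Cod
    by (intro conjI exI[of _ ?z] bexI[of _ "(M, \<lambda>x \<in> carrier M. \<zero>\<^bsub>?z\<^esub>, ?z)"]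
        bexI[of _ "(?z, \<lambda>x \<in> carrier ?z. \<zero>\<^bsub>N\<^esub>, N)"]) (unfold Mod_Arr Mod_hom_Pair Mod_Comp, blast+)
qed

section \<open>Monomorphisms and epimorphisms\<close>

lemma mono_iff:
  "mono_arrow ModC (M, f, N) \<longleftrightarrow> UM M \<and> UM N \<and> f \<in> module_homs A M N \<and> inj_on f (carrier M)"
proof
  assume m: "mono_arrow ModC (M, f, N)"
  then have *: "UM M" "UM N" "f \<in> module_homs A M N" by (auto simp: mono_arrow_def)
  note rm = *(1,2)[THEN UM_right_module]
  \<comment> \<open>Test f on the inclusion of its kernel and on the zero map from the kernel: both
    composites with f vanish.\<close>
  let ?B = "{x \<in> carrier M. f x = \<zero>\<^bsub>N\<^esub>}"
  have B: "submod A M ?B" by (rule submod_kernel[OF rm module_homs_rhom[OF *(3)]])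
  let ?K = "M\<lparr>carrier := ?B\<rparr>"
  have K: "UM ?K" by (rule UM_submod[OF *(1) B])
  have k: "(\<lambda>x \<in> carrier ?K. x) \<in> module_homs A ?K M"
    by (rule restrict_module_homs[OF K rhom_incl[OF B]])
  have 0: "(\<lambda>x \<in> carrier ?K. \<zero>\<^bsub>M\<^esub>) \<in> module_homs A ?K M"
    by (rule zero_map_homs[OF K *(1)])
  have "compose (carrier ?K) f (\<lambda>x \<in> carrier ?K. x) = compose (carrier ?K) f (\<lambda>x \<in> carrier ?K. \<zero>\<^bsub>M\<^esub>)"
    unfolding compose_def by (rule restrict_ext) (simp add: rhom_zero[OF rm module_homs_rhom[OF *(3)]])
  then have e: "(M, f, N) \<cdot>\<^bsub>ModC\<^esub> (?K, \<lambda>x \<in> carrier ?K. x, M) = (M, f, N) \<cdot>\<^bsub>ModC\<^esub> (?K, \<lambda>x \<in> carrier ?K. \<zero>\<^bsub>M\<^esub>, M)"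
    by (simp only: Mod_Comp)
  have "(?K, \<lambda>x \<in> carrier ?K. x, M) = (?K, \<lambda>x \<in> carrier ?K. \<zero>\<^bsub>M\<^esub>, M)"
    by (rule mp[OF bspec[OF bspec[OF spec[OF conjunct2[OF m[unfolded mono_arrow_def Mod_Dom]], of ?K]]] e])
      (simp_all only: Mod_hom_Pair * K k 0 simp_thms)
  then have "(\<lambda>x \<in> carrier ?K. x) = (\<lambda>x \<in> carrier ?K. \<zero>\<^bsub>M\<^esub>)" by (simp only: prod.inject)
  then have "\<forall>x \<in> ?B. x = \<zero>\<^bsub>M\<^esub>" by (auto simp: fun_eq_iff restrict_def split: if_splits)
  then show "UM M \<and> UM N \<and> f \<in> module_homs A M N \<and> inj_on f (carrier M)"
    using * rhom_inj_on[OF rm module_homs_rhom[OF *(3)]] by blast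
next
  assume *: "UM M \<and> UM N \<and> f \<in> module_homs A M N \<and> inj_on f (carrier M)"
  show "mono_arrow ModC (M, f, N)"
    unfolding mono_arrow_def
  proof (intro conjI allI ballI impI)
    fix W g h assume gh: "g \<in> hom_set ModC W (Dom ModC (M, f, N))" "h \<in> hom_set ModC W (Dom ModC (M, f, N))"
      and e: "(M, f, N) \<cdot>\<^bsub>ModC\<^esub> g = (M, f, N) \<cdot>\<^bsub>ModC\<^esub> h"
    then obtain g' h' where g: "g = (W, g', M)" "g' \<in> module_homs A W M"
      and h: "h = (W, h', M)" "h' \<in> module_homs A W M" by (auto simp: Mod_hom_iff)
    have "compose (carrier W) f g' = compose (carrier W) f h'" using e g h by simp
    then have "f (g' x) = f (h' x)" if "x \<in> carrier W" for x
      using that by (rule compose_eqD)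
    note fgh = this
    have "g' x = h' x" if "x \<in> carrier W" for x
    proof (rule inj_onD)
      show "inj_on f (carrier M)" using * by blast
      show "f (g' x) = f (h' x)" by (rule fgh[OF that])
      show "g' x \<in> carrier M" by (rule rhom_closed[OF module_homs_rhom[OF g(2)] that])
      show "h' x \<in> carrier M" by (rule rhom_closed[OF module_homs_rhom[OF h(2)] that])
    qed
    then show "g = h" using g h module_homs_eqI by blast
  qed (use * in simp)
qed

lemma epi_iff:
  "epi_arrow ModC (M, f, N) \<longleftrightarrow> UM M \<and> UM N \<and> f \<in> module_homs A M N \<and> f ` carrier M = carrier N"
proof
  assume m: "epi_arrow ModC (M, f, N)"
  then have *: "UM M" "UM N" "f \<in> module_homs A M N" by (auto simp: epi_arrow_def)
  note rm = *(1,2)[THEN UM_right_module] and f = module_homs_rhom[OF *(3)]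
  \<comment> \<open>Test f with the projection to the quotient by its image and with the zero map
    there: both kill the image.\<close>
  let ?B = "f ` carrier M"
  have B: "submod A N ?B" by (rule submod_image[OF rm f submod_carrier[OF rm(1)]])
  let ?Q = "quot N ?B"
  have Q: "UM ?Q" by (rule UM_quot[OF *(2) B])
  have k: "(\<lambda>x \<in> carrier N. coset_rep N ?B x) \<in> module_homs A N ?Q"
    using restrict_module_homs[OF *(2) rhom_quot[OF *(2) B]] by simp
  have 0: "(\<lambda>x \<in> carrier N. \<zero>\<^bsub>?Q\<^esub>) \<in> module_homs A N ?Q"
    by (rule zero_map_homs[OF *(2) Q])
  have "compose (carrier M) (\<lambda>x \<in> carrier N. coset_rep N ?B x) f = compose (carrier M) (\<lambda>x \<in> carrier N. \<zero>\<^bsub>?Q\<^esub>) f"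
    unfolding compose_def by (rule restrict_ext) (simp add: quot_zero_iff[OF *(2) B] rhom_closed[OF f])
  then have e: "(N, \<lambda>x \<in> carrier N. coset_rep N ?B x, ?Q) \<cdot>\<^bsub>ModC\<^esub> (M, f, N) = (N, \<lambda>x \<in> carrier N. \<zero>\<^bsub>?Q\<^esub>, ?Q) \<cdot>\<^bsub>ModC\<^esub> (M, f, N)"
    by (simp only: Mod_Comp)
  have "(N, \<lambda>x \<in> carrier N. coset_rep N ?B x, ?Q) = (N, \<lambda>x \<in> carrier N. \<zero>\<^bsub>?Q\<^esub>, ?Q)"
    by (rule mp[OF bspec[OF bspec[OF spec[OF conjunct2[OF m[unfolded epi_arrow_def Mod_Cod]], of ?Q]]] e])
      (simp_all only: Mod_hom_Pair * Q k 0 simp_thms)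
  then have "(\<lambda>x \<in> carrier N. coset_rep N ?B x) = (\<lambda>x \<in> carrier N. \<zero>\<^bsub>?Q\<^esub>)" by (simp only: prod.inject)
  note eq = fun_cong[OF this]
  have "coset_rep N ?B x = \<zero>\<^bsub>?Q\<^esub>" if "x \<in> carrier N" for x
    using eq[of x] unfolding restrict_apply'[OF that] .
  then have "carrier N \<subseteq> ?B" using quot_zero_iff[OF *(2) B] by auto
  then show "UM M \<and> UM N \<and> f \<in> module_homs A M N \<and> f ` carrier M = carrier N"
    using * rhom_closed[OF f] by auto
next
  assume *: "UM M \<and> UM N \<and> f \<in> module_homs A M N \<and> f ` carrier M = carrier N"
  show "epi_arrow ModC (M, f, N)"
    unfolding epi_arrow_def
  proof (intro conjI allI ballI impI)
    fix W g h assume gh: "g \<in> hom_set ModC (Cod ModC (M, f, N)) W" "h \<in> hom_set ModC (Cod ModC (M, f, N)) W"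
      and e: "g \<cdot>\<^bsub>ModC\<^esub> (M, f, N) = h \<cdot>\<^bsub>ModC\<^esub> (M, f, N)"
    then obtain g' h' where g: "g = (N, g', W)" "g' \<in> module_homs A N W"
      and h: "h = (N, h', W)" "h' \<in> module_homs A N W" by (auto simp: Mod_hom_iff)
    have "compose (carrier M) g' f = compose (carrier M) h' f" using e g h by simp
    then have "g' (f x) = h' (f x)" if "x \<in> carrier M" for x
      using that by (rule compose_eqD)
    then have "\<forall>y \<in> f ` carrier M. g' y = h' y" by blast
    then have "g' y = h' y" if "y \<in> carrier N" for y
      using that * by simp
    then show "g = h" using g h module_homs_eqI by blast
  qed (use * in simp)
qed

section \<open>Kernels and cokernels\<close>

lemma is_kernel_incl:
  assumes *: "UM M" "UM N" "f \<in> module_homs A M N"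
  defines "K \<equiv> M\<lparr>carrier := {x \<in> carrier M. f x = \<zero>\<^bsub>N\<^esub>}\<rparr>"
  shows "is_kernel ModC (M, f, N) (K, \<lambda>x \<in> carrier K. x, M)"
proof -
  note rm = *(1,2)[THEN UM_right_module] and f = module_homs_rhom[OF *(3)]
  have B: "submod A M (carrier K)" unfolding K_def using submod_kernel[OF rm f] by simp
  have K': "K = M\<lparr>carrier := carrier K\<rparr>" by (simp add: K_def)
  have K: "UM K" using UM_submod[OF *(1) B] K' by simp
  have kr: "rhom A K M (\<lambda>x. x)" using rhom_incl[OF B] K' by simp
  then have k: "(\<lambda>x \<in> carrier K. x) \<in> module_homs A K M"
    by (rule restrict_module_homs[OF K])
  show ?thesis
    unfolding is_kernel_def
  proof (intro conjI ballI impI)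
    show "zero_arrow ModC ((M, f, N) \<cdot>\<^bsub>ModC\<^esub> (K, \<lambda>x \<in> carrier K. x, M))"
      using * K k by (simp add: zero_arrow_iff compose_module_homs) (simp add: compose_def K_def)
    fix h assume "h \<in> Arr ModC" "Cod ModC h = Dom ModC (M, f, N) \<and> zero_arrow ModC ((M, f, N) \<cdot>\<^bsub>ModC\<^esub> h)"
    then obtain W h' where h: "h = (W, h', M)" "h' \<in> module_homs A W M" "UM W"
      "\<And>x. x \<in> carrier W \<Longrightarrow> f (h' x) = \<zero>\<^bsub>N\<^esub>"
      by (cases h) (auto simp: zero_arrow_iff compose_def)
    have sub: "h' x \<in> carrier K" if "x \<in> carrier W" for x
      using that h(4) rhom_closed[OF module_homs_rhom[OF h(2)]] by (simp add: K_def)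
    then have hK: "h' \<in> module_homs A W K"
      using h(2) rhom_corestrict[OF module_homs_rhom[OF h(2)] sub] K' by (simp add: module_homs_iff)
    show "\<exists>!u. u \<in> hom_set ModC (Dom ModC h) (Dom ModC (K, \<lambda>x \<in> carrier K. x, M)) \<and>
        (K, \<lambda>x \<in> carrier K. x, M) \<cdot>\<^bsub>ModC\<^esub> u = h"
    proof (rule ex1I[of _ "(W, h', K)"])
      show "(W, h', K) \<in> hom_set ModC (Dom ModC h) (Dom ModC (K, \<lambda>x \<in> carrier K. x, M)) \<and>
        (K, \<lambda>x \<in> carrier K. x, M) \<cdot>\<^bsub>ModC\<^esub> (W, h', K) = h"
        using hK h K k sub by (auto intro!: compose_eqI)
      fix u assume "u \<in> hom_set ModC (Dom ModC h) (Dom ModC (K, \<lambda>x \<in> carrier K. x, M)) \<and>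
        (K, \<lambda>x \<in> carrier K. x, M) \<cdot>\<^bsub>ModC\<^esub> u = h"
      then obtain u' where u: "u = (W, u', K)" "u' \<in> module_homs A W K"
        "compose (carrier W) (\<lambda>x \<in> carrier K. x) u' = h'"
        using h by (auto simp: Mod_hom_iff)
      have "u' x = h' x" if "x \<in> carrier W" for x
        using u(3) that rhom_closed[OF module_homs_rhom[OF u(2)] that] by (auto simp: compose_def)
      then show "u = (W, h', K)" using u hK module_homs_eqI by blast
    qed
  qed (use * K k in auto)
qed

text \<open>A categorical kernel is known only up to isomorphism. The inclusion of the set-theoretic
  kernel must factor through k, and this shows that k maps onto that set.\<close>

lemma is_kernelD:
  assumes "is_kernel ModC (M, f, N) (K, k, M')"
  shows "UM M" "UM N" "f \<in> module_homs A M N" "UM K" "M' = M" "k \<in> module_homs A K M"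
    and "\<And>x. x \<in> carrier K \<Longrightarrow> f (k x) = \<zero>\<^bsub>N\<^esub>"
    and "\<And>x. \<lbrakk>x \<in> carrier M; f x = \<zero>\<^bsub>N\<^esub>\<rbrakk> \<Longrightarrow> x \<in> k ` carrier K"
proof -
  show *: "UM M" "UM N" "f \<in> module_homs A M N" "UM K" "M' = M" "k \<in> module_homs A K M"
    "\<And>x. x \<in> carrier K \<Longrightarrow> f (k x) = \<zero>\<^bsub>N\<^esub>"
    using assms by (auto simp: is_kernel_def zero_arrow_iff compose_def)
  fix x assume x: "x \<in> carrier M" "f x = \<zero>\<^bsub>N\<^esub>"
  let ?K = "M\<lparr>carrier := {x \<in> carrier M. f x = \<zero>\<^bsub>N\<^esub>}\<rparr>"
  have i: "is_kernel ModC (M, f, N) (?K, \<lambda>x \<in> carrier ?K. x, M)"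
    by (rule is_kernel_incl[OF *(1-3)])
  let ?h = "(?K, \<lambda>x \<in> carrier ?K. x, M)"
  from i have h: "?h \<in> Arr ModC" "Cod ModC ?h = Dom ModC (M, f, N) \<and> zero_arrow ModC ((M, f, N) \<cdot>\<^bsub>ModC\<^esub> ?h)"
    by (simp_all only: is_kernel_def)
  from assms have "\<forall>h\<in>Arr ModC. Cod ModC h = Dom ModC (M, f, N) \<and> zero_arrow ModC ((M, f, N) \<cdot>\<^bsub>ModC\<^esub> h) \<longrightarrow>
    (\<exists>!u. u \<in> hom_set ModC (Dom ModC h) (Dom ModC (K, k, M')) \<and> (K, k, M') \<cdot>\<^bsub>ModC\<^esub> u = h)"
    unfolding is_kernel_def by (elim conjE)
  from ex1_implies_ex[OF mp[OF bspec[OF this h(1)] h(2)]] obtain u where u: "u \<in> module_homs A ?K K" "compose (carrier ?K) k u = (\<lambda>x \<in> carrier ?K. x)"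
    unfolding Mod_hom_iff Mod_Dom by auto
  have xK: "x \<in> carrier ?K" using x by simp
  have "u x \<in> carrier K" by (rule rhom_closed[OF module_homs_rhom[OF u(1)] xK])
  moreover have "k (u x) = x" using fun_cong[OF u(2), of x] xK by (simp add: compose_def)
  ultimately show "x \<in> k ` carrier K" by (metis imageI)
qed

lemma is_cokernel_quot:
  assumes *: "UM M" "UM N" "f \<in> module_homs A M N"
  defines "Q \<equiv> quot N (f ` carrier M)"
  shows "is_cokernel ModC (M, f, N) (N, restrict (coset_rep N (f ` carrier M)) (carrier N), Q)"
proof -
  note rm = *(1,2)[THEN UM_right_module] and f = module_homs_rhom[OF *(3)]
  let ?B = "f ` carrier M"
  have B: "submod A N ?B" by (rule submod_image[OF rm f submod_carrier[OF rm(1)]])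
  have Q: "UM Q" unfolding Q_def by (rule UM_quot[OF *(2) B])
  define c where "c = restrict (coset_rep N ?B) (carrier N)"
  have c: "c \<in> module_homs A N Q"
    unfolding c_def Q_def by (rule restrict_module_homs[OF *(2) rhom_quot[OF *(2) B]])
  have c0: "c x = \<zero>\<^bsub>Q\<^esub> \<longleftrightarrow> x \<in> ?B" if "x \<in> carrier N" for x
    using quot_zero_iff[OF *(2) B that] that by (simp add: c_def Q_def)
  have cs: "c ` carrier N = carrier Q"
    using surj_quot[OF *(2) B] by (simp add: c_def Q_def)
  show ?thesis
    unfolding is_cokernel_def c_def[symmetric]
  proof (intro conjI ballI impI)
    show "zero_arrow ModC ((N, c, Q) \<cdot>\<^bsub>ModC\<^esub> (M, f, N))"
      using * Q c c0 rhom_closed[OF f] by (simp add: zero_arrow_iff compose_module_homs) (simp add: compose_def)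
    fix h assume "h \<in> Arr ModC" "Dom ModC h = Cod ModC (M, f, N) \<and> zero_arrow ModC (h \<cdot>\<^bsub>ModC\<^esub> (M, f, N))"
    then obtain P h' where h: "h = (N, h', P)" "h' \<in> module_homs A N P" "UM P"
      "\<And>x. x \<in> carrier M \<Longrightarrow> h' (f x) = \<zero>\<^bsub>P\<^esub>"
      by (cases h) (auto simp: zero_arrow_iff compose_def)
    from rhom_factor_surj[OF rm(2) UM_right_module[OF Q] UM_right_module[OF h(3)]
        module_homs_rhom[OF c] cs module_homs_rhom[OF h(2)]]
    obtain u where u: "rhom A Q P u" "\<And>x. x \<in> carrier N \<Longrightarrow> u (c x) = h' x"
      using c0 h(4) by blast
    define u' where "u' = restrict u (carrier Q)"
    have u': "u' \<in> module_homs A Q P" unfolding u'_def by (rule restrict_module_homs[OF Q u(1)])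
    have u'c: "u' (c x) = h' x" if "x \<in> carrier N" for x
      using u(2) that cs by (auto simp: u'_def)
    show "\<exists>!u. u \<in> hom_set ModC (Cod ModC (N, c, Q)) (Cod ModC h) \<and> u \<cdot>\<^bsub>ModC\<^esub> (N, c, Q) = h"
    proof (rule ex1I[of _ "(Q, u', P)"])
      show "(Q, u', P) \<in> hom_set ModC (Cod ModC (N, c, Q)) (Cod ModC h) \<and> (Q, u', P) \<cdot>\<^bsub>ModC\<^esub> (N, c, Q) = h"
        using u' u'c h Q c * by (auto intro!: compose_eqI)
      fix v assume "v \<in> hom_set ModC (Cod ModC (N, c, Q)) (Cod ModC h) \<and> v \<cdot>\<^bsub>ModC\<^esub> (N, c, Q) = h"
      then obtain v' where v: "v = (Q, v', P)" "v' \<in> module_homs A Q P"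
        "compose (carrier N) v' c = h'"
        using h by (auto simp: Mod_hom_iff)
      have "v' (c x) = u' (c x)" if "x \<in> carrier N" for x
        using v(3) that u'c by (auto simp: compose_def)
      then have "v' y = u' y" if "y \<in> carrier Q" for y
        using that cs by (metis imageE)
      then show "v = (Q, u', P)" using v u' module_homs_eqI by blast
    qed
  qed (use * Q c in auto)
qed

text \<open>Dual comparison: the projection to the quotient by the image of f factors through c, so
  whatever c kills lies in the image.\<close>

lemma is_cokernelD:
  assumes "is_cokernel ModC (M, f, N) (N', c, Q)"
  shows "UM M" "UM N" "f \<in> module_homs A M N" "UM Q" "N' = N" "c \<in> module_homs A N Q"
    and "\<And>x. x \<in> carrier M \<Longrightarrow> c (f x) = \<zero>\<^bsub>Q\<^esub>"
    and "\<And>y. \<lbrakk>y \<in> carrier N; c y = \<zero>\<^bsub>Q\<^esub>\<rbrakk> \<Longrightarrow> y \<in> f ` carrier M"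
proof -
  show *: "UM M" "UM N" "f \<in> module_homs A M N" "UM Q" "N' = N" "c \<in> module_homs A N Q"
    "\<And>x. x \<in> carrier M \<Longrightarrow> c (f x) = \<zero>\<^bsub>Q\<^esub>"
    using assms by (auto simp: is_cokernel_def zero_arrow_iff compose_def)
  note rm = *(1,2)[THEN UM_right_module]
  fix y assume y: "y \<in> carrier N" "c y = \<zero>\<^bsub>Q\<^esub>"
  let ?B = "f ` carrier M"
  have B: "submod A N ?B"
    by (rule submod_image[OF rm module_homs_rhom[OF *(3)] submod_carrier[OF rm(1)]])
  let ?Q = "quot N ?B" and ?c = "restrict (coset_rep N ?B) (carrier N)"
  have i: "is_cokernel ModC (M, f, N) (N, ?c, ?Q)"
    by (rule is_cokernel_quot[OF *(1-3)])
  let ?h = "(N, ?c, ?Q)"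
  from i have h: "?h \<in> Arr ModC" "Dom ModC ?h = Cod ModC (M, f, N) \<and> zero_arrow ModC (?h \<cdot>\<^bsub>ModC\<^esub> (M, f, N))"
    by (simp_all only: is_cokernel_def)
  from assms have "\<forall>h\<in>Arr ModC. Dom ModC h = Cod ModC (M, f, N) \<and> zero_arrow ModC (h \<cdot>\<^bsub>ModC\<^esub> (M, f, N)) \<longrightarrow>
    (\<exists>!u. u \<in> hom_set ModC (Cod ModC (N', c, Q)) (Cod ModC h) \<and> u \<cdot>\<^bsub>ModC\<^esub> (N', c, Q) = h)"
    unfolding is_cokernel_def by (elim conjE)
  from ex1_implies_ex[OF mp[OF bspec[OF this h(1)] h(2)]] obtain u where u: "u \<in> module_homs A Q ?Q" "compose (carrier N) u c = ?c"
    using \<open>N' = N\<close> unfolding Mod_hom_iff Mod_Cod by auto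
  have "?c y = u (c y)" using fun_cong[OF u(2), of y] y by (simp add: compose_def)
  also have "\<dots> = \<zero>\<^bsub>?Q\<^esub>"
    using y rhom_zero[OF _ _ module_homs_rhom[OF u(1)]] *(4) UM_quot[OF *(2) B] by (simp add: UM_right_module)
  finally show "y \<in> f ` carrier M" using quot_zero_iff[OF *(2) B] y by simp
qed

end

section \<open>Modules over algebras with a multiplicative basis\<close>

text \<open>Subtracting one monomial at a time empties a finite set that contains the support.
  Linear statements then need checking on monomials only.\<close>

lemma poly_mapping_basis_induct [consumes 1, case_names zero single add]:
  fixes x :: "'b \<Rightarrow>\<^sub>0 'k::ab_group_add"
  assumes "Poly_Mapping.keys x \<subseteq> B"
    and "P 0"
    and single: "\<And>p c. p \<in> B \<Longrightarrow> P (Poly_Mapping.single p c)"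
    and add: "\<And>x y. \<lbrakk>Poly_Mapping.keys x \<subseteq> B; Poly_Mapping.keys y \<subseteq> B; P x; P y\<rbrakk> \<Longrightarrow> P (x + y)"
  shows "P x"
proof -
  have "finite S \<Longrightarrow> S \<subseteq> B \<Longrightarrow> Poly_Mapping.keys x \<subseteq> S \<Longrightarrow> P x" for S and x :: "'b \<Rightarrow>\<^sub>0 'k"
  proof (induction S arbitrary: x rule: finite_induct)
    case (insert p S)
    let ?s = "Poly_Mapping.single p (Poly_Mapping.lookup x p)"
    have "Poly_Mapping.keys (x - ?s) \<subseteq> S"
      using insert.prems(2) by (auto simp: in_keys_iff lookup_minus lookup_single when_def split: if_splits)
    then have "P (x - ?s)" and "Poly_Mapping.keys (x - ?s) \<subseteq> B" using insert by auto
    moreover have "P ?s" using single insert.prems by blast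
    moreover have "Poly_Mapping.keys ?s \<subseteq> B" using insert.prems by auto
    ultimately have "P (?s + (x - ?s))" by (intro add)
    then show ?case by simp
  qed (use assms in simp)
  from this[OF finite_keys assms(1) subset_refl] show ?thesis .
qed

section \<open>Arithmetic in an algebra with a multiplicative basis\<close>

lemma basis_algebra_simps [simp]:
  "carrier (basis_algebra B cat) = {x. Poly_Mapping.keys x \<subseteq> B}"
  "\<zero>\<^bsub>basis_algebra B cat\<^esub> = 0"
  "x \<oplus>\<^bsub>basis_algebra B cat\<^esub> y = x + y"
  "c \<odot>\<^bsub>basis_algebra B cat\<^esub> x = Poly_Mapping.map ((*) c) x"
  by (auto simp: basis_algebra_def)

lemma lookup_scale [simp]: "Poly_Mapping.lookup (Poly_Mapping.map ((*) c) x) p = c * Poly_Mapping.lookup x p"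
  for c :: "'k::mult_zero"
  by (simp add: map.rep_eq when_def)

lemma keys_scale: "Poly_Mapping.keys (Poly_Mapping.map ((*) c) x) \<subseteq> Poly_Mapping.keys x" for c :: "'k::mult_zero"
  by (auto simp: in_keys_iff)

lemma scale_add: "Poly_Mapping.map ((*) c) (x + y) = Poly_Mapping.map ((*) c) x + Poly_Mapping.map ((*) c) y"
  for c :: "'k::semiring_0"
  by (rule poly_mapping_eqI) (simp add: lookup_add algebra_simps)

lemma scale_single: "Poly_Mapping.map ((*) c) (Poly_Mapping.single p d) = Poly_Mapping.single p (c * d)"
  for c :: "'k::mult_zero"
  by (rule poly_mapping_eqI) (simp add: lookup_single when_def)

lemma scale_basis: "Poly_Mapping.map ((*) c) (basis_elem p) = Poly_Mapping.single p c" for c :: "'k::field"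
  by (simp add: scale_single)

lemma scale_zero_right [simp]: "Poly_Mapping.map ((*) c) 0 = 0" for c :: "'k::mult_zero"
  by (rule poly_mapping_eqI) simp

lemma scale_zero [simp]: "Poly_Mapping.map ((*) 0) x = 0" for x :: "'b \<Rightarrow>\<^sub>0 'k::mult_zero"
  by (rule poly_mapping_eqI) simp

text \<open>The product of the monomials at p and q with the coefficients already multiplied to c,
  which makes it additive in a single scalar.\<close>

definition basis_prod :: "('b \<Rightarrow> 'b \<Rightarrow> 'b option) \<Rightarrow> 'b \<Rightarrow> 'b \<Rightarrow> 'k \<Rightarrow> ('b \<Rightarrow>\<^sub>0 'k::field)" where
  "basis_prod cat p q c = (case cat p q of None \<Rightarrow> 0 | Some r \<Rightarrow> Poly_Mapping.single r c)"

lemma basis_prod_zero [simp]: "basis_prod cat p q 0 = 0"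
  and basis_prod_add: "basis_prod cat p q (c + d) = basis_prod cat p q c + basis_prod cat p q d"
  and basis_prod_scale: "Poly_Mapping.map ((*) a) (basis_prod cat p q c) = basis_prod cat p q (a * c)"
  by (auto simp: basis_prod_def single_add scale_single split: option.splits intro!: poly_mapping_eqI)

text \<open>Supersets of the supports give x, x' and x + x' one common index set; this is how
  distributivity is derived, as cancellation may shrink the support of the sum.\<close>

lemma basis_algebra_mult:
  assumes "finite S" "Poly_Mapping.keys x \<subseteq> S" "finite T" "Poly_Mapping.keys y \<subseteq> T"
  shows "x \<otimes>\<^bsub>basis_algebra B cat\<^esub> y =
    (\<Sum>p \<in> S. \<Sum>q \<in> T. basis_prod cat p q (Poly_Mapping.lookup x p * Poly_Mapping.lookup y q))"
proof -
  have "x \<otimes>\<^bsub>basis_algebra B cat\<^esub> y =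
    (\<Sum>p \<in> Poly_Mapping.keys x. \<Sum>q \<in> Poly_Mapping.keys y. basis_prod cat p q (Poly_Mapping.lookup x p * Poly_Mapping.lookup y q))"
    by (simp add: basis_algebra_def basis_prod_def)
  also have "\<dots> = (\<Sum>p \<in> Poly_Mapping.keys x. \<Sum>q \<in> T. basis_prod cat p q (Poly_Mapping.lookup x p * Poly_Mapping.lookup y q))"
    by (rule sum.cong[OF refl], rule sum.mono_neutral_left) (use assms in \<open>auto simp: in_keys_iff\<close>)
  also have "\<dots> = (\<Sum>p \<in> S. \<Sum>q \<in> T. basis_prod cat p q (Poly_Mapping.lookup x p * Poly_Mapping.lookup y q))"
    by (rule sum.mono_neutral_left) (use assms in \<open>auto simp: in_keys_iff intro!: sum.neutral\<close>)
  finally show ?thesis .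
qed

lemma basis_algebra_mult_add_left:
  "(x + x') \<otimes>\<^bsub>basis_algebra B cat\<^esub> y = x \<otimes>\<^bsub>basis_algebra B cat\<^esub> y + x' \<otimes>\<^bsub>basis_algebra B cat\<^esub> y"
proof -
  let ?S = "Poly_Mapping.keys x \<union> Poly_Mapping.keys x'"
  have "Poly_Mapping.keys (x + x') \<subseteq> ?S" by (rule keys_add)
  then show ?thesis
    by (simp add: basis_algebra_mult[of ?S _ "Poly_Mapping.keys y"] lookup_add algebra_simps
        basis_prod_add sum.distrib)
qed

lemma basis_algebra_mult_add_right:
  "x \<otimes>\<^bsub>basis_algebra B cat\<^esub> (y + y') = x \<otimes>\<^bsub>basis_algebra B cat\<^esub> y + x \<otimes>\<^bsub>basis_algebra B cat\<^esub> y'"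
proof -
  let ?S = "Poly_Mapping.keys y \<union> Poly_Mapping.keys y'"
  have "Poly_Mapping.keys (y + y') \<subseteq> ?S" by (rule keys_add)
  then show ?thesis
    by (simp add: basis_algebra_mult[of "Poly_Mapping.keys x" _ ?S] lookup_add algebra_simps
        basis_prod_add sum.distrib)
qed

lemma scale_sum: "Poly_Mapping.map ((*) c) (sum f S) = (\<Sum>i \<in> S. Poly_Mapping.map ((*) c) (f i))"
  for c :: "'k::field"
  by (rule poly_mapping_eqI) (simp add: lookup_sum sum_distrib_left)

lemma basis_algebra_mult_scale:
  "Poly_Mapping.map ((*) c) x \<otimes>\<^bsub>basis_algebra B cat\<^esub> y = Poly_Mapping.map ((*) c) (x \<otimes>\<^bsub>basis_algebra B cat\<^esub> y)"
  "x \<otimes>\<^bsub>basis_algebra B cat\<^esub> Poly_Mapping.map ((*) c) y = Poly_Mapping.map ((*) c) (x \<otimes>\<^bsub>basis_algebra B cat\<^esub> y)"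
  by (simp_all add: basis_algebra_mult[of "Poly_Mapping.keys x" _ "Poly_Mapping.keys y"] keys_scale
      scale_sum basis_prod_scale algebra_simps)

lemma basis_algebra_mult_single:
  "Poly_Mapping.single p c \<otimes>\<^bsub>basis_algebra B cat\<^esub> Poly_Mapping.single q d = basis_prod cat p q (c * d)"
  by (simp add: basis_algebra_mult[of "{p}" _ "{q}"])

lemma basis_algebra_mult_zero [simp]:
  "0 \<otimes>\<^bsub>basis_algebra B cat\<^esub> y = 0" "x \<otimes>\<^bsub>basis_algebra B cat\<^esub> 0 = 0"
  by (simp_all add: basis_algebra_mult[of "{}" 0 "Poly_Mapping.keys y"] basis_algebra_mult[of "Poly_Mapping.keys x" x "{}"])

lemma keys_plus_subset: "Poly_Mapping.keys x \<subseteq> B \<Longrightarrow> Poly_Mapping.keys y \<subseteq> B \<Longrightarrow> Poly_Mapping.keys (x + y) \<subseteq> B"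
  using keys_add[of x y] by blast

lemma keys_scale_subset: "Poly_Mapping.keys x \<subseteq> B \<Longrightarrow> Poly_Mapping.keys (Poly_Mapping.map ((*) c) x) \<subseteq> B" for c :: "'k::mult_zero"
  using keys_scale[of c x] by blast

lemma keys_sum_subset:
  "(\<And>i. i \<in> S \<Longrightarrow> Poly_Mapping.keys (f i) \<subseteq> B) \<Longrightarrow> Poly_Mapping.keys (sum f S) \<subseteq> B"
  using keys_sum[of f S] by blast

definition basis_closed :: "'b set \<Rightarrow> ('b \<Rightarrow> 'b \<Rightarrow> 'b option) \<Rightarrow> bool" where
  "basis_closed B cat \<longleftrightarrow> (\<forall>p \<in> B. \<forall>q \<in> B. \<forall>r. cat p q = Some r \<longrightarrow> r \<in> B)"

lemma basis_closedD: "\<lbrakk>basis_closed B cat; p \<in> B; q \<in> B; cat p q = Some r\<rbrakk> \<Longrightarrow> r \<in> B"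
  unfolding basis_closed_def by blast

lemma keys_basis_prod:
  assumes "basis_closed B cat" "p \<in> B" "q \<in> B"
  shows "Poly_Mapping.keys (basis_prod cat p q c) \<subseteq> B"
proof (cases "cat p q")
  case (Some r)
  with basis_closedD[OF assms] have "r \<in> B" by blast
  with Some show ?thesis by (simp add: basis_prod_def)
qed (simp add: basis_prod_def)

lemma keys_basis_mult:
  assumes "basis_closed B cat" "Poly_Mapping.keys x \<subseteq> B" "Poly_Mapping.keys y \<subseteq> B"
  shows "Poly_Mapping.keys (x \<otimes>\<^bsub>basis_algebra B cat\<^esub> y) \<subseteq> B"
  unfolding basis_algebra_mult[OF finite_keys subset_refl finite_keys subset_refl]
proof (intro keys_sum_subset)
  fix p q assume "p \<in> Poly_Mapping.keys x" "q \<in> Poly_Mapping.keys y"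
  then have "p \<in> B" "q \<in> B" using assms by auto
  then show "Poly_Mapping.keys (basis_prod cat p q (Poly_Mapping.lookup x p * Poly_Mapping.lookup y q)) \<subseteq> B"
    by (rule keys_basis_prod[OF assms(1)])
qed

lemma closed_basis_algebra:
  assumes "basis_closed B cat"
  shows "closed_algebra (basis_algebra B cat)"
  unfolding closed_algebra_def
  by (intro conjI ballI allI) (simp_all add: keys_plus_subset keys_scale_subset keys_basis_mult[OF assms])

text \<open>The acting algebra occurs in the record type, so passing to an action of another algebra
  takes a new record instead of a record update.\<close>

definition with_act :: "('k, 'b, 'm) rmodule \<Rightarrow> ('m \<Rightarrow> 'a \<Rightarrow> 'm) \<Rightarrow> ('k, 'a, 'm) rmodule" where
  "with_act M f = \<lparr>carrier = carrier M, monoid.mult = monoid.mult M, one = one M, ring.zero = ring.zero M,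
     add = add M, module.smult = module.smult M, act = f\<rparr>"

lemma with_act_simps [simp]:
  "carrier (with_act M f) = carrier M" "\<zero>\<^bsub>with_act M f\<^esub> = \<zero>\<^bsub>M\<^esub>" "add (with_act M f) = add M"
  "module.smult (with_act M f) = module.smult M" "act (with_act M f) = f"
  by (simp_all add: with_act_def)

lemma right_module_with_act:
  assumes "right_module E M"
    and "\<And>m a. \<lbrakk>m \<in> carrier M; a \<in> carrier A\<rbrakk> \<Longrightarrow> f m a \<in> carrier M"
    and "\<And>m n a. \<lbrakk>m \<in> carrier M; n \<in> carrier M; a \<in> carrier A\<rbrakk>
      \<Longrightarrow> f (m \<oplus>\<^bsub>M\<^esub> n) a = f m a \<oplus>\<^bsub>M\<^esub> f n a"
    and "\<And>m a b. \<lbrakk>m \<in> carrier M; a \<in> carrier A; b \<in> carrier A\<rbrakk>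
      \<Longrightarrow> f m (a \<oplus>\<^bsub>A\<^esub> b) = f m a \<oplus>\<^bsub>M\<^esub> f m b"
    and "\<And>c m a. \<lbrakk>m \<in> carrier M; a \<in> carrier A\<rbrakk> \<Longrightarrow> f (c \<odot>\<^bsub>M\<^esub> m) a = c \<odot>\<^bsub>M\<^esub> f m a"
    and "\<And>c m a. \<lbrakk>m \<in> carrier M; a \<in> carrier A\<rbrakk> \<Longrightarrow> f m (c \<odot>\<^bsub>A\<^esub> a) = c \<odot>\<^bsub>M\<^esub> f m a"
    and "\<And>m a b. \<lbrakk>m \<in> carrier M; a \<in> carrier A; b \<in> carrier A\<rbrakk>
      \<Longrightarrow> f m (a \<otimes>\<^bsub>A\<^esub> b) = f (f m a) b"
  shows "right_module A (with_act M f)"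
proof -
  interpret right_module E M by fact
  show ?thesis
    by (rule right_moduleI; unfold with_act_simps)
      (auto simp: assms(2-) sm_add_left sm_add_right sm_mult M.a_ac simp del: assms(1))
qed

section \<open>Extending operators indexed by a basis to a module structure\<close>

definition lin_ext :: "('k::field, 'a, 'm) rmodule \<Rightarrow> ('b \<Rightarrow> 'm \<Rightarrow> 'm) \<Rightarrow> 'm \<Rightarrow> ('b \<Rightarrow>\<^sub>0 'k) \<Rightarrow> 'm" where
  "lin_ext M \<rho> m x = finsum M (\<lambda>p. Poly_Mapping.lookup x p \<odot>\<^bsub>M\<^esub> \<rho> p m) (Poly_Mapping.keys x)"

context
  fixes E :: "('k::field, 'a) module" and M :: "('k, 'a, 'm) rmodule" and B :: "'b set"
    and \<rho> :: "'b \<Rightarrow> 'm \<Rightarrow> 'm" and cat :: "'b \<Rightarrow> 'b \<Rightarrow> 'b option"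
  assumes M: "right_module E M"
    and closed: "\<And>p m. \<lbrakk>p \<in> B; m \<in> carrier M\<rbrakk> \<Longrightarrow> \<rho> p m \<in> carrier M"
    and add: "\<And>p m n. \<lbrakk>p \<in> B; m \<in> carrier M; n \<in> carrier M\<rbrakk> \<Longrightarrow> \<rho> p (m \<oplus>\<^bsub>M\<^esub> n) = \<rho> p m \<oplus>\<^bsub>M\<^esub> \<rho> p n"
    and smult: "\<And>p c m. \<lbrakk>p \<in> B; m \<in> carrier M\<rbrakk> \<Longrightarrow> \<rho> p (c \<odot>\<^bsub>M\<^esub> m) = c \<odot>\<^bsub>M\<^esub> \<rho> p m"
begin

interpretation M: right_module E M by (fact M)

lemma lin_ext_superset:
  assumes "finite S" "Poly_Mapping.keys x \<subseteq> S" "S \<subseteq> B" "m \<in> carrier M"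
  shows "lin_ext M \<rho> m x = finsum M (\<lambda>p. Poly_Mapping.lookup x p \<odot>\<^bsub>M\<^esub> \<rho> p m) S"
  unfolding lin_ext_def
proof (rule M.M.add.finprod_mono_neutral_cong_left[OF assms(1,2)])
  have cl: "\<rho> i m \<in> carrier M" if "i \<in> S" for i using closed assms that by blast
  then show "(\<lambda>p. Poly_Mapping.lookup x p \<odot>\<^bsub>M\<^esub> \<rho> p m) \<in> S \<rightarrow> carrier M" by simp
  show "Poly_Mapping.lookup x i \<odot>\<^bsub>M\<^esub> \<rho> i m = \<zero>\<^bsub>M\<^esub>" if "i \<in> S - Poly_Mapping.keys x" for i
    using that cl[of i] by (simp add: in_keys_iff)
qed (rule refl)

lemma lin_ext_closed: "Poly_Mapping.keys x \<subseteq> B \<Longrightarrow> m \<in> carrier M \<Longrightarrow> lin_ext M \<rho> m x \<in> carrier M"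
  unfolding lin_ext_def by (rule M.M.finsum_closed) (use closed in auto)

lemma lin_ext_add:
  assumes x: "Poly_Mapping.keys x \<subseteq> B" and y: "Poly_Mapping.keys y \<subseteq> B" and m: "m \<in> carrier M"
  shows "lin_ext M \<rho> m (x + y) = lin_ext M \<rho> m x \<oplus>\<^bsub>M\<^esub> lin_ext M \<rho> m y"
proof -
  let ?S = "Poly_Mapping.keys x \<union> Poly_Mapping.keys y"
  have S: "finite ?S" "?S \<subseteq> B" "Poly_Mapping.keys (x + y) \<subseteq> ?S" using x y keys_add[of x y] by auto
  have cl: "\<rho> p m \<in> carrier M" if "p \<in> ?S" for p using that S closed m by blast
  have "lin_ext M \<rho> m (x + y) = finsum M (\<lambda>p. Poly_Mapping.lookup (x + y) p \<odot>\<^bsub>M\<^esub> \<rho> p m) ?S"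
    by (rule lin_ext_superset[OF S(1,3,2) m])
  also have "\<dots> = finsum M (\<lambda>p. Poly_Mapping.lookup x p \<odot>\<^bsub>M\<^esub> \<rho> p m \<oplus>\<^bsub>M\<^esub> Poly_Mapping.lookup y p \<odot>\<^bsub>M\<^esub> \<rho> p m) ?S"
    by (rule M.M.finsum_cong') (use cl in \<open>auto simp: lookup_add M.sm_add_left\<close>)
  also have "\<dots> = finsum M (\<lambda>p. Poly_Mapping.lookup x p \<odot>\<^bsub>M\<^esub> \<rho> p m) ?S \<oplus>\<^bsub>M\<^esub> finsum M (\<lambda>p. Poly_Mapping.lookup y p \<odot>\<^bsub>M\<^esub> \<rho> p m) ?S"
    by (rule M.M.finsum_addf) (use cl in auto)
  also have "\<dots> = lin_ext M \<rho> m x \<oplus>\<^bsub>M\<^esub> lin_ext M \<rho> m y"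
    using S lin_ext_superset[of ?S x m] lin_ext_superset[of ?S y m] m by simp
  finally show ?thesis .
qed

lemma lin_ext_zero [simp]: "lin_ext M \<rho> m 0 = \<zero>\<^bsub>M\<^esub>"
  by (simp add: lin_ext_def)

lemma lin_ext_single: "p \<in> B \<Longrightarrow> m \<in> carrier M \<Longrightarrow> lin_ext M \<rho> m (Poly_Mapping.single p c) = c \<odot>\<^bsub>M\<^esub> \<rho> p m"
proof -
  assume p: "p \<in> B" "m \<in> carrier M"
  have "lin_ext M \<rho> m (Poly_Mapping.single p c) = finsum M (\<lambda>q. Poly_Mapping.lookup (Poly_Mapping.single p c) q \<odot>\<^bsub>M\<^esub> \<rho> q m) {p}"
    by (rule lin_ext_superset) (use p in auto)
  then show ?thesis using closed[OF p] by simp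
qed

lemma lin_ext_scale:
  assumes "Poly_Mapping.keys x \<subseteq> B" and m: "m \<in> carrier M"
  shows "lin_ext M \<rho> m (Poly_Mapping.map ((*) c) x) = c \<odot>\<^bsub>M\<^esub> lin_ext M \<rho> m x"
  using assms(1)
proof (induction rule: poly_mapping_basis_induct)
  case (single p d)
  then show ?case using m closed[of p m] by (simp add: scale_single lin_ext_single M.sm_mult)
next
  case (add x y)
  then show ?case
    using m by (simp add: scale_add lin_ext_add keys_scale_subset lin_ext_closed M.sm_add_right)
qed simp

lemma lin_ext_add_left:
  assumes "Poly_Mapping.keys x \<subseteq> B" and m: "m \<in> carrier M" "n \<in> carrier M"
  shows "lin_ext M \<rho> (m \<oplus>\<^bsub>M\<^esub> n) x = lin_ext M \<rho> m x \<oplus>\<^bsub>M\<^esub> lin_ext M \<rho> n x"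
  using assms(1)
proof (induction rule: poly_mapping_basis_induct)
  case (single p d)
  then show ?case using m closed[of p] add[of p] by (simp add: lin_ext_single M.sm_add_right)
next
  case (add x y)
  then show ?case using m by (simp add: lin_ext_add lin_ext_closed M.M.a_ac)
qed simp

lemma lin_ext_scale_left:
  assumes "Poly_Mapping.keys x \<subseteq> B" and m: "m \<in> carrier M"
  shows "lin_ext M \<rho> (c \<odot>\<^bsub>M\<^esub> m) x = c \<odot>\<^bsub>M\<^esub> lin_ext M \<rho> m x"
  using assms(1)
proof (induction rule: poly_mapping_basis_induct)
  case (single p d)
  then show ?case
    using m closed[of p m] smult[of p m] by (simp add: lin_ext_single mult.commute flip: M.sm_mult)
next
  case (add x y)
  then show ?case using m by (simp add: lin_ext_add lin_ext_closed M.sm_add_right)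
qed simp

text \<open>Both sides are additive in x and in y, so two nested inductions lead to monomials, where
  \<open>comp\<close> applies, with \<open>None\<close> as the product 0.\<close>

lemma lin_ext_mult:
  assumes cat: "basis_closed B cat"
    and comp: "\<And>p q m. \<lbrakk>p \<in> B; q \<in> B; m \<in> carrier M\<rbrakk>
      \<Longrightarrow> \<rho> q (\<rho> p m) = (case cat p q of None \<Rightarrow> \<zero>\<^bsub>M\<^esub> | Some r \<Rightarrow> \<rho> r m)"
    and x: "Poly_Mapping.keys x \<subseteq> B" and y: "Poly_Mapping.keys y \<subseteq> B" and m: "m \<in> carrier M"
  shows "lin_ext M \<rho> m (x \<otimes>\<^bsub>basis_algebra B cat\<^esub> y) = lin_ext M \<rho> (lin_ext M \<rho> m x) y"
  using x
proof (induction rule: poly_mapping_basis_induct)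
  case zero
  show ?case
    using y lin_ext_scale_left[of y "\<zero>\<^bsub>M\<^esub>" 0] by (simp add: lin_ext_closed)
next
  case (single p c)
  show ?case
    using y
  proof (induction rule: poly_mapping_basis_induct)
    case (single q d)
    have "c \<odot>\<^bsub>M\<^esub> (d \<odot>\<^bsub>M\<^esub> \<rho> q (\<rho> p m)) = d \<odot>\<^bsub>M\<^esub> (c \<odot>\<^bsub>M\<^esub> \<rho> q (\<rho> p m))"
      using single \<open>p \<in> B\<close> m closed by (simp add: mult.commute flip: M.sm_mult)
    moreover have "r \<in> B" if "cat p q = Some r" for r
      using basis_closedD[OF cat \<open>p \<in> B\<close> \<open>q \<in> B\<close> that] .
    ultimately show ?case
      using single \<open>p \<in> B\<close> m comp[of p q m] closed
      by (cases "cat p q") (simp_all add: basis_algebra_mult_single basis_prod_def lin_ext_single smult M.sm_mult)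
  next
    case (add y y')
    then show ?case
      using \<open>p \<in> B\<close> m by (simp add: basis_algebra_mult_add_right lin_ext_add lin_ext_closed keys_basis_mult[OF cat])
  qed (simp add: lin_ext_closed)
next
  case (add x x')
  then show ?case
    using y m by (simp add: basis_algebra_mult_add_left lin_ext_add lin_ext_closed lin_ext_add_left keys_basis_mult[OF cat])
qed

text \<open>This constructs both the path algebra module underlying a Leavitt module, with operators
  indexed by paths, and the module of germs, with operators indexed by words.\<close>

lemma right_module_lin_ext:
  assumes cat: "basis_closed B cat"
    and comp: "\<And>p q m. \<lbrakk>p \<in> B; q \<in> B; m \<in> carrier M\<rbrakk>
      \<Longrightarrow> \<rho> q (\<rho> p m) = (case cat p q of None \<Rightarrow> \<zero>\<^bsub>M\<^esub> | Some r \<Rightarrow> \<rho> r m)"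
  shows "right_module (basis_algebra B cat) (with_act M (lin_ext M \<rho>))"
  by (rule right_module_with_act[OF M])
    (simp_all add: lin_ext_closed lin_ext_add lin_ext_scale lin_ext_add_left lin_ext_scale_left
      lin_ext_mult[OF cat comp])

end

lemma act_single:
  assumes "right_module (basis_algebra B cat) M" "p \<in> B" "m \<in> carrier M"
  shows "act M m (Poly_Mapping.single p c) = c \<odot>\<^bsub>M\<^esub> act M m (basis_elem p)"
proof -
  interpret right_module "basis_algebra B cat" M by fact
  show ?thesis using act_smult_right[of m "basis_elem p" c] assms by (simp add: scale_basis)
qed

lemma act_zero_right:
  assumes "right_module (basis_algebra B cat) M" "m \<in> carrier M"
  shows "act M m 0 = \<zero>\<^bsub>M\<^esub>"
proof -
  interpret right_module "basis_algebra B cat" M by fact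
  have "0 \<in> carrier (basis_algebra B cat)" by simp
  from act_smult_right[OF assms(2) this, of 0] have "act M m 0 = 0 \<odot>\<^bsub>M\<^esub> act M m 0"
    unfolding basis_algebra_simps scale_zero .
  also have "\<dots> = \<zero>\<^bsub>M\<^esub>" by (rule sm_zero_left, rule act_closed) (use assms in simp_all)
  finally show ?thesis .
qed

text \<open>The expansion of m x along the support of x in the form of a membership statement, so
  that later arguments avoid finite sums in M.\<close>

lemma act_basis_mem:
  assumes M: "right_module (basis_algebra B cat) M" and x: "Poly_Mapping.keys x \<subseteq> B" and m: "m \<in> carrier M"
    and Q: "\<zero>\<^bsub>M\<^esub> \<in> Q" "\<And>u v. u \<in> Q \<Longrightarrow> v \<in> Q \<Longrightarrow> u \<oplus>\<^bsub>M\<^esub> v \<in> Q" "\<And>c u. u \<in> Q \<Longrightarrow> c \<odot>\<^bsub>M\<^esub> u \<in> Q"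
    and basis: "\<And>p. p \<in> Poly_Mapping.keys x \<Longrightarrow> act M m (basis_elem p) \<in> Q"
  shows "act M m x \<in> Q"
proof -
  interpret right_module "basis_algebra B cat" M by fact
  have "act M m y \<in> Q" if "Poly_Mapping.keys y \<subseteq> Poly_Mapping.keys x" for y
    using that
  proof (induction rule: poly_mapping_basis_induct)
    case zero
    show ?case using act_zero_right[OF M m] Q(1) by simp
  next
    case (single p c)
    then show ?case using act_single[OF M _ m, of p c] basis Q(3) x by auto
  next
    case (add y z)
    then show ?case using act_add_right[of m y z] m x Q(2) by auto
  qed
  then show ?thesis by blast
qed

lemma submod_basisI:
  assumes M: "right_module (basis_algebra B cat) M"
    and Q: "Q \<subseteq> carrier M" "\<zero>\<^bsub>M\<^esub> \<in> Q" "\<And>u v. u \<in> Q \<Longrightarrow> v \<in> Q \<Longrightarrow> u \<oplus>\<^bsub>M\<^esub> v \<in> Q" "\<And>c u. u \<in> Q \<Longrightarrow> c \<odot>\<^bsub>M\<^esub> u \<in> Q"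
    and basis: "\<And>u p. u \<in> Q \<Longrightarrow> p \<in> B \<Longrightarrow> act M u (basis_elem p) \<in> Q"
  shows "submod (basis_algebra B cat) M Q"
  using Q by (intro submodI) (auto intro!: act_basis_mem[OF M] basis)

lemma act_basis_hom:
  fixes M :: "('k::field, 'b \<Rightarrow>\<^sub>0 'k, 'm) rmodule" and N :: "('k, 'b \<Rightarrow>\<^sub>0 'k, 'n) rmodule"
  assumes M: "right_module (basis_algebra B cat) M" and N: "right_module (basis_algebra B cat) N"
    and f: "f \<in> carrier M \<rightarrow> carrier N"
    and f_add: "\<And>x y. \<lbrakk>x \<in> carrier M; y \<in> carrier M\<rbrakk> \<Longrightarrow> f (x \<oplus>\<^bsub>M\<^esub> y) = f x \<oplus>\<^bsub>N\<^esub> f y"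
    and f_smult: "\<And>c x. x \<in> carrier M \<Longrightarrow> f (c \<odot>\<^bsub>M\<^esub> x) = c \<odot>\<^bsub>N\<^esub> f x"
    and basis: "\<And>x p. \<lbrakk>x \<in> carrier M; p \<in> B\<rbrakk> \<Longrightarrow> f (act M x (basis_elem p)) = act N (f x) (basis_elem p)"
  shows "rhom (basis_algebra B cat) M N f"
proof (rule rhomI)
  interpret M: right_module "basis_algebra B cat" M by fact
  interpret N: right_module "basis_algebra B cat" N by fact
  have f0: "f \<zero>\<^bsub>M\<^esub> = \<zero>\<^bsub>N\<^esub>"
    using f_smult[of "\<zero>\<^bsub>M\<^esub>" 0] f N.sm_zero_left[of "f \<zero>\<^bsub>M\<^esub>"] by (auto simp: Pi_iff)
  fix x and a :: "'b \<Rightarrow>\<^sub>0 'k" assume x: "x \<in> carrier M" and "a \<in> carrier (basis_algebra B cat)"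
  then have "Poly_Mapping.keys a \<subseteq> B" by simp
  then show "f (act M x a) = act N (f x) a"
  proof (induction rule: poly_mapping_basis_induct)
    case zero
    show ?case using x f by (simp add: f0 act_zero_right[OF M] act_zero_right[OF N] Pi_iff)
  next
    case (single p c)
    then show ?case
      using act_single[OF M _ x, of p c] act_single[OF N, of p "f x" c] x f M.act_closed[of x "basis_elem p"]
      by (simp add: f_smult basis Pi_iff)
  next
    case (add y z)
    then show ?case
      using M.act_add_right[of x y z] N.act_add_right[of "f x" y z] x f M.act_closed[of x y] M.act_closed[of x z]
      by (simp add: f_add Pi_iff)
  qed
next
  show "f x \<in> carrier N" if "x \<in> carrier M" for x using f that by blast
qed (rule f_add f_smult; assumption)+

section \<open>Modules over the path algebra\<close>

text \<open>\<open>K\<close> carries the field type, so that \<open>PA\<close>, and later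
  \<open>LA\<close>, have one fixed type inside the locale.\<close>

locale row_finite_digraph = wf_digraph G for G :: "('v, 'e) pre_digraph" +
  fixes K :: "'k::field itself"
  assumes row_finite: "row_finite G"
begin

abbreviation PA :: "('k, ('v, 'e, 'k) path_algebra_elem) module" where
  "PA \<equiv> path_algebra G"

abbreviation pact :: "('k, ('v, 'e, 'k) path_algebra_elem, 'm) rmodule \<Rightarrow> 'm \<Rightarrow> 'v \<times> 'e list \<Rightarrow> 'm" where
  "pact M m p \<equiv> act M m (basis_elem p)"

section \<open>Paths and local units of the path algebra\<close>

lemma paths_Nil [simp]: "(u, []) \<in> paths G \<longleftrightarrow> u \<in> verts G"
  by (auto simp: paths_def awalk_Nil_iff)

lemma paths_Cons [simp]: "(u, e # es) \<in> paths G \<longleftrightarrow> e \<in> arcs G \<and> u = tail G e \<and> (head G e, es) \<in> paths G"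
  by (auto simp: paths_def awalk_Cons_iff)

lemma path_end_Nil [simp]: "path_end G (u, []) = u"
  and path_end_Cons [simp]: "path_end G (u, e # es) = path_end G (head G e, es)"
  by (simp_all add: path_end_def)

lemma path_end_append [simp]: "path_end G (u, es @ fs) = path_end G (path_end G (u, es), fs)"
  by (induction es arbitrary: u) simp_all

lemma path_start_verts: "(u, es) \<in> paths G \<Longrightarrow> u \<in> verts G"
  by (cases es) auto

lemma path_end_verts: "(u, es) \<in> paths G \<Longrightarrow> path_end G (u, es) \<in> verts G"
  by (induction es arbitrary: u) auto

lemma paths_append [simp]:
  "(u, es @ fs) \<in> paths G \<longleftrightarrow> (u, es) \<in> paths G \<and> (path_end G (u, es), fs) \<in> paths G"
  by (induction es arbitrary: u) (auto dest: path_start_verts)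

lemma paths_basis_closed: "basis_closed (paths G) (path_concat G)"
  unfolding basis_closed_def by (auto simp: path_concat_def split: if_splits)

definition vertex_sum :: "'v set \<Rightarrow> ('v, 'e, 'k) path_algebra_elem" where
  "vertex_sum F = (\<Sum>v \<in> F. basis_elem (v, []))"

lemma keys_vertex_sum: "Poly_Mapping.keys (vertex_sum F) \<subseteq> (\<lambda>v. (v, [])) ` F"
  unfolding vertex_sum_def by (rule keys_sum_subset) simp

lemma vertex_sum_PA: "F \<subseteq> verts G \<Longrightarrow> vertex_sum F \<in> carrier PA"
  unfolding path_algebra_def using keys_vertex_sum[of F] by fastforce

lemma basis_prod_path_vertex: "basis_prod (path_concat G) p (v, []) c = (if v = path_end G p then Poly_Mapping.single p c else 0)"
  by (cases p) (simp add: basis_prod_def path_concat_def)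

lemma basis_prod_vertex_path: "basis_prod (path_concat G) (v, []) p c = (if v = fst p then Poly_Mapping.single p c else 0)"
  by (cases p) (simp add: basis_prod_def path_concat_def)

lemma PA_mult_sum_right: "x \<otimes>\<^bsub>PA\<^esub> sum f F = (\<Sum>i \<in> F. x \<otimes>\<^bsub>PA\<^esub> f i)"
  unfolding path_algebra_def by (induction F rule: infinite_finite_induct) (simp_all add: basis_algebra_mult_add_right)

lemma PA_mult_sum_left: "sum f F \<otimes>\<^bsub>PA\<^esub> x = (\<Sum>i \<in> F. f i \<otimes>\<^bsub>PA\<^esub> x)"
  unfolding path_algebra_def by (induction F rule: infinite_finite_induct) (simp_all add: basis_algebra_mult_add_left)

lemma vertex_sum_right_unit:
  assumes "finite F" "Poly_Mapping.keys a \<subseteq> {p. path_end G p \<in> F}"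
  shows "a \<otimes>\<^bsub>PA\<^esub> vertex_sum F = a"
  using assms(2)
proof (induction rule: poly_mapping_basis_induct)
  case (single p c)
  then show ?case using assms(1)
    unfolding vertex_sum_def PA_mult_sum_right
    by (simp add: path_algebra_def basis_algebra_mult_single basis_prod_path_vertex)
next
  case (add x y)
  then show ?case by (simp add: path_algebra_def basis_algebra_mult_add_left)
qed (simp add: path_algebra_def)

lemma vertex_sum_mult_basis:
  assumes "finite F"
  shows "vertex_sum F \<otimes>\<^bsub>PA\<^esub> basis_elem p = (if fst p \<in> F then basis_elem p else 0)"
  using assms unfolding vertex_sum_def PA_mult_sum_left
  by (simp add: path_algebra_def basis_algebra_mult_single basis_prod_vertex_path)

sublocale P: local_unit_algebra PA
proof
  show "closed_algebra PA"
    unfolding path_algebra_def by (rule closed_basis_algebra[OF paths_basis_closed])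
  show "carrier PA \<noteq> {}" unfolding path_algebra_def by (auto intro: exI[of _ 0])
  fix a b assume "a \<in> carrier PA" "b \<in> carrier PA"
  then have ab: "Poly_Mapping.keys a \<subseteq> paths G" "Poly_Mapping.keys b \<subseteq> paths G"
    by (simp_all add: path_algebra_def)
  let ?F = "path_end G ` (Poly_Mapping.keys a \<union> Poly_Mapping.keys b)"
  have "?F \<subseteq> verts G" using ab path_end_verts by fast
  then have "vertex_sum ?F \<in> carrier PA" by (rule vertex_sum_PA)
  moreover have "a \<otimes>\<^bsub>PA\<^esub> vertex_sum ?F = a" "b \<otimes>\<^bsub>PA\<^esub> vertex_sum ?F = b"
    by (rule vertex_sum_right_unit; force)+
  ultimately show "\<exists>e\<in>carrier PA. a \<otimes>\<^bsub>PA\<^esub> e = a \<and> b \<otimes>\<^bsub>PA\<^esub> e = b" by blast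
qed

lemma basis_PA [simp]: "p \<in> paths G \<Longrightarrow> basis_elem p \<in> carrier PA"
  by (simp add: path_algebra_def)

lemma pact_closed [simp]: "right_module PA M \<Longrightarrow> m \<in> carrier M \<Longrightarrow> p \<in> paths G \<Longrightarrow> pact M m p \<in> carrier M"
  by (simp add: right_module.act_closed)

lemma pact_concat:
  assumes "right_module PA M" "m \<in> carrier M" "p \<in> paths G" "q \<in> paths G"
  shows "pact M (pact M m p) q =
    (if path_end G p = fst q then pact M m (fst p, snd p @ snd q) else \<zero>\<^bsub>M\<^esub>)"
proof -
  interpret right_module PA M by fact
  have "pact M (pact M m p) q = act M m (basis_elem p \<otimes>\<^bsub>PA\<^esub> basis_elem q)"
    using assms by (simp add: act_mult)
  also have "\<dots> = act M m (basis_prod (path_concat G) p q 1)"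
    by (simp add: path_algebra_def basis_algebra_mult_single)
  also have "\<dots> = (if path_end G p = fst q then pact M m (fst p, snd p @ snd q) else \<zero>\<^bsub>M\<^esub>)"
    using act_zero_right[OF assms(1)[unfolded path_algebra_def] assms(2)]
    by (simp add: basis_prod_def path_concat_def)
  finally show ?thesis .
qed

text \<open>If e is the sum of the vertices in F and m = m e, then m p = m (e p), and e p = 0 unless
  p starts in F. Together with row-finiteness this leaves finitely many p in \<open>E_n\<close> with
  m p nonzero.\<close>

lemma UM_support:
  assumes "P.UM M" "m \<in> carrier M"
  obtains F where "finite F" "F \<subseteq> verts G" "act M m (vertex_sum F) = m"
    "\<And>p. p \<in> paths G \<Longrightarrow> fst p \<notin> F \<Longrightarrow> pact M m p = \<zero>\<^bsub>M\<^esub>"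
proof -
  interpret right_module PA M by (rule P.UM_right_module) fact
  obtain a where a: "a \<in> carrier PA" "act M m a = m" using assms(1)[unfolded P.UM_iff] assms(2) by blast
  let ?F = "path_end G ` Poly_Mapping.keys a"
  have "Poly_Mapping.keys a \<subseteq> paths G" using a(1) by (simp add: path_algebra_def)
  then have F: "finite ?F" "?F \<subseteq> verts G" using path_end_verts by auto
  have "a \<otimes>\<^bsub>PA\<^esub> vertex_sum ?F = a" by (rule vertex_sum_right_unit) auto
  then have e: "act M m (vertex_sum ?F) = m"
    using a act_mult[OF assms(2) a(1) vertex_sum_PA[OF F(2)]] by simp
  have "pact M m p = \<zero>\<^bsub>M\<^esub>" if "p \<in> paths G" "fst p \<notin> ?F" for p
  proof -
    have "pact M m p = act M m (vertex_sum ?F \<otimes>\<^bsub>PA\<^esub> basis_elem p)"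
      using act_mult[OF assms(2) vertex_sum_PA[OF F(2)] basis_PA[OF that(1)]] e by simp
    also have "\<dots> = \<zero>\<^bsub>M\<^esub>"
      using that(2) F(1) act_zero_right[OF right_module_axioms[unfolded path_algebra_def] assms(2)]
      by (simp add: vertex_sum_mult_basis)
    finally show ?thesis .
  qed
  with F e that show thesis by blast
qed

text \<open>By \<open>UM_support\<close>, m is the sum of the elements m v over a finite set of
  vertices.\<close>

lemma UM_vertex_mem:
  assumes M: "P.UM M" and m: "m \<in> carrier M"
    and Q: "\<zero>\<^bsub>M\<^esub> \<in> Q" "\<And>u v. u \<in> Q \<Longrightarrow> v \<in> Q \<Longrightarrow> u \<oplus>\<^bsub>M\<^esub> v \<in> Q" "\<And>c u. u \<in> Q \<Longrightarrow> c \<odot>\<^bsub>M\<^esub> u \<in> Q"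
    and v: "\<And>v. v \<in> verts G \<Longrightarrow> pact M m (v, []) \<in> Q"
  shows "m \<in> Q"
proof -
  from M m obtain F where F: "finite F" "F \<subseteq> verts G" "act M m (vertex_sum F) = m"
    by (rule UM_support) blast
  have "act M m (vertex_sum F) \<in> Q"
  proof (rule act_basis_mem[OF P.UM_right_module[OF M, unfolded path_algebra_def] _ m Q])
    show "Poly_Mapping.keys (vertex_sum F) \<subseteq> paths G" using keys_vertex_sum[of F] F(2) by fastforce
    show "pact M m p \<in> Q" if "p \<in> Poly_Mapping.keys (vertex_sum F)" for p
      using that keys_vertex_sum[of F] F(2) v by auto
  qed
  with F(3) show ?thesis by simp
qed

section \<open>The path sets \<open>E_n\<close>\<close>

lemma level_paths_paths: "p \<in> level_paths G n \<Longrightarrow> p \<in> paths G"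
  by (simp add: level_paths_def)

text \<open>Cut after n arcs. If nothing remains, then either k = 0 or the path ends at a sink, and
  in both cases the trivial path at its end lies in \<open>E_k\<close>.\<close>

lemma level_paths_split:
  assumes "p \<in> level_paths G (n + k)"
  obtains q r where "q \<in> level_paths G n" "r \<in> level_paths G k" "path_end G q = fst r"
    "p = (fst q, snd q @ snd r)"
proof -
  obtain u es where p: "p = (u, es)" by (cases p)
  let ?q = "(u, take n es)" and ?r = "(path_end G (u, take n es), drop n es)"
  have pp: "(u, take n es @ drop n es) \<in> paths G" using assms p by (simp add: level_paths_def)
  have e: "path_end G ?r = path_end G p"
    using path_end_append[of u "take n es" "drop n es"] p by simp
  have "?q \<in> level_paths G n" "?r \<in> level_paths G k"
    using assms pp e p unfolding paths_append by (auto simp: level_paths_def min_def not_le)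
  with that[of ?q ?r] p show thesis by simp
qed

lemma level_paths_append:
  assumes "r \<in> paths G" "p \<in> level_paths G n" "path_end G r = fst p"
  shows "(fst r, snd r @ snd p) \<in> level_paths G (length (snd r) + n)"
  using assms by (cases r; cases p) (auto simp: level_paths_def)

text \<open>By \<open>level_paths_split\<close> every path of the higher level extends one of
  \<open>E_n\<close> on the right, so properties stable under right extension are inherited.\<close>

lemma level_paths_mono:
  assumes "\<And>p. p \<in> level_paths G n \<Longrightarrow> Q p" "n \<le> n'"
    and "\<And>q r. \<lbrakk>q \<in> paths G; r \<in> paths G; path_end G q = fst r; Q q\<rbrakk> \<Longrightarrow> Q (fst q, snd q @ snd r)"
    and "p \<in> level_paths G n'"
  shows "Q p"
proof -
  have "p \<in> level_paths G (n + (n' - n))" using assms by simp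
  then obtain q r where "q \<in> level_paths G n" "r \<in> level_paths G (n' - n)" "path_end G q = fst r"
    "p = (fst q, snd q @ snd r)" by (rule level_paths_split)
  with assms(1,3) level_paths_paths show ?thesis by metis
qed

text \<open>Row-finiteness makes the branching finite. The induction bounds the length by n instead
  of fixing it, since paths in \<open>E_n\<close> that end at sinks may be shorter.\<close>

lemma finite_level_paths:
  assumes "v \<in> verts G" shows "finite {p \<in> level_paths G n. fst p = v}"
proof -
  have "v \<in> verts G \<Longrightarrow> finite {es. (v, es) \<in> paths G \<and> length es \<le> n}" for v
  proof (induction n arbitrary: v)
    case 0
    have "{es. (v, es) \<in> paths G \<and> length es \<le> 0} \<subseteq> {[]}" by auto
    then show ?case by (rule finite_subset) simp
  next
    case (Suc n)
    have "{es. (v, es) \<in> paths G \<and> length es \<le> Suc n} \<subseteq>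
      {[]} \<union> (\<Union>e \<in> out_arcs G v. (#) e ` {es. (head G e, es) \<in> paths G \<and> length es \<le> n})"
    proof
      fix es assume "es \<in> {es. (v, es) \<in> paths G \<and> length es \<le> Suc n}"
      then show "es \<in> {[]} \<union> (\<Union>e \<in> out_arcs G v. (#) e ` {es. (head G e, es) \<in> paths G \<and> length es \<le> n})"
        by (cases es) auto
    qed
    moreover have "finite (out_arcs G v)" using row_finite Suc.prems by (simp add: row_finite_def)
    moreover have "head G e \<in> verts G" if "e \<in> out_arcs G v" for e using that by auto
    ultimately show ?case by (intro finite_subset[OF \<open>_ \<subseteq> _\<close>] finite_UnI finite_UN_I finite_imageI Suc.IH) simp_all
  qed
  then have "finite (Pair v ` {es. (v, es) \<in> paths G \<and> length es \<le> n})" using assms by blast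
  moreover have "{p \<in> level_paths G n. fst p = v} \<subseteq> Pair v ` {es. (v, es) \<in> paths G \<and> length es \<le> n}"
    by (auto simp: level_paths_def)
  ultimately show ?thesis by (rule finite_subset[rotated])
qed

text \<open>For a submodule B this is the preimage of the hat of M/B; the hat of M is the case B =
  0. On submodules of unital modules it is a closure operator (\<open>subset_sat\<close>,
  \<open>sat_mono\<close>, \<open>sat_sat\<close>).\<close>

definition sat :: "('k, ('v, 'e, 'k) path_algebra_elem, 'm) rmodule \<Rightarrow> 'm set \<Rightarrow> 'm set" where
  "sat M B = {m \<in> carrier M. \<exists>n. \<forall>p \<in> level_paths G n. pact M m p \<in> B}"

lemma hat_eq_sat: "hat G M = sat M {\<zero>\<^bsub>M\<^esub>}"
  by (simp add: hat_def sat_def)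

lemma sat_sub: "sat M B \<subseteq> carrier M"
  by (auto simp: sat_def)

lemma satI: "\<lbrakk>m \<in> carrier M; \<And>p. p \<in> level_paths G n \<Longrightarrow> pact M m p \<in> B\<rbrakk> \<Longrightarrow> m \<in> sat M B"
  unfolding sat_def by blast

lemma satE:
  assumes "m \<in> sat M B"
  obtains n where "m \<in> carrier M" "\<And>p. p \<in> level_paths G n \<Longrightarrow> pact M m p \<in> B"
  using assms by (auto simp: sat_def)

lemma sat_mono: "B \<subseteq> C \<Longrightarrow> sat M B \<subseteq> sat M C"
  unfolding sat_def by blast

lemma subset_sat:
  assumes B: "submod PA M B"
  shows "B \<subseteq> sat M B"
  using submodD(1,5)[OF B] level_paths_paths by (auto intro!: satI[where n = 0])

lemma sat_level_mono:
  assumes M: "right_module PA M" and B: "submod PA M B" and m: "m \<in> carrier M"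
    and "\<And>p. p \<in> level_paths G n \<Longrightarrow> pact M m p \<in> B" and "n \<le> n'" and "p \<in> level_paths G n'"
  shows "pact M m p \<in> B"
proof (rule level_paths_mono[OF assms(4,5) _ assms(6)])
  fix q r assume *: "q \<in> paths G" "r \<in> paths G" "path_end G q = fst r" "pact M m q \<in> B"
  from submod_act[OF B *(4) basis_PA[OF *(2)]] have "pact M (pact M m q) r \<in> B" .
  then show "pact M m (fst q, snd q @ snd r) \<in> B" using * pact_concat[OF M m *(1,2)] by simp
qed

text \<open>For a sum take the larger of the two levels. For the action of a path r use (u r) p = u
  (r p): if p is in \<open>E_n\<close>, then r p belongs to the level n + length of r, which also
  sends u into B.\<close>

lemma submod_sat:
  assumes M: "right_module PA M" and B: "submod PA M B"
  shows "submod PA M (sat M B)"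
proof -
  interpret right_module PA M by fact
  note BD = submodD[OF B]
  show ?thesis unfolding path_algebra_def
  proof (rule submod_basisI[OF M[unfolded path_algebra_def]])
    show "sat M B \<subseteq> carrier M" by (rule sat_sub)
    show "\<zero>\<^bsub>M\<^esub> \<in> sat M B" using subset_sat[OF B] BD(2) by blast
    show "c \<odot>\<^bsub>M\<^esub> u \<in> sat M B" if u: "u \<in> sat M B" for c u
    proof (rule satE[OF u])
      fix n assume "u \<in> carrier M" "\<And>p. p \<in> level_paths G n \<Longrightarrow> pact M u p \<in> B"
      then show ?thesis
        by (intro satI[where n = n]) (simp_all add: act_smult_left level_paths_paths BD(4))
    qed
    show "u \<oplus>\<^bsub>M\<^esub> v \<in> sat M B" if u: "u \<in> sat M B" and v: "v \<in> sat M B" for u v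
    proof (rule satE[OF u], rule satE[OF v])
      fix n n' assume uv: "u \<in> carrier M" "v \<in> carrier M"
        and n: "\<And>p. p \<in> level_paths G n \<Longrightarrow> pact M u p \<in> B"
        and n': "\<And>p. p \<in> level_paths G n' \<Longrightarrow> pact M v p \<in> B"
      show "u \<oplus>\<^bsub>M\<^esub> v \<in> sat M B"
      proof (rule satI[where n = "max n n'"])
        fix p assume p: "p \<in> level_paths G (max n n')"
        have "pact M u p \<in> B" "pact M v p \<in> B"
          using sat_level_mono[OF M B uv(1) n _ p] sat_level_mono[OF M B uv(2) n' _ p] by auto
        then show "pact M (u \<oplus>\<^bsub>M\<^esub> v) p \<in> B"
          using uv p by (simp add: act_add_left level_paths_paths BD(3))
      qed (use uv in simp)
    qed
    show "pact M u r \<in> sat M B" if u: "u \<in> sat M B" and r: "r \<in> paths G" for u r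
    proof (rule satE[OF u])
      fix n assume uc: "u \<in> carrier M" and n: "\<And>p. p \<in> level_paths G n \<Longrightarrow> pact M u p \<in> B"
      show ?thesis
      proof (rule satI[where n = n])
        fix p assume p: "p \<in> level_paths G n"
        show "pact M (pact M u r) p \<in> B"
        proof (cases "path_end G r = fst p")
          case True
          have "pact M u (fst r, snd r @ snd p) \<in> B"
            by (rule sat_level_mono[OF M B uc n le_add2 level_paths_append[OF r p True]])
          with True show ?thesis using pact_concat[OF M uc r level_paths_paths[OF p]] by simp
        next
          case False
          with BD(2) show ?thesis using pact_concat[OF M uc r level_paths_paths[OF p]] by simp
        qed
      qed (use M uc r in simp)
    qed
  qed
qed

text \<open>Each m p with p in \<open>E_n\<close> has its own level k. Outside finitely many p,
  those starting in the support F of m, the element m p is 0. So the maximum N of these levels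
  exists, and n + N serves for m.\<close>

lemma sat_sat:
  assumes UM: "P.UM M" and B: "submod PA M B" and m: "m \<in> sat M (sat M B)"
  shows "m \<in> sat M B"
proof (rule satE[OF m])
  note M = P.UM_right_module[OF UM]
  fix n assume mc: "m \<in> carrier M" and n: "\<And>p. p \<in> level_paths G n \<Longrightarrow> pact M m p \<in> sat M B"
  from UM mc obtain F where F: "finite F" "F \<subseteq> verts G"
    and F0: "\<And>p. p \<in> paths G \<Longrightarrow> fst p \<notin> F \<Longrightarrow> pact M m p = \<zero>\<^bsub>M\<^esub>"
    by (rule UM_support) blast
  let ?L = "\<Union>v \<in> F. {p \<in> level_paths G n. fst p = v}"
  have L: "finite ?L" using F finite_level_paths by blast
  have "\<exists>k. \<forall>r \<in> level_paths G k. pact M (pact M m p) r \<in> B" if "p \<in> level_paths G n" for p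
    using n[OF that] by (auto simp: sat_def)
  then obtain k where k: "\<And>p r. p \<in> level_paths G n \<Longrightarrow> r \<in> level_paths G (k p) \<Longrightarrow> pact M (pact M m p) r \<in> B"
    by metis
  \<comment> \<open>Inserting 0 keeps the set nonempty, so that \<open>Max\<close> is meaningful
    even when no path starts in F.\<close>
  let ?N = "Max (insert 0 (k ` ?L))"
  show ?thesis
  proof (rule satI[OF mc, where n = "n + ?N"])
    fix p assume "p \<in> level_paths G (n + ?N)"
    then obtain q r where qr: "q \<in> level_paths G n" "r \<in> level_paths G ?N" "path_end G q = fst r"
      and p: "p = (fst q, snd q @ snd r)" by (rule level_paths_split)
    note qp = level_paths_paths[OF qr(1)] and rp = level_paths_paths[OF qr(2)]
    have "pact M (pact M m q) r \<in> B"
    proof (cases "fst q \<in> F")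
      case True
      then have "k q \<le> ?N" using qr(1) L by (intro Max_ge) auto
      from sat_level_mono[OF M B _ k[OF qr(1)] this qr(2)] show ?thesis using M mc qp by simp
    next
      case False
      then show ?thesis
        using F0[OF qp] submod_zero[OF B] right_module.act_zero[OF M basis_PA[OF rp]] by simp
    qed
    then show "pact M m p \<in> B" using pact_concat[OF M mc qp rp] qr(3) p by simp
  qed
qed

lemma rhom_pact: "rhom PA M N f \<Longrightarrow> m \<in> carrier M \<Longrightarrow> p \<in> paths G \<Longrightarrow> f (pact M m p) = pact N (f m) p"
  by (rule rhom_act) (assumption, assumption, rule basis_PA)

lemma hat_carrierD: "M \<in> hat_modules G \<Longrightarrow> P.UM M \<and> hat G M = carrier M"
  by (simp add: hat_modules_def)

lemma hat_modulesI: "P.UM M \<Longrightarrow> (\<And>m. m \<in> carrier M \<Longrightarrow> m \<in> sat M {\<zero>\<^bsub>M\<^esub>}) \<Longrightarrow> M \<in> hat_modules G"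
  unfolding hat_modules_def hat_eq_sat
  by (intro CollectI conjI equalityI sat_sub subsetI)

lemma hat_modulesD: "M \<in> hat_modules G \<Longrightarrow> m \<in> carrier M \<Longrightarrow> m \<in> sat M {\<zero>\<^bsub>M\<^esub>}"
  unfolding hat_modules_def hat_eq_sat by simp

text \<open>Since f commutes with paths, a level for f m also serves for m.\<close>

lemma sat_vimage:
  assumes f: "rhom PA M N f" and m: "m \<in> carrier M" "f m \<in> sat N C"
    and BC: "\<And>x. x \<in> carrier M \<Longrightarrow> f x \<in> C \<Longrightarrow> x \<in> B" and M: "right_module PA M"
  shows "m \<in> sat M B"
proof (rule satE[OF m(2)])
  fix n assume n: "\<And>p. p \<in> level_paths G n \<Longrightarrow> pact N (f m) p \<in> C"
  show ?thesis
  proof (rule satI[OF m(1), where n = n], rule BC)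
    fix p assume p: "p \<in> level_paths G n"
    note pp = level_paths_paths[OF p]
    show "pact M m p \<in> carrier M" by (rule pact_closed[OF M m(1) pp])
    show "f (pact M m p) \<in> C" using n[OF p] unfolding rhom_pact[OF f m(1) pp] .
  qed
qed

lemma sat_image:
  assumes f: "rhom PA M N f" and m: "m \<in> sat M B" and BC: "\<And>x. x \<in> B \<Longrightarrow> f x \<in> C"
  shows "f m \<in> sat N C"
proof (rule satE[OF m])
  fix n assume mc: "m \<in> carrier M" and n: "\<And>p. p \<in> level_paths G n \<Longrightarrow> pact M m p \<in> B"
  show ?thesis
  proof (rule satI[where n = n])
    show "f m \<in> carrier N" by (rule rhom_closed[OF f mc])
    fix p assume p: "p \<in> level_paths G n"
    show "pact N (f m) p \<in> C"
      using BC[OF n[OF p]] unfolding rhom_pact[OF f mc level_paths_paths[OF p]] .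
  qed
qed

lemma hat_image:
  assumes "right_module PA M" "right_module PA N" "rhom PA M N f" "m \<in> sat M {\<zero>\<^bsub>M\<^esub>}"
  shows "f m \<in> sat N {\<zero>\<^bsub>N\<^esub>}"
  by (rule sat_image[OF assms(3,4)]) (simp add: rhom_zero[OF assms(1-3)])

lemma serre_hat_modules:
  "serre_subcategory P.ModC (hat_modules G :: ('k, ('v, 'e, 'k) path_algebra_elem, 'm) rmodule set)"
proof -
  let ?S = "hat_modules G :: ('k, ('v, 'e, 'k) path_algebra_elem, 'm) rmodule set"
  \<comment> \<open>A Serre subcategory has to be nonempty; the zero module on the one-point set
    {undefined} is an object over every graph.\<close>
  let ?Z = "with_act (undefined\<lparr>carrier := {undefined}, ring.zero := undefined, add := \<lambda>_ _. undefined,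
    module.smult := \<lambda>_ _. undefined\<rparr> :: ('k, 'm, 'm) rmodule) (\<lambda>_ _. undefined) :: ('k, ('v, 'e, 'k) path_algebra_elem, 'm) rmodule"
  have Z: "right_module PA ?Z"
    by (rule right_moduleI) (simp_all add: with_act_def)
  have "P.UM ?Z"
    unfolding P.UM_iff using Z P.nonempty by (auto simp: with_act_def)
  then have "?Z \<in> ?S"
    by (rule hat_modulesI) (auto intro!: satI simp: with_act_def)
  moreover have "W \<in> ?S"
    if mono: "mono_arrow P.ModC (W, f, M)" and M: "M \<in> ?S" for W M :: "('k, ('v, 'e, 'k) path_algebra_elem, 'm) rmodule" and f
  proof -
    from mono have *: "P.UM W" "P.UM M" "f \<in> module_homs PA W M" "inj_on f (carrier W)"
      by (simp_all add: P.mono_iff)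
    note rm = *(1,2)[THEN P.UM_right_module] and f = P.module_homs_rhom[OF *(3)]
    have inj: "x = \<zero>\<^bsub>W\<^esub>" if "x \<in> carrier W" "f x = \<zero>\<^bsub>M\<^esub>" for x
      using *(4) rhom_inj_on[OF rm f] that by blast
    show ?thesis
    proof (rule hat_modulesI[OF *(1)])
      fix w assume w: "w \<in> carrier W"
      show "w \<in> sat W {\<zero>\<^bsub>W\<^esub>}"
        by (rule sat_vimage[OF f w hat_modulesD[OF M rhom_closed[OF f w]] _ rm(1)]) (simp add: inj)
    qed
  qed
  moreover have "N \<in> ?S"
    if epi: "epi_arrow P.ModC (M, f, N)" and M: "M \<in> ?S" for N M :: "('k, ('v, 'e, 'k) path_algebra_elem, 'm) rmodule" and f
  proof -
    from epi have *: "P.UM M" "P.UM N" "f \<in> module_homs PA M N" "f ` carrier M = carrier N"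
      by (simp_all add: P.epi_iff)
    note rm = *(1,2)[THEN P.UM_right_module] and f = P.module_homs_rhom[OF *(3)]
    show ?thesis
    proof (rule hat_modulesI[OF *(2)])
      fix y assume "y \<in> carrier N"
      then obtain x where "x \<in> carrier M" "y = f x" using *(4) by blast
      then show "y \<in> sat N {\<zero>\<^bsub>N\<^esub>}" using hat_image[OF rm f hat_modulesD[OF M]] by simp
    qed
  qed
  moreover have "M \<in> ?S"
    if ex: "short_exact P.ModC (W, f, M) (M', g, N)" and W: "W \<in> ?S" and N: "N \<in> ?S"
    for W M M' N :: "('k, ('v, 'e, 'k) path_algebra_elem, 'm) rmodule" and f g
  proof -
    from ex have k: "is_kernel P.ModC (M', g, N) (W, f, M)" by (simp add: short_exact_def)
    note * = P.is_kernelD[OF k]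
    note rm = *(1,2,4)[THEN P.UM_right_module] and f = P.module_homs_rhom[OF *(6)] and g = P.module_homs_rhom[OF *(3)]
    have 0: "submod PA M' {\<zero>\<^bsub>M'\<^esub>}" by (rule submod_singleton_zero[OF rm(1)])
    \<comment> \<open>Some level sends g m to 0, hence m into the kernel of g, which is the image of
      the hat module W. So m lies in the double saturation of 0.\<close>
    have "m \<in> sat M' (sat M' {\<zero>\<^bsub>M'\<^esub>})" if m: "m \<in> carrier M'" for m
    proof (rule sat_vimage[OF g m hat_modulesD[OF N rhom_closed[OF g m]] _ rm(1)])
      fix x assume "x \<in> carrier M'" "g x \<in> {\<zero>\<^bsub>N\<^esub>}"
      then obtain w where "w \<in> carrier W" "x = f w" using *(8) by blast
      then show "x \<in> sat M' {\<zero>\<^bsub>M'\<^esub>}" using hat_image[OF rm(3,1) f hat_modulesD[OF W]] by simp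
    qed
    then have "M' \<in> ?S" by (intro hat_modulesI[OF *(1)] sat_sat[OF *(1) 0])
    with *(5) show ?thesis by simp
  qed
  moreover have "?S \<subseteq> Obj P.ModC" by (auto dest: hat_carrierD)
  ultimately show ?thesis
    unfolding serre_subcategory_def
  proof (intro conjI allI impI P.category_Mod)
    assume sub: "\<And>W f M. mono_arrow P.ModC (W, f, M) \<Longrightarrow> M \<in> ?S \<Longrightarrow> W \<in> ?S"
      and quo: "\<And>M f N. epi_arrow P.ModC (M, f, N) \<Longrightarrow> M \<in> ?S \<Longrightarrow> N \<in> ?S"
      and ext: "\<And>W f M M' g N. short_exact P.ModC (W, f, M) (M', g, N) \<Longrightarrow> W \<in> ?S \<Longrightarrow> N \<in> ?S \<Longrightarrow> M \<in> ?S"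
    show "Dom P.ModC f \<in> ?S" if "mono_arrow P.ModC f \<and> Cod P.ModC f \<in> ?S" for f
      using that sub by (cases f) (simp only: P.Mod_Dom P.Mod_Cod, blast)
    show "Cod P.ModC f \<in> ?S" if "epi_arrow P.ModC f \<and> Dom P.ModC f \<in> ?S" for f
      using that quo by (cases f) (simp only: P.Mod_Dom P.Mod_Cod, blast)
    show "Cod P.ModC f \<in> ?S" if "short_exact P.ModC f g \<and> Dom P.ModC f \<in> ?S \<and> Cod P.ModC g \<in> ?S" for f g
      using that ext by (cases f; cases g) (simp only: P.Mod_Dom P.Mod_Cod, blast)
  qed blast+
qed

text \<open>Vanishing in the cokernel means lying in i(W), so the cokernel is a hat module exactly
  when every m is sent into i(W) by some level.\<close>

lemma cosmall_iff:
  "cosmall_mono P.ModC (hat_modules G) (W, i, M) \<longleftrightarrow>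
     P.UM W \<and> P.UM M \<and> i \<in> module_homs PA W M \<and> inj_on i (carrier W) \<and> carrier M \<subseteq> sat M (i ` carrier W)"
proof
  assume c: "cosmall_mono P.ModC (hat_modules G) (W, i, M)"
  then have "mono_arrow P.ModC (W, i, M)" by (simp add: cosmall_mono_def)
  then have *: "P.UM W" "P.UM M" "i \<in> module_homs PA W M" "inj_on i (carrier W)"
    by (simp_all add: P.mono_iff)
  from c obtain M' c Q where ck: "is_cokernel P.ModC (W, i, M) (M', c, Q)" and Q: "Q \<in> hat_modules G"
    by (auto simp: cosmall_mono_def)
  note cD = P.is_cokernelD[OF ck]
  have "m \<in> sat M (i ` carrier W)" if m: "m \<in> carrier M" for m
    by (rule sat_vimage[OF P.module_homs_rhom[OF cD(6)] m hat_modulesD[OF Q]])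
      (use cD(8) rhom_closed[OF P.module_homs_rhom[OF cD(6)] m] P.UM_right_module[OF *(2)] in auto)
  with * show "P.UM W \<and> P.UM M \<and> i \<in> module_homs PA W M \<and> inj_on i (carrier W) \<and> carrier M \<subseteq> sat M (i ` carrier W)"
    by blast
next
  assume *: "P.UM W \<and> P.UM M \<and> i \<in> module_homs PA W M \<and> inj_on i (carrier W) \<and> carrier M \<subseteq> sat M (i ` carrier W)"
  let ?B = "i ` carrier W"
  have rm: "right_module PA W" "right_module PA M" using * P.UM_right_module by blast+
  have B: "submod PA M ?B"
    by (rule submod_image[OF rm P.module_homs_rhom submod_carrier[OF rm(1)]]) (use * in blast)
  have M: "P.UM M" using * by blast
  have ck: "is_cokernel P.ModC (W, i, M) (M, restrict (coset_rep M ?B) (carrier M), P.quot M ?B)"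
    by (rule P.is_cokernel_quot) (use * in blast)+
  have "P.quot M ?B \<in> hat_modules G"
  proof (rule hat_modulesI[OF P.UM_quot[OF M B]])
    fix y assume "y \<in> carrier (P.quot M ?B)"
    then obtain m where m: "m \<in> carrier M" "y = coset_rep M ?B m" using P.surj_quot[OF M B] by blast
    have "coset_rep M ?B m \<in> sat (P.quot M ?B) {\<zero>\<^bsub>P.quot M ?B\<^esub>}"
      by (rule sat_image[OF P.rhom_quot[OF M B]])
        (use * m P.quot_zero_iff[OF M B] submod_mem[OF B] in blast)+
    with m show "y \<in> sat (P.quot M ?B) {\<zero>\<^bsub>P.quot M ?B\<^esub>}" by simp
  qed
  then show "cosmall_mono P.ModC (hat_modules G) (W, i, M)"
    unfolding cosmall_mono_def P.mono_iff using * ck by force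
qed

text \<open>Levels are computed alike in the kernel and in M, so the kernel is a hat module exactly
  when it is contained in the hat of M.\<close>

lemma small_iff:
  "small_epi P.ModC (hat_modules G) (M, q, N) \<longleftrightarrow>
     P.UM M \<and> P.UM N \<and> q \<in> module_homs PA M N \<and> q ` carrier M = carrier N \<and>
     (\<forall>m \<in> carrier M. q m = \<zero>\<^bsub>N\<^esub> \<longrightarrow> m \<in> sat M {\<zero>\<^bsub>M\<^esub>})"
proof
  assume c: "small_epi P.ModC (hat_modules G) (M, q, N)"
  then have "epi_arrow P.ModC (M, q, N)" by (simp add: small_epi_def)
  then have *: "P.UM M" "P.UM N" "q \<in> module_homs PA M N" "q ` carrier M = carrier N"
    by (simp_all add: P.epi_iff)
  from c obtain W k M' where ck: "is_kernel P.ModC (M, q, N) (W, k, M')" and W: "W \<in> hat_modules G"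
    by (auto simp: small_epi_def)
  note kD = P.is_kernelD[OF ck]
  note rm = kD(4,1)[THEN P.UM_right_module]
  have "m \<in> sat M {\<zero>\<^bsub>M\<^esub>}" if "m \<in> carrier M" "q m = \<zero>\<^bsub>N\<^esub>" for m
    using kD(8)[OF that] hat_image[OF rm P.module_homs_rhom[OF kD(6)] hat_modulesD[OF W]] by auto
  with * show "P.UM M \<and> P.UM N \<and> q \<in> module_homs PA M N \<and> q ` carrier M = carrier N \<and>
     (\<forall>m \<in> carrier M. q m = \<zero>\<^bsub>N\<^esub> \<longrightarrow> m \<in> sat M {\<zero>\<^bsub>M\<^esub>})" by blast
next
  assume *: "P.UM M \<and> P.UM N \<and> q \<in> module_homs PA M N \<and> q ` carrier M = carrier N \<and>
     (\<forall>m \<in> carrier M. q m = \<zero>\<^bsub>N\<^esub> \<longrightarrow> m \<in> sat M {\<zero>\<^bsub>M\<^esub>})"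
  then have M: "P.UM M" "P.UM N" and q: "q \<in> module_homs PA M N" by blast+
  note rm = M[THEN P.UM_right_module]
  let ?B = "{x \<in> carrier M. q x = \<zero>\<^bsub>N\<^esub>}"
  let ?K = "M\<lparr>carrier := ?B\<rparr>"
  have B: "submod PA M ?B" by (rule submod_kernel[OF rm P.module_homs_rhom[OF q]])
  have "?K \<in> hat_modules G"
  proof (rule hat_modulesI[OF P.UM_submod[OF M(1) B]])
    fix m assume m: "m \<in> carrier ?K"
    then have "m \<in> sat M {\<zero>\<^bsub>M\<^esub>}" using * by simp
    then show "m \<in> sat ?K {\<zero>\<^bsub>?K\<^esub>}"
      using m by (auto simp: sat_def)
  qed
  then show "small_epi P.ModC (hat_modules G) (M, q, N)"
    unfolding small_epi_def P.epi_iff using * P.is_kernel_incl[OF M q] by force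
qed

end

section \<open>Modules over the Leavitt path algebra\<close>

context row_finite_digraph
begin

abbreviation LA :: "('k, ('v, 'e, 'k) leavitt_elem) module" where
  "LA \<equiv> leavitt_path_algebra G"

definition words :: "('v, 'e) gen list set" where
  "words = lists (gens G) - {[]}"

definition FA :: "('k, ('v, 'e) gen list \<Rightarrow>\<^sub>0 'k) module" where
  "FA = basis_algebra words (\<lambda>p q. Some (p @ q))"

definition LI :: "(('v, 'e) gen list \<Rightarrow>\<^sub>0 'k) set" where
  "LI = generated_ideal FA (leavitt_relations G)"

text \<open>The quotient map from the free algebra onto the Leavitt path algebra.\<close>

definition co :: "(('v, 'e) gen list \<Rightarrow>\<^sub>0 'k) \<Rightarrow> ('v, 'e, 'k) leavitt_elem" where
  "co a = (\<lambda>i. i + a) ` LI"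

lemma LA_eq: "LA = quotient_algebra FA LI"
  by (simp add: leavitt_path_algebra_def free_algebra_def FA_def LI_def words_def)

lemma FA_simps [simp]:
  "\<zero>\<^bsub>FA\<^esub> = 0" "x \<oplus>\<^bsub>FA\<^esub> y = x + y" "c \<odot>\<^bsub>FA\<^esub> x = Poly_Mapping.map ((*) c) x"
  by (simp_all add: FA_def)

lemma FA_carrier: "x \<in> carrier FA \<longleftrightarrow> Poly_Mapping.keys x \<subseteq> words"
  by (simp add: FA_def)

lemma words_basis_closed: "basis_closed words (\<lambda>p q. Some (p @ q))"
  by (simp add: basis_closed_def words_def)

lemma closed_FA: "closed_algebra FA"
  unfolding FA_def by (rule closed_basis_algebra[OF words_basis_closed])

lemma FA_add [simp]: "a \<in> carrier FA \<Longrightarrow> b \<in> carrier FA \<Longrightarrow> a + b \<in> carrier FA"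
  and FA_scale [simp]: "a \<in> carrier FA \<Longrightarrow> Poly_Mapping.map ((*) c) a \<in> carrier FA"
  and FA_mult [simp]: "a \<in> carrier FA \<Longrightarrow> b \<in> carrier FA \<Longrightarrow> a \<otimes>\<^bsub>FA\<^esub> b \<in> carrier FA"
  using closed_FA by (simp_all add: closed_algebra_def)

lemma FA_zero [simp]: "0 \<in> carrier FA" by (simp add: FA_carrier)

lemma FA_minus_eq: "a - b = a + Poly_Mapping.map ((*) (-1)) b" for a b :: "('v, 'e) gen list \<Rightarrow>\<^sub>0 'k"
  by (rule poly_mapping_eqI) (simp add: lookup_minus lookup_add)

lemma FA_minus [simp]: "a \<in> carrier FA \<Longrightarrow> b \<in> carrier FA \<Longrightarrow> a - b \<in> carrier FA"
  unfolding FA_minus_eq by simp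

lemma FA_basis [simp]: "w \<in> words \<Longrightarrow> Poly_Mapping.single w c \<in> carrier FA"
  by (simp add: FA_carrier)

lemma words_Cons: "g # w \<in> words \<longleftrightarrow> g \<in> gens G \<and> (w = [] \<or> w \<in> words)"
  by (auto simp: words_def)

lemma Nil_words [simp]: "[] \<notin> words" by (simp add: words_def)

lemma gens_simps [simp]:
  "Vertex v \<in> gens G \<longleftrightarrow> v \<in> verts G" "Arrow e \<in> gens G \<longleftrightarrow> e \<in> arcs G" "Ghost e \<in> gens G \<longleftrightarrow> e \<in> arcs G"
  by (auto simp: gens_def)

lemma FA_mult_basis: "Poly_Mapping.single u c \<otimes>\<^bsub>FA\<^esub> Poly_Mapping.single w d = Poly_Mapping.single (u @ w) (c * d)"
  by (simp add: FA_def basis_algebra_mult_single basis_prod_def)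

lemma FA_distrib:
  "(a + a') \<otimes>\<^bsub>FA\<^esub> b = a \<otimes>\<^bsub>FA\<^esub> b + a' \<otimes>\<^bsub>FA\<^esub> b" "a \<otimes>\<^bsub>FA\<^esub> (b + b') = a \<otimes>\<^bsub>FA\<^esub> b + a \<otimes>\<^bsub>FA\<^esub> b'"
  "Poly_Mapping.map ((*) c) a \<otimes>\<^bsub>FA\<^esub> b = Poly_Mapping.map ((*) c) (a \<otimes>\<^bsub>FA\<^esub> b)"
  "a \<otimes>\<^bsub>FA\<^esub> Poly_Mapping.map ((*) c) b = Poly_Mapping.map ((*) c) (a \<otimes>\<^bsub>FA\<^esub> b)"
  "0 \<otimes>\<^bsub>FA\<^esub> b = 0" "a \<otimes>\<^bsub>FA\<^esub> 0 = 0"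
  by (simp_all add: FA_def basis_algebra_mult_add_left basis_algebra_mult_add_right basis_algebra_mult_scale)

lemma FA_distrib_minus:
  "(a - a') \<otimes>\<^bsub>FA\<^esub> b = a \<otimes>\<^bsub>FA\<^esub> b - a' \<otimes>\<^bsub>FA\<^esub> b" "a \<otimes>\<^bsub>FA\<^esub> (b - b') = a \<otimes>\<^bsub>FA\<^esub> b - a \<otimes>\<^bsub>FA\<^esub> b'"
  by (simp_all only: FA_minus_eq FA_distrib)

lemma FA_mult_sum_right: "x \<otimes>\<^bsub>FA\<^esub> sum f F = (\<Sum>i \<in> F. x \<otimes>\<^bsub>FA\<^esub> f i)"
  by (induction F rule: infinite_finite_induct) (simp_all add: FA_distrib)

lemma sum_FA: "(\<And>i. i \<in> F \<Longrightarrow> f i \<in> carrier FA) \<Longrightarrow> sum f F \<in> carrier FA"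
  by (induction F rule: infinite_finite_induct) simp_all

lemma gen_source_gens: "x \<in> Arrow ` arcs G \<union> Ghost ` arcs G \<Longrightarrow> gen_source G x \<in> verts G \<and> gen_target G x \<in> verts G \<and> x \<in> gens G"
  by auto

lemma relations_FA: "r \<in> leavitt_relations G \<Longrightarrow> r \<in> carrier FA"
  unfolding leavitt_relations_def
  by (auto simp: words_Cons intro!: FA_minus FA_basis sum_FA)

lemma LI_zero: "0 \<in> LI" and LI_rel: "r \<in> leavitt_relations G \<Longrightarrow> r \<in> LI"
  and LI_add: "x \<in> LI \<Longrightarrow> y \<in> LI \<Longrightarrow> x + y \<in> LI"
  and LI_scale: "x \<in> LI \<Longrightarrow> Poly_Mapping.map ((*) c) x \<in> LI"
  and LI_mult_left: "a \<in> carrier FA \<Longrightarrow> x \<in> LI \<Longrightarrow> a \<otimes>\<^bsub>FA\<^esub> x \<in> LI"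
  and LI_mult_right: "a \<in> carrier FA \<Longrightarrow> x \<in> LI \<Longrightarrow> x \<otimes>\<^bsub>FA\<^esub> a \<in> LI"
  by (fact generated_ideal.zero[where A = FA and R = "leavitt_relations G", folded LI_def, unfolded FA_simps]
      generated_ideal.incl[where A = FA and R = "leavitt_relations G", folded LI_def]
      generated_ideal.add[where A = FA and R = "leavitt_relations G", folded LI_def, unfolded FA_simps]
      generated_ideal.smult[where A = FA and R = "leavitt_relations G", folded LI_def, unfolded FA_simps]
      generated_ideal.mult_left[where A = FA and R = "leavitt_relations G", folded LI_def]
      generated_ideal.mult_right[where A = FA and R = "leavitt_relations G", folded LI_def])+

lemma LI_minus: "x \<in> LI \<Longrightarrow> y \<in> LI \<Longrightarrow> x - y \<in> LI"
  unfolding FA_minus_eq by (rule LI_add[OF _ LI_scale])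

lemma LI_FA: "x \<in> LI \<Longrightarrow> x \<in> carrier FA"
  unfolding LI_def
  by (induction rule: generated_ideal.induct) (simp_all add: relations_FA)

lemma co_eq_iff: "co a = co b \<longleftrightarrow> a - b \<in> LI"
proof
  assume "co a = co b"
  moreover have "a \<in> co a" using LI_zero by (auto simp: co_def intro!: image_eqI[of _ _ 0])
  ultimately obtain i where "i \<in> LI" "a = i + b" by (auto simp: co_def)
  then show "a - b \<in> LI" by simp
next
  assume ab: "a - b \<in> LI"
  have "i + a \<in> co b" if "i \<in> LI" for i
    using LI_add[OF that ab] by (auto simp: co_def intro!: image_eqI[of _ _ "i + (a - b)"])
  moreover have "i + b \<in> co a" if "i \<in> LI" for i
    using LI_minus[OF that ab] by (auto simp: co_def intro!: image_eqI[of _ _ "i - (a - b)"])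
  ultimately show "co a = co b" by (auto simp: co_def)
qed

lemma co_mem_iff: "b \<in> co a \<longleftrightarrow> b - a \<in> LI"
  by (auto simp: co_def intro!: image_eqI[of _ _ "b - a"])

lemma co_r_coset: "LI +>\<^bsub>FA\<^esub> a = co a"
  by (auto simp: a_r_coset_def r_coset_def co_def)

lemma LA_carrier: "carrier LA = co ` carrier FA"
  by (auto simp: LA_eq quotient_algebra_def A_RCOSETS_def RCOSETS_def co_r_coset[symmetric] a_r_coset_def)

lemma co_LA [simp]: "a \<in> carrier FA \<Longrightarrow> co a \<in> carrier LA"
  by (simp add: LA_carrier)

lemma co_add: "co a \<oplus>\<^bsub>LA\<^esub> co b = co (a + b)"
proof -
  have "co a \<oplus>\<^bsub>LA\<^esub> co b = (\<Union>x \<in> co a. \<Union>y \<in> co b. {x + y})"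
    by (simp add: LA_eq quotient_algebra_def set_add_def set_mult_def)
  also have "\<dots> = co (a + b)"
  proof (intro equalityI subsetI)
    fix z assume "z \<in> (\<Union>x \<in> co a. \<Union>y \<in> co b. {x + y})"
    then obtain i j where "i \<in> LI" "j \<in> LI" "z = (i + a) + (j + b)" by (auto simp: co_def)
    then have "z = (i + j) + (a + b)" "i + j \<in> LI" by (simp_all add: LI_add algebra_simps)
    then show "z \<in> co (a + b)" unfolding co_def by blast
  next
    fix z assume "z \<in> co (a + b)"
    then obtain i where i: "i \<in> LI" "z = (i + a) + (0 + b)" by (auto simp: co_def algebra_simps)
    then have "i + a \<in> co a" "0 + b \<in> co b" using LI_zero unfolding co_def by blast+
    with i show "z \<in> (\<Union>x \<in> co a. \<Union>y \<in> co b. {x + y})" by blast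
  qed
  finally show ?thesis .
qed

lemma co_scale: "c \<odot>\<^bsub>LA\<^esub> co a = co (Poly_Mapping.map ((*) c) a)"
proof -
  have "c \<odot>\<^bsub>LA\<^esub> co a = (\<Union>x \<in> co a. co (Poly_Mapping.map ((*) c) x))"
    by (simp add: LA_eq quotient_algebra_def co_r_coset)
  also have "\<dots> = (\<Union>x \<in> co a. co (Poly_Mapping.map ((*) c) a))"
  proof (rule SUP_cong[OF refl])
    fix x assume "x \<in> co a"
    then have "Poly_Mapping.map ((*) c) (x - a) \<in> LI" by (simp add: co_mem_iff LI_scale)
    also have "Poly_Mapping.map ((*) c) (x - a) = Poly_Mapping.map ((*) c) x - Poly_Mapping.map ((*) c) a"
      by (rule poly_mapping_eqI) (simp add: lookup_minus algebra_simps)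
    finally show "co (Poly_Mapping.map ((*) c) x) = co (Poly_Mapping.map ((*) c) a)" by (simp add: co_eq_iff)
  qed
  also have "\<dots> = co (Poly_Mapping.map ((*) c) a)"
  proof -
    have "a \<in> co a" using LI_zero by (simp add: co_mem_iff)
    then show ?thesis by blast
  qed
  finally show ?thesis .
qed

text \<open>\<open>rcoset_mult\<close> is a union over representatives. It is a single coset because
  x y - a b = (x - a) y + a (y - b) lies in the ideal.\<close>

lemma co_mult:
  assumes a: "a \<in> carrier FA" and b: "b \<in> carrier FA"
  shows "co a \<otimes>\<^bsub>LA\<^esub> co b = co (a \<otimes>\<^bsub>FA\<^esub> b)"
proof -
  have "co a \<otimes>\<^bsub>LA\<^esub> co b = (\<Union>x \<in> co a. \<Union>y \<in> co b. co (x \<otimes>\<^bsub>FA\<^esub> y))"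
    by (simp add: LA_eq quotient_algebra_def rcoset_mult_def co_r_coset)
  also have "\<dots> = (\<Union>x \<in> co a. \<Union>y \<in> co b. co (a \<otimes>\<^bsub>FA\<^esub> b))"
  proof (intro SUP_cong[OF refl])
    fix x y assume xy: "x \<in> co a" "y \<in> co b"
    then have i: "x - a \<in> LI" "y - b \<in> LI" by (simp_all add: co_mem_iff)
    then have "y \<in> carrier FA" using b LI_FA FA_add[of "y - b" b] by simp
    then have "(x - a) \<otimes>\<^bsub>FA\<^esub> y + a \<otimes>\<^bsub>FA\<^esub> (y - b) \<in> LI"
      using i a by (intro LI_add LI_mult_left LI_mult_right)
    also have "(x - a) \<otimes>\<^bsub>FA\<^esub> y + a \<otimes>\<^bsub>FA\<^esub> (y - b) = x \<otimes>\<^bsub>FA\<^esub> y - a \<otimes>\<^bsub>FA\<^esub> b"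
      by (simp add: FA_distrib_minus)
    finally show "co (x \<otimes>\<^bsub>FA\<^esub> y) = co (a \<otimes>\<^bsub>FA\<^esub> b)" by (simp add: co_eq_iff)
  qed
  also have "\<dots> = co (a \<otimes>\<^bsub>FA\<^esub> b)"
  proof -
    have "a \<in> co a" "b \<in> co b" using LI_zero by (simp_all add: co_mem_iff)
    then show ?thesis by blast
  qed
  finally show ?thesis .
qed

lemma closed_LA: "closed_algebra LA"
  unfolding closed_algebra_def LA_carrier using FA_add FA_scale FA_mult
  by (auto simp: co_add co_scale co_mult)

text \<open>For an arrow or ghost x with target t the relations give x t = x. If v differs from t,
  then x v is congruent to x t v, and t v is in the ideal.\<close>

lemma vertex_end_LI:
  assumes x: "x \<in> gens G" and v: "v \<in> verts G"
  shows "basis_elem [x, Vertex v] - (if v = gen_target G x then basis_elem [x] else 0) \<in> LI"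
proof (cases "x \<in> Vertex ` verts G")
  case True
  then obtain u where u: "x = Vertex u" "u \<in> verts G" by blast
  have "basis_elem [Vertex u, Vertex v] - (if u = v then basis_elem [Vertex u] else 0) \<in> leavitt_relations G"
    unfolding leavitt_relations_def using u v by blast
  then show ?thesis using u LI_rel by (auto simp: eq_commute)
next
  case False
  with x have xe: "x \<in> Arrow ` arcs G \<union> Ghost ` arcs G" by (auto simp: gens_def)
  let ?t = "gen_target G x"
  have t: "?t \<in> verts G" using gen_source_gens[OF xe] by simp
  have r: "basis_elem [x, Vertex ?t] - basis_elem [x] \<in> LI"
    by (rule LI_rel) (use xe in \<open>unfold leavitt_relations_def, blast\<close>)
  show ?thesis
  proof (cases "v = ?t")
    case False
    have "basis_elem [Vertex ?t, Vertex v] - (if ?t = v then basis_elem [Vertex ?t] else 0) \<in> leavitt_relations G"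
      unfolding leavitt_relations_def using t v by blast
    then have "basis_elem [Vertex ?t, Vertex v] \<in> LI" using False LI_rel by force
    moreover have c: "basis_elem [x] \<in> carrier FA" "basis_elem [Vertex v] \<in> carrier FA"
      using x v by (simp_all add: words_Cons)
    ultimately have "basis_elem [x] \<otimes>\<^bsub>FA\<^esub> basis_elem [Vertex ?t, Vertex v] -
      (basis_elem [x, Vertex ?t] - basis_elem [x]) \<otimes>\<^bsub>FA\<^esub> basis_elem [Vertex v] \<in> LI"
      by (intro LI_minus[OF LI_mult_left[OF c(1)] LI_mult_right[OF c(2) r]])
    then show ?thesis using False by (simp add: FA_mult_basis FA_distrib_minus)
  qed (use r in simp)
qed

definition eps :: "'v set \<Rightarrow> ('v, 'e) gen list \<Rightarrow>\<^sub>0 'k" where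
  "eps F = (\<Sum>v \<in> F. basis_elem [Vertex v])"

lemma eps_FA: "F \<subseteq> verts G \<Longrightarrow> eps F \<in> carrier FA"
  unfolding eps_def by (intro sum_FA FA_basis) (auto simp: words_Cons)

lemma LI_sum: "(\<And>i. i \<in> F \<Longrightarrow> f i \<in> LI) \<Longrightarrow> sum f F \<in> LI"
  by (induction F rule: infinite_finite_induct) (simp_all add: LI_zero LI_add)

text \<open>Among the products of the last letter with the vertices in F only the one with its
  target survives.\<close>

lemma word_eps_LI:
  assumes w: "w \<in> words" and F: "finite F" "F \<subseteq> verts G" "gen_target G (last w) \<in> F"
  shows "Poly_Mapping.single w c \<otimes>\<^bsub>FA\<^esub> eps F - Poly_Mapping.single w c \<in> LI"
proof -
  obtain u x where u: "w = u @ [x]" using w by (cases w rule: rev_cases) auto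
  have x: "x \<in> gens G" and uw: "u = [] \<or> u \<in> words" using w by (auto simp: u words_def)
  let ?t = "gen_target G x"
  let ?f = "\<lambda>v. Poly_Mapping.single (u @ [x, Vertex v]) c - (if v = ?t then Poly_Mapping.single (u @ [x]) c else 0)"
  have 1: "?f v \<in> LI" if v: "v \<in> verts G" for v
  \<comment> \<open>The free algebra has no empty word, so an empty prefix u cannot be split off as
    a left factor.\<close>
  proof (cases "u = []")
    case True
    then have "?f v = Poly_Mapping.map ((*) c) (basis_elem [x, Vertex v] - (if v = ?t then basis_elem [x] else 0))"
      by (cases "v = ?t") (simp_all add: FA_minus_eq scale_add scale_single)
    then show ?thesis using LI_scale[OF vertex_end_LI[OF x v]] by simp
  next
    case False
    with uw have b: "u \<in> words" by simp
    have "?f v = Poly_Mapping.single u c \<otimes>\<^bsub>FA\<^esub> (basis_elem [x, Vertex v] - (if v = ?t then basis_elem [x] else 0))"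
      by (cases "v = ?t") (simp_all add: FA_distrib_minus FA_mult_basis FA_distrib)
    then show ?thesis using LI_mult_left[OF FA_basis[OF b] vertex_end_LI[OF x v]] by simp
  qed
  have "sum ?f F \<in> LI" by (rule LI_sum, rule 1) (use F in blast)
  also have "sum ?f F = Poly_Mapping.single w c \<otimes>\<^bsub>FA\<^esub> eps F - Poly_Mapping.single w c"
    using F(1,3) by (simp add: u sum_subtractf eps_def FA_mult_sum_right FA_mult_basis)
  finally show ?thesis .
qed

lemma FA_eps_LI:
  assumes a: "a \<in> carrier FA" and F: "finite F" "F \<subseteq> verts G" "(\<lambda>w. gen_target G (last w)) ` Poly_Mapping.keys a \<subseteq> F"
  shows "a \<otimes>\<^bsub>FA\<^esub> eps F - a \<in> LI"
proof -
  have "Poly_Mapping.keys a \<subseteq> {w \<in> words. gen_target G (last w) \<in> F}"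
    using a F(3) by (auto simp: FA_carrier)
  then show ?thesis
  proof (induction rule: poly_mapping_basis_induct)
    case (single w c)
    then show ?case using word_eps_LI[OF _ F(1,2)] by blast
  next
    case (add x y)
    have "(x + y) \<otimes>\<^bsub>FA\<^esub> eps F - (x + y) = (x \<otimes>\<^bsub>FA\<^esub> eps F - x) + (y \<otimes>\<^bsub>FA\<^esub> eps F - y)"
      by (simp add: FA_distrib)
    then show ?case using LI_add[OF add(3,4)] by (simp only:)
  qed (simp add: FA_distrib LI_zero)
qed

lemma gen_target_verts: "x \<in> gens G \<Longrightarrow> gen_target G x \<in> verts G"
  by (auto simp: gens_def)

text \<open>The unit property is claimed for all larger vertex sets so that two elements can share
  one unit.\<close>

lemma LA_local_eps:
  assumes "a \<in> carrier FA"
  obtains F where "finite F" "F \<subseteq> verts G"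
    "\<And>F'. finite F' \<Longrightarrow> F \<subseteq> F' \<Longrightarrow> F' \<subseteq> verts G \<Longrightarrow> co a \<otimes>\<^bsub>LA\<^esub> co (eps F') = co a"
proof
  let ?F = "(\<lambda>w. gen_target G (last w)) ` Poly_Mapping.keys a"
  show "finite ?F" by simp
  show "?F \<subseteq> verts G"
  proof
    fix v assume "v \<in> ?F"
    then obtain w where w: "w \<in> words" "v = gen_target G (last w)" using assms by (auto simp: FA_carrier)
    then have "last w \<in> gens G" by (auto simp: words_def)
    with w show "v \<in> verts G" by (simp add: gen_target_verts)
  qed
  show "co a \<otimes>\<^bsub>LA\<^esub> co (eps F') = co a" if "finite F'" "?F \<subseteq> F'" "F' \<subseteq> verts G" for F'
    using FA_eps_LI[OF assms that(1,3,2)] by (simp add: co_mult assms eps_FA that co_eq_iff)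
qed

sublocale L: local_unit_algebra LA
proof
  show "closed_algebra LA" by (rule closed_LA)
  show "carrier LA \<noteq> {}" unfolding LA_carrier using FA_zero by blast
  fix U V assume "U \<in> carrier LA" "V \<in> carrier LA"
  then obtain a b where ab: "a \<in> carrier FA" "b \<in> carrier FA" "U = co a" "V = co b" by (auto simp: LA_carrier)
  from LA_local_eps[OF ab(1)] obtain F where F: "finite F" "F \<subseteq> verts G"
    "\<And>F'. finite F' \<Longrightarrow> F \<subseteq> F' \<Longrightarrow> F' \<subseteq> verts G \<Longrightarrow> co a \<otimes>\<^bsub>LA\<^esub> co (eps F') = co a" by metis
  from LA_local_eps[OF ab(2)] obtain F2 where F2: "finite F2" "F2 \<subseteq> verts G"
    "\<And>F'. finite F' \<Longrightarrow> F2 \<subseteq> F' \<Longrightarrow> F' \<subseteq> verts G \<Longrightarrow> co b \<otimes>\<^bsub>LA\<^esub> co (eps F') = co b" by metis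
  have "U \<otimes>\<^bsub>LA\<^esub> co (eps (F \<union> F2)) = U" "V \<otimes>\<^bsub>LA\<^esub> co (eps (F \<union> F2)) = V"
    unfolding ab by (rule F(3) F2(3); use F F2 in simp)+
  moreover have "co (eps (F \<union> F2)) \<in> carrier LA" using F F2 by (simp add: eps_FA)
  ultimately show "\<exists>e\<in>carrier LA. U \<otimes>\<^bsub>LA\<^esub> e = U \<and> V \<otimes>\<^bsub>LA\<^esub> e = V" by blast
qed

text \<open>A module over the Leavitt path algebra is the same as a module over the free algebra that is
  annihilated by the defining relations.\<close>

definition free_module :: "('k, ('v, 'e, 'k) leavitt_elem, 'm) rmodule \<Rightarrow> ('k, ('v, 'e) gen list \<Rightarrow>\<^sub>0 'k, 'm) rmodule" where
  "free_module N = with_act N (\<lambda>m a. act N m (co a))"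

lemma right_module_free_module:
  assumes "right_module LA N" shows "right_module FA (free_module N)"
proof -
  interpret right_module LA N by fact
  show ?thesis unfolding free_module_def
    by (rule right_module_with_act[OF assms])
      (simp_all add: act_closed act_add_left act_add_right act_smult_left act_smult_right act_mult
        flip: co_add co_scale co_mult)
qed

lemma act_LI:
  assumes "right_module LA N" "m \<in> carrier N" "r \<in> LI"
  shows "act N m (co r) = \<zero>\<^bsub>N\<^esub>"
proof -
  have "co r = co 0" using assms(3) by (simp add: co_eq_iff)
  then show ?thesis
    using act_zero_right[OF right_module_free_module[OF assms(1), unfolded FA_def], of m] assms(2)
    by (simp add: free_module_def)
qed

text \<open>Converse of \<open>free_module\<close>: a coset acts through a chosen representative,
  which is legitimate once the ideal acts as 0.\<close>

definition leavitt_module :: "('k, ('v, 'e) gen list \<Rightarrow>\<^sub>0 'k, 'm) rmodule \<Rightarrow> ('k, ('v, 'e, 'k) leavitt_elem, 'm) rmodule" where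
  "leavitt_module N = with_act N (\<lambda>m U. act N m (SOME a. a \<in> U))"

context
  fixes N :: "('k, ('v, 'e) gen list \<Rightarrow>\<^sub>0 'k, 'm) rmodule"
  assumes N: "right_module FA N"
    and rel: "\<And>m r. \<lbrakk>m \<in> carrier N; r \<in> leavitt_relations G\<rbrakk> \<Longrightarrow> act N m r = \<zero>\<^bsub>N\<^esub>"
begin

interpretation N: right_module FA N by (fact N)

text \<open>The element m stays arbitrary in the induction: for a product a x the hypothesis on x is
  applied to m a.\<close>

lemma act_generated:
  assumes "r \<in> LI" "m \<in> carrier N" shows "act N m r = \<zero>\<^bsub>N\<^esub>"
  using assms(1)[unfolded LI_def] assms(2)
proof (induction arbitrary: m rule: generated_ideal.induct)
  case zero
  then show ?case using act_zero_right[OF N[unfolded FA_def]] by simp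
next
  case (add x y)
  then show ?case using N.act_add_right[of m x y] LI_FA by (simp add: LI_def)
next
  case (smult x c)
  then show ?case using N.act_smult_right[of m x c] LI_FA by (simp add: LI_def)
next
  case (mult_left a x)
  then show ?case using N.act_mult[of m a x] N.act_closed[of m a] LI_FA by (simp add: LI_def)
next
  case (mult_right a x)
  then show ?case using N.act_mult[of m x a] LI_FA by (simp add: LI_def)
qed (rule rel)

lemma act_leavitt_module:
  assumes "m \<in> carrier N" "a \<in> carrier FA"
  shows "act (leavitt_module N) m (co a) = act N m a"
proof -
  let ?b = "SOME b. b \<in> co a"
  have "a \<in> co a" using LI_zero by (simp add: co_mem_iff)
  then have "?b \<in> co a" by (rule someI)
  then have i: "?b - a \<in> LI" by (simp add: co_mem_iff)
  have "act N m (a + (?b - a)) = act N m a \<oplus>\<^bsub>N\<^esub> act N m (?b - a)"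
    using N.act_add_right[OF assms LI_FA[OF i]] by simp
  then show ?thesis
    using act_generated[OF i assms(1)] N.act_closed[OF assms] by (simp add: leavitt_module_def)
qed

lemma right_module_leavitt_module: "right_module LA (leavitt_module N)"
proof -
  note [simp] = act_leavitt_module[unfolded leavitt_module_def with_act_simps]
  show ?thesis unfolding leavitt_module_def
    by (rule right_module_with_act[OF N])
      (auto simp: LA_carrier co_add co_scale co_mult N.act_closed N.act_add_left N.act_add_right[simplified]
        N.act_smult_left N.act_smult_right[simplified] N.act_mult)
qed

end

end

context row_finite_digraph
begin

section \<open>Generators acting on a Leavitt module, and its restriction to the path
  algebra\<close>

definition gact :: "('k, ('v, 'e, 'k) leavitt_elem, 'm) rmodule \<Rightarrow> 'm \<Rightarrow> ('v, 'e) gen \<Rightarrow> 'm" where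
  "gact N m g = act N m (co (basis_elem [g]))"

text \<open>The leading vertex keeps the word of a trivial path nonempty, and it lets a path q act
  as 0 on m p when p does not end where q starts.\<close>

fun path_word :: "'v \<times> 'e list \<Rightarrow> ('v, 'e) gen list" where
  "path_word (u, es) = Vertex u # map Arrow es"

text \<open>Restriction of scalars along the map from the path algebra to the Leavitt path algebra,
  carried out directly on modules: each path acts through its word.\<close>

definition restr :: "('k, ('v, 'e, 'k) leavitt_elem, 'm) rmodule \<Rightarrow> ('k, ('v, 'e, 'k) path_algebra_elem, 'm) rmodule" where
  "restr N = with_act N (lin_ext N (\<lambda>p m. foldl (gact N) m (path_word p)))"

lemma restr_simps [simp]:
  "carrier (restr N) = carrier N" "\<zero>\<^bsub>restr N\<^esub> = \<zero>\<^bsub>N\<^esub>" "add (restr N) = add N"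
  "module.smult (restr N) = module.smult N"
  by (simp_all add: restr_def)

lemma gen_LA: "g \<in> gens G \<Longrightarrow> co (basis_elem [g]) \<in> carrier LA"
  by (simp add: words_Cons)

lemma path_word_gens:
  assumes "p \<in> paths G"
  shows "set (path_word p) \<subseteq> gens G"
proof -
  have "(u, es) \<in> paths G \<Longrightarrow> set es \<subseteq> arcs G" for u es
    by (induction es arbitrary: u) auto
  with assms path_start_verts show ?thesis by (cases p) fastforce
qed

context
  fixes N :: "('k, ('v, 'e, 'k) leavitt_elem, 'm) rmodule"
  assumes N: "right_module LA N"
begin

interpretation N: right_module LA N by (fact N)

lemma gact_closed [simp]: "m \<in> carrier N \<Longrightarrow> g \<in> gens G \<Longrightarrow> gact N m g \<in> carrier N"
  unfolding gact_def by (rule N.act_closed[OF _ gen_LA])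

lemma gact_add: "\<lbrakk>m \<in> carrier N; n \<in> carrier N; g \<in> gens G\<rbrakk> \<Longrightarrow> gact N (m \<oplus>\<^bsub>N\<^esub> n) g = gact N m g \<oplus>\<^bsub>N\<^esub> gact N n g"
  unfolding gact_def by (rule N.act_add_left[OF _ _ gen_LA])

lemma gact_smult: "\<lbrakk>m \<in> carrier N; g \<in> gens G\<rbrakk> \<Longrightarrow> gact N (c \<odot>\<^bsub>N\<^esub> m) g = c \<odot>\<^bsub>N\<^esub> gact N m g"
  unfolding gact_def by (rule N.act_smult_left[OF _ gen_LA])

lemma gact_zero [simp]: "g \<in> gens G \<Longrightarrow> gact N \<zero>\<^bsub>N\<^esub> g = \<zero>\<^bsub>N\<^esub>"
  unfolding gact_def by (rule N.act_zero[OF gen_LA])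

lemma act_word:
  assumes "w \<in> words" "m \<in> carrier N"
  shows "act N m (co (basis_elem w)) = foldl (gact N) m w"
  using assms
proof (induction w arbitrary: m)
  case (Cons g w)
  show ?case
  proof (cases "w = []")
    case False
    with Cons.prems have g: "g \<in> gens G" and w: "w \<in> words" by (simp_all add: words_Cons)
    have gw: "[g] \<in> words" using g by (simp add: words_Cons)
    have "co (basis_elem (g # w)) = co (basis_elem [g]) \<otimes>\<^bsub>LA\<^esub> co (basis_elem w)"
      using gw w by (simp add: co_mult FA_mult_basis)
    then have "act N m (co (basis_elem (g # w))) = act N (gact N m g) (co (basis_elem w))"
      using N.act_mult[OF Cons.prems(2) gen_LA[OF g], of "co (basis_elem w)"] w by (simp add: gact_def)
    then show ?thesis using Cons.IH[OF w gact_closed[OF Cons.prems(2) g]] by simp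
  qed (simp add: gact_def)
qed simp

lemma gact_gact: "\<lbrakk>m \<in> carrier N; g \<in> gens G; h \<in> gens G\<rbrakk> \<Longrightarrow> gact N (gact N m g) h = act N m (co (basis_elem [g, h]))"
  using act_word[of "[g, h]" m] by (simp add: words_Cons)

lemma act_co_eq: "r \<in> leavitt_relations G \<Longrightarrow> r = a - b \<Longrightarrow> act N m (co a) = act N m (co b)"
  using LI_rel co_eq_iff by metis

lemma act_co_zero: "m \<in> carrier N \<Longrightarrow> act N m (co 0) = \<zero>\<^bsub>N\<^esub>"
  by (rule act_LI[OF N _ LI_zero])

lemma gact_vertex_vertex:
  assumes m: "m \<in> carrier N" and vw: "v \<in> verts G" "w \<in> verts G"
  shows "gact N (gact N m (Vertex v)) (Vertex w) = (if v = w then gact N m (Vertex v) else \<zero>\<^bsub>N\<^esub>)"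
proof -
  have "act N m (co (basis_elem [Vertex v, Vertex w])) = act N m (co (if v = w then basis_elem [Vertex v] else 0))"
    by (rule act_co_eq[OF _ refl]) (use vw in \<open>unfold leavitt_relations_def, blast\<close>)
  with m vw show ?thesis by (simp add: gact_gact act_co_zero gact_def[symmetric] split: if_splits)
qed

lemma gact_source:
  assumes m: "m \<in> carrier N" and x: "x \<in> Arrow ` arcs G \<union> Ghost ` arcs G"
  shows "gact N (gact N m (Vertex (gen_source G x))) x = gact N m x"
proof -
  have "act N m (co (basis_elem [Vertex (gen_source G x), x])) = act N m (co (basis_elem [x]))"
    by (rule act_co_eq[OF _ refl]) (use x in \<open>unfold leavitt_relations_def, blast\<close>)
  with m gen_source_gens[OF x] show ?thesis by (simp add: gact_gact gact_def[symmetric])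
qed

lemma gact_target:
  assumes m: "m \<in> carrier N" and x: "x \<in> gens G" and v: "v \<in> verts G"
  shows "gact N (gact N m x) (Vertex v) = (if v = gen_target G x then gact N m x else \<zero>\<^bsub>N\<^esub>)"
proof -
  have "co (basis_elem [x, Vertex v]) = co (if v = gen_target G x then basis_elem [x] else 0)"
    unfolding co_eq_iff by (rule vertex_end_LI[OF x v])
  with m x v show ?thesis by (simp add: gact_gact act_co_zero gact_def[symmetric] split: if_splits)
qed

lemma gact_ghost_arrow:
  assumes m: "m \<in> carrier N" and e: "e \<in> arcs G" "f \<in> arcs G"
  shows "gact N (gact N m (Ghost e)) (Arrow f) = (if e = f then gact N m (Vertex (head G e)) else \<zero>\<^bsub>N\<^esub>)"
proof -
  have "act N m (co (basis_elem [Ghost e, Arrow f])) = act N m (co (if e = f then basis_elem [Vertex (head G e)] else 0))"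
    by (rule act_co_eq[OF _ refl]) (use e in \<open>unfold leavitt_relations_def, blast\<close>)
  with m e show ?thesis by (simp add: gact_gact act_co_zero gact_def[symmetric] split: if_splits)
qed

text \<open>The relation at the non-sink v writes m v as the sum of the elements (m e) e* over the
  arcs e leaving v. It is stated as a membership to avoid the sum in N.\<close>

lemma gact_cuntz_krieger:
  assumes m: "m \<in> carrier N" and v: "v \<in> verts G" "\<not> is_sink G v"
    and Q: "\<zero>\<^bsub>N\<^esub> \<in> Q" "\<And>u v. u \<in> Q \<Longrightarrow> v \<in> Q \<Longrightarrow> u \<oplus>\<^bsub>N\<^esub> v \<in> Q" "\<And>c u. u \<in> Q \<Longrightarrow> c \<odot>\<^bsub>N\<^esub> u \<in> Q"
    and e: "\<And>e. e \<in> out_arcs G v \<Longrightarrow> gact N (gact N m (Arrow e)) (Ghost e) \<in> Q"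
  shows "gact N m (Vertex v) \<in> Q"
proof -
  let ?x = "(\<Sum>e \<in> out_arcs G v. basis_elem [Arrow e, Ghost e]) :: ('v, 'e) gen list \<Rightarrow>\<^sub>0 'k"
  have k: "Poly_Mapping.keys ?x \<subseteq> (\<lambda>e. [Arrow e, Ghost e]) ` out_arcs G v"
    by (rule keys_sum_subset) simp
  have w: "(\<lambda>e. [Arrow e, Ghost e]) ` out_arcs G v \<subseteq> words" by (auto simp: words_Cons)
  have "gact N m (Vertex v) = act N m (co ?x)"
    unfolding gact_def by (rule act_co_eq[OF _ refl]) (use v in \<open>unfold leavitt_relations_def, blast\<close>)
  also have "\<dots> = act (free_module N) m ?x" by (simp add: free_module_def)
  also have "\<dots> \<in> Q"
  proof (rule act_basis_mem[OF right_module_free_module[OF N, unfolded FA_def]])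
    show "Poly_Mapping.keys ?x \<subseteq> words" using k w by (rule subset_trans)
    fix p assume "p \<in> Poly_Mapping.keys ?x"
    with k obtain f where f: "f \<in> out_arcs G v" "p = [Arrow f, Ghost f]" by blast
    then have "act (free_module N) m (basis_elem p) = gact N (gact N m (Arrow f)) (Ghost f)"
      using m by (simp add: free_module_def gact_gact)
    with e[OF f(1)] show "act (free_module N) m (basis_elem p) \<in> Q" by simp
  qed (use m Q in \<open>simp_all add: free_module_def\<close>)
  finally show ?thesis .
qed

lemma wact_closed: "m \<in> carrier N \<Longrightarrow> set w \<subseteq> gens G \<Longrightarrow> foldl (gact N) m w \<in> carrier N"
  by (induction w arbitrary: m) simp_all

lemma wact_add: "\<lbrakk>m \<in> carrier N; n \<in> carrier N; set w \<subseteq> gens G\<rbrakk>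
  \<Longrightarrow> foldl (gact N) (m \<oplus>\<^bsub>N\<^esub> n) w = foldl (gact N) m w \<oplus>\<^bsub>N\<^esub> foldl (gact N) n w"
  by (induction w arbitrary: m n) (simp_all add: gact_add)

lemma wact_smult: "\<lbrakk>m \<in> carrier N; set w \<subseteq> gens G\<rbrakk> \<Longrightarrow> foldl (gact N) (c \<odot>\<^bsub>N\<^esub> m) w = c \<odot>\<^bsub>N\<^esub> foldl (gact N) m w"
  by (induction w arbitrary: m) (simp_all add: gact_smult)

lemma wact_zero: "set w \<subseteq> gens G \<Longrightarrow> foldl (gact N) \<zero>\<^bsub>N\<^esub> w = \<zero>\<^bsub>N\<^esub>"
  by (induction w) simp_all

text \<open>Since m e = (m e) h for the head h of e, the leading vertex of the remaining path may be
  inserted. This makes induction along a path possible.\<close>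

lemma wact_path_Cons:
  assumes m: "m \<in> carrier N" and p: "(u, e # es) \<in> paths G"
  shows "foldl (gact N) m (path_word (u, e # es)) = foldl (gact N) (gact N m (Arrow e)) (path_word (head G e, es))"
proof -
  from p have e: "e \<in> arcs G" "u = tail G e" by simp_all
  have 1: "gact N (gact N m (Vertex (tail G e))) (Arrow e) = gact N m (Arrow e)"
    using gact_source[OF m, of "Arrow e"] e by simp
  have 2: "gact N (gact N m (Arrow e)) (Vertex (head G e)) = gact N m (Arrow e)"
    using gact_target[OF m, of "Arrow e" "head G e"] e by simp
  show ?thesis by (simp add: e(2) 1 2)
qed

lemma wact_path_end:
  assumes "m \<in> carrier N" "p \<in> paths G" "w \<in> verts G"
  shows "gact N (foldl (gact N) m (path_word p)) (Vertex w) =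
    (if w = path_end G p then foldl (gact N) m (path_word p) else \<zero>\<^bsub>N\<^esub>)"
proof -
  have "m \<in> carrier N \<Longrightarrow> (u, es) \<in> paths G \<Longrightarrow>
    gact N (foldl (gact N) m (path_word (u, es))) (Vertex w) =
    (if w = path_end G (u, es) then foldl (gact N) m (path_word (u, es)) else \<zero>\<^bsub>N\<^esub>)" for u es
  proof (induction es arbitrary: u m)
    case Nil
    then show ?case using gact_vertex_vertex[of m u w] assms(3) by auto
  next
    case (Cons e es)
    from Cons.prems(2) have e: "e \<in> arcs G" "(head G e, es) \<in> paths G" by simp_all
    from Cons.IH[OF gact_closed[OF Cons.prems(1)] e(2), of "Arrow e"] e(1)
    show ?case unfolding wact_path_Cons[OF Cons.prems] path_end_Cons by simp
  qed
  with assms show ?thesis by (cases p) blast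
qed

lemma wact_concat:
  assumes m: "m \<in> carrier N" and p: "p \<in> paths G" and q: "q \<in> paths G"
  shows "foldl (gact N) (foldl (gact N) m (path_word p)) (path_word q) =
    (case path_concat G p q of None \<Rightarrow> \<zero>\<^bsub>N\<^esub> | Some r \<Rightarrow> foldl (gact N) m (path_word r))"
proof -
  obtain u es w fs where pq: "p = (u, es)" "q = (w, fs)" by (cases p, cases q)
  have w: "w \<in> verts G" using q pq path_start_verts by blast
  have fs: "set (map Arrow fs) \<subseteq> gens G" using path_word_gens[OF q] pq by simp
  show ?thesis
    using wact_path_end[OF m p w] wact_zero[OF fs] by (simp add: pq path_concat_def)
qed

lemma right_module_restr: "right_module PA (restr N)"
  unfolding restr_def path_algebra_def
  by (rule right_module_lin_ext[OF N])
    (simp_all only: wact_closed path_word_gens wact_add wact_smult paths_basis_closed wact_concat)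

lemma pact_restr: "p \<in> paths G \<Longrightarrow> m \<in> carrier N \<Longrightarrow> pact (restr N) m p = foldl (gact N) m (path_word p)"
proof -
  assume p: "p \<in> paths G" and m: "m \<in> carrier N"
  have "lin_ext N (\<lambda>p m. foldl (gact N) m (path_word p)) m (basis_elem p) = 1 \<odot>\<^bsub>N\<^esub> foldl (gact N) m (path_word p)"
    by (rule lin_ext_single[OF N, where B = "paths G"])
      (simp_all only: wact_closed path_word_gens wact_add wact_smult p m)
  with wact_closed[OF m path_word_gens[OF p]] show ?thesis by (simp add: restr_def)
qed

lemma pact_restr_Nil: "u \<in> verts G \<Longrightarrow> m \<in> carrier N \<Longrightarrow> pact (restr N) m (u, []) = gact N m (Vertex u)"
  by (simp add: pact_restr)

lemma pact_restr_arc: "e \<in> arcs G \<Longrightarrow> m \<in> carrier N \<Longrightarrow> pact (restr N) m (tail G e, [e]) = gact N m (Arrow e)"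
  using gact_source[of m "Arrow e"] by (simp add: pact_restr)

lemma pact_restr_Cons:
  assumes "m \<in> carrier N" "(u, e # es) \<in> paths G"
  shows "pact (restr N) m (u, e # es) = pact (restr N) (gact N m (Arrow e)) (head G e, es)"
  using wact_path_Cons[OF assms] assms
  by (simp only: pact_restr paths_Cons gact_closed gens_simps)

lemma pact_restr_snoc:
  assumes "m \<in> carrier N" "(u, es @ [e]) \<in> paths G"
  shows "pact (restr N) m (u, es @ [e]) = gact N (pact (restr N) m (u, es)) (Arrow e)"
proof -
  have "(u, es) \<in> paths G" using assms(2) paths_append by blast
  then show ?thesis using pact_restr[OF assms(2,1)] pact_restr[of "(u, es)" m] assms(1) by simp
qed

text \<open>From e* e = head of e, and e* f = 0 for f different from e. A ghost thus shifts levels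
  by one: on paths with a first arc, the values of m e* on level n + 1 are values of m on level n,
  or 0.\<close>

lemma pact_ghost_Cons:
  assumes m: "m \<in> carrier N" and e: "e \<in> arcs G" and p: "(u, f # fs) \<in> paths G"
  shows "pact (restr N) (gact N m (Ghost e)) (u, f # fs) = (if e = f then pact (restr N) m (head G e, fs) else \<zero>\<^bsub>N\<^esub>)"
proof -
  from p have f: "f \<in> arcs G" "u = tail G f" and q: "(head G f, fs) \<in> paths G" by simp_all
  note fs = path_word_gens[OF q]
  have "pact (restr N) (gact N m (Ghost e)) (u, f # fs) =
      pact (restr N) (gact N (gact N m (Ghost e)) (Arrow f)) (head G f, fs)"
    by (rule pact_restr_Cons[OF _ p]) (use m e in simp)
  also have "\<dots> = (if e = f then pact (restr N) m (head G e, fs) else \<zero>\<^bsub>N\<^esub>)"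
  proof (cases "e = f")
    case True
    have "gact N (gact N m (Vertex (head G f))) (Vertex (head G f)) = gact N m (Vertex (head G f))"
      using gact_vertex_vertex[OF m] f by simp
    then show ?thesis using True q m f e by (simp add: gact_ghost_arrow pact_restr)
  next
    case False
    then show ?thesis using q m f e wact_zero[OF fs] by (simp add: gact_ghost_arrow pact_restr del: path_word.simps)
  qed
  finally show ?thesis .
qed

text \<open>This covers the members of the positive levels that have no first arc: they sit at
  sinks, and a sink is not the tail of e.\<close>

lemma pact_ghost_Nil:
  assumes m: "m \<in> carrier N" and e: "e \<in> arcs G" and u: "is_sink G u"
  shows "pact (restr N) (gact N m (Ghost e)) (u, []) = \<zero>\<^bsub>N\<^esub>"
proof -
  from u e have "u \<in> verts G" "u \<noteq> tail G e" by (auto simp: is_sink_def)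
  then show ?thesis using m e gact_target[OF m, of "Ghost e" u] by (simp add: pact_restr)
qed

lemma LA_eps_exists:
  assumes UM: "L.UM N" and m: "m \<in> carrier N"
  obtains F where "finite F" "F \<subseteq> verts G" "act N m (co (eps F)) = m"
proof -
  obtain U where "U \<in> carrier LA" "act N m U = m" using UM[unfolded L.UM_iff] m by blast
  then obtain a where a: "a \<in> carrier FA" "act N m (co a) = m" by (auto simp: LA_carrier)
  from LA_local_eps[OF a(1)] obtain F where F: "finite F" "F \<subseteq> verts G"
    and "\<And>F'. finite F' \<Longrightarrow> F \<subseteq> F' \<Longrightarrow> F' \<subseteq> verts G \<Longrightarrow> co a \<otimes>\<^bsub>LA\<^esub> co (eps F') = co a" by metis
  then have "co a \<otimes>\<^bsub>LA\<^esub> co (eps F) = co a" by blast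
  then have "act N m (co (eps F)) = m"
    using N.act_mult[OF m co_LA[OF a(1)] co_LA[OF eps_FA[OF F(2)]]] a(2) by simp
  with F that show thesis by blast
qed

text \<open>The local units of both algebras are sums of the same vertices, so unitality passes to
  the restriction.\<close>

lemma act_eps_restr:
  assumes F: "finite F" "F \<subseteq> verts G" and m: "m \<in> carrier N"
  shows "act N m (co (eps F)) = act (restr N) m (vertex_sum F)"
proof -
  interpret R: right_module PA "restr N" by (rule right_module_restr)
  show ?thesis using F
  proof (induction F rule: finite_induct)
    case empty
    have "act (restr N) m 0 = \<zero>\<^bsub>N\<^esub>"
      using act_zero_right[OF right_module_restr[unfolded path_algebra_def]] m by simp
    then show ?case using m by (simp add: eps_def vertex_sum_def act_co_zero)
  next
    case (insert v F)
    then have F: "F \<subseteq> verts G" and v: "v \<in> verts G" by simp_all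
    have 1: "basis_elem [Vertex v] \<in> carrier FA" using v by (simp add: words_Cons)
    have 2: "(v, []) \<in> paths G" using v by simp
    have 3: "basis_elem (v, []) + vertex_sum F = basis_elem (v, []) \<oplus>\<^bsub>PA\<^esub> vertex_sum F"
      by (simp add: path_algebra_def)
    have "act N m (co (eps (insert v F))) = act N m (co (basis_elem [Vertex v])) \<oplus>\<^bsub>N\<^esub> act N m (co (eps F))"
      using insert(1,2) N.act_add_right[OF m co_LA[OF 1] co_LA[OF eps_FA[OF F]]] by (simp add: eps_def co_add)
    also have "\<dots> = pact (restr N) m (v, []) \<oplus>\<^bsub>N\<^esub> act (restr N) m (vertex_sum F)"
      using insert.IH[OF F] pact_restr_Nil[OF v m] by (simp add: gact_def)
    also have "\<dots> = act (restr N) m (vertex_sum (insert v F))"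
      using insert(1,2) R.act_add_right[OF _ basis_PA[OF 2] vertex_sum_PA[OF F], of m] m 3
      by (simp add: vertex_sum_def)
    finally show ?case .
  qed
qed

lemma UM_restr:
  assumes "L.UM N" shows "P.UM (restr N)"
  unfolding P.UM_iff
proof (intro conjI ballI)
  show "right_module PA (restr N)" by (rule right_module_restr)
  fix m assume "m \<in> carrier (restr N)"
  then have m: "m \<in> carrier N" by simp
  from LA_eps_exists[OF assms m] obtain F where F: "finite F" "F \<subseteq> verts G" "act N m (co (eps F)) = m" .
  then have "act (restr N) m (vertex_sum F) = m" using act_eps_restr[OF F(1,2) m] by simp
  then show "\<exists>a\<in>carrier PA. act (restr N) m a = m" by (rule bexI) (rule vertex_sum_PA[OF F(2)])
qed

text \<open>The converse of the decomposition \<open>y = \<Sum>p \<in> E\<^sub>n. (y p) p\<^sup>*\<close>, avoiding the sum.\<close>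

lemma ghost_closed_mem:
  assumes UM: "L.UM N" and y: "y \<in> carrier N"
    and Q: "\<zero>\<^bsub>N\<^esub> \<in> Q" "\<And>u v. u \<in> Q \<Longrightarrow> v \<in> Q \<Longrightarrow> u \<oplus>\<^bsub>N\<^esub> v \<in> Q" "\<And>c u. u \<in> Q \<Longrightarrow> c \<odot>\<^bsub>N\<^esub> u \<in> Q"
    and ghost: "\<And>u e. u \<in> Q \<Longrightarrow> e \<in> arcs G \<Longrightarrow> gact N u (Ghost e) \<in> Q"
    and lev: "\<And>p. p \<in> level_paths G n \<Longrightarrow> pact (restr N) y p \<in> Q"
  shows "y \<in> Q"
  using lev
proof (induction n)
  case 0
  have "pact (restr N) y (v, []) \<in> Q" if "v \<in> verts G" for v
    by (rule 0) (use that in \<open>simp add: level_paths_def\<close>)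
  then show ?case
    using UM_vertex_mem[OF UM_restr[OF UM], of y Q] y Q by simp
next
  case (Suc n)
  show ?case
  proof (rule Suc.IH)
    fix p assume p: "p \<in> level_paths G n"
    obtain u es where ues: "p = (u, es)" by (cases p)
    note pp = level_paths_paths[OF p]
    let ?w = "path_end G p" and ?z = "pact (restr N) y p"
    have w: "?w \<in> verts G" using pp ues path_end_verts by blast
    show "?z \<in> Q"
    proof (cases "is_sink G ?w")
      case True
      then have "p \<in> level_paths G (Suc n)" using p by (auto simp: level_paths_def)
      then show ?thesis by (rule Suc.prems)
    next
      \<comment> \<open>At a non-sink p has exactly n arcs, each p e lies in the next level, and y p
        is recovered from the elements (y p) e by applying ghosts.\<close>
      case False
      then have len: "length es = n" using p ues by (simp add: level_paths_def)
      have zc: "?z \<in> carrier N" using pact_closed[OF right_module_restr _ pp] y by simp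
      have zw: "gact N ?z (Vertex ?w) = ?z" using wact_path_end[OF y pp w] pact_restr[OF pp y] by simp
      have "gact N ?z (Vertex ?w) \<in> Q"
      proof (rule gact_cuntz_krieger[OF zc w False Q])
        fix e assume e: "e \<in> out_arcs G ?w"
        then have pe: "(u, es @ [e]) \<in> paths G" using pp ues by simp
        then have "(u, es @ [e]) \<in> level_paths G (Suc n)" using len by (simp add: level_paths_def)
        then have "pact (restr N) y (u, es @ [e]) \<in> Q" by (rule Suc.prems)
        then have "gact N ?z (Arrow e) \<in> Q" using pact_restr_snoc[OF y pe] ues by simp
        then show "gact N (gact N ?z (Arrow e)) (Ghost e) \<in> Q" using e by (intro ghost) simp_all
      qed
      with zw show ?thesis by simp
    qed
  qed
qed

text \<open>The case Q = {0} of \<open>ghost_closed_mem\<close>: an element annihilated by all of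
  \<open>E_n\<close> is rebuilt from zeros.\<close>

lemma restr_torsion_free:
  assumes UM: "L.UM N" and y: "y \<in> sat (restr N) {\<zero>\<^bsub>restr N\<^esub>}"
  shows "y = \<zero>\<^bsub>N\<^esub>"
proof (rule satE[OF y])
  fix n assume "y \<in> carrier (restr N)" and n: "\<And>p. p \<in> level_paths G n \<Longrightarrow> pact (restr N) y p \<in> {\<zero>\<^bsub>restr N\<^esub>}"
  then have y: "y \<in> carrier N" by simp
  have "y \<in> {\<zero>\<^bsub>N\<^esub>}"
  proof (rule ghost_closed_mem[OF UM y, where n = n])
    show "pact (restr N) y p \<in> {\<zero>\<^bsub>N\<^esub>}" if "p \<in> level_paths G n" for p using n[OF that] by simp
  qed simp_all
  then show ?thesis by simp
qed

end

text \<open>Words act by composing generators and span the free algebra, so commuting with the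
  generators suffices.\<close>

lemma rhom_LAI:
  assumes N: "right_module LA N" and N': "right_module LA N'"
    and f: "\<And>x. x \<in> carrier N \<Longrightarrow> f x \<in> carrier N'"
    and f_add: "\<And>x y. \<lbrakk>x \<in> carrier N; y \<in> carrier N\<rbrakk> \<Longrightarrow> f (x \<oplus>\<^bsub>N\<^esub> y) = f x \<oplus>\<^bsub>N'\<^esub> f y"
    and f_smult: "\<And>c x. x \<in> carrier N \<Longrightarrow> f (c \<odot>\<^bsub>N\<^esub> x) = c \<odot>\<^bsub>N'\<^esub> f x"
    and f_gact: "\<And>x g. \<lbrakk>x \<in> carrier N; g \<in> gens G\<rbrakk> \<Longrightarrow> f (gact N x g) = gact N' (f x) g"
  shows "rhom LA N N' f"
proof -
  have fw: "x \<in> carrier N \<Longrightarrow> set w \<subseteq> gens G \<Longrightarrow> f (foldl (gact N) x w) = foldl (gact N') (f x) w" for x w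
  proof (induction w arbitrary: x)
    case (Cons g w)
    from Cons.prems have g: "g \<in> gens G" and w: "set w \<subseteq> gens G" by simp_all
    from Cons.IH[OF gact_closed[OF N Cons.prems(1) g] w] show ?case
      by (simp only: foldl_Cons f_gact[OF Cons.prems(1) g])
  qed simp
  have "rhom FA (free_module N) (free_module N') f"
    unfolding FA_def
  proof (rule act_basis_hom[OF right_module_free_module[OF N, unfolded FA_def] right_module_free_module[OF N', unfolded FA_def]])
    fix x w assume x: "x \<in> carrier (free_module N)" and w: "w \<in> words"
    then have xc: "x \<in> carrier N" and wg: "set w \<subseteq> gens G" by (simp_all add: free_module_def words_def in_lists_conv_set subset_eq)
    show "f (act (free_module N) x (basis_elem w)) = act (free_module N') (f x) (basis_elem w)"
      unfolding free_module_def with_act_simps act_word[OF N w xc] act_word[OF N' w f[OF xc]]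
      by (rule fw[OF xc wg])
  next
    show "f \<in> carrier (free_module N) \<rightarrow> carrier (free_module N')" using f by (simp add: free_module_def)
  qed (simp_all only: free_module_def with_act_simps f_add f_smult)
  note h = rhom_act[OF this]
  show ?thesis
  proof (rule rhomI)
    fix x U assume x: "x \<in> carrier N" and "U \<in> carrier LA"
    then obtain a where a: "a \<in> carrier FA" "U = co a" by (auto simp: LA_carrier)
    from h[of x a] a x show "f (act N x U) = act N' (f x) U" by (simp add: free_module_def)
  next
    show "f x \<in> carrier N'" if "x \<in> carrier N" for x by (rule f[OF that])
    show "f (x \<oplus>\<^bsub>N\<^esub> y) = f x \<oplus>\<^bsub>N'\<^esub> f y" if "x \<in> carrier N" "y \<in> carrier N" for x y by (rule f_add[OF that])
    show "f (c \<odot>\<^bsub>N\<^esub> x) = c \<odot>\<^bsub>N'\<^esub> f x" if "x \<in> carrier N" for x c by (rule f_smult[OF that])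
  qed
qed

lemma rhom_gact: "rhom LA N N' f \<Longrightarrow> x \<in> carrier N \<Longrightarrow> g \<in> gens G \<Longrightarrow> f (gact N x g) = gact N' (f x) g"
  unfolding gact_def by (rule rhom_act) (assumption, assumption, rule gen_LA)

lemma rhom_restr:
  assumes N: "right_module LA N" and N': "right_module LA N'" and f: "rhom LA N N' f"
  shows "rhom PA (restr N) (restr N') f"
proof -
  have fw: "x \<in> carrier N \<Longrightarrow> set w \<subseteq> gens G \<Longrightarrow> f (foldl (gact N) x w) = foldl (gact N') (f x) w" for x w
  proof (induction w arbitrary: x)
    case (Cons g w)
    from Cons.prems have g: "g \<in> gens G" and w: "set w \<subseteq> gens G" by simp_all
    from Cons.IH[OF gact_closed[OF N Cons.prems(1) g] w] show ?case
      by (simp only: foldl_Cons rhom_gact[OF f Cons.prems(1) g])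
  qed simp
  show ?thesis
    unfolding path_algebra_def
  proof (rule act_basis_hom[OF right_module_restr[OF N, unfolded path_algebra_def] right_module_restr[OF N', unfolded path_algebra_def]])
    fix x p assume x: "x \<in> carrier (restr N)" and p: "p \<in> paths G"
    then have xc: "x \<in> carrier N" by simp
    show "f (pact (restr N) x p) = pact (restr N') (f x) p"
      unfolding pact_restr[OF N p xc] pact_restr[OF N' p rhom_closed[OF f xc]]
      by (rule fw[OF xc path_word_gens[OF p]])
  next
    show "f \<in> carrier (restr N) \<rightarrow> carrier (restr N')" using rhom_closed[OF f] by simp
    show "f (x \<oplus>\<^bsub>restr N\<^esub> y) = f x \<oplus>\<^bsub>restr N'\<^esub> f y" if "x \<in> carrier (restr N)" "y \<in> carrier (restr N)" for x y
      using rhom_add[OF f, of x y] that by simp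
    show "f (c \<odot>\<^bsub>restr N\<^esub> x) = c \<odot>\<^bsub>restr N'\<^esub> f x" if "x \<in> carrier (restr N)" for x c
      using rhom_smult[OF f, of x c] that by simp
  qed
qed

end

section \<open>Localization of path algebra modules\<close>

text \<open>Ambient module for the graphs of homomorphisms, from which extensions to a localization
  are constructed.\<close>

definition prod_module :: "('k, 'a, 'm) rmodule \<Rightarrow> ('k, 'a, 'n) rmodule \<Rightarrow> ('k, 'a, 'm \<times> 'n) rmodule" where
  "prod_module M N = \<lparr>carrier = carrier M \<times> carrier N, monoid.mult = undefined, one = undefined,
     ring.zero = (\<zero>\<^bsub>M\<^esub>, \<zero>\<^bsub>N\<^esub>), add = (\<lambda>x y. (fst x \<oplus>\<^bsub>M\<^esub> fst y, snd x \<oplus>\<^bsub>N\<^esub> snd y)),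
     module.smult = (\<lambda>c x. (c \<odot>\<^bsub>M\<^esub> fst x, c \<odot>\<^bsub>N\<^esub> snd x)),
     act = (\<lambda>x a. (act M (fst x) a, act N (snd x) a))\<rparr>"

lemma prod_module_simps [simp]:
  "carrier (prod_module M N) = carrier M \<times> carrier N"
  "\<zero>\<^bsub>prod_module M N\<^esub> = (\<zero>\<^bsub>M\<^esub>, \<zero>\<^bsub>N\<^esub>)"
  "(x, y) \<oplus>\<^bsub>prod_module M N\<^esub> (x', y') = (x \<oplus>\<^bsub>M\<^esub> x', y \<oplus>\<^bsub>N\<^esub> y')"
  "c \<odot>\<^bsub>prod_module M N\<^esub> (x, y) = (c \<odot>\<^bsub>M\<^esub> x, c \<odot>\<^bsub>N\<^esub> y)"
  "act (prod_module M N) (x, y) a = (act M x a, act N y a)"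
  by (simp_all add: prod_module_def)

lemma right_module_prod:
  assumes "right_module A M" "right_module A N"
  shows "right_module A (prod_module M N)"
proof -
  interpret M: right_module A M by fact
  interpret N: right_module A N by fact
  show ?thesis
    by (rule right_moduleI)
      (auto simp: M.M.a_ac N.M.a_ac M.sm_add_left N.sm_add_left M.sm_add_right N.sm_add_right M.sm_mult N.sm_mult
        M.act_closed N.act_closed M.act_add_left N.act_add_left M.act_add_right N.act_add_right
        M.act_smult_left N.act_smult_left M.act_smult_right N.act_smult_right M.act_mult N.act_mult)
qed

context row_finite_digraph
begin

text \<open>The kernel condition is an inclusion; the reverse inclusion follows, in
  \<open>localization_ker\<close>, from the vanishing of the hat of a Leavitt module.\<close>

definition localization ::
  "('k, ('v, 'e, 'k) path_algebra_elem, 'm) rmodule \<Rightarrow> ('k, ('v, 'e, 'k) leavitt_elem, 'n) rmodule \<Rightarrow> ('m \<Rightarrow> 'n) \<Rightarrow> bool"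
where
  "localization W N \<alpha> \<longleftrightarrow> P.UM W \<and> L.UM N \<and> rhom PA W (restr N) \<alpha> \<and>
     (\<forall>x \<in> carrier W. \<alpha> x = \<zero>\<^bsub>N\<^esub> \<longrightarrow> x \<in> sat W {\<zero>\<^bsub>W\<^esub>}) \<and> carrier N \<subseteq> sat (restr N) (\<alpha> ` carrier W)"

lemma localizationD:
  assumes "localization W N \<alpha>"
  shows "P.UM W" "L.UM N" "rhom PA W (restr N) \<alpha>"
    "\<And>x. x \<in> carrier W \<Longrightarrow> \<alpha> x = \<zero>\<^bsub>N\<^esub> \<Longrightarrow> x \<in> sat W {\<zero>\<^bsub>W\<^esub>}"
    "\<And>y. y \<in> carrier N \<Longrightarrow> y \<in> sat (restr N) (\<alpha> ` carrier W)"
  using assms by (auto simp: localization_def)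

lemma localization_ker:
  assumes "localization W N \<alpha>" "x \<in> sat W {\<zero>\<^bsub>W\<^esub>}"
  shows "\<alpha> x = \<zero>\<^bsub>N\<^esub>"
proof -
  note D = localizationD[OF assms(1)]
  note rmN = L.UM_right_module[OF D(2)]
  show ?thesis
    by (rule restr_torsion_free[OF rmN D(2)],
        rule hat_image[OF P.UM_right_module[OF D(1)] right_module_restr[OF rmN] D(3) assms(2)])
qed

lemma localization_id:
  assumes "L.UM N" shows "localization (restr N) N (\<lambda>x. x)"
proof -
  note rm = L.UM_right_module[OF assms]
  show ?thesis unfolding localization_def
  proof (intro conjI ballI impI subsetI)
    show "P.UM (restr N)" by (rule UM_restr[OF rm assms])
    show "rhom PA (restr N) (restr N) (\<lambda>x. x)" by (simp add: rhom_def)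
    note r = right_module_restr[OF rm]
    show "x \<in> sat (restr N) {\<zero>\<^bsub>restr N\<^esub>}" if "x \<in> carrier (restr N)" "x = \<zero>\<^bsub>N\<^esub>" for x
      using subsetD[OF subset_sat[OF submod_singleton_zero[OF r]], of x] that by simp
    show "y \<in> sat (restr N) ((\<lambda>x. x) ` carrier (restr N))" if "y \<in> carrier N" for y
      using subsetD[OF subset_sat[OF submod_carrier[OF r]], of y] that by simp
  qed (fact assms)
qed

text \<open>The equalizer of g and g' is closed under ghosts and contains all y p for p in a
  suitable \<open>E_n\<close>; hence it contains y.\<close>

lemma localization_unique:
  assumes loc: "localization W N \<alpha>" and N': "right_module LA N'"
    and g: "rhom LA N N' g" and g': "rhom LA N N' g'"
    and eq: "\<And>x. x \<in> carrier W \<Longrightarrow> g (\<alpha> x) = g' (\<alpha> x)" and y: "y \<in> carrier N"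
  shows "g y = g' y"
proof (rule satE[OF localizationD(5)[OF loc y]])
  note D = localizationD[OF loc] and rmN = L.UM_right_module[OF localizationD(2)[OF loc]]
  interpret N: right_module LA N by (rule rmN)
  let ?Q = "{y \<in> carrier N. g y = g' y}"
  fix n assume n: "\<And>p. p \<in> level_paths G n \<Longrightarrow> pact (restr N) y p \<in> \<alpha> ` carrier W"
  have "y \<in> ?Q"
  proof (rule ghost_closed_mem[OF rmN D(2) y, where n = n])
    show "\<zero>\<^bsub>N\<^esub> \<in> ?Q" using rhom_zero[OF rmN N' g] rhom_zero[OF rmN N' g'] by simp
    show "u \<oplus>\<^bsub>N\<^esub> v \<in> ?Q" if "u \<in> ?Q" "v \<in> ?Q" for u v
      using that by (simp add: rhom_add[OF g] rhom_add[OF g'])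
    show "c \<odot>\<^bsub>N\<^esub> u \<in> ?Q" if "u \<in> ?Q" for c u
      using that by (simp add: rhom_smult[OF g] rhom_smult[OF g'])
    show "gact N u (Ghost e) \<in> ?Q" if "u \<in> ?Q" "e \<in> arcs G" for u e
      using that by (simp add: rhom_gact[OF g] rhom_gact[OF g'] gact_closed[OF rmN])
    fix p assume "p \<in> level_paths G n"
    from n[OF this] obtain x where x: "x \<in> carrier W" "pact (restr N) y p = \<alpha> x" by blast
    then show "pact (restr N) y p \<in> ?Q" using eq rhom_closed[OF D(3) x(1)] by simp
  qed
  then show ?thesis by simp
qed

text \<open>The extension is constructed as a relation R, the saturation of the graph {(\<alpha> x,
  h x)} in the product of N and N'. It is closed under ghosts, is defined on all of N by
  \<open>ghost_closed_mem\<close>, and is single-valued because N' has zero hat.\<close>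

lemma localization_extend:
  assumes loc: "localization W N \<alpha>" and UM': "L.UM N'" and h: "rhom PA W (restr N') h"
  obtains g where "rhom LA N N' g" "\<And>x. x \<in> carrier W \<Longrightarrow> g (\<alpha> x) = h x"
proof -
  note D = localizationD[OF loc]
  note rmW = P.UM_right_module[OF D(1)] and rmN = L.UM_right_module[OF D(2)] and rmN' = L.UM_right_module[OF UM']
  note rN = right_module_restr[OF rmN] and rN' = right_module_restr[OF rmN']
  interpret N: right_module LA N by (rule rmN)
  interpret N': right_module LA N' by (rule rmN')
  let ?T = "prod_module (restr N) (restr N')"
  have T: "right_module PA ?T" by (rule right_module_prod[OF rN rN'])
  have ah: "rhom PA W ?T (\<lambda>x. (\<alpha> x, h x))"
    by (rule rhomI) (simp_all add: rhomD(2-)[OF D(3)] rhomD(2-)[OF h] rhom_closed[OF D(3), simplified] rhom_closed[OF h, simplified])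
  let ?B = "(\<lambda>x. (\<alpha> x, h x)) ` carrier W"
  have B: "submod PA ?T ?B" by (rule submod_image[OF rmW T ah submod_carrier[OF rmW]])
  let ?R = "sat ?T ?B"
  have R: "submod PA ?T ?R" by (rule submod_sat[OF T B])
  note RD = submodD[OF R]
  have Rc: "y \<in> carrier N \<and> z \<in> carrier N'" if "(y, z) \<in> ?R" for y z
    using subsetD[OF RD(1) that] by simp
  have pactT: "pact ?T (y, z) p = (pact (restr N) y p, pact (restr N') z p)" for y z p by simp
  have ghost: "(gact N y (Ghost e), gact N' z (Ghost e)) \<in> ?R" if yz: "(y, z) \<in> ?R" and e: "e \<in> arcs G" for y z e
  proof (rule satE[OF yz])
    from Rc[OF yz] have y: "y \<in> carrier N" and z: "z \<in> carrier N'" by blast+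
    fix n assume n: "\<And>p. p \<in> level_paths G n \<Longrightarrow> pact ?T (y, z) p \<in> ?B"
    show ?thesis
    proof (rule satI[where n = "Suc n"])
      show "(gact N y (Ghost e), gact N' z (Ghost e)) \<in> carrier ?T"
        using y z e by (simp add: gact_closed[OF rmN] gact_closed[OF rmN'])
      fix p assume p: "p \<in> level_paths G (Suc n)"
      obtain u es where ues: "p = (u, es)" by (cases p)
      have B0: "(\<zero>\<^bsub>N\<^esub>, \<zero>\<^bsub>N'\<^esub>) \<in> ?B" using submod_zero[OF B] by simp
      show "pact ?T (gact N y (Ghost e), gact N' z (Ghost e)) p \<in> ?B"
      proof (cases es)
        case Nil
        then have "is_sink G u" using p ues by (simp add: level_paths_def)
        then show ?thesis
          unfolding pactT ues Nil pact_ghost_Nil[OF rmN y e \<open>is_sink G u\<close>] pact_ghost_Nil[OF rmN' z e \<open>is_sink G u\<close>]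
          using B0 by blast
      next
        case (Cons f fs)
        have pp: "(u, f # fs) \<in> paths G" using level_paths_paths[OF p] ues Cons by simp
        show ?thesis
        proof (cases "e = f")
          case True
          have "(head G e, fs) \<in> level_paths G n" using p ues Cons True by (auto simp: level_paths_def)
          from n[OF this] show ?thesis
            unfolding pactT ues Cons pact_ghost_Cons[OF rmN y e pp] pact_ghost_Cons[OF rmN' z e pp] if_P[OF True] .
        next
          case False
          show ?thesis
            unfolding pactT ues Cons pact_ghost_Cons[OF rmN y e pp] pact_ghost_Cons[OF rmN' z e pp] if_not_P[OF False]
            by (rule B0)
        qed
      qed
    qed
  qed
  \<comment> \<open>The first projection of R contains the image of \<alpha> and is closed under
    ghosts, so it is all of N.\<close>
  have total: "\<exists>z. (y, z) \<in> ?R" if y: "y \<in> carrier N" for y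
  proof (rule satE[OF D(5)[OF y]])
    fix n assume n: "\<And>p. p \<in> level_paths G n \<Longrightarrow> pact (restr N) y p \<in> \<alpha> ` carrier W"
    have "y \<in> {y. \<exists>z. (y, z) \<in> ?R}"
    proof (rule ghost_closed_mem[OF rmN D(2) y, where n = n])
      have "(\<zero>\<^bsub>N\<^esub>, \<zero>\<^bsub>N'\<^esub>) \<in> ?R" using RD(2) by simp
      then show "\<zero>\<^bsub>N\<^esub> \<in> {y. \<exists>z. (y, z) \<in> ?R}" by blast
      show "u \<oplus>\<^bsub>N\<^esub> v \<in> {y. \<exists>z. (y, z) \<in> ?R}" if uv: "u \<in> {y. \<exists>z. (y, z) \<in> ?R}" "v \<in> {y. \<exists>z. (y, z) \<in> ?R}" for u v
      proof -
        from uv obtain u' v' where "(u, u') \<in> ?R" "(v, v') \<in> ?R" by blast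
        from RD(3)[OF this] have "(u \<oplus>\<^bsub>N\<^esub> v, u' \<oplus>\<^bsub>N'\<^esub> v') \<in> ?R" by simp
        then show ?thesis by blast
      qed
      show "c \<odot>\<^bsub>N\<^esub> u \<in> {y. \<exists>z. (y, z) \<in> ?R}" if u: "u \<in> {y. \<exists>z. (y, z) \<in> ?R}" for c u
      proof -
        from u obtain u' where "(u, u') \<in> ?R" by blast
        from RD(4)[OF this, of c] have "(c \<odot>\<^bsub>N\<^esub> u, c \<odot>\<^bsub>N'\<^esub> u') \<in> ?R" by simp
        then show ?thesis by blast
      qed
      show "gact N u (Ghost e) \<in> {y. \<exists>z. (y, z) \<in> ?R}" if "u \<in> {y. \<exists>z. (y, z) \<in> ?R}" "e \<in> arcs G" for u e
        using that ghost by blast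
      fix p assume "p \<in> level_paths G n"
      from n[OF this] obtain x where x: "x \<in> carrier W" "pact (restr N) y p = \<alpha> x" by blast
      then have "(\<alpha> x, h x) \<in> ?R" using subsetD[OF subset_sat[OF B]] by blast
      with x(2) show "pact (restr N) y p \<in> {y. \<exists>z. (y, z) \<in> ?R}" by auto
    qed
    then show ?thesis by blast
  qed
  \<comment> \<open>If (0, z) is in R, then for p in some \<open>E_n\<close> there is x with
    \<alpha> x = 0 and z p = h x. Such an x lies in the hat of W, so h x lies in the hat as well,
    and z is in a double saturation of 0.\<close>
  have tf: "z = \<zero>\<^bsub>N'\<^esub>" if z: "(\<zero>\<^bsub>N\<^esub>, z) \<in> ?R" for z
  proof -
    have zc: "z \<in> carrier N'" using Rc[OF z] by blast
    have 0: "submod PA (restr N') {\<zero>\<^bsub>restr N'\<^esub>}" by (rule submod_singleton_zero[OF rN'])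
    have "z \<in> sat (restr N') (sat (restr N') {\<zero>\<^bsub>restr N'\<^esub>})"
    proof (rule satE[OF z])
      fix n assume n: "\<And>p. p \<in> level_paths G n \<Longrightarrow> pact ?T (\<zero>\<^bsub>N\<^esub>, z) p \<in> ?B"
      show ?thesis
      proof (rule satI[where n = n])
        fix p assume p: "p \<in> level_paths G n"
        from n[OF this] obtain x where x: "x \<in> carrier W" "pact (restr N) \<zero>\<^bsub>N\<^esub> p = \<alpha> x" "pact (restr N') z p = h x"
          unfolding pactT by blast
        have "pact (restr N) \<zero>\<^bsub>restr N\<^esub> p = \<zero>\<^bsub>restr N\<^esub>"
          by (rule right_module.act_zero[OF rN basis_PA[OF level_paths_paths[OF p]]])
        then have "\<alpha> x = \<zero>\<^bsub>N\<^esub>" using x(2) by simp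
        from hat_image[OF rmW rN' h D(4)[OF x(1) this]] x(3)
        show "pact (restr N') z p \<in> sat (restr N') {\<zero>\<^bsub>restr N'\<^esub>}" by (simp only:)
      qed (use zc in simp)
    qed
    from sat_sat[OF UM_restr[OF rmN' UM'] 0 this] show ?thesis by (rule restr_torsion_free[OF rmN' UM'])
  qed
  have single: "z = z'" if z: "(y, z) \<in> ?R" and z': "(y, z') \<in> ?R" for y z z'
  proof -
    have c: "y \<in> carrier N" "z \<in> carrier N'" "z' \<in> carrier N'" using Rc[OF z] Rc[OF z'] by blast+
    have "(y, z) \<oplus>\<^bsub>?T\<^esub> (-1) \<odot>\<^bsub>?T\<^esub> (y, z') \<in> ?R" by (rule RD(3)[OF z RD(4)[OF z']])
    then have "(y \<oplus>\<^bsub>N\<^esub> (-1) \<odot>\<^bsub>N\<^esub> y, z \<oplus>\<^bsub>N'\<^esub> (-1) \<odot>\<^bsub>N'\<^esub> z') \<in> ?R" by simp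
    then have "(\<zero>\<^bsub>N\<^esub>, z \<ominus>\<^bsub>N'\<^esub> z') \<in> ?R"
      using c by (simp add: N.sm_minus_one N'.sm_minus_one N.M.r_neg a_minus_def)
    from tf[OF this] show ?thesis using N'.minus_zero_iff[OF c(2,3)] by blast
  qed
  define g where "g y = (THE z. (y, z) \<in> ?R)" for y
  have gR: "(y, g y) \<in> ?R" if "y \<in> carrier N" for y
  proof -
    from total[OF that] obtain z where z: "(y, z) \<in> ?R" by blast
    show ?thesis unfolding g_def
      by (rule theI[where P = "\<lambda>z. (y, z) \<in> ?R" and a = z]) (use z single[OF _ z] in blast)+
  qed
  have g_eq: "g y = z" if "(y, z) \<in> ?R" for y z
    using single[OF gR that] Rc[OF that] by blast
  have "rhom LA N N' g"
  proof (rule rhom_LAI[OF rmN rmN'])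
    fix x assume x: "x \<in> carrier N"
    show "g x \<in> carrier N'" using Rc[OF gR[OF x]] by blast
    show "g (c \<odot>\<^bsub>N\<^esub> x) = c \<odot>\<^bsub>N'\<^esub> g x" for c
      by (rule g_eq) (use RD(4)[OF gR[OF x], of c] in simp)
    show "g (x \<oplus>\<^bsub>N\<^esub> y) = g x \<oplus>\<^bsub>N'\<^esub> g y" if y: "y \<in> carrier N" for y
      by (rule g_eq) (use RD(3)[OF gR[OF x] gR[OF y]] in simp)
    note gx = conjunct2[OF Rc[OF gR[OF x]]]
    have path: "(pact (restr N) x p, pact (restr N') (g x) p) \<in> ?R" if "p \<in> paths G" for p
      using RD(5)[OF gR[OF x] basis_PA[OF that]] by simp
    \<comment> \<open>R is a submodule over the path algebra, which settles vertices and arrows;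
      ghosts are covered by the closure property proved above.\<close>
    show "g (gact N x a) = gact N' (g x) a" if a: "a \<in> gens G" for a
    proof (rule g_eq, cases a)
      case (Vertex v)
      then have v: "v \<in> verts G" using a by simp
      show "(gact N x a, gact N' (g x) a) \<in> ?R"
        using path[of "(v, [])"] v unfolding Vertex pact_restr_Nil[OF rmN v x] pact_restr_Nil[OF rmN' v gx] by simp
    next
      case (Arrow e)
      then have e: "e \<in> arcs G" using a by simp
      show "(gact N x a, gact N' (g x) a) \<in> ?R"
        using path[of "(tail G e, [e])"] e unfolding Arrow pact_restr_arc[OF rmN e x] pact_restr_arc[OF rmN' e gx] by simp
    next
      case (Ghost e)
      then have e: "e \<in> arcs G" using a by simp
      show "(gact N x a, gact N' (g x) a) \<in> ?R" unfolding Ghost by (rule ghost[OF gR[OF x] e])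
    qed
  qed
  moreover have "g (\<alpha> x) = h x" if "x \<in> carrier W" for x
    by (rule g_eq, rule subsetD[OF subset_sat[OF B]]) (use that in blast)
  ultimately show thesis by (rule that)
qed

end

text \<open>Pairs inject into an infinite type by cardinal arithmetic. Lists are coded as nested
  pairs whose tags \<open>num 0\<close> and \<open>num 1\<close> separate the empty list from the
  others.\<close>

lemma list_injection_exists:
  assumes "infinite (UNIV :: 'm set)"
  obtains enc :: "'m list \<Rightarrow> 'm" and prd :: "'m \<times> 'm \<Rightarrow> 'm" and num :: "nat \<Rightarrow> 'm"
  where "inj enc" "inj prd" "inj num"
proof -
  obtain num :: "nat \<Rightarrow> 'm" where num: "inj num"
    using assms unfolding infinite_iff_countable_subset by (elim exE conjE)
  have "(card_of (UNIV \<times> UNIV :: ('m \<times> 'm) set), card_of (UNIV :: 'm set)) \<in> ordLeq"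
    using card_of_Times_same_infinite[OF assms] unfolding ordIso_iff_ordLeq by (rule conjunct1)
  then obtain prd :: "'m \<times> 'm \<Rightarrow> 'm" where prd: "inj prd"
    unfolding card_of_ordLeq[symmetric] UNIV_Times_UNIV by blast
  define enc where "enc = rec_list (prd (num 0, num 0)) (\<lambda>a l r. prd (num 1, prd (a, r)))"
  have enc: "enc [] = prd (num 0, num 0)" "enc (a # l) = prd (num 1, prd (a, enc l))" for a l
    by (simp_all add: enc_def)
  have n01: "num 0 \<noteq> num 1" using num by (simp add: inj_eq)
  have "enc l = enc l' \<Longrightarrow> l = l'" for l l'
  proof (induction l arbitrary: l')
    case Nil
    then show ?case using n01 by (cases l') (simp_all add: enc inj_eq[OF prd])
  next
    case (Cons a l)
    then show ?case using n01 by (cases l') (auto simp: enc inj_eq[OF prd])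
  qed
  then have "inj enc" by (rule injI)
  then show thesis using prd num by (rule that)
qed

text \<open>\<open>code\<close> separates cosets but may vary within a coset. Applying it to chosen
  representatives makes it constant there.\<close>

lemma fibre_map_exists:
  fixes M :: "('k::field, 'a, 'm) rmodule" and code :: "'m \<Rightarrow> 'c"
  assumes M: "right_module A M" and B: "submod A M B"
    and code: "\<And>x y. \<lbrakk>x \<in> carrier M; y \<in> carrier M; code x = code y\<rbrakk> \<Longrightarrow> x \<ominus>\<^bsub>M\<^esub> y \<in> B"
  obtains \<pi> :: "'m \<Rightarrow> 'c" where "\<And>x y. \<lbrakk>x \<in> carrier M; y \<in> carrier M\<rbrakk> \<Longrightarrow> \<pi> x = \<pi> y \<longleftrightarrow> x \<ominus>\<^bsub>M\<^esub> y \<in> B"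
proof
  interpret right_module A M by fact
  have r: "coset_rep M B x \<in> carrier M" "coset_rep M B (coset_rep M B x) = coset_rep M B x" if x: "x \<in> carrier M" for x
  proof -
    have "x \<ominus>\<^bsub>M\<^esub> x = \<zero>\<^bsub>M\<^esub>" using x by (simp add: minus_zero_iff)
    then have "\<exists>y. y \<in> carrier M \<and> y \<ominus>\<^bsub>M\<^esub> x \<in> B" using x submod_zero[OF B] by metis
    from someI_ex[OF this, folded coset_rep_def]
    have rx: "coset_rep M B x \<in> carrier M" "coset_rep M B x \<ominus>\<^bsub>M\<^esub> x \<in> B" by blast+
    show "coset_rep M B x \<in> carrier M" by (rule rx(1))
    show "coset_rep M B (coset_rep M B x) = coset_rep M B x"
      using coset_rep_eq_iff[OF M B rx(1) x] rx(2) by blast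
  qed
  fix x y assume x: "x \<in> carrier M" and y: "y \<in> carrier M"
  show "(code \<circ> coset_rep M B) x = (code \<circ> coset_rep M B) y \<longleftrightarrow> x \<ominus>\<^bsub>M\<^esub> y \<in> B"
  proof
    assume "(code \<circ> coset_rep M B) x = (code \<circ> coset_rep M B) y"
    then have "coset_rep M B x \<ominus>\<^bsub>M\<^esub> coset_rep M B y \<in> B"
      using code[OF r(1)[OF x] r(1)[OF y]] by simp
    then have "coset_rep M B (coset_rep M B x) = coset_rep M B (coset_rep M B y)"
      using coset_rep_eq_iff[OF M B r(1)[OF x] r(1)[OF y]] by blast
    then show "x \<ominus>\<^bsub>M\<^esub> y \<in> B" using r(2)[OF x] r(2)[OF y] coset_rep_eq_iff[OF M B x y] by simp
  next
    assume "x \<ominus>\<^bsub>M\<^esub> y \<in> B"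
    then show "(code \<circ> coset_rep M B) x = (code \<circ> coset_rep M B) y"
      using coset_rep_eq_iff[OF M B x y] by simp
  qed
qed

context row_finite_digraph
begin

text \<open>This is membership in the union of the sets \<open>E_k\<close> over all k at least
  n.\<close>

definition late :: "nat \<Rightarrow> 'v \<times> 'e list \<Rightarrow> bool" where
  "late n p \<longleftrightarrow> p \<in> paths G \<and> (n \<le> length (snd p) \<or> is_sink G (path_end G p))"

lemma level_late: "p \<in> level_paths G n \<Longrightarrow> late n p"
  by (auto simp: level_paths_def late_def)

lemma late_mono: "late n' p \<Longrightarrow> n \<le> n' \<Longrightarrow> late n p"
  by (auto simp: late_def)

text \<open>A late path with fewer than n arcs ends at a sink, and is then itself the prefix in
  \<open>E_n\<close>, followed by a trivial path.\<close>

lemma late_split: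
  assumes "late n p"
  obtains q r where "q \<in> level_paths G n" "r \<in> paths G" "path_end G q = fst r" "p = (fst q, snd q @ snd r)"
proof (cases "n \<le> length (snd p)")
  case True
  then have "p \<in> level_paths G (n + (length (snd p) - n))" using assms by (simp add: late_def level_paths_def)
  then obtain q r where "q \<in> level_paths G n" "r \<in> level_paths G (length (snd p) - n)" "path_end G q = fst r"
    "p = (fst q, snd q @ snd r)" by (rule level_paths_split)
  with that level_paths_paths show thesis by blast
next
  case False
  then have p: "p \<in> level_paths G n" using assms by (simp add: late_def level_paths_def)
  have "(path_end G p, []) \<in> paths G"
    using path_end_verts[of "fst p" "snd p"] level_paths_paths[OF p] by simp
  with that[OF p this] show thesis by simp
qed

lemma out_arcs_sink: "is_sink G v \<Longrightarrow> e \<notin> out_arcs G v"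
  by (simp add: is_sink_def)

text \<open>The values of y g in terms of those of y, read off from (y e) p = y (e p) and from e* f
  q being q or 0. At a trivial path y e* receives the value 0: this is correct at a sink, and other
  trivial paths are too short to matter.\<close>

fun germ_op :: "'m \<Rightarrow> ('v, 'e) gen \<Rightarrow> ('v \<times> 'e list \<Rightarrow> 'm) \<Rightarrow> 'v \<times> 'e list \<Rightarrow> 'm" where
  "germ_op z (Vertex v) x (u, es) = (if u = v then x (u, es) else z)"
| "germ_op z (Arrow e) x (u, es) = (if u = head G e then x (tail G e, e # es) else z)"
| "germ_op z (Ghost e) x (u, []) = z"
| "germ_op z (Ghost e) x (u, f # fs) = (if f = e \<and> u = tail G e then x (head G e, fs) else z)"

context
  fixes M :: "('k, ('v, 'e, 'k) path_algebra_elem, 'm) rmodule"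
  assumes UM: "P.UM M"
begin

private lemma M: "right_module PA M"
  by (rule P.UM_right_module[OF UM])

interpretation M: right_module PA M by (rule M)

text \<open>The condition starts at level n because for an element y of the localization the
  products y p are known to come from M only for p of sufficiently high level.\<close>

definition coherent :: "nat \<Rightarrow> ('v \<times> 'e list \<Rightarrow> 'm) \<Rightarrow> bool" where
  "coherent n x \<longleftrightarrow> (\<forall>u es. late n (u, es) \<longrightarrow>
     (\<forall>e \<in> out_arcs G (path_end G (u, es)). x (u, es @ [e]) = pact M (x (u, es)) (path_end G (u, es), [e])))"

text \<open>A germ assigns to each path \<open>p\<close> the prospective value \<open>y p\<close> of an element \<open>y\<close> of the localization.
  Only the values on long paths (and on paths to sinks) matter.\<close>

definition germs :: "('v \<times> 'e list \<Rightarrow> 'm) set" where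
  "germs = {x. (\<forall>p. x p \<in> carrier M) \<and> (\<forall>p. p \<notin> paths G \<longrightarrow> x p = \<zero>\<^bsub>M\<^esub>) \<and>
     (\<forall>p \<in> paths G. pact M (x p) (path_end G p, []) = x p) \<and>
     (\<exists>F. finite F \<and> F \<subseteq> verts G \<and> (\<forall>p. fst p \<notin> F \<longrightarrow> x p = \<zero>\<^bsub>M\<^esub>)) \<and> (\<exists>n. coherent n x)}"

lemma germsI:
  assumes "\<And>p. x p \<in> carrier M" "\<And>p. p \<notin> paths G \<Longrightarrow> x p = \<zero>\<^bsub>M\<^esub>"
    "\<And>p. p \<in> paths G \<Longrightarrow> pact M (x p) (path_end G p, []) = x p"
    "finite F" "F \<subseteq> verts G" "\<And>p. fst p \<notin> F \<Longrightarrow> x p = \<zero>\<^bsub>M\<^esub>" "coherent n x"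
  shows "x \<in> germs"
  unfolding germs_def
  by (intro CollectI conjI allI ballI impI exI[of _ F] exI[of _ n]) (rule assms; assumption?)+

lemma germsD:
  assumes "x \<in> germs"
  shows "x p \<in> carrier M" "p \<notin> paths G \<Longrightarrow> x p = \<zero>\<^bsub>M\<^esub>"
    "p \<in> paths G \<Longrightarrow> pact M (x p) (path_end G p, []) = x p"
    "\<exists>F. finite F \<and> F \<subseteq> verts G \<and> (\<forall>p. fst p \<notin> F \<longrightarrow> x p = \<zero>\<^bsub>M\<^esub>)" "\<exists>n. coherent n x"
  using assms unfolding germs_def by blast+

lemma coherentD: "\<lbrakk>coherent n x; late n (u, es); e \<in> out_arcs G (path_end G (u, es))\<rbrakk>
  \<Longrightarrow> x (u, es @ [e]) = pact M (x (u, es)) (path_end G (u, es), [e])"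
  unfolding coherent_def by blast

lemma coherentI:
  "(\<And>u es e. \<lbrakk>late n (u, es); e \<in> out_arcs G (path_end G (u, es))\<rbrakk>
    \<Longrightarrow> x (u, es @ [e]) = pact M (x (u, es)) (path_end G (u, es), [e])) \<Longrightarrow> coherent n x"
  unfolding coherent_def by blast

lemma coherent_mono: "coherent n x \<Longrightarrow> n \<le> n' \<Longrightarrow> coherent n' x"
  by (rule coherentI, rule coherentD, assumption, rule late_mono)

lemma pact_zero [simp]: "p \<in> paths G \<Longrightarrow> pact M \<zero>\<^bsub>M\<^esub> p = \<zero>\<^bsub>M\<^esub>"
  by (rule M.act_zero[OF basis_PA])

lemma arc_path: "e \<in> out_arcs G v \<Longrightarrow> (v, [e]) \<in> paths G"
  by auto

text \<open>Only the linear structure is meant here; the action by \<open>unit\<close> is a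
  placeholder until the free algebra acts in \<open>germ_module\<close>.\<close>

definition germ_space :: "('k, unit, 'v \<times> 'e list \<Rightarrow> 'm) rmodule" where
  "germ_space = \<lparr>carrier = germs, monoid.mult = undefined, one = undefined, ring.zero = (\<lambda>_. \<zero>\<^bsub>M\<^esub>),
     add = (\<lambda>x y p. x p \<oplus>\<^bsub>M\<^esub> y p), module.smult = (\<lambda>c x p. c \<odot>\<^bsub>M\<^esub> x p), act = (\<lambda>x _. x)\<rparr>"

lemma germ_space_simps [simp]:
  "carrier germ_space = germs" "\<zero>\<^bsub>germ_space\<^esub> = (\<lambda>_. \<zero>\<^bsub>M\<^esub>)"
  "x \<oplus>\<^bsub>germ_space\<^esub> y = (\<lambda>p. x p \<oplus>\<^bsub>M\<^esub> y p)" "c \<odot>\<^bsub>germ_space\<^esub> x = (\<lambda>p. c \<odot>\<^bsub>M\<^esub> x p)"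
  by (simp_all add: germ_space_def)

lemma germs_zero: "(\<lambda>_. \<zero>\<^bsub>M\<^esub>) \<in> germs"
  by (rule germsI[of _ "{}" 0]) (auto intro!: coherentI simp: arc_path path_end_verts)

lemma germs_add:
  assumes x: "x \<in> germs" and y: "y \<in> germs"
  shows "(\<lambda>p. x p \<oplus>\<^bsub>M\<^esub> y p) \<in> germs"
proof -
  note xD = germsD[OF x] and yD = germsD[OF y]
  from xD(4) obtain F where F: "finite F" "F \<subseteq> verts G" "\<And>p. fst p \<notin> F \<Longrightarrow> x p = \<zero>\<^bsub>M\<^esub>" by blast
  from yD(4) obtain F' where F': "finite F'" "F' \<subseteq> verts G" "\<And>p. fst p \<notin> F' \<Longrightarrow> y p = \<zero>\<^bsub>M\<^esub>" by blast
  from xD(5) yD(5) obtain n n' where n: "coherent n x" "coherent n' y" by blast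
  have c: "coherent (max n n') x" "coherent (max n n') y"
    using coherent_mono[OF n(1)] coherent_mono[OF n(2)] by simp_all
  show ?thesis
  proof (rule germsI[where F = "F \<union> F'" and n = "max n n'"])
    show "pact M (x p \<oplus>\<^bsub>M\<^esub> y p) (path_end G p, []) = x p \<oplus>\<^bsub>M\<^esub> y p" if p: "p \<in> paths G" for p
      using xD(1,3) yD(1,3) p path_end_verts[of "fst p" "snd p"] by (simp add: M.act_add_left)
    show "coherent (max n n') (\<lambda>p. x p \<oplus>\<^bsub>M\<^esub> y p)"
    proof (rule coherentI)
      fix u es e assume *: "late (max n n') (u, es)" "e \<in> out_arcs G (path_end G (u, es))"
      show "x (u, es @ [e]) \<oplus>\<^bsub>M\<^esub> y (u, es @ [e]) = pact M (x (u, es) \<oplus>\<^bsub>M\<^esub> y (u, es)) (path_end G (u, es), [e])"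
        unfolding coherentD[OF c(1) *] coherentD[OF c(2) *]
        by (rule M.act_add_left[OF xD(1) yD(1) basis_PA[OF arc_path[OF *(2)]], symmetric])
    qed
  qed (use xD(1,2) yD(1,2) F F' in auto)
qed

lemma germs_smult:
  assumes x: "x \<in> germs" shows "(\<lambda>p. c \<odot>\<^bsub>M\<^esub> x p) \<in> germs"
proof -
  note xD = germsD[OF x]
  from xD(4) obtain F where F: "finite F" "F \<subseteq> verts G" "\<And>p. fst p \<notin> F \<Longrightarrow> x p = \<zero>\<^bsub>M\<^esub>" by blast
  from xD(5) obtain n where n: "coherent n x" by blast
  show ?thesis
  proof (rule germsI[where F = F and n = n])
    show "pact M (c \<odot>\<^bsub>M\<^esub> x p) (path_end G p, []) = c \<odot>\<^bsub>M\<^esub> x p" if p: "p \<in> paths G" for p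
      using xD(1,3) p path_end_verts[of "fst p" "snd p"] by (simp add: M.act_smult_left)
    show "coherent n (\<lambda>p. c \<odot>\<^bsub>M\<^esub> x p)"
    proof (rule coherentI)
      fix u es e assume *: "late n (u, es)" "e \<in> out_arcs G (path_end G (u, es))"
      show "c \<odot>\<^bsub>M\<^esub> x (u, es @ [e]) = pact M (c \<odot>\<^bsub>M\<^esub> x (u, es)) (path_end G (u, es), [e])"
        unfolding coherentD[OF n *]
        by (rule M.act_smult_left[OF xD(1) basis_PA[OF arc_path[OF *(2)]], symmetric])
    qed
  qed (use xD(1,2) F in auto)
qed

text \<open>An arrow lengthens the path at which x is evaluated, so coherence persists from level n.
  A ghost removes the first arc, so coherence starts at level n + 1.\<close>

lemma germ_op_closed:
  assumes x: "x \<in> germs" and g: "g \<in> gens G"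
  shows "germ_op \<zero>\<^bsub>M\<^esub> g x \<in> germs"
proof -
  note xD = germsD[OF x]
  from xD(4) obtain F where F: "finite F" "F \<subseteq> verts G" "\<And>p. fst p \<notin> F \<Longrightarrow> x p = \<zero>\<^bsub>M\<^esub>" by blast
  from xD(5) obtain n where n: "coherent n x" by blast
  have vp: "(path_end G p, []) \<in> paths G" if "p \<in> paths G" for p
    using path_end_verts[of "fst p" "snd p"] that by simp
  show ?thesis
  proof (cases g)
    case (Vertex v)
    show ?thesis unfolding Vertex
    proof (rule germsI[where F = F and n = n])
      fix p :: "'v \<times> 'e list"
      obtain u es where p: "p = (u, es)" by (cases p)
      show "germ_op \<zero>\<^bsub>M\<^esub> (Vertex v) x p \<in> carrier M" using xD(1) by (simp add: p)
      show "germ_op \<zero>\<^bsub>M\<^esub> (Vertex v) x p = \<zero>\<^bsub>M\<^esub>" if "p \<notin> paths G" using xD(2)[OF that] by (cases "u = v") (simp_all add: p)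
      show "germ_op \<zero>\<^bsub>M\<^esub> (Vertex v) x p = \<zero>\<^bsub>M\<^esub>" if "fst p \<notin> F" using F(3)[OF that] by (cases "u = v") (simp_all add: p)
      show "pact M (germ_op \<zero>\<^bsub>M\<^esub> (Vertex v) x p) (path_end G p, []) = germ_op \<zero>\<^bsub>M\<^esub> (Vertex v) x p" if "p \<in> paths G"
        using xD(3)[OF that] pact_zero[OF vp[OF that]] by (cases "u = v") (simp_all add: p)
    next
      show "coherent n (germ_op \<zero>\<^bsub>M\<^esub> (Vertex v) x)"
      proof (rule coherentI)
        fix u es e assume *: "late n (u, es)" "e \<in> out_arcs G (path_end G (u, es))"
        show "germ_op \<zero>\<^bsub>M\<^esub> (Vertex v) x (u, es @ [e]) = pact M (germ_op \<zero>\<^bsub>M\<^esub> (Vertex v) x (u, es)) (path_end G (u, es), [e])"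
          using coherentD[OF n *] pact_zero[OF arc_path[OF *(2)]] by (cases "u = v") simp_all
      qed
    qed (rule F)+
  next
    case (Arrow a)
    with g have a: "a \<in> arcs G" by simp
    show ?thesis unfolding Arrow
    proof (rule germsI[where F = "{head G a}" and n = n])
      fix p :: "'v \<times> 'e list"
      obtain u es where p: "p = (u, es)" by (cases p)
      show "germ_op \<zero>\<^bsub>M\<^esub> (Arrow a) x p \<in> carrier M" using xD(1) by (simp add: p)
      show "germ_op \<zero>\<^bsub>M\<^esub> (Arrow a) x p = \<zero>\<^bsub>M\<^esub>" if "p \<notin> paths G"
        using xD(2)[of "(tail G a, a # es)"] that by (cases "u = head G a") (simp_all add: p)
      show "germ_op \<zero>\<^bsub>M\<^esub> (Arrow a) x p = \<zero>\<^bsub>M\<^esub>" if "fst p \<notin> {head G a}" using that by (simp add: p)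
      show "pact M (germ_op \<zero>\<^bsub>M\<^esub> (Arrow a) x p) (path_end G p, []) = germ_op \<zero>\<^bsub>M\<^esub> (Arrow a) x p" if pp: "p \<in> paths G"
      proof (cases "u = head G a")
        case True
        then have "(tail G a, a # es) \<in> paths G" using pp p a by simp
        from xD(3)[OF this] True show ?thesis by (simp add: p)
      next
        case False
        then show ?thesis using pact_zero[OF vp[OF pp]] by (simp add: p)
      qed
    next
      show "coherent n (germ_op \<zero>\<^bsub>M\<^esub> (Arrow a) x)"
      proof (rule coherentI)
        fix u es e assume *: "late n (u, es)" "e \<in> out_arcs G (path_end G (u, es))"
        show "germ_op \<zero>\<^bsub>M\<^esub> (Arrow a) x (u, es @ [e]) = pact M (germ_op \<zero>\<^bsub>M\<^esub> (Arrow a) x (u, es)) (path_end G (u, es), [e])"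
        proof (cases "u = head G a")
          case True
          have "late n (tail G a, a # es)" using *(1) True a by (auto simp: late_def)
          from coherentD[OF n this, of e] *(2) True show ?thesis by simp
        next
          case False
          then show ?thesis using pact_zero[OF arc_path[OF *(2)]] by simp
        qed
      qed
    qed (use a in auto)
  next
    case (Ghost a)
    with g have a: "a \<in> arcs G" by simp
    show ?thesis unfolding Ghost
    proof (rule germsI[where F = "{tail G a}" and n = "Suc n"])
      fix p :: "'v \<times> 'e list"
      obtain u es where p: "p = (u, es)" by (cases p)
      show "germ_op \<zero>\<^bsub>M\<^esub> (Ghost a) x p \<in> carrier M" using xD(1) by (cases es) (simp_all add: p)
      show "germ_op \<zero>\<^bsub>M\<^esub> (Ghost a) x p = \<zero>\<^bsub>M\<^esub>" if "p \<notin> paths G"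
        using xD(2)[of "(head G a, tl es)"] that a by (cases es) (auto simp: p)
      show "germ_op \<zero>\<^bsub>M\<^esub> (Ghost a) x p = \<zero>\<^bsub>M\<^esub>" if "fst p \<notin> {tail G a}" using that by (cases es) (simp_all add: p)
      show "pact M (germ_op \<zero>\<^bsub>M\<^esub> (Ghost a) x p) (path_end G p, []) = germ_op \<zero>\<^bsub>M\<^esub> (Ghost a) x p" if pp: "p \<in> paths G"
      proof (cases "es \<noteq> [] \<and> hd es = a")
        case True
        then obtain fs where es: "es = a # fs" by (cases es) auto
        then have "(head G a, fs) \<in> paths G" using pp p by simp
        from xD(3)[OF this] show ?thesis using pact_zero[OF vp[OF pp]] by (simp add: p es)
      next
        case False
        then have "germ_op \<zero>\<^bsub>M\<^esub> (Ghost a) x p = \<zero>\<^bsub>M\<^esub>" by (cases es) (simp_all add: p)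
        then show ?thesis using pact_zero[OF vp[OF pp]] by simp
      qed
    next
      show "coherent (Suc n) (germ_op \<zero>\<^bsub>M\<^esub> (Ghost a) x)"
      proof (rule coherentI)
        fix u es e assume *: "late (Suc n) (u, es)" "e \<in> out_arcs G (path_end G (u, es))"
        \<comment> \<open>The arc e leaves the end of the path, so this end is no sink and lateness
          must come from the length.\<close>
        then have len: "Suc n \<le> length es" using out_arcs_sink by (auto simp: late_def)
        then obtain f fs where es: "es = f # fs" by (cases es) auto
        show "germ_op \<zero>\<^bsub>M\<^esub> (Ghost a) x (u, es @ [e]) = pact M (germ_op \<zero>\<^bsub>M\<^esub> (Ghost a) x (u, es)) (path_end G (u, es), [e])"
        proof (cases "f = a \<and> u = tail G a")
          case True
          have "late n (head G a, fs)" using *(1) True len es by (auto simp: late_def)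
          from coherentD[OF n this, of e] *(2) True es show ?thesis by simp
        next
          case False
          then have "germ_op \<zero>\<^bsub>M\<^esub> (Ghost a) x (u, es @ [e]) = \<zero>\<^bsub>M\<^esub>" "germ_op \<zero>\<^bsub>M\<^esub> (Ghost a) x (u, es) = \<zero>\<^bsub>M\<^esub>"
            unfolding es by auto
          then show ?thesis using pact_zero[OF arc_path[OF *(2)]] by simp
        qed
      qed
    qed (use a in auto)
  qed
qed

abbreviation germ_word :: "('v, 'e) gen list \<Rightarrow> ('v \<times> 'e list \<Rightarrow> 'm) \<Rightarrow> 'v \<times> 'e list \<Rightarrow> 'm" where
  "germ_word w x \<equiv> foldl (\<lambda>x g. germ_op \<zero>\<^bsub>M\<^esub> g x) x w"

text \<open>The Leavitt relations hold on germs only up to values on short paths. So the germs form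
  a module over the free algebra, and become a Leavitt module after division by
  \<open>germ_null\<close>.\<close>

definition germ_module :: "('k, ('v, 'e) gen list \<Rightarrow>\<^sub>0 'k, 'v \<times> 'e list \<Rightarrow> 'm) rmodule" where
  "germ_module = with_act germ_space (lin_ext germ_space germ_word)"

lemma germ_module_simps [simp]:
  "carrier germ_module = germs" "\<zero>\<^bsub>germ_module\<^esub> = (\<lambda>_. \<zero>\<^bsub>M\<^esub>)"
  "x \<oplus>\<^bsub>germ_module\<^esub> y = (\<lambda>p. x p \<oplus>\<^bsub>M\<^esub> y p)" "c \<odot>\<^bsub>germ_module\<^esub> x = (\<lambda>p. c \<odot>\<^bsub>M\<^esub> x p)"
  by (simp_all add: germ_module_def)

lemma right_module_germ_space: "right_module (undefined\<lparr>carrier := {}\<rparr>) germ_space"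
  by (rule right_moduleI)
    (simp_all add: germs_zero germs_add germs_smult germsD(1) M.M.a_ac fun_eq_iff
      M.sm_add_left M.sm_add_right M.sm_mult)

lemma germ_op_add:
  "germ_op \<zero>\<^bsub>M\<^esub> g (\<lambda>p. x p \<oplus>\<^bsub>M\<^esub> y p) = (\<lambda>p. germ_op \<zero>\<^bsub>M\<^esub> g x p \<oplus>\<^bsub>M\<^esub> germ_op \<zero>\<^bsub>M\<^esub> g y p)"
proof
  fix p show "germ_op \<zero>\<^bsub>M\<^esub> g (\<lambda>p. x p \<oplus>\<^bsub>M\<^esub> y p) p = germ_op \<zero>\<^bsub>M\<^esub> g x p \<oplus>\<^bsub>M\<^esub> germ_op \<zero>\<^bsub>M\<^esub> g y p"
    by (induction "\<zero>\<^bsub>M\<^esub>" g x p rule: germ_op.induct) simp_all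
qed

lemma germ_op_smult:
  "germ_op \<zero>\<^bsub>M\<^esub> g (\<lambda>p. c \<odot>\<^bsub>M\<^esub> x p) = (\<lambda>p. c \<odot>\<^bsub>M\<^esub> germ_op \<zero>\<^bsub>M\<^esub> g x p)"
proof
  fix p show "germ_op \<zero>\<^bsub>M\<^esub> g (\<lambda>p. c \<odot>\<^bsub>M\<^esub> x p) p = c \<odot>\<^bsub>M\<^esub> germ_op \<zero>\<^bsub>M\<^esub> g x p"
    by (induction "\<zero>\<^bsub>M\<^esub>" g x p rule: germ_op.induct) simp_all
qed

lemma germ_word_closed: "x \<in> germs \<Longrightarrow> set w \<subseteq> gens G \<Longrightarrow> germ_word w x \<in> germs"
  by (induction w arbitrary: x) (simp_all add: germ_op_closed)

lemma germ_word_add: "germ_word w (\<lambda>p. x p \<oplus>\<^bsub>M\<^esub> y p) = (\<lambda>p. germ_word w x p \<oplus>\<^bsub>M\<^esub> germ_word w y p)"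
  by (induction w arbitrary: x y) (simp_all add: germ_op_add)

lemma germ_word_smult: "germ_word w (\<lambda>p. c \<odot>\<^bsub>M\<^esub> x p) = (\<lambda>p. c \<odot>\<^bsub>M\<^esub> germ_word w x p)"
  by (induction w arbitrary: x) (simp_all add: germ_op_smult)

lemma words_gens: "w \<in> words \<Longrightarrow> set w \<subseteq> gens G"
  by (auto simp: words_def)

lemma right_module_germ_module: "right_module FA germ_module"
  unfolding germ_module_def FA_def
proof (rule right_module_lin_ext[OF right_module_germ_space _ _ _ words_basis_closed])
  fix w x assume "w \<in> words" "x \<in> carrier germ_space"
  then show "germ_word w x \<in> carrier germ_space" by (simp add: germ_word_closed words_gens)
qed (simp_all add: germ_word_add germ_word_smult)

interpretation X: right_module FA germ_module by (rule right_module_germ_module)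

lemma act_germ_word: "x \<in> germs \<Longrightarrow> w \<in> words \<Longrightarrow> act germ_module x (basis_elem w) = germ_word w x"
proof -
  assume x: "x \<in> germs" and w: "w \<in> words"
  have "lin_ext germ_space germ_word x (basis_elem w) = 1 \<odot>\<^bsub>germ_space\<^esub> germ_word w x"
  proof (rule lin_ext_single[OF right_module_germ_space, where B = words])
    fix w x assume "w \<in> words" "x \<in> carrier germ_space"
    then show "germ_word w x \<in> carrier germ_space" by (simp add: germ_word_closed words_gens)
  qed (simp_all add: germ_word_add germ_word_smult x w)
  also have "\<dots> = germ_word w x"
    using germsD(1)[OF germ_word_closed[OF x words_gens[OF w]]] by (simp add: fun_eq_iff)
  finally show ?thesis by (simp add: germ_module_def)
qed

text \<open>The germs that represent 0: two germs agreeing on all late paths describe the same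
  element of the localization.\<close>

definition germ_null :: "('v \<times> 'e list \<Rightarrow> 'm) set" where
  "germ_null = {x \<in> germs. \<exists>n. \<forall>p. late n p \<longrightarrow> x p = \<zero>\<^bsub>M\<^esub>}"

lemma germ_nullI: "x \<in> germs \<Longrightarrow> (\<And>p. late n p \<Longrightarrow> x p = \<zero>\<^bsub>M\<^esub>) \<Longrightarrow> x \<in> germ_null"
  unfolding germ_null_def by blast

text \<open>Level n + 1 serves all generators; a ghost is the case that requires it, since it
  evaluates x at a path shortened by one arc.\<close>

lemma germ_null_op:
  assumes x: "x \<in> germ_null" and g: "g \<in> gens G"
  shows "germ_op \<zero>\<^bsub>M\<^esub> g x \<in> germ_null"
proof -
  from x obtain n where xg: "x \<in> germs" and n: "\<And>p. late n p \<Longrightarrow> x p = \<zero>\<^bsub>M\<^esub>"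
    by (auto simp: germ_null_def)
  show ?thesis
  proof (rule germ_nullI[OF germ_op_closed[OF xg g], where n = "Suc n"])
    fix p assume p: "late (Suc n) p"
    obtain u es where ues: "p = (u, es)" by (cases p)
    show "germ_op \<zero>\<^bsub>M\<^esub> g x p = \<zero>\<^bsub>M\<^esub>"
    proof (cases g)
      case (Vertex v)
      then show ?thesis using n[OF late_mono[OF p]] ues by (cases "u = v") simp_all
    next
      case (Arrow e)
      have "late n (tail G e, e # es)" if "u = head G e"
        using p ues that g Arrow by (auto simp: late_def)
      from n[OF this] show ?thesis using ues Arrow by simp
    next
      case (Ghost e)
      show ?thesis
      proof (cases es)
        case (Cons f fs)
        have "late n (head G e, fs)" if "f = e"
          using p ues that Cons by (auto simp: late_def)
        from n[OF this] show ?thesis using ues Ghost Cons by simp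
      qed (simp add: ues Ghost)
    qed
  qed
qed

lemma submod_germ_null: "submod FA germ_module germ_null"
  unfolding FA_def
proof (rule submod_basisI[OF right_module_germ_module[unfolded FA_def]])
  show "germ_null \<subseteq> carrier germ_module" by (auto simp: germ_null_def)
  show "\<zero>\<^bsub>germ_module\<^esub> \<in> germ_null" using germ_nullI[OF germs_zero] by simp
  show "c \<odot>\<^bsub>germ_module\<^esub> x \<in> germ_null" if x: "x \<in> germ_null" for c x
  proof -
    from x obtain n where xg: "x \<in> germs" and n: "\<And>p. late n p \<Longrightarrow> x p = \<zero>\<^bsub>M\<^esub>"
      by (auto simp: germ_null_def)
    show ?thesis unfolding germ_module_simps
      by (rule germ_nullI[OF germs_smult[OF xg], where n = n]) (simp add: n)
  qed
  show "x \<oplus>\<^bsub>germ_module\<^esub> y \<in> germ_null" if x: "x \<in> germ_null" and y: "y \<in> germ_null" for x y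
  proof -
    from x obtain n where xg: "x \<in> germs" and n: "\<And>p. late n p \<Longrightarrow> x p = \<zero>\<^bsub>M\<^esub>"
      by (auto simp: germ_null_def)
    from y obtain n' where yg: "y \<in> germs" and n': "\<And>p. late n' p \<Longrightarrow> y p = \<zero>\<^bsub>M\<^esub>"
      by (auto simp: germ_null_def)
    show ?thesis unfolding germ_module_simps
    proof (rule germ_nullI[OF germs_add[OF xg yg], where n = "max n n'"])
      fix p assume p: "late (max n n') p"
      show "x p \<oplus>\<^bsub>M\<^esub> y p = \<zero>\<^bsub>M\<^esub>"
        using n[OF late_mono[OF p max.cobounded1]] n'[OF late_mono[OF p max.cobounded2]] by simp
    qed
  qed
  fix x w assume x: "x \<in> germ_null" and w: "w \<in> words"
  have "y \<in> germ_null \<Longrightarrow> set w \<subseteq> gens G \<Longrightarrow> germ_word w y \<in> germ_null" for w y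
    by (induction w arbitrary: y) (simp_all add: germ_null_op)
  from this[OF x words_gens[OF w]] show "act germ_module x (basis_elem w) \<in> germ_null"
    using act_germ_word[OF _ w, of x] x by (simp add: germ_null_def)
qed

text \<open>This is how a relation a - b is verified modulo \<open>germ_null\<close>: the two
  actions have to agree on late paths only.\<close>

lemma act_germ_minus:
  assumes x: "x \<in> germs" and a: "a \<in> carrier FA" and b: "b \<in> carrier FA"
    and eq: "\<And>p. late n p \<Longrightarrow> act germ_module x a p = act germ_module x b p"
  shows "act germ_module x (a - b) \<in> germ_null"
proof (rule germ_nullI[where n = n])
  have xc: "x \<in> carrier germ_module" using x by simp
  show "act germ_module x (a - b) \<in> germs" using X.act_closed[OF xc FA_minus[OF a b]] by simp
  fix p assume p: "late n p"
  have ca: "act germ_module x a p \<in> carrier M" "act germ_module x b p \<in> carrier M"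
    using X.act_closed[OF xc a] X.act_closed[OF xc b] germsD(1) by simp_all
  have "act germ_module x (a - b) = (\<lambda>p. act germ_module x a p \<oplus>\<^bsub>M\<^esub> (-1) \<odot>\<^bsub>M\<^esub> act germ_module x b p)"
    using X.act_add_right[OF xc a FA_scale[OF b], of "-1"] X.act_smult_right[OF xc b, of "-1"]
    by (simp add: FA_minus_eq)
  then show "act germ_module x (a - b) p = \<zero>\<^bsub>M\<^esub>"
    using eq[OF p] ca by (simp add: M.sm_minus_one M.M.r_neg)
qed

lemma act_germ_zero: "x \<in> germs \<Longrightarrow> act germ_module x 0 = (\<lambda>_. \<zero>\<^bsub>M\<^esub>)"
  using act_zero_right[OF right_module_germ_module[unfolded FA_def], of x] by simp

text \<open>The elements e e* add up to the identity on paths whose first arc is in S, but give 0 at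
  a trivial path. This discrepancy is what \<open>germ_null\<close> absorbs.\<close>

lemma act_germ_sum:
  assumes x: "x \<in> germs" and S: "finite S" "S \<subseteq> arcs G"
  shows "act germ_module x (\<Sum>e \<in> S. basis_elem [Arrow e, Ghost e]) (u, []) = \<zero>\<^bsub>M\<^esub>"
    and "act germ_module x (\<Sum>e \<in> S. basis_elem [Arrow e, Ghost e]) (u, f # fs) =
      (if f \<in> S \<and> u = tail G f then x (u, f # fs) else \<zero>\<^bsub>M\<^esub>)"
proof -
  have xc: "x \<in> carrier germ_module" using x by simp
  have "act germ_module x (\<Sum>e \<in> S. basis_elem [Arrow e, Ghost e]) (u, []) = \<zero>\<^bsub>M\<^esub> \<and>
    act germ_module x (\<Sum>e \<in> S. basis_elem [Arrow e, Ghost e]) (u, f # fs) =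
      (if f \<in> S \<and> u = tail G f then x (u, f # fs) else \<zero>\<^bsub>M\<^esub>)"
    using S
  proof (induction S rule: finite_induct)
    case (insert e S)
    let ?y = "\<Sum>e \<in> S. basis_elem [Arrow e, Ghost e] :: ('v, 'e) gen list \<Rightarrow>\<^sub>0 'k"
    have w: "[Arrow e, Ghost e] \<in> words" using insert.prems by (simp add: words_Cons)
    have y: "?y \<in> carrier FA" using insert.prems by (intro sum_FA FA_basis) (auto simp: words_Cons)
    have "act germ_module x (basis_elem [Arrow e, Ghost e] + ?y) =
        (\<lambda>p. germ_word [Arrow e, Ghost e] x p \<oplus>\<^bsub>M\<^esub> act germ_module x ?y p)"
      using X.act_add_right[OF xc FA_basis[OF w] y] by (simp add: act_germ_word[OF x w])
    then show ?case
      using insert.IH insert.prems insert.hyps germsD(1)[OF x] by auto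
  qed (simp add: act_germ_zero[OF x])
  then show "act germ_module x (\<Sum>e \<in> S. basis_elem [Arrow e, Ghost e]) (u, []) = \<zero>\<^bsub>M\<^esub>"
    and "act germ_module x (\<Sum>e \<in> S. basis_elem [Arrow e, Ghost e]) (u, f # fs) =
      (if f \<in> S \<and> u = tail G f then x (u, f # fs) else \<zero>\<^bsub>M\<^esub>)" by blast+
qed

lemma act_germ_eps:
  assumes x: "x \<in> germs" and F: "finite F" "F \<subseteq> verts G"
  shows "act germ_module x (eps F) (u, es) = (if u \<in> F then x (u, es) else \<zero>\<^bsub>M\<^esub>)"
proof -
  have xc: "x \<in> carrier germ_module" using x by simp
  show ?thesis using F
  proof (induction F rule: finite_induct)
    case (insert v F)
    have w: "[Vertex v] \<in> words" using insert.prems by (simp add: words_Cons)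
    have y: "eps F \<in> carrier FA" using insert.prems by (intro eps_FA) simp
    have "eps (insert v F) = basis_elem [Vertex v] + eps F" using insert.hyps by (simp add: eps_def)
    then have "act germ_module x (eps (insert v F)) =
        (\<lambda>p. germ_word [Vertex v] x p \<oplus>\<^bsub>M\<^esub> act germ_module x (eps F) p)"
      using X.act_add_right[OF xc FA_basis[OF w] y] by (simp add: act_germ_word[OF x w])
    then show ?case
      using insert.IH insert.prems insert.hyps germsD(1)[OF x] by auto
  qed (simp add: eps_def act_germ_zero[OF x])
qed

text \<open>The first four families of relations hold at every path, whence n = 0. The last one can
  fail at the trivial path at v; since v is not a sink, that path is not late for n = 1.\<close>

lemma act_germ_relations:
  assumes x: "x \<in> germs" and r: "r \<in> leavitt_relations G"
  shows "act germ_module x r \<in> germ_null"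
proof -
  note W = act_germ_word[OF x]
  note op = fun_eq_iff split_paired_all
  have gh: "germ_op \<zero>\<^bsub>M\<^esub> (Ghost e) y (u, es) =
      (case es of [] \<Rightarrow> \<zero>\<^bsub>M\<^esub> | f # fs \<Rightarrow> if f = e \<and> u = tail G e then y (head G e, fs) else \<zero>\<^bsub>M\<^esub>)" for e y u es
    by (cases es) simp_all
  from r consider
    (1) v w where "r = basis_elem [Vertex v, Vertex w] - (if v = w then basis_elem [Vertex v] else 0)" "v \<in> verts G" "w \<in> verts G"
  | (2) y where "r = basis_elem [Vertex (gen_source G y), y] - basis_elem [y]" "y \<in> Arrow ` arcs G \<union> Ghost ` arcs G"
  | (3) y where "r = basis_elem [y, Vertex (gen_target G y)] - basis_elem [y]" "y \<in> Arrow ` arcs G \<union> Ghost ` arcs G"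
  | (4) e f where "r = basis_elem [Ghost e, Arrow f] - (if e = f then basis_elem [Vertex (head G e)] else 0)" "e \<in> arcs G" "f \<in> arcs G"
  | (5) v where "r = basis_elem [Vertex v] - (\<Sum>e \<in> out_arcs G v. basis_elem [Arrow e, Ghost e])" "v \<in> verts G" "\<not> is_sink G v"
    unfolding leavitt_relations_def by blast
  then show ?thesis
  proof cases
    case 1
    have w: "[Vertex v, Vertex w] \<in> words" "[Vertex v] \<in> words" using 1 by (simp_all add: words_Cons)
    show ?thesis unfolding 1(1)
    proof (rule act_germ_minus[OF x, where n = 0])
      show "(if v = w then basis_elem [Vertex v] else 0) \<in> carrier FA" using w by (cases "v = w") simp_all
      have "act germ_module x (if v = w then basis_elem [Vertex v] else 0) = (if v = w then germ_word [Vertex v] x else (\<lambda>_. \<zero>\<^bsub>M\<^esub>))"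
        using W[OF w(2)] act_germ_zero[OF x] by (cases "v = w") simp_all
      then show "act germ_module x (basis_elem [Vertex v, Vertex w]) p = act germ_module x (if v = w then basis_elem [Vertex v] else 0) p" for p
        unfolding W[OF w(1)] by (cases p) simp
    qed (use w in simp)
  next
    case 2
    have y: "gen_source G y \<in> verts G" "y \<in> gens G" using gen_source_gens[OF 2(2)] by simp_all
    have w: "[Vertex (gen_source G y), y] \<in> words" "[y] \<in> words" using y by (simp_all add: words_Cons)
    show ?thesis unfolding 2(1)
    proof (rule act_germ_minus[OF x FA_basis[OF w(1)] FA_basis[OF w(2)], where n = 0])
      show "act germ_module x (basis_elem [Vertex (gen_source G y), y]) p = act germ_module x (basis_elem [y]) p" for p
        unfolding W[OF w(1)] W[OF w(2)] using 2(2) by (cases p) (auto simp: gh split: list.splits)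
    qed
  next
    case 3
    have y: "gen_target G y \<in> verts G" "y \<in> gens G" using gen_source_gens[OF 3(2)] by simp_all
    have w: "[y, Vertex (gen_target G y)] \<in> words" "[y] \<in> words" using y by (simp_all add: words_Cons)
    show ?thesis unfolding 3(1)
    proof (rule act_germ_minus[OF x FA_basis[OF w(1)] FA_basis[OF w(2)], where n = 0])
      show "act germ_module x (basis_elem [y, Vertex (gen_target G y)]) p = act germ_module x (basis_elem [y]) p" for p
        unfolding W[OF w(1)] W[OF w(2)] using 3(2) by (cases p) (auto simp: gh split: list.splits)
    qed
  next
    case 4
    have w: "[Ghost e, Arrow f] \<in> words" "[Vertex (head G e)] \<in> words" using 4 by (simp_all add: words_Cons)
    show ?thesis unfolding 4(1)
    proof (rule act_germ_minus[OF x, where n = 0])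
      show "(if e = f then basis_elem [Vertex (head G e)] else 0) \<in> carrier FA" using w by (cases "e = f") simp_all
      have "act germ_module x (if e = f then basis_elem [Vertex (head G e)] else 0) = (if e = f then germ_word [Vertex (head G e)] x else (\<lambda>_. \<zero>\<^bsub>M\<^esub>))"
        using W[OF w(2)] act_germ_zero[OF x] by (cases "e = f") simp_all
      then show "act germ_module x (basis_elem [Ghost e, Arrow f]) p = act germ_module x (if e = f then basis_elem [Vertex (head G e)] else 0) p" for p
        unfolding W[OF w(1)] by (cases p) auto
    qed (use w in simp)
  next
    case 5
    have w: "[Vertex v] \<in> words" using 5 by (simp add: words_Cons)
    have S: "finite (out_arcs G v)" "out_arcs G v \<subseteq> arcs G" using row_finite 5(2) by (auto simp: row_finite_def)
    show ?thesis unfolding 5(1)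
    proof (rule act_germ_minus[OF x FA_basis[OF w], where n = 1])
      show "(\<Sum>e \<in> out_arcs G v. basis_elem [Arrow e, Ghost e]) \<in> carrier FA"
        using S(2) by (intro sum_FA FA_basis) (auto simp: words_Cons)
      fix p assume p: "late 1 p"
      obtain u es where ues: "p = (u, es)" by (cases p)
      show "act germ_module x (basis_elem [Vertex v]) p = act germ_module x (\<Sum>e \<in> out_arcs G v. basis_elem [Arrow e, Ghost e]) p"
      proof (cases es)
        case Nil
        then have "u \<noteq> v" using p ues 5(3) by (auto simp: late_def)
        then show ?thesis unfolding W[OF w] ues Nil act_germ_sum(1)[OF x S] by simp
      next
        case (Cons f fs)
        then have "f \<in> arcs G" "u = tail G f" using p ues by (simp_all add: late_def)
        then show ?thesis unfolding W[OF w] ues Cons act_germ_sum(2)[OF x S] by simp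
      qed
    qed
  qed
qed

text \<open>The formal rule (y p) q = y (p q).\<close>

lemma germ_word_path:
  "(u, es) \<in> paths G \<Longrightarrow> germ_word (path_word (u, es)) x (w, fs) = (if w = path_end G (u, es) then x (u, es @ fs) else \<zero>\<^bsub>M\<^esub>)"
proof (induction es arbitrary: u x)
  case (Cons e es)
  from Cons.prems have e: "e \<in> arcs G" "u = tail G e" and q: "(head G e, es) \<in> paths G" by simp_all
  let ?y = "germ_op \<zero>\<^bsub>M\<^esub> (Arrow e) (germ_op \<zero>\<^bsub>M\<^esub> (Vertex u) x)"
  \<comment> \<open>\<open>Arrow e\<close> yields a germ supported on paths starting at the head of
    e, so the leading vertex of the remaining path may be inserted.\<close>
  have "germ_op \<zero>\<^bsub>M\<^esub> (Vertex (head G e)) ?y = ?y" by (auto simp: fun_eq_iff)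
  then have "germ_word (path_word (u, e # es)) x = germ_word (path_word (head G e, es)) ?y" by simp
  with Cons.IH[OF q, of ?y] e(2) show ?case by (simp del: path_word.simps split: if_splits)
qed simp

text \<open>Coherence for single arcs propagates along r. If r has an arc, q does not end at a sink,
  so q has n arcs and all its extensions are late.\<close>

lemma coherent_extend:
  assumes x: "x \<in> germs" and n: "coherent n x" and q: "q \<in> level_paths G n"
    and r: "r \<in> paths G" "path_end G q = fst r"
  shows "x (fst q, snd q @ snd r) = pact M (x q) r"
proof -
  note qp = level_paths_paths[OF q]
  have "(path_end G q, fs) \<in> paths G \<Longrightarrow> x (fst q, snd q @ fs) = pact M (x q) (path_end G q, fs)" for fs
  proof (induction fs rule: rev_induct)
    case Nil
    then show ?case using germsD(3)[OF x qp] by simp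
  next
    case (snoc e fs)
    let ?w = "path_end G q"
    from snoc.prems have fs: "(?w, fs) \<in> paths G" and e: "e \<in> out_arcs G (path_end G (?w, fs))" by auto
    have qe: "path_end G (fst q, snd q @ fs) = path_end G (?w, fs)"
      using path_end_append[of "fst q" "snd q" fs] by simp
    have "\<not> is_sink G ?w"
      using snoc.prems by (cases fs) (auto simp: is_sink_def)
    then have "n \<le> length (snd q)" using q by (auto simp: level_paths_def)
    moreover have "(fst q, snd q @ fs) \<in> paths G" using qp fs by simp
    ultimately have "late n (fst q, snd q @ fs)" by (simp add: late_def)
    from coherentD[OF n this] e qe
    have "x (fst q, (snd q @ fs) @ [e]) = pact M (x (fst q, snd q @ fs)) (path_end G (?w, fs), [e])" by simp
    also have "\<dots> = pact M (pact M (x q) (?w, fs)) (path_end G (?w, fs), [e])" using snoc.IH[OF fs] by simp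
    also have "\<dots> = pact M (x q) (?w, fs @ [e])"
      using pact_concat[OF M germsD(1)[OF x] fs arc_path[OF e]] by simp
    finally show ?case by simp
  qed
  with r show ?thesis by (cases r) simp
qed

text \<open>The germ that represents the image of m in the localization; it is coherent from level
  0.\<close>

definition eta_germ :: "'m \<Rightarrow> 'v \<times> 'e list \<Rightarrow> 'm" where
  "eta_germ m p = (if p \<in> paths G then pact M m p else \<zero>\<^bsub>M\<^esub>)"

lemma eta_germ_germs:
  assumes m: "m \<in> carrier M" shows "eta_germ m \<in> germs"
proof -
  from UM m obtain F where F: "finite F" "F \<subseteq> verts G" "\<And>p. p \<in> paths G \<Longrightarrow> fst p \<notin> F \<Longrightarrow> pact M m p = \<zero>\<^bsub>M\<^esub>"
    by (rule UM_support) blast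
  show ?thesis
  proof (rule germsI[where F = F and n = 0])
    show "eta_germ m p \<in> carrier M" for p using pact_closed[OF M m] by (simp add: eta_germ_def)
    show "pact M (eta_germ m p) (path_end G p, []) = eta_germ m p" if p: "p \<in> paths G" for p
    proof -
      have "(path_end G p, []) \<in> paths G" using path_end_verts[of "fst p" "snd p"] p by simp
      from pact_concat[OF M m p this] p show ?thesis by (simp add: eta_germ_def)
    qed
    show "coherent 0 (eta_germ m)"
    proof (rule coherentI)
      fix u es e assume *: "late 0 (u, es)" "e \<in> out_arcs G (path_end G (u, es))"
      then have p: "(u, es) \<in> paths G" by (simp add: late_def)
      then have pe: "(u, es @ [e]) \<in> paths G" using *(2) by simp
      from pact_concat[OF M m p arc_path[OF *(2)]] p pe
      show "eta_germ m (u, es @ [e]) = pact M (eta_germ m (u, es)) (path_end G (u, es), [e])"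
        unfolding eta_germ_def by simp
    qed
  qed (use F in \<open>auto simp: eta_germ_def\<close>)
qed

lemma germ_word_eta:
  assumes m: "m \<in> carrier M" and p: "p \<in> paths G"
  shows "germ_word (path_word p) (eta_germ m) = eta_germ (pact M m p)"
proof
  fix r :: "'v \<times> 'e list"
  obtain u es w fs where pr: "p = (u, es)" "r = (w, fs)" by (cases p, cases r)
  note gw = germ_word_path[OF p[unfolded pr(1)], of "eta_germ m" w fs]
  show "germ_word (path_word p) (eta_germ m) r = eta_germ (pact M m p) r"
  proof (cases "r \<in> paths G")
    case True
    then show ?thesis
      using pact_concat[OF M m p True] p unfolding pr gw by (auto simp: eta_germ_def)
  next
    case False
    then show ?thesis unfolding pr gw by (auto simp: eta_germ_def)
  qed
qed

text \<open>The product of a germ with q in \<open>E_n\<close> is the germ of its value at q. Hence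
  some level sends every element of the localization into the image of M.\<close>

lemma germ_word_coherent:
  assumes x: "x \<in> germs" and n: "coherent n x" and q: "q \<in> level_paths G n"
  shows "germ_word (path_word q) x = eta_germ (x q)"
proof
  fix r :: "'v \<times> 'e list"
  obtain u es w fs where qr: "q = (u, es)" "r = (w, fs)" by (cases q, cases r)
  note qp = level_paths_paths[OF q]
  note gw = germ_word_path[OF qp[unfolded qr(1)], of x w fs]
  show "germ_word (path_word q) x r = eta_germ (x q) r"
  proof (cases "r \<in> paths G")
    case True
    show ?thesis
    proof (cases "w = path_end G q")
      case w: True
      then show ?thesis using coherent_extend[OF x n q True] True unfolding qr gw by (simp add: eta_germ_def)
    next
      case False
      have "(path_end G q, []) \<in> paths G" using path_end_verts[of u es] qp qr by simp
      from pact_concat[OF M germsD(1)[OF x] this True, of q]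
      have "pact M (x q) r = (if path_end G q = fst r then pact M (x q) (path_end G q, snd r) else \<zero>\<^bsub>M\<^esub>)"
        unfolding germsD(3)[OF x qp] path_end_Nil fst_conv snd_conv append_Nil .
      with False have "pact M (x q) r = \<zero>\<^bsub>M\<^esub>" using qr by simp
      then show ?thesis using False True unfolding qr gw by (simp add: eta_germ_def)
    qed
  next
    case False
    then have "x (u, es @ fs) = \<zero>\<^bsub>M\<^esub>" if "w = path_end G (u, es)"
      using germsD(2)[OF x, of "(u, es @ fs)"] that qr by simp
    then show ?thesis using False unfolding qr gw by (simp add: eta_germ_def)
  qed
qed

text \<open>The localization is the quotient of the germs by \<open>germ_null\<close>, realized in
  the type where \<pi> takes its values. If the germ of m is null, m p = 0 for all p late enough,
  which puts m into the hat.\<close>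

lemma localization_from_fibre_map:
  fixes \<pi> :: "('v \<times> 'e list \<Rightarrow> 'm) \<Rightarrow> 'n"
  assumes fib: "\<And>x y. \<lbrakk>x \<in> carrier germ_module; y \<in> carrier germ_module\<rbrakk>
      \<Longrightarrow> \<pi> x = \<pi> y \<longleftrightarrow> x \<ominus>\<^bsub>germ_module\<^esub> y \<in> germ_null"
  shows "localization M (leavitt_module (image_module germ_module \<pi>)) (\<lambda>m. \<pi> (eta_germ m))"
proof -
  let ?I = "image_module germ_module \<pi>"
  let ?N = "leavitt_module ?I"
  note ax = closed_FA right_module_germ_module submod_germ_null fib
  have N0: "right_module FA ?I" and \<pi>: "rhom FA germ_module ?I \<pi>" and c: "carrier ?I = \<pi> ` germs"
    and z: "\<And>x. x \<in> germs \<Longrightarrow> \<pi> x = \<zero>\<^bsub>?I\<^esub> \<longleftrightarrow> x \<in> germ_null"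
    using image_module_right_module[OF ax] image_module_rhom[OF ax] image_module_carrier[OF ax]
      image_module_zero_iff[OF ax] by simp_all
  have rel: "act ?I m r = \<zero>\<^bsub>?I\<^esub>" if m: "m \<in> carrier ?I" and r: "r \<in> leavitt_relations G" for m r
  proof -
    from m c obtain x where x: "x \<in> germs" "m = \<pi> x" by blast
    have n: "act germ_module x r \<in> germ_null" by (rule act_germ_relations[OF x(1) r])
    then have g: "act germ_module x r \<in> germs" by (simp add: germ_null_def)
    have "act ?I (\<pi> x) r = \<pi> (act germ_module x r)"
      using rhom_act[OF \<pi>, of x r] x(1) relations_FA[OF r] by simp
    with z[OF g] n x(2) show ?thesis by simp
  qed
  have N: "right_module LA ?N" by (rule right_module_leavitt_module[OF N0 rel])
  have Nc: "carrier ?N = \<pi> ` germs" and Nz: "\<zero>\<^bsub>?N\<^esub> = \<zero>\<^bsub>?I\<^esub>"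
    by (simp_all add: leavitt_module_def c)
  have actN: "act ?N (\<pi> x) (co a) = \<pi> (act germ_module x a)" if "x \<in> germs" "a \<in> carrier FA" for x a
  proof -
    have "\<pi> x \<in> carrier ?I" using that c by simp
    from act_leavitt_module[OF N0 rel this that(2)] rhom_act[OF \<pi>, of x a] that show ?thesis by simp
  qed
  have gactN: "gact ?N (\<pi> x) g = \<pi> (germ_op \<zero>\<^bsub>M\<^esub> g x)" if x: "x \<in> germs" and g: "g \<in> gens G" for x g
  proof -
    have w: "[g] \<in> words" using g by (simp add: words_Cons)
    show ?thesis unfolding gact_def actN[OF x FA_basis[OF w]] act_germ_word[OF x w] by simp
  qed
  have wactN: "x \<in> germs \<Longrightarrow> set w \<subseteq> gens G \<Longrightarrow> foldl (gact ?N) (\<pi> x) w = \<pi> (germ_word w x)" for x w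
    by (induction w arbitrary: x) (simp_all add: gactN germ_op_closed)
  have pactN: "pact (restr ?N) (\<pi> x) p = \<pi> (germ_word (path_word p) x)" if x: "x \<in> germs" and p: "p \<in> paths G" for x p
  proof -
    have "\<pi> x \<in> carrier ?N" using x Nc by simp
    from pact_restr[OF N p this] wactN[OF x path_word_gens[OF p]] show ?thesis by simp
  qed
  have UMN: "L.UM ?N"
    unfolding L.UM_iff
  proof (intro conjI ballI)
    fix y assume "y \<in> carrier ?N"
    then obtain x where x: "x \<in> germs" "y = \<pi> x" using Nc by blast
    from germsD(4)[OF x(1)] obtain F where F: "finite F" "F \<subseteq> verts G" "\<And>p. fst p \<notin> F \<Longrightarrow> x p = \<zero>\<^bsub>M\<^esub>" by blast
    have "act germ_module x (eps F) = x"
    proof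
      fix p show "act germ_module x (eps F) p = x p"
        using act_germ_eps[OF x(1) F(1,2)] F(3)[of p] by (cases p) simp
    qed
    then have "act ?N y (co (eps F)) = y" using actN[OF x(1) eps_FA[OF F(2)]] x(2) by simp
    then show "\<exists>a\<in>carrier LA. act ?N y a = y" by (rule bexI) (rule co_LA[OF eps_FA[OF F(2)]])
  qed (rule N)
  have \<alpha>: "rhom PA M (restr ?N) (\<lambda>m. \<pi> (eta_germ m))"
    unfolding path_algebra_def
  proof (rule act_basis_hom[OF M[unfolded path_algebra_def] right_module_restr[OF N, unfolded path_algebra_def]])
    show "(\<lambda>m. \<pi> (eta_germ m)) \<in> carrier M \<rightarrow> carrier (restr ?N)"
      using eta_germ_germs Nc by simp
    have Nadd: "add (restr ?N) = add ?I" and Nsmult: "module.smult (restr ?N) = module.smult ?I"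
      by (simp_all add: leavitt_module_def)
    fix x assume x: "x \<in> carrier M"
    show "\<pi> (eta_germ (x \<oplus>\<^bsub>M\<^esub> y)) = \<pi> (eta_germ x) \<oplus>\<^bsub>restr ?N\<^esub> \<pi> (eta_germ y)" if y: "y \<in> carrier M" for y
    proof -
      have "eta_germ (x \<oplus>\<^bsub>M\<^esub> y) = (\<lambda>p. eta_germ x p \<oplus>\<^bsub>M\<^esub> eta_germ y p)"
        using x y by (auto simp: eta_germ_def fun_eq_iff M.act_add_left)
      then show ?thesis
        unfolding Nadd using rhom_add[OF \<pi>, of "eta_germ x" "eta_germ y"] eta_germ_germs x y by simp
    qed
    show "\<pi> (eta_germ (c \<odot>\<^bsub>M\<^esub> x)) = c \<odot>\<^bsub>restr ?N\<^esub> \<pi> (eta_germ x)" for c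
    proof -
      have "eta_germ (c \<odot>\<^bsub>M\<^esub> x) = (\<lambda>p. c \<odot>\<^bsub>M\<^esub> eta_germ x p)"
        using x by (auto simp: eta_germ_def fun_eq_iff M.act_smult_left)
      then show ?thesis
        unfolding Nsmult using rhom_smult[OF \<pi>, of "eta_germ x" c] eta_germ_germs x by simp
    qed
    show "\<pi> (eta_germ (pact M x p)) = pact (restr ?N) (\<pi> (eta_germ x)) p" if p: "p \<in> paths G" for p
      using pactN[OF eta_germ_germs[OF x] p] germ_word_eta[OF x p] by simp
  qed
  show ?thesis
    unfolding localization_def
  proof (intro conjI ballI impI subsetI UM UMN \<alpha>)
    fix m assume m: "m \<in> carrier M" and "\<pi> (eta_germ m) = \<zero>\<^bsub>?N\<^esub>"
    then have "eta_germ m \<in> germ_null" using z[OF eta_germ_germs[OF m]] Nz by simp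
    then obtain n where n: "\<And>p. late n p \<Longrightarrow> eta_germ m p = \<zero>\<^bsub>M\<^esub>" by (auto simp: germ_null_def)
    show "m \<in> sat M {\<zero>\<^bsub>M\<^esub>}"
    proof (rule satI[OF m, where n = n])
      fix p assume p: "p \<in> level_paths G n"
      show "pact M m p \<in> {\<zero>\<^bsub>M\<^esub>}"
        using n[OF level_late[OF p]] level_paths_paths[OF p] by (simp add: eta_germ_def)
    qed
  next
    fix y assume y: "y \<in> carrier ?N"
    then obtain x where x: "x \<in> germs" "y = \<pi> x" using Nc by blast
    from germsD(5)[OF x(1)] obtain n where n: "coherent n x" by blast
    show "y \<in> sat (restr ?N) ((\<lambda>m. \<pi> (eta_germ m)) ` carrier M)"
    proof (rule satI[where n = n])
      show "y \<in> carrier (restr ?N)" using y by simp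
      fix q assume q: "q \<in> level_paths G n"
      have "pact (restr ?N) y q = \<pi> (eta_germ (x q))"
        using pactN[OF x(1) level_paths_paths[OF q]] germ_word_coherent[OF x(1) n q] x(2) by simp
      with germsD(1)[OF x(1), of q] show "pact (restr ?N) y q \<in> (\<lambda>m. \<pi> (eta_germ m)) ` carrier M" by blast
    qed
  qed
qed

text \<open>By \<open>coherent_extend\<close> the values on \<open>E_n\<close> determine those on
  all late paths.\<close>

lemma germ_minus_null:
  assumes x: "x \<in> germs" and y: "y \<in> germs" and n: "coherent n x" "coherent n y"
    and eq: "\<And>p. p \<in> level_paths G n \<Longrightarrow> x p = y p"
  shows "x \<ominus>\<^bsub>germ_module\<^esub> y \<in> germ_null"
proof (rule germ_nullI[where n = n])
  have c: "x \<in> carrier germ_module" "y \<in> carrier germ_module" using x y by simp_all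
  show "x \<ominus>\<^bsub>germ_module\<^esub> y \<in> germs" using X.M.minus_closed[OF c] by simp
  have m: "x \<ominus>\<^bsub>germ_module\<^esub> y = (\<lambda>p. x p \<oplus>\<^bsub>M\<^esub> (-1) \<odot>\<^bsub>M\<^esub> y p)"
    unfolding a_minus_def X.sm_minus_one[OF c(2), symmetric] by simp
  fix p assume "late n p"
  then obtain q r where q: "q \<in> level_paths G n" and r: "r \<in> paths G" "path_end G q = fst r"
    and p: "p = (fst q, snd q @ snd r)" by (rule late_split)
  have "x p = y p"
    using coherent_extend[OF x n(1) q r] coherent_extend[OF y n(2) q r] eq[OF q] p by simp
  then show "(x \<ominus>\<^bsub>germ_module\<^esub> y) p = \<zero>\<^bsub>M\<^esub>"
    unfolding m using germsD(1)[OF y, of p] by (simp add: M.sm_minus_one M.M.r_neg)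
qed

text \<open>The arcs of a path determine its source unless the path is a vertex; a nonzero value at a vertex
  determines the vertex, so the vertices, of which there may be too many, need not be recorded.\<close>

definition germ_data :: "nat \<Rightarrow> ('v \<times> 'e list \<Rightarrow> 'm) \<Rightarrow> ('e list \<times> 'm) set" where
  "germ_data n x = (\<lambda>p. (snd p, x p)) ` {p \<in> level_paths G n. x p \<noteq> \<zero>\<^bsub>M\<^esub>}"

text \<open>Nonzero values occur on paths from finitely many vertices, and each vertex starts
  finitely many paths of \<open>E_n\<close>.\<close>

lemma finite_germ_data:
  assumes x: "x \<in> germs" shows "finite (germ_data n x)"
proof -
  from germsD(4)[OF x] obtain F where F: "finite F" "F \<subseteq> verts G" "\<And>p. fst p \<notin> F \<Longrightarrow> x p = \<zero>\<^bsub>M\<^esub>" by blast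
  have "{p \<in> level_paths G n. x p \<noteq> \<zero>\<^bsub>M\<^esub>} \<subseteq> (\<Union>v \<in> F. {p \<in> level_paths G n. fst p = v})"
    using F(3) by auto
  moreover have "finite (\<Union>v \<in> F. {p \<in> level_paths G n. fst p = v})"
    using F(1,2) by (intro finite_UN_I finite_level_paths) auto
  ultimately show ?thesis unfolding germ_data_def by (intro finite_imageI) (rule finite_subset)
qed

lemma path_arcs: "(u, es) \<in> paths G \<Longrightarrow> set es \<subseteq> arcs G"
  by (induction es arbitrary: u) auto

lemma germ_data_arcs: "germ_data n x \<subseteq> lists (arcs G) \<times> UNIV"
proof
  fix d assume "d \<in> germ_data n x"
  then obtain u es where "(u, es) \<in> level_paths G n" "d = (es, x (u, es))" by (auto simp: germ_data_def)
  with path_arcs[OF level_paths_paths] show "d \<in> lists (arcs G) \<times> UNIV" by auto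
qed

lemma germ_data_subset:
  assumes x: "x \<in> germs" and y: "y \<in> germs" and D: "germ_data n x \<subseteq> germ_data n y"
    and p: "p \<in> level_paths G n" and nz: "x p \<noteq> \<zero>\<^bsub>M\<^esub>"
  shows "y p = x p"
proof -
  have "(snd p, x p) \<in> germ_data n x" using p nz by (auto simp: germ_data_def)
  with D have "(snd p, x p) \<in> germ_data n y" by blast
  then obtain p' where p': "p' \<in> level_paths G n" "snd p = snd p'" "x p = y p'" by (auto simp: germ_data_def)
  obtain u es u' where ues: "p = (u, es)" "p' = (u', es)" using p'(2) by (cases p, cases p') simp
  note pp = level_paths_paths[OF p] and pp' = level_paths_paths[OF p'(1)]
  have "u' = u"
  proof (cases es)
    case Nil
    then have v: "(u, []) \<in> paths G" "(u', []) \<in> paths G" using pp pp' ues by simp_all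
    \<comment> \<open>Both vertices fix the common nonzero value, and products of distinct vertices
      vanish.\<close>
    have 1: "pact M (x p) (u, []) = x p" using germsD(3)[OF x pp] ues Nil by simp
    have 2: "pact M (x p) (u', []) = x p" using germsD(3)[OF y pp'] ues Nil p'(3) by simp
    from pact_concat[OF M germsD(1)[OF x] v, of p] show ?thesis
      unfolding 1 2 using nz by (auto split: if_splits)
  next
    case (Cons e es')
    then show ?thesis using pp pp' ues by simp
  qed
  with p'(3) ues show ?thesis by simp
qed

text \<open>Modulo \<open>germ_null\<close> a germ is determined by a level from which it is
  coherent and by its finite data at that level. The size conditions on \<open>'m\<close> allow arc
  lists, values and levels to be coded together by one element of \<open>'m\<close>.\<close>

lemma localization_exists:
  assumes inf: "infinite (UNIV :: 'm set)" and arcs: "arcs G \<lesssim> (UNIV :: 'm set)"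
  obtains N :: "('k, ('v, 'e, 'k) leavitt_elem, 'm) rmodule" and \<alpha> where "localization M N \<alpha>"
proof -
  obtain enc :: "'m list \<Rightarrow> 'm" and prd :: "'m \<times> 'm \<Rightarrow> 'm" and num :: "nat \<Rightarrow> 'm"
    where enc: "inj enc" and prd: "inj prd" and num: "inj num"
    using list_injection_exists[OF inf] .
  obtain j :: "'e \<Rightarrow> 'm" where j: "inj_on j (arcs G)" using arcs unfolding lepoll_def by blast
  define f where "f = (\<lambda>(es, m). prd (enc (map j es), m))"
  have f: "inj_on f (lists (arcs G) \<times> UNIV)"
  proof (rule inj_onI)
    fix d d' assume d: "d \<in> lists (arcs G) \<times> (UNIV :: 'm set)" "d' \<in> lists (arcs G) \<times> UNIV" and eq: "f d = f d'"
    obtain es m es' m' where dd: "d = (es, m)" "d' = (es', m')" by (cases d, cases d')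
    with d have es: "es \<in> lists (arcs G)" "es' \<in> lists (arcs G)" by simp_all
    from eq dd have "map j es = map j es'" "m = m'" by (simp_all add: f_def inj_eq[OF prd] inj_eq[OF enc])
    moreover have "inj_on j (set es \<union> set es')" using es by (intro inj_on_subset[OF j]) auto
    from inj_on_map_eq_map[OF this] \<open>map j es = map j es'\<close> have "es = es'" by (rule iffD1)
    ultimately show "d = d'" by (simp add: dd)
  qed
  define lev where "lev x = (SOME n. coherent n x)" for x
  define lis where "lis x = (SOME l. set l = germ_data (lev x) x)" for x
  define code where "code x = enc [num (lev x), enc (map f (lis x))]" for x
  have lev: "coherent (lev x) x" if "x \<in> germs" for x
    unfolding lev_def by (rule someI_ex[OF germsD(5)[OF that]])
  have lis: "set (lis x) = germ_data (lev x) x" if "x \<in> germs" for x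
    unfolding lis_def by (rule someI_ex) (rule finite_list[OF finite_germ_data[OF that]])
  have code: "x \<ominus>\<^bsub>germ_module\<^esub> y \<in> germ_null"
    if "x \<in> carrier germ_module" "y \<in> carrier germ_module" and eq: "code x = code y" for x y
  proof -
    from that have x: "x \<in> germs" and y: "y \<in> germs" by simp_all
    have "[num (lev x), enc (map f (lis x))] = [num (lev y), enc (map f (lis y))]"
      using eq unfolding code_def inj_eq[OF enc] .
    then have n: "lev x = lev y" and m: "map f (lis x) = map f (lis y)"
      by (simp_all add: inj_eq[OF num] inj_eq[OF enc])
    have "inj_on f (set (lis x) \<union> set (lis y))"
      unfolding lis[OF x] lis[OF y] by (intro inj_on_subset[OF f] Un_least germ_data_arcs)
    from inj_on_map_eq_map[OF this] m have "lis x = lis y" by (rule iffD1)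
    then have D: "germ_data (lev x) x = germ_data (lev x) y" using lis[OF x] lis[OF y] n by (simp only:)
    show ?thesis
    proof (rule germ_minus_null[OF x y lev[OF x]])
      show "coherent (lev x) y" unfolding n by (rule lev[OF y])
      fix p assume p: "p \<in> level_paths G (lev x)"
      show "x p = y p"
      proof (cases "x p = \<zero>\<^bsub>M\<^esub> \<and> y p = \<zero>\<^bsub>M\<^esub>")
        case False
        then show ?thesis
          using germ_data_subset[OF x y equalityD1[OF D] p, symmetric] germ_data_subset[OF y x equalityD2[OF D] p]
          by blast
      qed simp
    qed
  qed
  show thesis
  proof (rule fibre_map_exists[OF right_module_germ_module submod_germ_null code])
    fix \<pi> :: "('v \<times> 'e list \<Rightarrow> 'm) \<Rightarrow> 'm"
    assume fib: "\<And>x y. \<lbrakk>x \<in> carrier germ_module; y \<in> carrier germ_module\<rbrakk>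
      \<Longrightarrow> \<pi> x = \<pi> y \<longleftrightarrow> x \<ominus>\<^bsub>germ_module\<^esub> y \<in> germ_null"
    show thesis by (rule that, rule localization_from_fibre_map, rule fib)
  qed
qed

end

end

section \<open>Equivalences of categories\<close>

text \<open>An arrow g of D is conjugated by chosen isomorphisms with objects in the image of F,
  giving \<open>T g\<close>, and then lifted to C. As F is faithful, functor laws and the naturality
  of the unit can be verified in D.\<close>

lemma equivalence_of_fully_faithful:
  fixes C :: "('o, 'a) cat" and D :: "('p, 'b) cat"
  assumes F: "covariant_functor C D Fo Fa"
    and full: "\<And>a b g. \<lbrakk>a \<in> Obj C; b \<in> Obj C; g \<in> hom_set D (Fo a) (Fo b)\<rbrakk> \<Longrightarrow> \<exists>f \<in> hom_set C a b. Fa f = g"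
    and faithful: "\<And>a b f f'. \<lbrakk>f \<in> hom_set C a b; f' \<in> hom_set C a b; Fa f = Fa f'\<rbrakk> \<Longrightarrow> f = f'"
    and es: "\<And>d. d \<in> Obj D \<Longrightarrow> \<exists>a \<in> Obj C. \<exists>i \<in> hom_set D (Fo a) d. \<exists>j \<in> hom_set D d (Fo a).
      i \<cdot>\<^bsub>D\<^esub> j = Ident D d \<and> j \<cdot>\<^bsub>D\<^esub> i = Ident D (Fo a)"
  shows "equivalent_categories C D"
proof -
  interpret F: covariant_functor C D Fo Fa by fact
  obtain Go i j where G: "\<And>d. d \<in> Obj D \<Longrightarrow> Go d \<in> Obj C" "\<And>d. d \<in> Obj D \<Longrightarrow> i d \<in> hom_set D (Fo (Go d)) d"
    "\<And>d. d \<in> Obj D \<Longrightarrow> j d \<in> hom_set D d (Fo (Go d))" "\<And>d. d \<in> Obj D \<Longrightarrow> i d \<cdot>\<^bsub>D\<^esub> j d = Ident D d"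
    "\<And>d. d \<in> Obj D \<Longrightarrow> j d \<cdot>\<^bsub>D\<^esub> i d = Ident D (Fo (Go d))"
    using es by metis
  define lft where "lft a b g = (SOME f. f \<in> hom_set C a b \<and> Fa f = g)" for a b g
  have lft: "lft a b g \<in> hom_set C a b" "Fa (lft a b g) = g"
    if "a \<in> Obj C" "b \<in> Obj C" "g \<in> hom_set D (Fo a) (Fo b)" for a b g
  proof -
    have "\<exists>f. f \<in> hom_set C a b \<and> Fa f = g" using full[OF that] by blast
    from someI_ex[OF this] show "lft a b g \<in> hom_set C a b" "Fa (lft a b g) = g" by (simp_all add: lft_def)
  qed
  have homD: "g \<in> hom_set D c d \<Longrightarrow> c \<in> Obj D \<and> d \<in> Obj D \<and> Dom D g = c \<and> Cod D g = d" for g c d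
    using F.D.Dom_Obj F.D.Cod_Obj by (auto simp: hom_set_def)
  have homC: "g \<in> hom_set C c d \<Longrightarrow> c \<in> Obj C \<and> d \<in> Obj C \<and> Dom C g = c \<and> Cod C g = d" for g c d
    using F.C.Dom_Obj F.C.Cod_Obj by (auto simp: hom_set_def)
  define T where "T g = j (Cod D g) \<cdot>\<^bsub>D\<^esub> (g \<cdot>\<^bsub>D\<^esub> i (Dom D g))" for g
  define Ga where "Ga g = lft (Go (Dom D g)) (Go (Cod D g)) (T g)" for g
  have T: "T g = j d \<cdot>\<^bsub>D\<^esub> (g \<cdot>\<^bsub>D\<^esub> i c)" "T g \<in> hom_set D (Fo (Go c)) (Fo (Go d))" if g: "g \<in> hom_set D c d" for g c d
  proof -
    note c = homD[OF g]
    show 1: "T g = j d \<cdot>\<^bsub>D\<^esub> (g \<cdot>\<^bsub>D\<^esub> i c)" using c by (simp add: T_def)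
    show "T g \<in> hom_set D (Fo (Go c)) (Fo (Go d))"
      unfolding 1 using c by (intro F.D.Comp_hom[OF F.D.Comp_hom[OF G(2) g] G(3)]) blast+
  qed
  have Ga: "Ga g \<in> hom_set C (Go c) (Go d)" "Fa (Ga g) = T g" if g: "g \<in> hom_set D c d" for g c d
  proof -
    note c = homD[OF g]
    then have e: "Ga g = lft (Go c) (Go d) (T g)" by (simp add: Ga_def)
    have o: "Go c \<in> Obj C" "Go d \<in> Obj C" using c G(1) by blast+
    show "Ga g \<in> hom_set C (Go c) (Go d)" "Fa (Ga g) = T g" unfolding e by (rule lft[OF o T(2)[OF g]])+
  qed
  have iT: "i d \<cdot>\<^bsub>D\<^esub> T g = g \<cdot>\<^bsub>D\<^esub> i c" if g: "g \<in> hom_set D c d" for g c d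
  proof -
    from homD[OF g] have c: "c \<in> Obj D" and d: "d \<in> Obj D" by blast+
    note gi = F.D.Comp_hom[OF G(2)[OF c] g]
    have "i d \<cdot>\<^bsub>D\<^esub> T g = (i d \<cdot>\<^bsub>D\<^esub> j d) \<cdot>\<^bsub>D\<^esub> (g \<cdot>\<^bsub>D\<^esub> i c)"
      unfolding T(1)[OF g] by (rule F.D.Comp_assoc[OF gi G(3)[OF d] G(2)[OF d]])
    then show ?thesis using F.D.Comp_Ident_left[OF gi] G(4)[OF d] by simp
  qed
  have Tj: "T g \<cdot>\<^bsub>D\<^esub> j c = j d \<cdot>\<^bsub>D\<^esub> g" if g: "g \<in> hom_set D c d" for g c d
  proof -
    from homD[OF g] have c: "c \<in> Obj D" and d: "d \<in> Obj D" by blast+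
    note gi = F.D.Comp_hom[OF G(2)[OF c] g]
    have "T g \<cdot>\<^bsub>D\<^esub> j c = j d \<cdot>\<^bsub>D\<^esub> ((g \<cdot>\<^bsub>D\<^esub> i c) \<cdot>\<^bsub>D\<^esub> j c)"
      unfolding T(1)[OF g] by (rule F.D.Comp_assoc[OF G(3)[OF c] gi G(3)[OF d], symmetric])
    also have "(g \<cdot>\<^bsub>D\<^esub> i c) \<cdot>\<^bsub>D\<^esub> j c = g \<cdot>\<^bsub>D\<^esub> (i c \<cdot>\<^bsub>D\<^esub> j c)"
      by (rule F.D.Comp_assoc[OF G(3)[OF c] G(2)[OF c] g, symmetric])
    finally show ?thesis using F.D.Comp_Ident_right[OF g] G(4)[OF c] by simp
  qed
  have TT: "T (h \<cdot>\<^bsub>D\<^esub> g) = T h \<cdot>\<^bsub>D\<^esub> T g" if g: "g \<in> hom_set D b c" and h: "h \<in> hom_set D c d" for g h b c d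
  proof -
    from homD[OF g] homD[OF h] have o: "b \<in> Obj D" "c \<in> Obj D" "d \<in> Obj D" by blast+
    note gi = F.D.Comp_hom[OF G(2)[OF o(1)] g] and hi = F.D.Comp_hom[OF G(2)[OF o(2)] h]
    have "T h \<cdot>\<^bsub>D\<^esub> T g = j d \<cdot>\<^bsub>D\<^esub> ((h \<cdot>\<^bsub>D\<^esub> i c) \<cdot>\<^bsub>D\<^esub> T g)"
      unfolding T(1)[OF h] by (rule F.D.Comp_assoc[OF T(2)[OF g] hi G(3)[OF o(3)], symmetric])
    also have "(h \<cdot>\<^bsub>D\<^esub> i c) \<cdot>\<^bsub>D\<^esub> T g = h \<cdot>\<^bsub>D\<^esub> (i c \<cdot>\<^bsub>D\<^esub> T g)"
      by (rule F.D.Comp_assoc[OF T(2)[OF g] G(2)[OF o(2)] h, symmetric])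
    also have "i c \<cdot>\<^bsub>D\<^esub> T g = g \<cdot>\<^bsub>D\<^esub> i b" by (rule iT[OF g])
    also have "h \<cdot>\<^bsub>D\<^esub> (g \<cdot>\<^bsub>D\<^esub> i b) = (h \<cdot>\<^bsub>D\<^esub> g) \<cdot>\<^bsub>D\<^esub> i b" by (rule F.D.Comp_assoc[OF G(2)[OF o(1)] g h])
    finally show ?thesis unfolding T(1)[OF F.D.Comp_hom[OF g h]] by simp
  qed
  have GF: "covariant_functor D C Go Ga"
  proof
    show "Go a \<in> Obj C" if "a \<in> Obj D" for a by (rule G(1)[OF that])
    show "Ga f \<in> hom_set C (Go a) (Go b)" if "f \<in> hom_set D a b" for f a b by (rule Ga(1)[OF that])
    show "Ga (Ident D a) = Ident C (Go a)" if a: "a \<in> Obj D" for a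
    proof (rule faithful)
      note I = F.D.Ident_hom[OF a]
      show "Ga (Ident D a) \<in> hom_set C (Go a) (Go a)" by (rule Ga(1)[OF I])
      show "Ident C (Go a) \<in> hom_set C (Go a) (Go a)" by (rule F.C.Ident_hom[OF G(1)[OF a]])
      show "Fa (Ga (Ident D a)) = Fa (Ident C (Go a))"
        unfolding Ga(2)[OF I] T(1)[OF I] F.D.Comp_Ident_left[OF G(2)[OF a]] G(5)[OF a] F.Fa_Ident[OF G(1)[OF a]] ..
    qed
    show "Ga (g \<cdot>\<^bsub>D\<^esub> f) = Ga g \<cdot>\<^bsub>C\<^esub> Ga f" if f: "f \<in> hom_set D a b" and g: "g \<in> hom_set D b c" for f g a b c
    proof (rule faithful)
      note gf = F.D.Comp_hom[OF f g]
      show "Ga (g \<cdot>\<^bsub>D\<^esub> f) \<in> hom_set C (Go a) (Go c)" by (rule Ga(1)[OF gf])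
      show "Ga g \<cdot>\<^bsub>C\<^esub> Ga f \<in> hom_set C (Go a) (Go c)" by (rule F.C.Comp_hom[OF Ga(1)[OF f] Ga(1)[OF g]])
      show "Fa (Ga (g \<cdot>\<^bsub>D\<^esub> f)) = Fa (Ga g \<cdot>\<^bsub>C\<^esub> Ga f)"
        unfolding Ga(2)[OF gf] F.Fa_Comp[OF Ga(1)[OF f] Ga(1)[OF g]] Ga(2)[OF f] Ga(2)[OF g] by (rule TT[OF f g])
    qed
  qed
  define \<eta> where "\<eta> a = lft a (Go (Fo a)) (j (Fo a))" for a
  define \<theta> where "\<theta> a = lft (Go (Fo a)) a (i (Fo a))" for a
  have \<eta>: "\<eta> a \<in> hom_set C a (Go (Fo a))" "Fa (\<eta> a) = j (Fo a)"
    "\<theta> a \<in> hom_set C (Go (Fo a)) a" "Fa (\<theta> a) = i (Fo a)" if a: "a \<in> Obj C" for a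
  proof -
    note Fa = F.Fo_Obj[OF a]
    show "\<eta> a \<in> hom_set C a (Go (Fo a))" "Fa (\<eta> a) = j (Fo a)" unfolding \<eta>_def by (rule lft[OF a G(1)[OF Fa] G(3)[OF Fa]])+
    show "\<theta> a \<in> hom_set C (Go (Fo a)) a" "Fa (\<theta> a) = i (Fo a)" unfolding \<theta>_def by (rule lft[OF G(1)[OF Fa] a G(2)[OF Fa]])+
  qed
  have nat1: "natural_isomorphism C C (\<lambda>a. a) (\<lambda>f. f) (Go \<circ> Fo) (Ga \<circ> Fa) \<eta>"
    unfolding natural_isomorphism_def comp_def
  proof (intro conjI ballI)
    fix a assume a: "a \<in> Obj C"
    note e = \<eta>[OF a] and Fa = F.Fo_Obj[OF a]
    show "\<eta> a \<in> hom_set C a (Go (Fo a))" by (rule e(1))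
    have 1: "\<theta> a \<cdot>\<^bsub>C\<^esub> \<eta> a = Ident C a"
    proof (rule faithful[OF F.C.Comp_hom[OF e(1,3)] F.C.Ident_hom[OF a]])
      show "Fa (\<theta> a \<cdot>\<^bsub>C\<^esub> \<eta> a) = Fa (Ident C a)"
        unfolding F.Fa_Comp[OF e(1,3)] e F.Fa_Ident[OF a] by (rule G(4)[OF Fa])
    qed
    have 2: "\<eta> a \<cdot>\<^bsub>C\<^esub> \<theta> a = Ident C (Go (Fo a))"
    proof (rule faithful[OF F.C.Comp_hom[OF e(3,1)] F.C.Ident_hom[OF G(1)[OF Fa]]])
      show "Fa (\<eta> a \<cdot>\<^bsub>C\<^esub> \<theta> a) = Fa (Ident C (Go (Fo a)))"
        unfolding F.Fa_Comp[OF e(3,1)] e F.Fa_Ident[OF G(1)[OF Fa]] by (rule G(5)[OF Fa])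
    qed
    show "iso_arrow C (\<eta> a)"
      unfolding iso_arrow_def using e(1,3) 1 2 by (auto simp: hom_set_def intro!: bexI[of _ "\<theta> a"])
  next
    fix f assume "f \<in> Arr C"
    then have f: "f \<in> hom_set C (Dom C f) (Cod C f)" by (simp add: hom_set_def)
    let ?a = "Dom C f" and ?b = "Cod C f"
    from homC[OF f] have a: "?a \<in> Obj C" and b: "?b \<in> Obj C" by blast+
    note ea = \<eta>[OF a] and eb = \<eta>[OF b] and Ff = F.Fa_hom[OF f]
    show "\<eta> ?b \<cdot>\<^bsub>C\<^esub> f = Ga (Fa f) \<cdot>\<^bsub>C\<^esub> \<eta> ?a"
    proof (rule faithful[OF F.C.Comp_hom[OF f eb(1)] F.C.Comp_hom[OF ea(1) Ga(1)[OF Ff]]])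
      show "Fa (\<eta> ?b \<cdot>\<^bsub>C\<^esub> f) = Fa (Ga (Fa f) \<cdot>\<^bsub>C\<^esub> \<eta> ?a)"
        unfolding F.Fa_Comp[OF f eb(1)] F.Fa_Comp[OF ea(1) Ga(1)[OF Ff]] Ga(2)[OF Ff] ea(2) eb(2)
        by (rule Tj[OF Ff, symmetric])
    qed
  qed
  have nat2: "natural_isomorphism D D (Fo \<circ> Go) (Fa \<circ> Ga) (\<lambda>a. a) (\<lambda>f. f) i"
    unfolding natural_isomorphism_def comp_def
  proof (intro conjI ballI)
    fix d assume d: "d \<in> Obj D"
    show "i d \<in> hom_set D (Fo (Go d)) d" by (rule G(2)[OF d])
    show "iso_arrow D (i d)"
      unfolding iso_arrow_def using G(2-5)[OF d] by (auto simp: hom_set_def intro!: bexI[of _ "j d"])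
  next
    fix g assume "g \<in> Arr D"
    then have g: "g \<in> hom_set D (Dom D g) (Cod D g)" by (simp add: hom_set_def)
    show "i (Cod D g) \<cdot>\<^bsub>D\<^esub> Fa (Ga g) = g \<cdot>\<^bsub>D\<^esub> i (Dom D g)"
      unfolding Ga(2)[OF g] by (rule iT[OF g])
  qed
  show ?thesis unfolding equivalent_categories_def using F GF nat1 nat2 by blast
qed

text \<open>The data needed to identify the quotient category with a full subcategory of \<open>D\<close>: \<open>\<Phi>\<close> sends a triple
  \<open>(i, f, q)\<close> to the morphism \<open>F(q)\<^sup>-\<^sup>1 F(f) F(i)\<^sup>-\<^sup>1\<close>.\<close>

locale quotient_realization = C: category C + D: category D
  for C :: "('o, 'a) cat" and D :: "('p, 'b) cat" +
  fixes S :: "'o set" and Fo :: "'o \<Rightarrow> 'p" and \<Phi> :: "'o \<Rightarrow> 'o \<Rightarrow> 'a \<times> 'a \<times> 'a \<Rightarrow> 'b"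
  assumes Fo: "a \<in> Obj C \<Longrightarrow> Fo a \<in> Obj D"
    and \<Phi>_hom: "\<lbrakk>a \<in> Obj C; b \<in> Obj C; \<rho> \<in> partial_maps C S a b\<rbrakk> \<Longrightarrow> \<Phi> a b \<rho> \<in> hom_set D (Fo a) (Fo b)"
    and \<Phi>_eq: "\<lbrakk>a \<in> Obj C; b \<in> Obj C; \<rho> \<in> partial_maps C S a b; \<rho>' \<in> partial_maps C S a b\<rbrakk>
      \<Longrightarrow> (\<rho>, \<rho>') \<in> limit_rel C S a b \<longleftrightarrow> \<Phi> a b \<rho> = \<Phi> a b \<rho>'"
    and \<Phi>_surj: "\<lbrakk>a \<in> Obj C; b \<in> Obj C; g \<in> hom_set D (Fo a) (Fo b)\<rbrakk> \<Longrightarrow> \<exists>\<rho> \<in> partial_maps C S a b. \<Phi> a b \<rho> = g"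
    and \<Phi>_comp: "\<lbrakk>a \<in> Obj C; b \<in> Obj C; c \<in> Obj C; \<rho> \<in> partial_maps C S a b; \<sigma> \<in> partial_maps C S b c;
        composite_rel C S \<sigma> \<rho> \<tau>\<rbrakk> \<Longrightarrow> \<tau> \<in> partial_maps C S a c \<and> \<Phi> a c \<tau> = \<Phi> b c \<sigma> \<cdot>\<^bsub>D\<^esub> \<Phi> a b \<rho>"
    and composite_exists: "\<lbrakk>a \<in> Obj C; b \<in> Obj C; c \<in> Obj C; \<rho> \<in> partial_maps C S a b; \<sigma> \<in> partial_maps C S b c\<rbrakk>
      \<Longrightarrow> \<exists>\<tau>. composite_rel C S \<sigma> \<rho> \<tau>"
    and \<Phi>_Ident: "a \<in> Obj C \<Longrightarrow> (Ident C a, Ident C a, Ident C a) \<in> partial_maps C S a a \<and>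
      \<Phi> a a (Ident C a, Ident C a, Ident C a) = Ident D (Fo a)"
begin

text \<open>By \<open>\<Phi>_eq\<close> and \<open>\<Phi>_surj\<close> these are the classes of
  \<open>limit_rel\<close>, so that arrows of the quotient correspond to arrows of D.\<close>

definition fibre :: "'o \<Rightarrow> 'o \<Rightarrow> 'b \<Rightarrow> ('a \<times> 'a \<times> 'a) set" where
  "fibre a b g = {\<rho> \<in> partial_maps C S a b. \<Phi> a b \<rho> = g}"

abbreviation Q where "Q \<equiv> serre_quotient C S"

lemma limit_class:
  assumes "a \<in> Obj C" "b \<in> Obj C" "\<rho> \<in> partial_maps C S a b"
  shows "limit_rel C S a b `` {\<rho>} = fibre a b (\<Phi> a b \<rho>)"
proof (intro equalityI subsetI)
  fix \<rho>' assume "\<rho>' \<in> limit_rel C S a b `` {\<rho>}"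
  then have r: "(\<rho>, \<rho>') \<in> limit_rel C S a b" by blast
  then have p: "\<rho>' \<in> partial_maps C S a b" unfolding limit_rel_def by fast
  with r \<Phi>_eq[OF assms p] show "\<rho>' \<in> fibre a b (\<Phi> a b \<rho>)" by (simp add: fibre_def)
next
  fix \<rho>' assume "\<rho>' \<in> fibre a b (\<Phi> a b \<rho>)"
  then have p: "\<rho>' \<in> partial_maps C S a b" and e: "\<Phi> a b \<rho> = \<Phi> a b \<rho>'" by (simp_all add: fibre_def)
  with \<Phi>_eq[OF assms p] show "\<rho>' \<in> limit_rel C S a b `` {\<rho>}" by simp
qed

lemma Q_hom:
  "\<phi> \<in> hom_set Q a b \<longleftrightarrow> a \<in> Obj C \<and> b \<in> Obj C \<and> (\<exists>g \<in> hom_set D (Fo a) (Fo b). \<phi> = (a, fibre a b g, b))"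
proof
  assume "\<phi> \<in> hom_set Q a b"
  then obtain U where \<phi>: "\<phi> = (a, U, b)" and ab: "a \<in> Obj C" "b \<in> Obj C" and "U \<in> partial_maps C S a b // limit_rel C S a b"
    by (auto simp: hom_set_def serre_quotient_def)
  then obtain \<rho> where \<rho>: "\<rho> \<in> partial_maps C S a b" "U = limit_rel C S a b `` {\<rho>}" by (auto elim: quotientE)
  with \<phi> ab show "a \<in> Obj C \<and> b \<in> Obj C \<and> (\<exists>g \<in> hom_set D (Fo a) (Fo b). \<phi> = (a, fibre a b g, b))"
    using limit_class[OF ab \<rho>(1)] \<Phi>_hom[OF ab \<rho>(1)] by auto
next
  assume r: "a \<in> Obj C \<and> b \<in> Obj C \<and> (\<exists>g \<in> hom_set D (Fo a) (Fo b). \<phi> = (a, fibre a b g, b))"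
  then obtain g where ab: "a \<in> Obj C" "b \<in> Obj C" and g: "g \<in> hom_set D (Fo a) (Fo b)" "\<phi> = (a, fibre a b g, b)" by blast
  from \<Phi>_surj[OF ab g(1)] obtain \<rho> where \<rho>: "\<rho> \<in> partial_maps C S a b" "\<Phi> a b \<rho> = g" by blast
  have "fibre a b g \<in> partial_maps C S a b // limit_rel C S a b"
    using quotientI[OF \<rho>(1), of "limit_rel C S a b"] unfolding limit_class[OF ab \<rho>(1)] \<rho>(2) .
  with ab g(2) show "\<phi> \<in> hom_set Q a b" by (simp add: hom_set_def serre_quotient_def)
qed

text \<open>Any representative may be chosen, since \<Phi> is constant on a class.\<close>

definition Fa :: "'o \<times> ('a \<times> 'a \<times> 'a) set \<times> 'o \<Rightarrow> 'b" where
  "Fa = (\<lambda>(a, U, b). \<Phi> a b (SOME \<rho>. \<rho> \<in> U))"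

lemma Fa_fibre:
  assumes "a \<in> Obj C" "b \<in> Obj C" "g \<in> hom_set D (Fo a) (Fo b)"
  shows "Fa (a, fibre a b g, b) = g"
proof -
  have "\<exists>\<rho>. \<rho> \<in> fibre a b g" using \<Phi>_surj[OF assms] by (auto simp: fibre_def)
  then have "(SOME \<rho>. \<rho> \<in> fibre a b g) \<in> fibre a b g" by (rule someI_ex)
  then show ?thesis by (simp add: Fa_def fibre_def)
qed

text \<open>The union defining the composite runs over a single class: \<Phi> sends every composite
  triple to the composite of h and g, and \<open>composite_exists\<close> provides at least
  one.\<close>

lemma Q_Comp:
  assumes o: "a \<in> Obj C" "b \<in> Obj C" "c \<in> Obj C"
    and g: "g \<in> hom_set D (Fo a) (Fo b)" and h: "h \<in> hom_set D (Fo b) (Fo c)"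
  shows "(b, fibre b c h, c) \<cdot>\<^bsub>Q\<^esub> (a, fibre a b g, b) = (a, fibre a c (h \<cdot>\<^bsub>D\<^esub> g), c)"
proof -
  let ?A = "{limit_rel C S a c `` {\<tau>} |\<tau>. \<exists>\<sigma> \<in> fibre b c h. \<exists>\<rho> \<in> fibre a b g. composite_rel C S \<sigma> \<rho> \<tau>}"
  have cls: "limit_rel C S a c `` {\<tau>} = fibre a c (h \<cdot>\<^bsub>D\<^esub> g)"
    if "\<sigma> \<in> fibre b c h" "\<rho> \<in> fibre a b g" "composite_rel C S \<sigma> \<rho> \<tau>" for \<sigma> \<rho> \<tau>
  proof -
    from that have \<rho>: "\<rho> \<in> partial_maps C S a b" "\<Phi> a b \<rho> = g" and \<sigma>: "\<sigma> \<in> partial_maps C S b c" "\<Phi> b c \<sigma> = h"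
      by (simp_all add: fibre_def)
    from \<Phi>_comp[OF o \<rho>(1) \<sigma>(1) that(3)] have "\<tau> \<in> partial_maps C S a c" "\<Phi> a c \<tau> = h \<cdot>\<^bsub>D\<^esub> g"
      unfolding \<rho>(2) \<sigma>(2) by blast+
    with limit_class[OF o(1,3), of \<tau>] show ?thesis by simp
  qed
  from \<Phi>_surj[OF o(1,2) g] \<Phi>_surj[OF o(2,3) h] obtain \<rho> \<sigma> where
    \<rho>: "\<rho> \<in> partial_maps C S a b" "\<rho> \<in> fibre a b g" and \<sigma>: "\<sigma> \<in> partial_maps C S b c" "\<sigma> \<in> fibre b c h"
    by (auto simp: fibre_def)
  from composite_exists[OF o \<rho>(1) \<sigma>(1)] obtain \<tau> where \<tau>: "composite_rel C S \<sigma> \<rho> \<tau>" by blast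
  have "?A = {fibre a c (h \<cdot>\<^bsub>D\<^esub> g)}"
  proof (intro equalityI subsetI)
    fix V assume "V \<in> ?A"
    then obtain \<sigma>' \<rho>' \<tau>' where "V = limit_rel C S a c `` {\<tau>'}" "\<sigma>' \<in> fibre b c h" "\<rho>' \<in> fibre a b g" "composite_rel C S \<sigma>' \<rho>' \<tau>'"
      by blast
    with cls show "V \<in> {fibre a c (h \<cdot>\<^bsub>D\<^esub> g)}" by simp
  next
    fix V assume "V \<in> {fibre a c (h \<cdot>\<^bsub>D\<^esub> g)}"
    then have "V = limit_rel C S a c `` {\<tau>}" using cls[OF \<sigma>(2) \<rho>(2) \<tau>] by simp
    with \<sigma>(2) \<rho>(2) \<tau> show "V \<in> ?A" by blast
  qed
  then show ?thesis by (simp add: serre_quotient_def)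
qed

lemma Q_Ident:
  assumes "a \<in> Obj C" shows "Ident Q a = (a, fibre a a (Ident D (Fo a)), a)"
  using \<Phi>_Ident[OF assms] limit_class[OF assms assms] by (simp add: serre_quotient_def)

lemma Q_Obj [simp]: "a \<in> Obj Q \<longleftrightarrow> a \<in> Obj C"
  by (simp add: serre_quotient_def)

text \<open>Through \<open>Q_Ident\<close> and \<open>Q_Comp\<close> each axiom becomes the
  corresponding one in D.\<close>

lemma category_Q: "category Q"
proof
  show "Dom Q f \<in> Obj Q" "Cod Q f \<in> Obj Q" if "f \<in> Arr Q" for f
    using that by (auto simp: serre_quotient_def)
  show "Ident Q a \<in> hom_set Q a a" if "a \<in> Obj Q" for a
    using that D.Ident_hom[OF Fo] by (auto simp: Q_Ident Q_hom)
  fix f g and a b c :: 'o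
  assume f: "f \<in> hom_set Q a b"
  then obtain f' where f': "a \<in> Obj C" "b \<in> Obj C" "f' \<in> hom_set D (Fo a) (Fo b)" "f = (a, fibre a b f', b)"
    by (auto simp: Q_hom)
  show "Ident Q b \<cdot>\<^bsub>Q\<^esub> f = f"
    unfolding Q_Ident[OF f'(2)] f'(4) Q_Comp[OF f'(1,2,2,3) D.Ident_hom[OF Fo[OF f'(2)]]] D.Comp_Ident_left[OF f'(3)] ..
  show "f \<cdot>\<^bsub>Q\<^esub> Ident Q a = f"
    unfolding Q_Ident[OF f'(1)] f'(4) Q_Comp[OF f'(1,1,2) D.Ident_hom[OF Fo[OF f'(1)]] f'(3)] D.Comp_Ident_right[OF f'(3)] ..
  assume g: "g \<in> hom_set Q b c"
  then obtain g' where g': "c \<in> Obj C" "g' \<in> hom_set D (Fo b) (Fo c)" "g = (b, fibre b c g', c)"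
    by (auto simp: Q_hom)
  note gf = D.Comp_hom[OF f'(3) g'(2)]
  show "g \<cdot>\<^bsub>Q\<^esub> f \<in> hom_set Q a c"
    unfolding f'(4) g'(3) Q_Comp[OF f'(1,2) g'(1) f'(3) g'(2)] using f'(1) g'(1) gf by (auto simp: Q_hom)
  fix h and d :: 'o
  assume h: "h \<in> hom_set Q c d"
  then obtain h' where h': "d \<in> Obj C" "h' \<in> hom_set D (Fo c) (Fo d)" "h = (c, fibre c d h', d)"
    by (auto simp: Q_hom)
  note hg = D.Comp_hom[OF g'(2) h'(2)]
  show "h \<cdot>\<^bsub>Q\<^esub> (g \<cdot>\<^bsub>Q\<^esub> f) = (h \<cdot>\<^bsub>Q\<^esub> g) \<cdot>\<^bsub>Q\<^esub> f"
    unfolding f'(4) g'(3) h'(3) Q_Comp[OF f'(1,2) g'(1) f'(3) g'(2)] Q_Comp[OF f'(2) g'(1) h'(1) g'(2) h'(2)]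
      Q_Comp[OF f'(1) g'(1) h'(1) gf h'(2)] Q_Comp[OF f'(1,2) h'(1) f'(3) hg]
      D.Comp_assoc[OF f'(3) g'(2) h'(2)] ..
qed

lemma functor_Q: "covariant_functor Q D Fo Fa"
proof (intro covariant_functor.intro covariant_functor_axioms.intro category_Q D.category_axioms)
  show "Fo a \<in> Obj D" if "a \<in> Obj Q" for a using that Fo by simp
  show "Fa (Ident Q a) = Ident D (Fo a)" if "a \<in> Obj Q" for a
    using that Fa_fibre[OF _ _ D.Ident_hom[OF Fo]] by (simp add: Q_Ident)
  fix f g and a b c :: 'o
  assume f: "f \<in> hom_set Q a b"
  then obtain f' where f': "a \<in> Obj C" "b \<in> Obj C" "f' \<in> hom_set D (Fo a) (Fo b)" "f = (a, fibre a b f', b)"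
    by (auto simp: Q_hom)
  note Ff = Fa_fibre[OF f'(1-3)]
  show "Fa f \<in> hom_set D (Fo a) (Fo b)" unfolding f'(4) Ff by (rule f'(3))
  assume g: "g \<in> hom_set Q b c"
  then obtain g' where g': "c \<in> Obj C" "g' \<in> hom_set D (Fo b) (Fo c)" "g = (b, fibre b c g', c)"
    by (auto simp: Q_hom)
  show "Fa (g \<cdot>\<^bsub>Q\<^esub> f) = Fa g \<cdot>\<^bsub>D\<^esub> Fa f"
    unfolding f'(4) g'(3) Q_Comp[OF f'(1,2) g'(1) f'(3) g'(2)] Ff Fa_fibre[OF f'(2) g'(1,2)]
    by (rule Fa_fibre[OF f'(1) g'(1) D.Comp_hom[OF f'(3) g'(2)]])
qed

lemma equivalent_Q:
  assumes es: "\<And>d. d \<in> Obj D \<Longrightarrow> \<exists>a \<in> Obj C. \<exists>i \<in> hom_set D (Fo a) d. \<exists>j \<in> hom_set D d (Fo a).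
      i \<cdot>\<^bsub>D\<^esub> j = Ident D d \<and> j \<cdot>\<^bsub>D\<^esub> i = Ident D (Fo a)"
  shows "equivalent_categories Q D"
proof (rule equivalence_of_fully_faithful[OF functor_Q])
  show "\<exists>f \<in> hom_set Q a b. Fa f = g" if "a \<in> Obj Q" "b \<in> Obj Q" "g \<in> hom_set D (Fo a) (Fo b)" for a b g
  proof
    show "(a, fibre a b g, b) \<in> hom_set Q a b" using that by (auto simp: Q_hom)
    show "Fa (a, fibre a b g, b) = g" by (rule Fa_fibre) (use that in simp_all)
  qed
  show "f = f'" if f: "f \<in> hom_set Q a b" "f' \<in> hom_set Q a b" and e: "Fa f = Fa f'" for a b f f'
  proof -
    from f(1)[unfolded Q_hom] obtain g where g: "a \<in> Obj C" "b \<in> Obj C" "g \<in> hom_set D (Fo a) (Fo b)" "f = (a, fibre a b g, b)"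
      by blast
    from f(2)[unfolded Q_hom] obtain g' where g': "g' \<in> hom_set D (Fo a) (Fo b)" "f' = (a, fibre a b g', b)"
      by blast
    from e show ?thesis
      unfolding g(4) g'(2) Fa_fibre[OF g(1-3)] Fa_fibre[OF g(1,2) g'(1)] by simp
  qed
  show "\<exists>a \<in> Obj Q. \<exists>i \<in> hom_set D (Fo a) d. \<exists>j \<in> hom_set D d (Fo a).
      i \<cdot>\<^bsub>D\<^esub> j = Ident D d \<and> j \<cdot>\<^bsub>D\<^esub> i = Ident D (Fo a)" if "d \<in> Obj D" for d
    using es[OF that] by (simp add: serre_quotient_def)
qed

end


section \<open>The quotient by the modules \<open>M\<close> with \<open>M\<close> equal to its hat\<close>

context row_finite_digraph
begin

lemma sat_Int:
  assumes M: "right_module PA M" and B: "submod PA M B" and C: "submod PA M C"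
    and m: "m \<in> sat M B" "m \<in> sat M C"
  shows "m \<in> sat M (B \<inter> C)"
proof (rule satE[OF m(1)], rule satE[OF m(2)])
  fix n n' assume mc: "m \<in> carrier M" and n: "\<And>p. p \<in> level_paths G n \<Longrightarrow> pact M m p \<in> B"
    and n': "\<And>p. p \<in> level_paths G n' \<Longrightarrow> pact M m p \<in> C"
  show ?thesis
  proof (rule satI[OF mc, where n = "max n n'"])
    fix p assume p: "p \<in> level_paths G (max n n')"
    show "pact M m p \<in> B \<inter> C"
      using sat_level_mono[OF M B mc n max.cobounded1 p] sat_level_mono[OF M C mc n' max.cobounded2 p] by blast
  qed
qed

lemma sat_subsetI:
  assumes UM: "P.UM M" and C: "submod PA M C" and BC: "B \<subseteq> sat M C" and m: "m \<in> sat M B"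
  shows "m \<in> sat M C"
  by (rule sat_sat[OF UM C]) (rule subsetD[OF sat_mono[OF BC] m])

text \<open>Passing to a cosmall subobject does not change the localization: some level sends each
  element of N into \<alpha>(M), another one sends each element of M into i(W), and saturation is
  idempotent.\<close>

lemma localization_precomp:
  assumes loc: "localization M N \<alpha>" and W: "P.UM W" and i: "rhom PA W M i" and inj: "inj_on i (carrier W)"
    and cos: "carrier M \<subseteq> sat M (i ` carrier W)"
  shows "localization W N (\<lambda>x. \<alpha> (i x))"
proof -
  note D = localizationD[OF loc]
  note rmM = P.UM_right_module[OF D(1)] and rmW = P.UM_right_module[OF W] and rmN = L.UM_right_module[OF D(2)]
  have ai: "rhom PA W (restr N) (\<lambda>x. \<alpha> (i x))" by (rule rhom_comp[OF i D(3)])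
  have B: "submod PA (restr N) ((\<lambda>x. \<alpha> (i x)) ` carrier W)"
    by (rule submod_image[OF rmW right_module_restr[OF rmN] ai submod_carrier[OF rmW]])
  have i0: "x = \<zero>\<^bsub>W\<^esub>" if "x \<in> carrier W" "i x = \<zero>\<^bsub>M\<^esub>" for x
    using rhom_inj_on[OF rmW rmM i] inj that by blast
  show ?thesis
    unfolding localization_def
  proof (intro conjI ballI impI subsetI W D(2) ai)
    fix x assume x: "x \<in> carrier W" and "\<alpha> (i x) = \<zero>\<^bsub>N\<^esub>"
    then have "i x \<in> sat M {\<zero>\<^bsub>M\<^esub>}" using D(4) rhom_closed[OF i x] by blast
    then show "x \<in> sat W {\<zero>\<^bsub>W\<^esub>}"
      by (rule sat_vimage[OF i x _ _ rmW]) (simp add: i0)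
  next
    fix y assume y: "y \<in> carrier N"
    have "\<alpha> ` carrier M \<subseteq> sat (restr N) ((\<lambda>x. \<alpha> (i x)) ` carrier W)"
    proof
      fix z assume "z \<in> \<alpha> ` carrier M"
      then obtain m where m: "m \<in> carrier M" "z = \<alpha> m" by blast
      have "\<alpha> m \<in> sat (restr N) ((\<lambda>x. \<alpha> (i x)) ` carrier W)"
        by (rule sat_image[OF D(3) subsetD[OF cos m(1)]]) blast
      with m(2) show "z \<in> sat (restr N) ((\<lambda>x. \<alpha> (i x)) ` carrier W)" by simp
    qed
    from sat_subsetI[OF UM_restr[OF rmN D(2)] B this D(5)[OF y]]
    show "y \<in> sat (restr N) ((\<lambda>x. \<alpha> (i x)) ` carrier W)" .
  qed
qed

lemma partial_maps_iff:
  "\<rho> \<in> partial_maps P.ModC (hat_modules G) M M' \<longleftrightarrow>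
    (\<exists>W i f q Q. \<rho> = ((W, i, M), (W, f, Q), (M', q, Q)) \<and> cosmall_mono P.ModC (hat_modules G) (W, i, M) \<and>
       small_epi P.ModC (hat_modules G) (M', q, Q) \<and> f \<in> module_homs PA W Q)"
proof
  assume "\<rho> \<in> partial_maps P.ModC (hat_modules G) M M'"
  then obtain i f q where \<rho>: "\<rho> = (i, f, q)" and c: "cosmall_mono P.ModC (hat_modules G) i" "Cod P.ModC i = M"
    "small_epi P.ModC (hat_modules G) q" "Dom P.ModC q = M'" "f \<in> hom_set P.ModC (Dom P.ModC i) (Cod P.ModC q)"
    unfolding partial_maps_def by blast
  obtain W i' M1 where i: "i = (W, i', M1)" by (cases i)
  obtain M2 q' Q where q: "q = (M2, q', Q)" by (cases q)
  have M1: "M1 = M" and M2: "M2 = M'" using c(2,4) unfolding i q P.Mod_Dom P.Mod_Cod by simp_all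
  from c(5) obtain f' where f: "f = (W, f', Q)" "f' \<in> module_homs PA W Q"
    unfolding i q P.Mod_Dom P.Mod_Cod P.Mod_hom_iff by blast
  show "\<exists>W i f q Q. \<rho> = ((W, i, M), (W, f, Q), (M', q, Q)) \<and> cosmall_mono P.ModC (hat_modules G) (W, i, M) \<and>
       small_epi P.ModC (hat_modules G) (M', q, Q) \<and> f \<in> module_homs PA W Q"
    using c(1,3) f(2) unfolding \<rho> f(1) i q M1 M2 by blast
next
  assume "\<exists>W i f q Q. \<rho> = ((W, i, M), (W, f, Q), (M', q, Q)) \<and> cosmall_mono P.ModC (hat_modules G) (W, i, M) \<and>
       small_epi P.ModC (hat_modules G) (M', q, Q) \<and> f \<in> module_homs PA W Q"
  then obtain W i f q Q where \<rho>: "\<rho> = ((W, i, M), (W, f, Q), (M', q, Q))"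
    and c: "cosmall_mono P.ModC (hat_modules G) (W, i, M)" "small_epi P.ModC (hat_modules G) (M', q, Q)" "f \<in> module_homs PA W Q"
    by blast
  have "P.UM W" "P.UM Q" using c(1,2) unfolding cosmall_iff small_iff by blast+
  with c show "\<rho> \<in> partial_maps P.ModC (hat_modules G) M M'"
    unfolding partial_maps_def \<rho> by simp
qed

section \<open>Arrows of the quotient category as homomorphisms of localizations\<close>

context
  fixes FM :: "('k, ('v, 'e, 'k) path_algebra_elem, 'm) rmodule \<Rightarrow> ('k, ('v, 'e, 'k) leavitt_elem, 'm) rmodule"
    and et :: "('k, ('v, 'e, 'k) path_algebra_elem, 'm) rmodule \<Rightarrow> 'm \<Rightarrow> 'm"
  assumes loc: "\<And>M. P.UM M \<Longrightarrow> localization M (FM M) (et M)"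
begin

abbreviation hatS :: "('k, ('v, 'e, 'k) path_algebra_elem, 'm) rmodule set" where
  "hatS \<equiv> hat_modules G"

lemma UM_FM: "P.UM M \<Longrightarrow> L.UM (FM M)"
  using localizationD(2)[OF loc] .

lemma et_rhom: "P.UM M \<Longrightarrow> rhom PA M (restr (FM M)) (et M)"
  using localizationD(3)[OF loc] .

lemma et_eq_iff:
  assumes M: "P.UM M" and x: "x \<in> carrier M" and y: "y \<in> carrier M"
  shows "et M x = et M y \<longleftrightarrow> x \<ominus>\<^bsub>M\<^esub> y \<in> sat M {\<zero>\<^bsub>M\<^esub>}"
proof -
  note rmM = P.UM_right_module[OF M] and rmN = L.UM_right_module[OF UM_FM[OF M]]
  interpret M: right_module PA M by (rule rmM)
  have c: "x \<ominus>\<^bsub>M\<^esub> y \<in> carrier M" using x y by simp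
  have e: "et M x = et M y \<longleftrightarrow> et M (x \<ominus>\<^bsub>M\<^esub> y) = \<zero>\<^bsub>FM M\<^esub>"
    using rhom_eq_iff[OF rmM right_module_restr[OF rmN] et_rhom[OF M] x y] by simp
  show ?thesis
  proof
    assume "et M x = et M y"
    then show "x \<ominus>\<^bsub>M\<^esub> y \<in> sat M {\<zero>\<^bsub>M\<^esub>}" using e localizationD(4)[OF loc[OF M] c] by blast
  next
    assume "x \<ominus>\<^bsub>M\<^esub> y \<in> sat M {\<zero>\<^bsub>M\<^esub>}"
    then show "et M x = et M y" using e localization_ker[OF loc[OF M]] by blast
  qed
qed

text \<open>The kernel of a small epimorphism lies in the hat, which \<open>et\<close>
  annihilates.\<close>

lemma small_et_eq:
  assumes s: "small_epi P.ModC hatS (M, q, Q)" and x: "x \<in> carrier M" and y: "y \<in> carrier M" and e: "q x = q y"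
  shows "et M x = et M y"
proof -
  from s have *: "P.UM M" "P.UM Q" "q \<in> module_homs PA M Q"
    and k: "\<And>m. m \<in> carrier M \<Longrightarrow> q m = \<zero>\<^bsub>Q\<^esub> \<Longrightarrow> m \<in> sat M {\<zero>\<^bsub>M\<^esub>}"
    unfolding small_iff by blast+
  interpret M: right_module PA M by (rule P.UM_right_module[OF *(1)])
  have "q (x \<ominus>\<^bsub>M\<^esub> y) = \<zero>\<^bsub>Q\<^esub>"
    using rhom_eq_iff[OF *(1,2)[THEN P.UM_right_module] P.module_homs_rhom[OF *(3)] x y] e by blast
  then have "x \<ominus>\<^bsub>M\<^esub> y \<in> sat M {\<zero>\<^bsub>M\<^esub>}" using k x y by simp
  then show ?thesis using et_eq_iff[OF *(1) x y] by blast
qed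

text \<open>An elementwise description of F(q)^-1 F(f) F(i)^-1. It involves neither chosen
  localizations of W and of the target of q nor chosen preimages under q.\<close>

definition realizes ::
  "('k, ('v, 'e, 'k) path_algebra_elem, 'm) rmodule \<Rightarrow> ('m \<Rightarrow> 'm) \<Rightarrow> ('m \<Rightarrow> 'm) \<Rightarrow> ('m \<Rightarrow> 'm) \<Rightarrow>
   ('k, ('v, 'e, 'k) path_algebra_elem, 'm) rmodule \<Rightarrow> ('k, ('v, 'e, 'k) path_algebra_elem, 'm) rmodule \<Rightarrow> ('m \<Rightarrow> 'm) \<Rightarrow> bool"
where
  "realizes W i f q M M' g \<longleftrightarrow> g \<in> module_homs LA (FM M) (FM M') \<and>
     (\<forall>x \<in> carrier W. \<forall>y \<in> carrier M'. f x = q y \<longrightarrow> g (et M (i x)) = et M' y)"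

lemma realizesD: "realizes W i f q M M' g \<Longrightarrow> g \<in> module_homs LA (FM M) (FM M')"
  "\<lbrakk>realizes W i f q M M' g; x \<in> carrier W; y \<in> carrier M'; f x = q y\<rbrakk> \<Longrightarrow> g (et M (i x)) = et M' y"
  unfolding realizes_def by blast+

lemma realizesI: "\<lbrakk>g \<in> module_homs LA (FM M) (FM M');
  \<And>x y. \<lbrakk>x \<in> carrier W; y \<in> carrier M'; f x = q y\<rbrakk> \<Longrightarrow> g (et M (i x)) = et M' y\<rbrakk> \<Longrightarrow> realizes W i f q M M' g"
  unfolding realizes_def by blast

lemma cosmall_localization:
  assumes "cosmall_mono P.ModC hatS (W, i, M)"
  shows "localization W (FM M) (\<lambda>x. et M (i x))"
proof -
  from assms have *: "P.UM W" "P.UM M" "i \<in> module_homs PA W M" "inj_on i (carrier W)" "carrier M \<subseteq> sat M (i ` carrier W)"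
    unfolding cosmall_iff by blast+
  show ?thesis by (rule localization_precomp[OF loc[OF *(2)] *(1) P.module_homs_rhom[OF *(3)] *(4,5)])
qed

text \<open>A cosmall subobject has the same localization, and homomorphisms from a localization are
  determined on the module being localized.\<close>

lemma FM_hom_eqI:
  assumes c: "cosmall_mono P.ModC hatS (W, i, M)" and M': "P.UM M'"
    and g: "g \<in> module_homs LA (FM M) (FM M')" and g': "g' \<in> module_homs LA (FM M) (FM M')"
    and eq: "\<And>x. x \<in> carrier W \<Longrightarrow> g (et M (i x)) = g' (et M (i x))"
  shows "g = g'"
proof (rule L.module_homs_eqI[OF g g'])
  fix y assume "y \<in> carrier (FM M)"
  from localization_unique[OF cosmall_localization[OF c] L.UM_right_module[OF UM_FM[OF M']]
      L.module_homs_rhom[OF g] L.module_homs_rhom[OF g'] eq this]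
  show "g y = g' y" .
qed

text \<open>\<open>et M'\<close> factors through q as u, and u after f extends to
  \<open>FM M\<close>, which is also a localization of W.\<close>

lemma realizes_exists:
  assumes c: "cosmall_mono P.ModC hatS (W, i, M)" and s: "small_epi P.ModC hatS (M', q, Q)" and f: "f \<in> module_homs PA W Q"
  shows "\<exists>g. realizes W i f q M M' g"
proof -
  from s have *: "P.UM M'" "P.UM Q" "q \<in> module_homs PA M' Q" "q ` carrier M' = carrier Q"
    and k: "\<And>m. m \<in> carrier M' \<Longrightarrow> q m = \<zero>\<^bsub>Q\<^esub> \<Longrightarrow> m \<in> sat M' {\<zero>\<^bsub>M'\<^esub>}"
    unfolding small_iff by blast+
  have M: "P.UM M" using c unfolding cosmall_iff by blast
  note rmN' = L.UM_right_module[OF UM_FM[OF *(1)]]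
  note fr = P.module_homs_rhom[OF f]
  have k': "et M' x = \<zero>\<^bsub>restr (FM M')\<^esub>" if "x \<in> carrier M'" "q x = \<zero>\<^bsub>Q\<^esub>" for x
    using localization_ker[OF loc[OF *(1)] k[OF that]] by simp
  obtain u where u: "rhom PA Q (restr (FM M')) u" "\<And>y. y \<in> carrier M' \<Longrightarrow> u (q y) = et M' y"
    using rhom_factor_surj[OF *(1,2)[THEN P.UM_right_module] right_module_restr[OF rmN'] P.module_homs_rhom[OF *(3)] *(4)
        et_rhom[OF *(1)] k'] by metis
  from localization_extend[OF cosmall_localization[OF c] UM_FM[OF *(1)] rhom_comp[OF fr u(1)]]
  obtain g where g: "rhom LA (FM M) (FM M') g" "\<And>x. x \<in> carrier W \<Longrightarrow> g (et M (i x)) = u (f x)" by metis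
  have "realizes W i f q M M' (restrict g (carrier (FM M)))"
  proof (rule realizesI)
    show "restrict g (carrier (FM M)) \<in> module_homs LA (FM M) (FM M')"
      by (rule L.restrict_module_homs[OF UM_FM[OF M] g(1)])
    fix x y assume x: "x \<in> carrier W" and y: "y \<in> carrier M'" and e: "f x = q y"
    have "et M (i x) \<in> carrier (FM M)"
      using rhom_closed[OF localizationD(3)[OF cosmall_localization[OF c]] x] by simp
    then show "restrict g (carrier (FM M)) (et M (i x)) = et M' y"
      using g(2)[OF x] u(2)[OF y] e by simp
  qed
  then show ?thesis by blast
qed

lemma realizes_unique:
  assumes c: "cosmall_mono P.ModC hatS (W, i, M)" and s: "small_epi P.ModC hatS (M', q, Q)" and f: "f \<in> module_homs PA W Q"
    and g: "realizes W i f q M M' g" and g': "realizes W i f q M M' g'"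
  shows "g = g'"
proof -
  from s have *: "P.UM M'" "q ` carrier M' = carrier Q" unfolding small_iff by blast+
  show ?thesis
  proof (rule FM_hom_eqI[OF c *(1) realizesD(1)[OF g] realizesD(1)[OF g']])
    fix x assume x: "x \<in> carrier W"
    have "f x \<in> carrier Q" by (rule rhom_closed[OF P.module_homs_rhom[OF f] x])
    then obtain y where "y \<in> carrier M'" "f x = q y" using *(2) by blast
    then show "g (et M (i x)) = g' (et M (i x))"
      using realizesD(2)[OF g x] realizesD(2)[OF g' x] by simp
  qed
qed

text \<open>The definite description is justified by \<open>realizes_exists\<close> and
  \<open>realizes_unique\<close>.\<close>

definition \<Phi>Q :: "('k, ('v, 'e, 'k) path_algebra_elem, 'm) rmodule \<Rightarrow> ('k, ('v, 'e, 'k) path_algebra_elem, 'm) rmodule \<Rightarrow> _" where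
  "\<Phi>Q M M' = (\<lambda>((W, i, _), (_, f, _), (_, q, _)). (FM M, THE g. realizes W i f q M M' g, FM M'))"

lemma \<Phi>Q_eq:
  assumes "cosmall_mono P.ModC hatS (W, i, M)" "small_epi P.ModC hatS (M', q, Q)" "f \<in> module_homs PA W Q" "realizes W i f q M M' g"
  shows "\<Phi>Q M M' ((W, i, M), (W, f, Q), (M', q, Q)) = (FM M, g, FM M')"
proof -
  have "(THE g. realizes W i f q M M' g) = g"
    by (rule the_equality[where P = "realizes W i f q M M'", OF assms(4)]) (rule realizes_unique[OF assms(1-3) _ assms(4)])
  then show ?thesis by (simp add: \<Phi>Q_def)
qed

lemma cosmall_id: "P.UM M \<Longrightarrow> cosmall_mono P.ModC hatS (M, \<lambda>x \<in> carrier M. x, M)"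
  unfolding cosmall_iff
  using P.id_module_homs subset_sat[OF submod_carrier[OF P.UM_right_module]] by (auto simp: inj_on_def)

lemma small_id: "P.UM M \<Longrightarrow> small_epi P.ModC hatS (M, \<lambda>x \<in> carrier M. x, M)"
  unfolding small_iff
  using P.id_module_homs subset_sat[OF submod_singleton_zero[OF P.UM_right_module]] by auto

lemma incl_homs:
  assumes M: "P.UM M" and B: "submod PA M B"
  shows "P.UM (M\<lparr>carrier := B\<rparr>)" "(\<lambda>x \<in> B. x) \<in> module_homs PA (M\<lparr>carrier := B\<rparr>) M"
proof -
  show K: "P.UM (M\<lparr>carrier := B\<rparr>)" by (rule P.UM_submod[OF M B])
  show "(\<lambda>x \<in> B. x) \<in> module_homs PA (M\<lparr>carrier := B\<rparr>) M"
    using P.restrict_module_homs[OF K rhom_incl[OF B]] by simp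
qed

text \<open>Division by the whole hat is the last stage of the direct limit in the second argument,
  because the kernel of every small epimorphism is contained in the hat.\<close>

lemma small_hat_quot:
  assumes M: "P.UM M"
  defines "H \<equiv> sat M {\<zero>\<^bsub>M\<^esub>}"
  shows "submod PA M H" "small_epi P.ModC hatS (M, restrict (coset_rep M H) (carrier M), P.quot M H)"
proof -
  note rm = P.UM_right_module[OF M]
  show H: "submod PA M H" unfolding H_def by (rule submod_sat[OF rm submod_singleton_zero[OF rm]])
  show "small_epi P.ModC hatS (M, restrict (coset_rep M H) (carrier M), P.quot M H)"
    unfolding small_iff
    using M P.UM_quot[OF M H] P.restrict_module_homs[OF M P.rhom_quot[OF M H]] P.surj_quot[OF M H]
      P.quot_zero_iff[OF M H] by (auto simp: H_def)
qed

lemma limit_rel_iff: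
  assumes "cosmall_mono P.ModC hatS (W, i, M)" "small_epi P.ModC hatS (M', q, Q)" "f \<in> module_homs PA W Q"
    "cosmall_mono P.ModC hatS (W', i', M)" "small_epi P.ModC hatS (M', q', Q')" "f' \<in> module_homs PA W' Q'"
  shows "(((W, i, M), (W, f, Q), (M', q, Q)), ((W', i', M), (W', f', Q'), (M', q', Q'))) \<in> limit_rel P.ModC hatS M M' \<longleftrightarrow>
    (\<exists>V Y u u' w w'. P.UM V \<and> P.UM Y \<and> u \<in> module_homs PA V W \<and> u' \<in> module_homs PA V W' \<and>
       w \<in> module_homs PA Q Y \<and> w' \<in> module_homs PA Q' Y \<and>
       compose (carrier V) i u = compose (carrier V) i' u' \<and>
       cosmall_mono P.ModC hatS (V, compose (carrier V) i u, M) \<and>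
       compose (carrier M') w q = compose (carrier M') w' q' \<and>
       small_epi P.ModC hatS (M', compose (carrier M') w q, Y) \<and>
       compose (carrier V) (compose (carrier W) w f) u = compose (carrier V) (compose (carrier W') w' f') u')"
    (is "?l \<longleftrightarrow> ?r")
proof -
  have UM: "P.UM W" "P.UM W'" "P.UM Q" "P.UM Q'" using assms(1,2,4,5) unfolding cosmall_iff small_iff by blast+
  have pm: "((W, i, M), (W, f, Q), (M', q, Q)) \<in> partial_maps P.ModC hatS M M'"
    "((W', i', M), (W', f', Q'), (M', q', Q')) \<in> partial_maps P.ModC hatS M M'"
    unfolding partial_maps_iff using assms by blast+
  have "?l \<longleftrightarrow> (\<exists>V Y. \<exists>u \<in> hom_set P.ModC V W. \<exists>u' \<in> hom_set P.ModC V W'.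
    \<exists>w \<in> hom_set P.ModC Q Y. \<exists>w' \<in> hom_set P.ModC Q' Y.
      (W, i, M) \<cdot>\<^bsub>P.ModC\<^esub> u = (W', i', M) \<cdot>\<^bsub>P.ModC\<^esub> u' \<and> cosmall_mono P.ModC hatS ((W, i, M) \<cdot>\<^bsub>P.ModC\<^esub> u) \<and>
      w \<cdot>\<^bsub>P.ModC\<^esub> (M', q, Q) = w' \<cdot>\<^bsub>P.ModC\<^esub> (M', q', Q') \<and> small_epi P.ModC hatS (w \<cdot>\<^bsub>P.ModC\<^esub> (M', q, Q)) \<and>
      w \<cdot>\<^bsub>P.ModC\<^esub> (W, f, Q) \<cdot>\<^bsub>P.ModC\<^esub> u = w' \<cdot>\<^bsub>P.ModC\<^esub> (W', f', Q') \<cdot>\<^bsub>P.ModC\<^esub> u')"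
    unfolding limit_rel_def using pm by (simp only: mem_Collect_eq prod.case P.Mod_Dom P.Mod_Cod simp_thms)
  also have "\<dots> \<longleftrightarrow> ?r"
  proof
    assume "\<exists>V Y. \<exists>u \<in> hom_set P.ModC V W. \<exists>u' \<in> hom_set P.ModC V W'.
      \<exists>w \<in> hom_set P.ModC Q Y. \<exists>w' \<in> hom_set P.ModC Q' Y.
      (W, i, M) \<cdot>\<^bsub>P.ModC\<^esub> u = (W', i', M) \<cdot>\<^bsub>P.ModC\<^esub> u' \<and> cosmall_mono P.ModC hatS ((W, i, M) \<cdot>\<^bsub>P.ModC\<^esub> u) \<and>
      w \<cdot>\<^bsub>P.ModC\<^esub> (M', q, Q) = w' \<cdot>\<^bsub>P.ModC\<^esub> (M', q', Q') \<and> small_epi P.ModC hatS (w \<cdot>\<^bsub>P.ModC\<^esub> (M', q, Q)) \<and>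
      w \<cdot>\<^bsub>P.ModC\<^esub> (W, f, Q) \<cdot>\<^bsub>P.ModC\<^esub> u = w' \<cdot>\<^bsub>P.ModC\<^esub> (W', f', Q') \<cdot>\<^bsub>P.ModC\<^esub> u'"
    then obtain V Y u u' w w' where h: "u \<in> hom_set P.ModC V W" "u' \<in> hom_set P.ModC V W'" "w \<in> hom_set P.ModC Q Y" "w' \<in> hom_set P.ModC Q' Y"
      and r: "(W, i, M) \<cdot>\<^bsub>P.ModC\<^esub> u = (W', i', M) \<cdot>\<^bsub>P.ModC\<^esub> u'" "cosmall_mono P.ModC hatS ((W, i, M) \<cdot>\<^bsub>P.ModC\<^esub> u)"
      "w \<cdot>\<^bsub>P.ModC\<^esub> (M', q, Q) = w' \<cdot>\<^bsub>P.ModC\<^esub> (M', q', Q')" "small_epi P.ModC hatS (w \<cdot>\<^bsub>P.ModC\<^esub> (M', q, Q))"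
      "w \<cdot>\<^bsub>P.ModC\<^esub> (W, f, Q) \<cdot>\<^bsub>P.ModC\<^esub> u = w' \<cdot>\<^bsub>P.ModC\<^esub> (W', f', Q') \<cdot>\<^bsub>P.ModC\<^esub> u'" by blast
    from h obtain u1 u2 w1 w2 where *: "u = (V, u1, W)" "u' = (V, u2, W')" "w = (Q, w1, Y)" "w' = (Q', w2, Y)"
      "P.UM V" "P.UM Y" "u1 \<in> module_homs PA V W" "u2 \<in> module_homs PA V W'" "w1 \<in> module_homs PA Q Y" "w2 \<in> module_homs PA Q' Y"
      unfolding P.Mod_hom_iff by blast
    from r have r': "compose (carrier V) i u1 = compose (carrier V) i' u2"
      "cosmall_mono P.ModC hatS (V, compose (carrier V) i u1, M)"
      "compose (carrier M') w1 q = compose (carrier M') w2 q'"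
      "small_epi P.ModC hatS (M', compose (carrier M') w1 q, Y)"
      "compose (carrier V) (compose (carrier W) w1 f) u1 = compose (carrier V) (compose (carrier W') w2 f') u2"
      unfolding *(1-4) P.Mod_Comp by (simp_all only: prod.inject simp_thms)
    show ?r by (rule exI[of _ V], rule exI[of _ Y], rule exI[of _ u1], rule exI[of _ u2], rule exI[of _ w1], rule exI[of _ w2])
        (intro conjI *(5-10) r')
  next
    assume ?r
    then obtain V Y u u' w w' where *: "P.UM V" "P.UM Y" "u \<in> module_homs PA V W" "u' \<in> module_homs PA V W'"
       "w \<in> module_homs PA Q Y" "w' \<in> module_homs PA Q' Y"
       "compose (carrier V) i u = compose (carrier V) i' u'"
       "cosmall_mono P.ModC hatS (V, compose (carrier V) i u, M)"
       "compose (carrier M') w q = compose (carrier M') w' q'"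
       "small_epi P.ModC hatS (M', compose (carrier M') w q, Y)"
       "compose (carrier V) (compose (carrier W) w f) u = compose (carrier V) (compose (carrier W') w' f') u'"
      by (elim exE conjE) (rule that)
    show "\<exists>V Y. \<exists>u \<in> hom_set P.ModC V W. \<exists>u' \<in> hom_set P.ModC V W'.
      \<exists>w \<in> hom_set P.ModC Q Y. \<exists>w' \<in> hom_set P.ModC Q' Y.
      (W, i, M) \<cdot>\<^bsub>P.ModC\<^esub> u = (W', i', M) \<cdot>\<^bsub>P.ModC\<^esub> u' \<and> cosmall_mono P.ModC hatS ((W, i, M) \<cdot>\<^bsub>P.ModC\<^esub> u) \<and>
      w \<cdot>\<^bsub>P.ModC\<^esub> (M', q, Q) = w' \<cdot>\<^bsub>P.ModC\<^esub> (M', q', Q') \<and> small_epi P.ModC hatS (w \<cdot>\<^bsub>P.ModC\<^esub> (M', q, Q)) \<and>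
      w \<cdot>\<^bsub>P.ModC\<^esub> (W, f, Q) \<cdot>\<^bsub>P.ModC\<^esub> u = w' \<cdot>\<^bsub>P.ModC\<^esub> (W', f', Q') \<cdot>\<^bsub>P.ModC\<^esub> u'"
      by (rule exI[of _ V], rule exI[of _ Y], rule bexI[of _ "(V, u, W)"], rule bexI[of _ "(V, u', W')"],
          rule bexI[of _ "(Q, w, Y)"], rule bexI[of _ "(Q', w', Y)"])
        (unfold P.Mod_Comp P.Mod_hom_Pair *(7,9,11), (intro conjI refl UM *(1-6) *(8)[unfolded *(7)] *(10)[unfolded *(9)])+)
  qed
  finally show ?thesis .
qed

text \<open>Agreement at a later stage forces g = g' on a cosmall subobject, hence everywhere.
  Conversely, the triples agree on the intersection of the two subobjects of M and in the quotient
  of M' by its hat.\<close>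

lemma limit_rel_realizes:
  assumes c: "cosmall_mono P.ModC hatS (W, i, M)" and s: "small_epi P.ModC hatS (M', q, Q)" and f: "f \<in> module_homs PA W Q"
    and c': "cosmall_mono P.ModC hatS (W', i', M)" and s': "small_epi P.ModC hatS (M', q', Q')" and f': "f' \<in> module_homs PA W' Q'"
    and g: "realizes W i f q M M' g" and g': "realizes W' i' f' q' M M' g'"
  shows "(((W, i, M), (W, f, Q), (M', q, Q)), ((W', i', M), (W', f', Q'), (M', q', Q'))) \<in> limit_rel P.ModC hatS M M' \<longleftrightarrow> g = g'"
  unfolding limit_rel_iff[OF c s f c' s' f']
proof
  from s s' have M': "P.UM M'" and q: "q ` carrier M' = carrier Q" "q' ` carrier M' = carrier Q'"
    unfolding small_iff by blast+
  assume "\<exists>V Y u u' w w'. P.UM V \<and> P.UM Y \<and> u \<in> module_homs PA V W \<and> u' \<in> module_homs PA V W' \<and>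
       w \<in> module_homs PA Q Y \<and> w' \<in> module_homs PA Q' Y \<and>
       compose (carrier V) i u = compose (carrier V) i' u' \<and>
       cosmall_mono P.ModC hatS (V, compose (carrier V) i u, M) \<and>
       compose (carrier M') w q = compose (carrier M') w' q' \<and>
       small_epi P.ModC hatS (M', compose (carrier M') w q, Y) \<and>
       compose (carrier V) (compose (carrier W) w f) u = compose (carrier V) (compose (carrier W') w' f') u'"
  then obtain V Y u u' w w' where u: "u \<in> module_homs PA V W" "u' \<in> module_homs PA V W'"
       and iu: "compose (carrier V) i u = compose (carrier V) i' u'"
       and cV: "cosmall_mono P.ModC hatS (V, compose (carrier V) i u, M)"
       and wq: "compose (carrier M') w q = compose (carrier M') w' q'"
       and sY: "small_epi P.ModC hatS (M', compose (carrier M') w q, Y)"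
       and wfu: "compose (carrier V) (compose (carrier W) w f) u = compose (carrier V) (compose (carrier W') w' f') u'"
    by (elim exE conjE) (rule that)
  show "g = g'"
  proof (rule FM_hom_eqI[OF cV M' realizesD(1)[OF g] realizesD(1)[OF g']])
    fix z assume z: "z \<in> carrier V"
    have uz: "u z \<in> carrier W" "u' z \<in> carrier W'"
      using rhom_closed[OF P.module_homs_rhom[OF u(1)] z] rhom_closed[OF P.module_homs_rhom[OF u(2)] z] by blast+
    have "f (u z) \<in> carrier Q" "f' (u' z) \<in> carrier Q'"
      by (rule rhom_closed[OF P.module_homs_rhom[OF f] uz(1)] rhom_closed[OF P.module_homs_rhom[OF f'] uz(2)])+
    then obtain y y' where y: "y \<in> carrier M'" "f (u z) = q y" and y': "y' \<in> carrier M'" "f' (u' z) = q' y'"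
      using q by blast
    have "w (f (u z)) = w' (f' (u' z))"
      using compose_eq[OF z, of "compose (carrier W) w f" u] compose_eq[OF z, of "compose (carrier W') w' f'" u']
        compose_eq[OF uz(1), of w f] compose_eq[OF uz(2), of w' f'] wfu by simp
    then have "compose (carrier M') w q y = compose (carrier M') w q y'"
      using y y' wq compose_eq[OF y(1), of w q] compose_eq[OF y'(1), of w' q'] by simp
    then have e: "et M' y = et M' y'" by (rule small_et_eq[OF sY y(1) y'(1)])
    have iz: "compose (carrier V) i u z = i (u z)" "compose (carrier V) i u z = i' (u' z)"
      unfolding iu compose_eq[OF z] using compose_eq[OF z, of i u] compose_eq[OF z, of i' u'] iu by simp_all
    have "g (et M (i (u z))) = et M' y" by (rule realizesD(2)[OF g uz(1) y])
    moreover have "g' (et M (i' (u' z))) = et M' y'" by (rule realizesD(2)[OF g' uz(2) y'])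
    ultimately show "g (et M (compose (carrier V) i u z)) = g' (et M (compose (carrier V) i u z))"
      using e iz by metis
  qed
next
  assume gg: "g = g'"
  from c c' have UM: "P.UM M" "P.UM W" "P.UM W'" and i: "i \<in> module_homs PA W M" "i' \<in> module_homs PA W' M"
    and inj: "inj_on i (carrier W)" "inj_on i' (carrier W')"
    and cos: "carrier M \<subseteq> sat M (i ` carrier W)" "carrier M \<subseteq> sat M (i' ` carrier W')"
    unfolding cosmall_iff by blast+
  from s s' have M': "P.UM M'" and UMQ: "P.UM Q" "P.UM Q'" and q: "q \<in> module_homs PA M' Q" "q' \<in> module_homs PA M' Q'"
    and qs: "q ` carrier M' = carrier Q" "q' ` carrier M' = carrier Q'"
    and qk: "\<And>m. m \<in> carrier M' \<Longrightarrow> q m = \<zero>\<^bsub>Q\<^esub> \<Longrightarrow> m \<in> sat M' {\<zero>\<^bsub>M'\<^esub>}"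
    "\<And>m. m \<in> carrier M' \<Longrightarrow> q' m = \<zero>\<^bsub>Q'\<^esub> \<Longrightarrow> m \<in> sat M' {\<zero>\<^bsub>M'\<^esub>}"
    unfolding small_iff by blast+
  note rm = UM[THEN P.UM_right_module] and rmM' = P.UM_right_module[OF M'] and rmQ = UMQ[THEN P.UM_right_module]
  note ir = i[THEN P.module_homs_rhom] and qr = q[THEN P.module_homs_rhom]
  let ?B = "i ` carrier W \<inter> i' ` carrier W'"
  have B12: "submod PA M (i ` carrier W)" "submod PA M (i' ` carrier W')"
    by (rule submod_image[OF rm(2,1) ir(1) submod_carrier[OF rm(2)]] submod_image[OF rm(3,1) ir(2) submod_carrier[OF rm(3)]])+
  have B: "submod PA M ?B" by (rule submod_Int[OF B12])
  let ?V = "M\<lparr>carrier := ?B\<rparr>"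
  note V = incl_homs[OF UM(1) B]
  have inc: "rhom PA ?V M (\<lambda>x. x)" by (rule rhom_incl[OF B])
  note rV = P.UM_right_module[OF V(1)]
  have sub1: "(\<lambda>x. x) ` carrier ?V \<subseteq> i ` carrier W" and sub2: "(\<lambda>x. x) ` carrier ?V \<subseteq> i' ` carrier W'" by auto
  obtain u where u: "rhom PA ?V W u" "\<And>x. x \<in> carrier ?V \<Longrightarrow> i (u x) = x"
    using rhom_lift_inj[OF rm(2) rV ir(1) inj(1) inc sub1] by metis
  obtain u' where u': "rhom PA ?V W' u'" "\<And>x. x \<in> carrier ?V \<Longrightarrow> i' (u' x) = x"
    using rhom_lift_inj[OF rm(3) rV ir(2) inj(2) inc sub2] by metis
  let ?u = "restrict u (carrier ?V)" and ?u' = "restrict u' (carrier ?V)"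
  have uh: "?u \<in> module_homs PA ?V W" "?u' \<in> module_homs PA ?V W'"
    by (rule P.restrict_module_homs[OF V(1)], fact)+
  have iu: "compose (carrier ?V) i ?u = (\<lambda>x \<in> ?B. x)"
    by (rule P.compose_eqI[OF V(1) uh(1) i(1) V(2)]) (use u(2) in simp)
  have iu': "compose (carrier ?V) i' ?u' = (\<lambda>x \<in> ?B. x)"
    by (rule P.compose_eqI[OF V(1) uh(2) i(2) V(2)]) (use u'(2) in simp)
  have cV: "cosmall_mono P.ModC hatS (?V, \<lambda>x \<in> ?B. x, M)"
    unfolding cosmall_iff
  proof (intro conjI V UM(1) subsetI)
    show "inj_on (\<lambda>x \<in> ?B. x) (carrier ?V)" by (simp add: inj_on_def)
    fix m assume m: "m \<in> carrier M"
    have "m \<in> sat M ?B" by (rule sat_Int[OF rm(1) B12 subsetD[OF cos(1) m] subsetD[OF cos(2) m]])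
    then show "m \<in> sat M ((\<lambda>x \<in> ?B. x) ` carrier ?V)" by simp
  qed
  let ?H = "sat M' {\<zero>\<^bsub>M'\<^esub>}"
  let ?Y = "P.quot M' ?H" and ?t = "restrict (coset_rep M' ?H) (carrier M')"
  note HS = small_hat_quot[OF M']
  from HS(2) have UMY: "P.UM ?Y" and t: "?t \<in> module_homs PA M' ?Y" unfolding small_iff by blast+
  note rY = P.UM_right_module[OF UMY]
  have tk: "?t m = \<zero>\<^bsub>?Y\<^esub>" if "m \<in> carrier M'" "m \<in> ?H" for m
    using P.quot_zero_iff[OF M' HS(1) that(1)] that by simp
  obtain w where w: "rhom PA Q ?Y w" "\<And>x. x \<in> carrier M' \<Longrightarrow> w (q x) = ?t x"
    using rhom_factor_surj[OF rmM' rmQ(1) rY qr(1) qs(1) P.module_homs_rhom[OF t] tk[OF _ qk(1)]] by metis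
  obtain w' where w': "rhom PA Q' ?Y w'" "\<And>x. x \<in> carrier M' \<Longrightarrow> w' (q' x) = ?t x"
    using rhom_factor_surj[OF rmM' rmQ(2) rY qr(2) qs(2) P.module_homs_rhom[OF t] tk[OF _ qk(2)]] by metis
  let ?w = "restrict w (carrier Q)" and ?w' = "restrict w' (carrier Q')"
  have wh: "?w \<in> module_homs PA Q ?Y" "?w' \<in> module_homs PA Q' ?Y"
    by (rule P.restrict_module_homs[OF UMQ(1) w(1)] P.restrict_module_homs[OF UMQ(2) w'(1)])+
  have wq: "?w (q x) = ?t x" "?w' (q' x) = ?t x" if "x \<in> carrier M'" for x
    using w(2)[OF that] w'(2)[OF that] rhom_closed[OF qr(1) that] rhom_closed[OF qr(2) that] by simp_all
  have cwq: "compose (carrier M') ?w q = ?t" by (rule P.compose_eqI[OF M' q(1) wh(1) t wq(1)])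
  have cwq': "compose (carrier M') ?w' q' = ?t" by (rule P.compose_eqI[OF M' q(2) wh(2) t wq(2)])
  have last: "compose (carrier ?V) (compose (carrier W) ?w f) ?u = compose (carrier ?V) (compose (carrier W') ?w' f') ?u'"
    unfolding compose_def[of "carrier ?V"]
  proof (rule restrict_ext)
    fix z assume z: "z \<in> carrier ?V"
    have uz: "?u z \<in> carrier W" "?u' z \<in> carrier W'"
      by (rule rhom_closed[OF P.module_homs_rhom[OF uh(1)] z] rhom_closed[OF P.module_homs_rhom[OF uh(2)] z])+
    have "f (?u z) \<in> carrier Q" "f' (?u' z) \<in> carrier Q'"
      by (rule rhom_closed[OF P.module_homs_rhom[OF f] uz(1)] rhom_closed[OF P.module_homs_rhom[OF f'] uz(2)])+
    then obtain y y' where y: "y \<in> carrier M'" "f (?u z) = q y" and y': "y' \<in> carrier M'" "f' (?u' z) = q' y'"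
      using qs by blast
    have "i (?u z) = z" "i' (?u' z) = z" using u(2)[OF z] u'(2)[OF z] z by simp_all
    then have "et M' y = et M' y'"
      using realizesD(2)[OF g uz(1) y] realizesD(2)[OF g' uz(2) y'] gg by simp
    then have "y \<ominus>\<^bsub>M'\<^esub> y' \<in> ?H" using et_eq_iff[OF M' y(1) y'(1)] by blast
    then have "?t y = ?t y'" using coset_rep_eq_iff[OF rmM' HS(1) y(1) y'(1)] y(1) y'(1) by simp
    then show "compose (carrier W) ?w f (?u z) = compose (carrier W') ?w' f' (?u' z)"
      unfolding compose_eq[OF uz(1)] compose_eq[OF uz(2)] y(2) y'(2) wq(1)[OF y(1)] wq(2)[OF y'(1)] .
  qed
  show "\<exists>V Y u u' w w'. P.UM V \<and> P.UM Y \<and> u \<in> module_homs PA V W \<and> u' \<in> module_homs PA V W' \<and>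
       w \<in> module_homs PA Q Y \<and> w' \<in> module_homs PA Q' Y \<and>
       compose (carrier V) i u = compose (carrier V) i' u' \<and>
       cosmall_mono P.ModC hatS (V, compose (carrier V) i u, M) \<and>
       compose (carrier M') w q = compose (carrier M') w' q' \<and>
       small_epi P.ModC hatS (M', compose (carrier M') w q, Y) \<and>
       compose (carrier V) (compose (carrier W) w f) u = compose (carrier V) (compose (carrier W') w' f') u'"
    by (rule exI[of _ ?V], rule exI[of _ ?Y], rule exI[of _ ?u], rule exI[of _ ?u'], rule exI[of _ ?w], rule exI[of _ ?w'],
        unfold iu iu' cwq cwq', intro conjI V(1) UMY uh wh refl cV HS(2) last)
qed

lemma \<Phi>Q_surj:
  assumes M: "P.UM M" and M': "P.UM M'" and g: "g \<in> module_homs LA (FM M) (FM M')"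
  shows "\<exists>\<rho> \<in> partial_maps P.ModC hatS M M'. \<Phi>Q M M' \<rho> = (FM M, g, FM M')"
proof -
  note rm = M[THEN P.UM_right_module] M'[THEN P.UM_right_module]
  note rN = UM_FM[OF M, THEN L.UM_right_module] UM_FM[OF M', THEN L.UM_right_module]
  note rr = rN[THEN right_module_restr]
  have gr: "rhom PA (restr (FM M)) (restr (FM M')) g" by (rule rhom_restr[OF rN L.module_homs_rhom[OF g]])
  have ge: "rhom PA M (restr (FM M')) (\<lambda>m. g (et M m))" by (rule rhom_comp[OF et_rhom[OF M] gr])
  let ?E = "et M' ` carrier M'"
  let ?B = "{m \<in> carrier M. g (et M m) \<in> ?E}"
  have E: "submod PA (restr (FM M')) ?E" by (rule submod_image[OF rm(2) rr(2) et_rhom[OF M'] submod_carrier[OF rm(2)]])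
  have B: "submod PA M ?B" by (rule submod_vimage[OF rm(1) rr(2) ge E])
  let ?V = "M\<lparr>carrier := ?B\<rparr>"
  note V = incl_homs[OF M B]
  note rV = P.UM_right_module[OF V(1)]
  have cV: "cosmall_mono P.ModC hatS (?V, \<lambda>x \<in> ?B. x, M)"
    unfolding cosmall_iff
  proof (intro conjI V M subsetI)
    show "inj_on (\<lambda>x \<in> ?B. x) (carrier ?V)" by (simp add: inj_on_def)
    fix m assume m: "m \<in> carrier M"
    have gm: "g (et M m) \<in> carrier (FM M')" using rhom_closed[OF ge m] by simp
    \<comment> \<open>Some level sends g (et m) into the image of M', and hence m into ?B.\<close>
    have "m \<in> sat M ?B"
      by (rule sat_vimage[OF ge m localizationD(5)[OF loc[OF M'] gm] _ rm(1)]) blast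
    then show "m \<in> sat M ((\<lambda>x \<in> ?B. x) ` carrier ?V)" by simp
  qed
  let ?H = "sat M' {\<zero>\<^bsub>M'\<^esub>}"
  let ?Q = "P.quot M' ?H" and ?t = "restrict (coset_rep M' ?H) (carrier M')"
  note HS = small_hat_quot[OF M']
  from HS(2) have UMQ: "P.UM ?Q" and t: "?t \<in> module_homs PA M' ?Q" and ts: "?t ` carrier M' = carrier ?Q"
    unfolding small_iff by blast+
  note rQ = P.UM_right_module[OF UMQ]
  have t0: "?t y = \<zero>\<^bsub>?Q\<^esub> \<longleftrightarrow> y \<in> ?H" if "y \<in> carrier M'" for y
    using P.quot_zero_iff[OF M' HS(1) that] that by simp
  have k0: "et M' y = \<zero>\<^bsub>restr (FM M')\<^esub>" if "y \<in> carrier M'" "?t y = \<zero>\<^bsub>?Q\<^esub>" for y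
    using localization_ker[OF loc[OF M']] t0[OF that(1)] that(2) by simp
  \<comment> \<open>The quotient of M' by its hat embeds into the localization through k, so g after
    \<open>et\<close>, restricted to ?B, lifts to a map into that quotient.\<close>
  obtain k where k: "rhom PA ?Q (restr (FM M')) k" "\<And>y. y \<in> carrier M' \<Longrightarrow> k (?t y) = et M' y"
    by (rule rhom_factor_surj[OF rm(2) rQ rr(2) P.module_homs_rhom[OF t] ts et_rhom[OF M'] k0], assumption, assumption) (rule that)
  have "x = \<zero>\<^bsub>?Q\<^esub>" if x: "x \<in> carrier ?Q" and kx: "k x = \<zero>\<^bsub>restr (FM M')\<^esub>" for x
  proof -
    from x ts obtain y where y: "y \<in> carrier M'" "x = ?t y" by blast
    have "et M' y = \<zero>\<^bsub>FM M'\<^esub>" using kx k(2)[OF y(1)] unfolding y(2) by simp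
    with localizationD(4)[OF loc[OF M'] y(1)] t0[OF y(1)] y(2) show ?thesis by blast
  qed
  then have inj: "inj_on k (carrier ?Q)" unfolding rhom_inj_on[OF rQ rr(2) k(1)] by blast
  have sub: "(\<lambda>m. g (et M m)) ` carrier ?V \<subseteq> k ` carrier ?Q"
  proof
    fix z assume "z \<in> (\<lambda>m. g (et M m)) ` carrier ?V"
    then obtain y where y: "y \<in> carrier M'" "z = et M' y" by auto
    show "z \<in> k ` carrier ?Q"
      using k(2)[OF y(1)] y(2) rhom_closed[OF P.module_homs_rhom[OF t] y(1)] by (metis imageI)
  qed
  have hV: "rhom PA ?V (restr (FM M')) (\<lambda>m. g (et M m))" by (rule rhom_subdomain[OF ge]) blast
  obtain f where f: "rhom PA ?V ?Q f" "\<And>x. x \<in> carrier ?V \<Longrightarrow> k (f x) = g (et M x)"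
    by (rule rhom_lift_inj[OF rQ rV k(1) inj hV sub]) (rule that)
  let ?f = "restrict f (carrier ?V)"
  have fh: "?f \<in> module_homs PA ?V ?Q" by (rule P.restrict_module_homs[OF V(1) f(1)])
  have real: "realizes ?V (\<lambda>x \<in> ?B. x) ?f ?t M M' g"
  proof (rule realizesI[OF g])
    fix x y assume x: "x \<in> carrier ?V" and y: "y \<in> carrier M'" and e: "?f x = ?t y"
    have "k (f x) = k (?t y)" using e x by simp
    then have "g (et M x) = et M' y" unfolding k(2)[OF y] f(2)[OF x] .
    then show "g (et M ((\<lambda>x \<in> ?B. x) x)) = et M' y" using x by simp
  qed
  have pm: "((?V, \<lambda>x \<in> ?B. x, M), (?V, ?f, ?Q), (M', ?t, ?Q)) \<in> partial_maps P.ModC hatS M M'"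
    unfolding partial_maps_iff using cV HS(2) fh by blast
  show ?thesis by (rule bexI, rule \<Phi>Q_eq[OF cV HS(2) fh real], rule pm)
qed

text \<open>A chase at an element x: choose n, v and l with f (u x) = q n, f1 x = e v and g v = r l.
  Then j v and n agree after q, while l and y agree in the final quotient of M'', so
  \<open>et\<close> identifies the members of each pair.\<close>

lemma composite_realizes:
  assumes c: "cosmall_mono P.ModC hatS (W, i, M)" and s: "small_epi P.ModC hatS (M', q, Q)" and f: "f \<in> module_homs PA W Q"
    and c': "cosmall_mono P.ModC hatS (V, j, M')" and s': "small_epi P.ModC hatS (M'', r, R)" and g: "g \<in> module_homs PA V R"
    and a: "realizes W i f q M M' a" and b: "realizes V j g r M' M'' b"
    and comp: "composite_rel P.ModC hatS ((V, j, M'), (V, g, R), (M'', r, R)) ((W, i, M), (W, f, Q), (M', q, Q)) \<tau>"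
  shows "\<tau> \<in> partial_maps P.ModC hatS M M'' \<and> \<Phi>Q M M'' \<tau> = (FM M, compose (carrier (FM M)) b a, FM M'')"
proof -
  obtain k h t where \<tau>: "\<tau> = (k, h, t)" by (cases \<tau>)
  obtain T Y Z u' w' e' m' f1' g1' where
    hm: "u' \<in> hom_set P.ModC T W" "w' \<in> hom_set P.ModC R Y" "e' \<in> hom_set P.ModC V Z"
      "m' \<in> hom_set P.ModC Z Q" "f1' \<in> hom_set P.ModC T Z" "g1' \<in> hom_set P.ModC Z Y"
    and eqs: "k = (W, i, M) \<cdot>\<^bsub>P.ModC\<^esub> u'" "cosmall_mono P.ModC hatS k"
      "t = w' \<cdot>\<^bsub>P.ModC\<^esub> (M'', r, R)" "small_epi P.ModC hatS t" "epi_arrow P.ModC e'" "mono_arrow P.ModC m'"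
      "(M', q, Q) \<cdot>\<^bsub>P.ModC\<^esub> (V, j, M') = m' \<cdot>\<^bsub>P.ModC\<^esub> e'"
      "(W, f, Q) \<cdot>\<^bsub>P.ModC\<^esub> u' = m' \<cdot>\<^bsub>P.ModC\<^esub> f1'"
      "w' \<cdot>\<^bsub>P.ModC\<^esub> (V, g, R) = g1' \<cdot>\<^bsub>P.ModC\<^esub> e'" "h = g1' \<cdot>\<^bsub>P.ModC\<^esub> f1'"
    using comp unfolding \<tau> composite_rel_def prod.case P.Mod_Dom P.Mod_Cod
    by (elim bexE exE conjE) (rule that)
  obtain u w e m f1 g1 where d: "u' = (T, u, W)" "w' = (R, w, Y)" "e' = (V, e, Z)" "m' = (Z, m, Q)" "f1' = (T, f1, Z)" "g1' = (Z, g1, Y)"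
    and U: "P.UM T" "P.UM Y" "P.UM Z"
    and hs: "u \<in> module_homs PA T W" "w \<in> module_homs PA R Y" "e \<in> module_homs PA V Z"
      "m \<in> module_homs PA Z Q" "f1 \<in> module_homs PA T Z" "g1 \<in> module_homs PA Z Y"
    using hm unfolding P.Mod_hom_iff by blast
  let ?k = "compose (carrier T) i u" and ?h = "compose (carrier T) g1 f1" and ?t = "compose (carrier M'') w r"
  have kht: "k = (T, ?k, M)" "h = (T, ?h, Y)" "t = (M'', ?t, Y)"
    unfolding eqs(1,3,10) d by simp_all
  note ck = eqs(2)[unfolded kht] and st = eqs(4)[unfolded kht]
  have hh: "?h \<in> module_homs PA T Y" by (rule P.compose_module_homs[OF U(1) hs(5,6)])
  have E: "compose (carrier V) q j = compose (carrier V) m e" "compose (carrier T) f u = compose (carrier T) m f1"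
    "compose (carrier V) w g = compose (carrier V) g1 e"
    using eqs(7-9) unfolding d P.Mod_Comp by (simp_all only: prod.inject)
  have es: "e ` carrier V = carrier Z" using eqs(5) unfolding d P.epi_iff by blast
  from s s' have q: "q ` carrier M' = carrier Q" and r: "r ` carrier M'' = carrier R" and M'': "P.UM M''"
    unfolding small_iff by blast+
  from c c' have M: "P.UM M" and i: "i \<in> module_homs PA W M" and j: "j \<in> module_homs PA V M'" unfolding cosmall_iff by blast+
  note rh = P.module_homs_rhom[THEN rhom_closed]
  have real: "realizes T ?k ?h ?t M M'' (compose (carrier (FM M)) b a)"
  proof (rule realizesI)
    show "compose (carrier (FM M)) b a \<in> module_homs LA (FM M) (FM M'')"
      by (rule L.compose_module_homs[OF UM_FM[OF M] realizesD(1)[OF a] realizesD(1)[OF b]])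
    fix x y assume x: "x \<in> carrier T" and y: "y \<in> carrier M''" and xy: "?h x = ?t y"
    have ux: "u x \<in> carrier W" by (rule rh[OF hs(1) x])
    have "f (u x) \<in> carrier Q" by (rule rh[OF f ux])
    then obtain n where n: "n \<in> carrier M'" "f (u x) = q n" using q by blast
    have "f1 x \<in> carrier Z" by (rule rh[OF hs(5) x])
    then obtain v where v: "v \<in> carrier V" "f1 x = e v" using es by blast
    have "g v \<in> carrier R" by (rule rh[OF g v(1)])
    then obtain l where l: "l \<in> carrier M''" "g v = r l" using r by blast
    have jv: "j v \<in> carrier M'" by (rule rh[OF j v(1)])
    have "q (j v) = m (e v)" by (rule P.compose_eqD[OF E(1) v(1)])
    also have "\<dots> = f (u x)" using P.compose_eqD[OF E(2) x] v(2) by simp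
    finally have 1: "et M' (j v) = et M' n" using small_et_eq[OF s jv n(1)] n(2) by simp
    have "?t l = w (g v)" using l compose_eq[OF l(1)] by simp
    also have "\<dots> = g1 (e v)" by (rule P.compose_eqD[OF E(3) v(1)])
    also have "\<dots> = ?h x" using v(2) compose_eq[OF x, of g1 f1] by simp
    also have "\<dots> = ?t y" by (rule xy)
    finally have 2: "et M'' l = et M'' y" by (rule small_et_eq[OF st l(1) y])
    have kx: "?k x = i (u x)" by (rule compose_eq[OF x])
    have "et M (i (u x)) \<in> carrier (FM M)" using rhom_closed[OF et_rhom[OF M] rh[OF i ux]] by simp
    then have "compose (carrier (FM M)) b a (et M (?k x)) = b (a (et M (i (u x))))" unfolding kx by (rule compose_eq)
    also have "a (et M (i (u x))) = et M' n" by (rule realizesD(2)[OF a ux n])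
    also have "b (et M' n) = et M'' l" unfolding 1[symmetric] by (rule realizesD(2)[OF b v(1) l])
    finally show "compose (carrier (FM M)) b a (et M (?k x)) = et M'' y" unfolding 2 .
  qed
  have "\<tau> \<in> partial_maps P.ModC hatS M M''"
    unfolding \<tau> kht partial_maps_iff using ck st hh by blast
  moreover have "\<Phi>Q M M'' \<tau> = (FM M, compose (carrier (FM M)) b a, FM M'')"
    unfolding \<tau> kht by (rule \<Phi>Q_eq[OF ck st hh real])
  ultimately show ?thesis ..
qed

text \<open>The middle object is Z = q(j(V)), and f is restricted to the preimage of Z. On the other
  side R is divided by its whole hat, which contains the image under g of the kernel of V ->
  Z.\<close>

lemma hat_composite_exists:
  assumes c: "cosmall_mono P.ModC hatS (W, i, M)" and s: "small_epi P.ModC hatS (M', q, Q)" and f: "f \<in> module_homs PA W Q"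
    and c': "cosmall_mono P.ModC hatS (V, j, M')" and s': "small_epi P.ModC hatS (M'', r, R)" and g: "g \<in> module_homs PA V R"
  shows "\<exists>\<tau>. composite_rel P.ModC hatS ((V, j, M'), (V, g, R), (M'', r, R)) ((W, i, M), (W, f, Q), (M', q, Q)) \<tau>"
proof -
  from c c' have U: "P.UM M" "P.UM W" "P.UM V" "P.UM M'" and i: "i \<in> module_homs PA W M" and j: "j \<in> module_homs PA V M'"
    and inj: "inj_on i (carrier W)" "inj_on j (carrier V)"
    and cos: "carrier M \<subseteq> sat M (i ` carrier W)" "carrier M' \<subseteq> sat M' (j ` carrier V)"
    unfolding cosmall_iff by blast+
  from s s' have U': "P.UM Q" "P.UM M''" "P.UM R" and q: "q \<in> module_homs PA M' Q" and r: "r \<in> module_homs PA M'' R"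
    and qs: "q ` carrier M' = carrier Q" and rs: "r ` carrier M'' = carrier R"
    and qk: "\<And>m. m \<in> carrier M' \<Longrightarrow> q m = \<zero>\<^bsub>Q\<^esub> \<Longrightarrow> m \<in> sat M' {\<zero>\<^bsub>M'\<^esub>}"
    and rk: "\<And>m. m \<in> carrier M'' \<Longrightarrow> r m = \<zero>\<^bsub>R\<^esub> \<Longrightarrow> m \<in> sat M'' {\<zero>\<^bsub>M''\<^esub>}"
    unfolding small_iff by blast+
  note rU = U[THEN P.UM_right_module] and rU' = U'[THEN P.UM_right_module]
  note ir = P.module_homs_rhom[OF i] and jr = P.module_homs_rhom[OF j] and qr = P.module_homs_rhom[OF q]
    and rr = P.module_homs_rhom[OF r] and fr = P.module_homs_rhom[OF f] and gr = P.module_homs_rhom[OF g]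
  let ?J = "j ` carrier V"
  let ?ZS = "q ` ?J"
  have J: "submod PA M' ?J" by (rule submod_image[OF rU(3,4) jr submod_carrier[OF rU(3)]])
  have ZS: "submod PA Q ?ZS" by (rule submod_image[OF rU(4) rU'(1) qr J])
  let ?Z = "Q\<lparr>carrier := ?ZS\<rparr>" and ?m = "\<lambda>x \<in> ?ZS. x"
  note Z = incl_homs[OF U'(1) ZS]
  note rZ = P.UM_right_module[OF Z(1)]
  let ?e = "restrict (\<lambda>v. q (j v)) (carrier V)"
  have eh: "?e \<in> module_homs PA V ?Z"
    by (rule P.restrict_module_homs[OF U(3) rhom_corestrict[OF rhom_comp[OF jr qr]]]) blast
  have eimg: "?e ` carrier V = carrier ?Z" by (auto simp: image_image)
  let ?XS = "{x \<in> carrier W. f x \<in> ?ZS}"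
  have XS: "submod PA W ?XS" by (rule submod_vimage[OF rU(2) rU'(1) fr ZS])
  let ?X = "W\<lparr>carrier := ?XS\<rparr>" and ?u = "\<lambda>x \<in> ?XS. x"
  note X = incl_homs[OF U(2) XS]
  let ?f1 = "restrict f (carrier ?X)"
  have f1: "?f1 \<in> module_homs PA ?X ?Z"
    by (rule P.restrict_module_homs[OF X(1) rhom_corestrict[OF rhom_subdomain[OF fr]]]) auto
  let ?H = "sat R {\<zero>\<^bsub>R\<^esub>}"
  let ?Y = "P.quot R ?H" and ?w = "restrict (coset_rep R ?H) (carrier R)"
  note HS = small_hat_quot[OF U'(3)]
  from HS(2) have UMY: "P.UM ?Y" and w: "?w \<in> module_homs PA R ?Y" and ws: "?w ` carrier R = carrier ?Y"
    unfolding small_iff by blast+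
  note rY = P.UM_right_module[OF UMY] and wr = P.module_homs_rhom[OF w]
  have w0: "?w y = \<zero>\<^bsub>?Y\<^esub> \<longleftrightarrow> y \<in> ?H" if "y \<in> carrier R" for y
    using P.quot_zero_iff[OF U'(3) HS(1) that] that by simp
  \<comment> \<open>If q (j v) = 0, then j v lies in the hat; so does v, because j is injective, and
    therefore g v.\<close>
  have ker: "?w (g v) = \<zero>\<^bsub>?Y\<^esub>" if v: "v \<in> carrier V" and ev: "?e v = \<zero>\<^bsub>?Z\<^esub>" for v
  proof -
    have "j v \<in> sat M' {\<zero>\<^bsub>M'\<^esub>}" using qk[OF rhom_closed[OF jr v]] ev v by simp
    then have "v \<in> sat V {\<zero>\<^bsub>V\<^esub>}"
      by (rule sat_vimage[OF jr v _ _ rU(3)]) (use rhom_inj_on[OF rU(3,4) jr] inj(2) in simp)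
    from hat_image[OF rU(3) rU'(3) gr this] show ?thesis unfolding w0[OF rhom_closed[OF gr v]] .
  qed
  obtain g1' where g1': "rhom PA ?Z ?Y g1'" "\<And>v. v \<in> carrier V \<Longrightarrow> g1' (?e v) = ?w (g v)"
    by (rule rhom_factor_surj[OF rU(3) rZ rY P.module_homs_rhom[OF eh] eimg rhom_comp[OF gr wr] ker], assumption, assumption) (rule that)
  let ?g1 = "restrict g1' (carrier ?Z)"
  have g1: "?g1 \<in> module_homs PA ?Z ?Y" by (rule P.restrict_module_homs[OF Z(1) g1'(1)])
  let ?k = "compose (carrier ?X) i ?u" and ?t = "compose (carrier M'') ?w r"
  have ck: "cosmall_mono P.ModC hatS (?X, ?k, M)"
    unfolding cosmall_iff
  proof (intro conjI X(1) U(1) P.compose_module_homs[OF X(1) X(2) i])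
    show "inj_on ?k (carrier ?X)" using inj(1) by (auto simp: inj_on_def compose_def)
    have kX: "?k ` carrier ?X = i ` ?XS" by (auto simp: compose_def)
    have iX: "submod PA M (i ` ?XS)" by (rule submod_image[OF rU(2,1) ir XS])
    \<comment> \<open>For x in W write f x = q n. Some level sends n into j(V), hence f x into Z and
      x into the preimage of Z.\<close>
    have "i ` carrier W \<subseteq> sat M (i ` ?XS)"
    proof
      fix y assume "y \<in> i ` carrier W"
      then obtain x where x: "x \<in> carrier W" "y = i x" by blast
      from rhom_closed[OF fr x(1)] qs obtain n where n: "n \<in> carrier M'" "f x = q n" by blast
      have "q n \<in> sat Q ?ZS" by (rule sat_image[OF qr subsetD[OF cos(2) n(1)]]) blast
      then have "x \<in> sat W ?XS" unfolding n(2)[symmetric] by (rule sat_vimage[OF fr x(1) _ _ rU(2)]) blast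
      then show "y \<in> sat M (i ` ?XS)" unfolding x(2) by (rule sat_image[OF ir]) blast
    qed
    then show "carrier M \<subseteq> sat M (?k ` carrier ?X)"
      unfolding kX using sat_subsetI[OF U(1) iX] cos(1) by blast
  qed
  have st: "small_epi P.ModC hatS (M'', ?t, ?Y)"
    unfolding small_iff
  proof (intro conjI ballI impI U'(2) UMY P.compose_module_homs[OF U'(2) r w])
    have "?t ` carrier M'' = ?w ` (r ` carrier M'')" by (auto simp: compose_def image_image)
    then show "?t ` carrier M'' = carrier ?Y" unfolding rs ws .
    fix y assume y: "y \<in> carrier M''" and "?t y = \<zero>\<^bsub>?Y\<^esub>"
    then have "?w (r y) = \<zero>\<^bsub>?Y\<^esub>" using compose_eq[OF y, of ?w r] by simp
    then have "r y \<in> ?H" unfolding w0[OF rhom_closed[OF rr y]] .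
    \<comment> \<open>An element whose image under r lies in the hat of R is sent by some level into
      the kernel of r, which is contained in the hat of M''.\<close>
    then have "y \<in> sat M'' {y \<in> carrier M''. r y = \<zero>\<^bsub>R\<^esub>}" by (rule sat_vimage[OF rr y _ _ rU'(2)]) simp
    then show "y \<in> sat M'' {\<zero>\<^bsub>M''\<^esub>}"
      by (rule sat_subsetI[OF U'(2) submod_singleton_zero[OF rU'(2)], rotated]) (use rk in blast)
  qed
  have E: "compose (carrier V) q j = compose (carrier V) ?m ?e" "compose (carrier ?X) f ?u = compose (carrier ?X) ?m ?f1"
    by (auto simp: compose_def intro!: restrict_ext)
  have E3: "compose (carrier V) ?w g = compose (carrier V) ?g1 ?e"
    unfolding compose_def
  proof (rule restrict_ext)
    fix v assume v: "v \<in> carrier V"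
    have "?e v \<in> carrier ?Z" by (rule rhom_closed[OF P.module_homs_rhom[OF eh] v])
    then show "?w (g v) = ?g1 (?e v)" using g1'(2)[OF v] by simp
  qed
  have mm: "mono_arrow P.ModC (?Z, ?m, Q)"
    unfolding P.mono_iff by (intro conjI Z U'(1)) (simp add: inj_on_def)
  have ee: "epi_arrow P.ModC (V, ?e, ?Z)"
    unfolding P.epi_iff by (intro conjI Z U(3) eh eimg)
  show ?thesis
    unfolding composite_rel_def split_paired_Ex prod.case P.Mod_Dom P.Mod_Cod
    by (rule exI[of _ "?X"], rule exI[of _ ?k], rule exI[of _ M],
        rule exI[of _ "?X"], rule exI[of _ "compose (carrier ?X) ?g1 ?f1"], rule exI[of _ ?Y],
        rule exI[of _ M''], rule exI[of _ ?t], rule exI[of _ ?Y],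
        rule exI[of _ ?X], rule exI[of _ ?Y], rule exI[of _ ?Z],
        rule bexI[of _ "(?X, ?u, W)"], rule bexI[of _ "(R, ?w, ?Y)"], rule bexI[of _ "(V, ?e, ?Z)"],
        rule bexI[of _ "(?Z, ?m, Q)"], rule bexI[of _ "(?X, ?f1, ?Z)"], rule bexI[of _ "(?Z, ?g1, ?Y)"],
        unfold P.Mod_Comp P.Mod_hom_Pair, fold E E3)
      (intro conjI refl ck st mm ee X Z U U' UMY w eh f1 g1)+
qed

lemma realizes_id:
  assumes "P.UM M"
  shows "realizes M (\<lambda>x \<in> carrier M. x) (\<lambda>x \<in> carrier M. x) (\<lambda>x \<in> carrier M. x) M M (\<lambda>y \<in> carrier (FM M). y)"
proof (rule realizesI[OF L.id_module_homs[OF UM_FM[OF assms]]])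
  fix x y assume x: "x \<in> carrier M" and "y \<in> carrier M" "(\<lambda>x \<in> carrier M. x) x = (\<lambda>x \<in> carrier M. x) y"
  then have "y = x" by simp
  moreover have "et M x \<in> carrier (FM M)" using rhom_closed[OF et_rhom[OF assms] x] by simp
  ultimately show "(\<lambda>y \<in> carrier (FM M). y) (et M ((\<lambda>x \<in> carrier M. x) x)) = et M y" using x by simp
qed

text \<open>N is a localization of its own restriction, and the extension property makes two
  localizations isomorphic. This is essential surjectivity.\<close>

lemma FM_restr:
  assumes N: "L.UM N"
  shows "\<exists>g \<in> module_homs LA (FM (restr N)) N. \<exists>h \<in> module_homs LA N (FM (restr N)).
    compose (carrier N) g h = (\<lambda>x \<in> carrier N. x) \<and>
    compose (carrier (FM (restr N))) h g = (\<lambda>x \<in> carrier (FM (restr N)). x)"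
proof -
  note id = localization_id[OF N]
  note M = localizationD(1)[OF id]
  note l = loc[OF M] and F = UM_FM[OF M]
  let ?F = "FM (restr N)"
  note e = et_rhom[OF M]
  have eN: "et (restr N) x \<in> carrier ?F" if "x \<in> carrier N" for x
    using rhom_closed[OF e] that by simp
  obtain g where g: "rhom LA ?F N g" "\<And>x. x \<in> carrier (restr N) \<Longrightarrow> g (et (restr N) x) = x"
    by (rule localization_extend[OF l N localizationD(3)[OF id]]) (rule that)
  obtain h where h: "rhom LA N ?F h" "\<And>x. x \<in> carrier (restr N) \<Longrightarrow> h x = et (restr N) x"
    by (rule localization_extend[OF id F e]) (rule that)
  have gh: "g (h x) = x" if "x \<in> carrier N" for x using g(2) h(2) that by simp
  have hg: "h (g y) = y" if y: "y \<in> carrier ?F" for y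
  proof (rule localization_unique[OF l L.UM_right_module[OF F] rhom_comp[OF g(1) h(1)] _ _ y])
    show "rhom LA ?F ?F (\<lambda>y. y)" by (rule rhomI) simp_all
    show "h (g (et (restr N) x)) = et (restr N) x" if "x \<in> carrier (restr N)" for x
      using g(2)[OF that] h(2)[OF that] by simp
  qed
  show ?thesis
  proof (intro bexI conjI)
    show "restrict g (carrier ?F) \<in> module_homs LA ?F N" by (rule L.restrict_module_homs[OF F g(1)])
    show "restrict h (carrier N) \<in> module_homs LA N ?F" by (rule L.restrict_module_homs[OF N h(1)])
    show "compose (carrier N) (restrict g (carrier ?F)) (restrict h (carrier N)) = (\<lambda>x \<in> carrier N. x)"
      unfolding compose_def by (rule restrict_ext) (simp add: gh rhom_closed[OF h(1)])
    show "compose (carrier ?F) (restrict h (carrier N)) (restrict g (carrier ?F)) = (\<lambda>x \<in> carrier ?F. x)"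
      unfolding compose_def by (rule restrict_ext) (simp add: hg rhom_closed[OF g(1)])
  qed
qed

lemma quotient_realization_hat: "quotient_realization P.ModC L.ModC hatS FM \<Phi>Q"
proof (intro quotient_realization.intro quotient_realization_axioms.intro P.category_Mod L.category_Mod)
  have val: "\<exists>W i f q Q g. \<rho> = ((W, i, M), (W, f, Q), (M', q, Q)) \<and> cosmall_mono P.ModC hatS (W, i, M) \<and>
      small_epi P.ModC hatS (M', q, Q) \<and> f \<in> module_homs PA W Q \<and> realizes W i f q M M' g \<and>
      \<Phi>Q M M' \<rho> = (FM M, g, FM M')" if \<rho>: "\<rho> \<in> partial_maps P.ModC hatS M M'" for \<rho> M M'
  proof -
    from \<rho>[unfolded partial_maps_iff] obtain W i f q Q where r: "\<rho> = ((W, i, M), (W, f, Q), (M', q, Q))"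
      "cosmall_mono P.ModC hatS (W, i, M)" "small_epi P.ModC hatS (M', q, Q)" "f \<in> module_homs PA W Q" by blast
    from realizes_exists[OF r(2-4)] obtain g where g: "realizes W i f q M M' g" by blast
    from \<Phi>Q_eq[OF r(2-4) g] r g show ?thesis by blast
  qed
  show "FM M \<in> Obj L.ModC" if "M \<in> Obj P.ModC" for M using UM_FM that by simp
  show "\<Phi>Q M M' \<rho> \<in> hom_set L.ModC (FM M) (FM M')"
    if M: "M \<in> Obj P.ModC" "M' \<in> Obj P.ModC" and \<rho>: "\<rho> \<in> partial_maps P.ModC hatS M M'" for M M' \<rho>
  proof -
    from val[OF \<rho>] obtain W i f q g where g: "realizes W i f q M M' g" "\<Phi>Q M M' \<rho> = (FM M, g, FM M')" by blast
    show ?thesis unfolding g(2) P.Mod_Obj L.Mod_hom_Pair using M UM_FM realizesD(1)[OF g(1)] by simp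
  qed
  show "(\<rho>, \<rho>') \<in> limit_rel P.ModC hatS M M' \<longleftrightarrow> \<Phi>Q M M' \<rho> = \<Phi>Q M M' \<rho>'"
    if \<rho>: "\<rho> \<in> partial_maps P.ModC hatS M M'" "\<rho>' \<in> partial_maps P.ModC hatS M M'" for M M' \<rho> \<rho>'
  proof -
    from val[OF \<rho>(1)] obtain W i f q Q g where r: "\<rho> = ((W, i, M), (W, f, Q), (M', q, Q))"
      "cosmall_mono P.ModC hatS (W, i, M)" "small_epi P.ModC hatS (M', q, Q)" "f \<in> module_homs PA W Q"
      "realizes W i f q M M' g" "\<Phi>Q M M' \<rho> = (FM M, g, FM M')" by blast
    from val[OF \<rho>(2)] obtain W' i' f' q' Q' g' where r': "\<rho>' = ((W', i', M), (W', f', Q'), (M', q', Q'))"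
      "cosmall_mono P.ModC hatS (W', i', M)" "small_epi P.ModC hatS (M', q', Q')" "f' \<in> module_homs PA W' Q'"
      "realizes W' i' f' q' M M' g'" "\<Phi>Q M M' \<rho>' = (FM M, g', FM M')" by blast
    show ?thesis unfolding r(6) r'(6) prod.inject simp_thms unfolding r(1) r'(1)
      by (rule limit_rel_realizes[OF r(2-4) r'(2-4) r(5) r'(5)])
  qed
  show "\<exists>\<rho> \<in> partial_maps P.ModC hatS M M'. \<Phi>Q M M' \<rho> = \<gamma>"
    if M: "M \<in> Obj P.ModC" "M' \<in> Obj P.ModC" and \<gamma>: "\<gamma> \<in> hom_set L.ModC (FM M) (FM M')" for M M' \<gamma>
  proof -
    from \<gamma> obtain g where g: "\<gamma> = (FM M, g, FM M')" "g \<in> module_homs LA (FM M) (FM M')" unfolding L.Mod_hom_iff by blast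
    show ?thesis unfolding g(1) by (rule \<Phi>Q_surj[OF M[unfolded P.Mod_Obj] g(2)])
  qed
  fix M M' M'' \<rho> \<sigma>
  assume \<rho>: "\<rho> \<in> partial_maps P.ModC hatS M M'" and \<sigma>: "\<sigma> \<in> partial_maps P.ModC hatS M' M''"
  from val[OF \<rho>] obtain W i f q Q a where r: "\<rho> = ((W, i, M), (W, f, Q), (M', q, Q))"
    "cosmall_mono P.ModC hatS (W, i, M)" "small_epi P.ModC hatS (M', q, Q)" "f \<in> module_homs PA W Q"
    "realizes W i f q M M' a" "\<Phi>Q M M' \<rho> = (FM M, a, FM M')" by blast
  from val[OF \<sigma>] obtain V j g t R b where s: "\<sigma> = ((V, j, M'), (V, g, R), (M'', t, R))"
    "cosmall_mono P.ModC hatS (V, j, M')" "small_epi P.ModC hatS (M'', t, R)" "g \<in> module_homs PA V R"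
    "realizes V j g t M' M'' b" "\<Phi>Q M' M'' \<sigma> = (FM M', b, FM M'')" by blast
  show "\<exists>\<tau>. composite_rel P.ModC hatS \<sigma> \<rho> \<tau>"
    unfolding r(1) s(1) by (rule hat_composite_exists[OF r(2-4) s(2-4)])
  show "\<tau> \<in> partial_maps P.ModC hatS M M'' \<and> \<Phi>Q M M'' \<tau> = \<Phi>Q M' M'' \<sigma> \<cdot>\<^bsub>L.ModC\<^esub> \<Phi>Q M M' \<rho>"
    if "composite_rel P.ModC hatS \<sigma> \<rho> \<tau>" for \<tau>
    unfolding r(6) s(6) L.Mod_Comp
    by (rule composite_realizes[OF r(2-4) s(2-4) r(5) s(5) that[unfolded r(1) s(1)]])
next
  fix M :: "('k, ('v, 'e, 'k) path_algebra_elem, 'm) rmodule"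
  assume "M \<in> Obj P.ModC"
  then have M: "P.UM M" by simp
  note 1 = cosmall_id[OF M] small_id[OF M] P.id_module_homs[OF M]
  have pm: "((M, \<lambda>x \<in> carrier M. x, M), (M, \<lambda>x \<in> carrier M. x, M), (M, \<lambda>x \<in> carrier M. x, M)) \<in> partial_maps P.ModC hatS M M"
    unfolding partial_maps_iff using 1 by blast
  show "(Ident P.ModC M, Ident P.ModC M, Ident P.ModC M) \<in> partial_maps P.ModC hatS M M \<and>
      \<Phi>Q M M (Ident P.ModC M, Ident P.ModC M, Ident P.ModC M) = Ident L.ModC (FM M)"
    unfolding P.Mod_Ident L.Mod_Ident using pm \<Phi>Q_eq[OF 1 realizes_id[OF M]] by blast
qed

lemma equivalent_hat_quotient: "equivalent_categories (serre_quotient P.ModC hatS)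
    (L.ModC :: (('k, ('v, 'e, 'k) leavitt_elem, 'm) rmodule, _) cat)"
proof (rule quotient_realization.equivalent_Q[OF quotient_realization_hat])
  fix N :: "('k, ('v, 'e, 'k) leavitt_elem, 'm) rmodule"
  assume "N \<in> Obj L.ModC"
  then have N: "L.UM N" by simp
  from FM_restr[OF N] obtain g h where gh: "g \<in> module_homs LA (FM (restr N)) N" "h \<in> module_homs LA N (FM (restr N))"
    "compose (carrier N) g h = (\<lambda>x \<in> carrier N. x)"
    "compose (carrier (FM (restr N))) h g = (\<lambda>x \<in> carrier (FM (restr N)). x)" by blast
  note M = localizationD(1)[OF localization_id[OF N]]
  show "\<exists>M \<in> Obj P.ModC. \<exists>i \<in> hom_set L.ModC (FM M) N. \<exists>j \<in> hom_set L.ModC N (FM M).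
      i \<cdot>\<^bsub>L.ModC\<^esub> j = Ident L.ModC N \<and> j \<cdot>\<^bsub>L.ModC\<^esub> i = Ident L.ModC (FM M)"
  proof (intro bexI conjI)
    show "restr N \<in> Obj P.ModC" using M by simp
    show "(FM (restr N), g, N) \<in> hom_set L.ModC (FM (restr N)) N" using UM_FM[OF M] N gh(1) by simp
    show "(N, h, FM (restr N)) \<in> hom_set L.ModC N (FM (restr N))" using UM_FM[OF M] N gh(2) by simp
  qed (simp_all only: L.Mod_Comp L.Mod_Ident gh(3,4))
qed

end

end

theorem theorem7p10:
  fixes G :: "('v, 'e) pre_digraph"
  assumes "wf_digraph G"
    and "row_finite G"
    and "infinite (UNIV :: 'm set)"
    and "arcs G \<lesssim> (UNIV :: 'm set)"
  shows "serre_subcategory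
           (module_category (path_algebra G :: ('k::field, ('v, 'e, 'k) path_algebra_elem) module))
           (hat_modules G :: ('k, ('v, 'e, 'k) path_algebra_elem, 'm) rmodule set) \<and>
         equivalent_categories
           (serre_quotient
             (module_category (path_algebra G :: ('k, ('v, 'e, 'k) path_algebra_elem) module))
             (hat_modules G :: ('k, ('v, 'e, 'k) path_algebra_elem, 'm) rmodule set))
           (module_category (leavitt_path_algebra G) ::
             (('k, ('v, 'e, 'k) leavitt_elem, 'm) rmodule,
              ('k, ('v, 'e, 'k) leavitt_elem, 'm) rmodule \<times> ('m \<Rightarrow> 'm) \<times>
              ('k, ('v, 'e, 'k) leavitt_elem, 'm) rmodule) cat)"
proof -
  interpret D: row_finite_digraph G "TYPE('k)"
    by (intro row_finite_digraph.intro row_finite_digraph_axioms.intro assms)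
  \<comment> \<open>The size conditions on \<open>'m\<close> enter here: they allow the localization
    of every M to be carried by \<open>'m\<close>.\<close>
  have "\<exists>(N :: ('k, ('v, 'e, 'k) leavitt_elem, 'm) rmodule) \<alpha>. D.localization M N \<alpha>" if "D.P.UM M" for M :: "('k, ('v, 'e, 'k) path_algebra_elem, 'm) rmodule"
    by (rule D.localization_exists[OF that assms(3,4)]) (rule exI, rule exI)
  then obtain FM :: "('k, ('v, 'e, 'k) path_algebra_elem, 'm) rmodule \<Rightarrow> ('k, ('v, 'e, 'k) leavitt_elem, 'm) rmodule"
      and et :: "('k, ('v, 'e, 'k) path_algebra_elem, 'm) rmodule \<Rightarrow> 'm \<Rightarrow> 'm"
    where "\<And>M. D.P.UM M \<Longrightarrow> D.localization M (FM M) (et M)"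
    by metis
  then show ?thesis
    by (intro conjI D.serre_hat_modules D.equivalent_hat_quotient)
qed

end
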